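(* Let $(X_1,Y_1),\dots,(X_n,Y_n)$ be i.i.d. from $N_{p+m}(0,\Sigma)$, and let $\mathcal F_q=\mathcal F_q(s_u,s_v,p,m,r,\lambda;\kappa,M)$, $k_q^u,k_q^v$, $\varepsilon_n^2$ and $(\widehat U_1,\widehat V_1)$ be as defined in the context. Assume that $$\varepsilon_n^2\le c,\qquad \lambda_{r+1}\le c\lambda,$$ for some sufficiently small constant $c\in(0,1)$. For any constant $C'>0$, there exists a constant $C>0$ only depending on $M,q,\kappa$ and $C'$, such that for any $\Sigma\in\mathcal F_q$, $$\bigl\|\widehat U_1\widehat V_1'-U_1V_1'\bigr\|_{\mathrm F}^2\le C\varepsilon_n^2,$$ with $\mathbb P_\Sigma$-probability at least $$1-\exp\bigl(-C'(k_q^u+\log(ep/k_q^u))\bigr)-\exp\bigl(-C'(k_q^v+\log(em/k_q^v))\bigr).$$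
   Context: Notation: $'$ is transpose (except in the constant $C'$), $A_{i*}$ the $i$th row of $A$, $\|\cdot\|_{\mathrm F}$ and $\|\cdot\|_{\mathrm{op}}$ the Frobenius and operator norms, $a\vee b=\max(a,b)$, $e$ is Euler's number. $n,p,m,r$ are positive integers, $\bar r=\min(p,m)$, $r\le\bar r$; $q\in[0,2)$, $s_u,s_v,\lambda>0$; $\kappa,M>1$ are treated as absolute constants, while $s_u,s_v,p,m,r,\lambda$ may depend on $n$. For a matrix $A$ with ordered row norms $\|A_{(1)*}\|\ge\|A_{(2)*}\|\ge\cdots$, put $\|A\|_{q,w}=\max_j j\|A_{(j)*}\|^q$ with $0^q=0$ (so $\|A\|_{0,w}$ is the number of nonzero rows). Parameter space. $\mathcal F_q$ is the set of covariance matrices $\Sigma=\begin{pmatrix}\Sigma_x&\Sigma_{xy}\\ \Sigma_{yx}&\Sigma_y\end{pmatrix}$ ($\Sigma_x$ is $p\times p$, $\Sigma_y$ is $m\times m$) with $\Sigma_{xy}=\Sigma_x(U\Lambda V')\Sigma_y$, $U'\Sigma_xU=V'\Sigma_yV=I_{\bar r}$, $\Lambda=\mathrm{diag}(\lambda_1,\dots,\lambda_{\bar r})$, $1>\lambda_1\ge\cdots\ge\lambda_{\bar r}\ge0$, split as $U\Lambda V'=U_1\Lambda_1V_1'+U_2\Lambda_2V_2'$ where $\Lambda_1=\mathrm{diag}(\lambda_1,\dots,\lambda_r)$, $\Lambda_2=\mathrm{diag}(\lambda_{r+1},\dots,\lambda_{\bar r})$, and $U_1,V_1$ (resp. $U_2,V_2$)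 are the first $r$ (resp. last $\bar r-r$) columns of $U,V$, such that: (1) $\|U_1\|_{q,w}\le s_u$, $\|V_1\|_{q,w}\le s_v$; (2) $\|\Sigma_x^l\|_{\mathrm{op}}\vee\|\Sigma_y^l\|_{\mathrm{op}}\le M$ for $l=\pm1$; (3) $1>\kappa\lambda\ge\lambda_1\ge\cdots\ge\lambda_r\ge\lambda>0$. The assumption $\lambda_{r+1}\le c\lambda$ refers to the $(r+1)$th entry of $\Lambda$ for the given $\Sigma$ (read $\lambda_{r+1}=0$ if $r=\bar r$). Standing assumption: $\kappa\lambda\le1-c_0$ for an absolute constant $c_0\in(0,1)$. Effective sparsity. $x_q^u=\max\{0\le x\le p: x\le s_u(\frac{n\lambda^2}{r+\log(ep/x)})^{q/2}\}$, $x_q^v=\max\{0\le x\le m: x\le s_v(\frac{n\lambda^2}{r+\log(em/x)})^{q/2}\}$, $k_q^u=\lceil x_q^u\rceil$, $k_q^v=\lceil x_q^v\rceil$, and $$\varepsilon_n^2=\frac1{n\lambda^2}\Bigl(r(k_q^u+k_q^v)+k_q^u\log\frac{ep}{k_q^u}+k_q^v\log\frac{em}{k_q^v}\Bigr).$$ Estimator. Let $\widehat\Sigma=\begin{pmatrix}\widehat\Sigma_x&\widehat\Sigma_{xy}\\ \widehat\Sigma_{yx}&\widehat\Sigma_y\end{pmatrix}$ be the sample covariance matrix $\frac1n\sum_i Z_iZ_i'$ with $Z_i=(X_i',Y_i')'$. $(\widehat U_1,\widehat V_1)$ is a solution of: maximize $\mathrm{Tr}(A'\widehat\Sigma_{xy}B)$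 over $A\in\mathbb R^{p\times r}$, $B\in\mathbb R^{m\times r}$ subject to $A'\widehat\Sigma_xA=B'\widehat\Sigma_yB=I_r$, $\|A\|_{0,w}=k_q^u$, $\|B\|_{0,w}=k_q^v$. $\mathbb P_\Sigma$ is the law of the sample under $N_{p+m}(0,\Sigma)$. *)

theory Defs
  imports
    "HOL-Probability.Probability"
    "Jordan_Normal_Form.Gauss_Jordan_Elimination"
    "Jordan_Normal_Form.Determinant"
begin

unbundle no vec_syntax
unbundle no inner_syntax

text \<open>
  The dimensions n, p, m, r are quantified inside the main statement (the constants there must not
  depend on them), so matrices are carrier-based.
\<close>

subsection \<open>Matrix norms\<close>

definition vnorm :: "real vec \<Rightarrow> real" where
  "vnorm v = sqrt (v \<bullet> v)"

definition op_norm :: "real mat \<Rightarrow> real" where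
  "op_norm A = Sup ((\<lambda>v. vnorm (A *\<^sub>v v)) ` {v \<in> carrier_vec (dim_col A). vnorm v = 1})"

definition frob_norm :: "real mat \<Rightarrow> real" where
  "frob_norm A = sqrt (\<Sum>i<dim_row A. \<Sum>j<dim_col A. (A $$ (i, j))\<^sup>2)"

definition mtrace :: "real mat \<Rightarrow> real" where
  "mtrace A = (\<Sum>i<dim_row A. A $$ (i, i))"

text \<open>Only applied to invertible matrices.\<close>

definition minv :: "real mat \<Rightarrow> real mat" where
  "minv A = the (mat_inverse A)"

definition first_cols :: "nat \<Rightarrow> real mat \<Rightarrow> real mat" where
  "first_cols r A = mat (dim_row A) r (\<lambda>(i, j). A $$ (i, j))"

definition row_norms_desc :: "real mat \<Rightarrow> real list" where
  "row_norms_desc A = rev (sort (map vnorm (rows A)))"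

text \<open>
  Since \<open>0 powr q = 0\<close> for every q, including \<open>q = 0\<close>, the value at \<open>q = 0\<close> is the number of
  nonzero rows.
\<close>

definition weak_norm :: "real \<Rightarrow> real mat \<Rightarrow> real" where
  "weak_norm q A = Max ((\<lambda>j. real j * (row_norms_desc A ! (j - 1)) powr q) ` {1..dim_row A})"

subsection \<open>Blocks of a matrix indexed by the coordinates of (X, Y)\<close>

definition block_x :: "nat \<Rightarrow> real mat \<Rightarrow> real mat" where
  "block_x p S = mat p p (\<lambda>(i, j). S $$ (i, j))"

definition block_y :: "nat \<Rightarrow> nat \<Rightarrow> real mat \<Rightarrow> real mat" where
  "block_y p m S = mat m m (\<lambda>(i, j). S $$ (p + i, p + j))"

definition block_xy :: "nat \<Rightarrow> nat \<Rightarrow> real mat \<Rightarrow> real mat" where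
  "block_xy p m S = mat p m (\<lambda>(i, j). S $$ (i, p + j))"

definition covariance_mat :: "nat \<Rightarrow> real mat \<Rightarrow> bool" where
  "covariance_mat d S \<longleftrightarrow> S \<in> carrier_mat d d \<and> S\<^sup>T = S \<and>
     (\<forall>v\<in>carrier_vec d. 0 \<le> v \<bullet> (S *\<^sub>v v))"

subsection \<open>Parameter space\<close>

text \<open>
  The canonical correlations are indexed from 1, as \<open>l 1, \<dots>, l (min p m)\<close>.  The splitting of
  \<open>U \<Lambda> V'\<close> into its first r and last \<open>min p m - r\<close> components is an identity, hence no condition.
\<close>

definition Fq_decomp ::
  "real \<Rightarrow> real \<Rightarrow> real \<Rightarrow> nat \<Rightarrow> nat \<Rightarrow> nat \<Rightarrow> real \<Rightarrow> real \<Rightarrow> real \<Rightarrow>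
   real mat \<Rightarrow> real mat \<Rightarrow> real mat \<Rightarrow> (nat \<Rightarrow> real) \<Rightarrow> bool" where
  "Fq_decomp q su sv p m r lam kap M S U V l \<longleftrightarrow>
     (let rb = min p m; Sx = block_x p S; Sy = block_y p m S in
        U \<in> carrier_mat p rb \<and> V \<in> carrier_mat m rb \<and>
        block_xy p m S = Sx * (U * mat_diag rb (\<lambda>i. l (i + 1)) * V\<^sup>T) * Sy \<and>
        U\<^sup>T * Sx * U = 1\<^sub>m rb \<and> V\<^sup>T * Sy * V = 1\<^sub>m rb \<and>
        l 1 < 1 \<and> (\<forall>i\<in>{1..<rb}. l (i + 1) \<le> l i) \<and> 0 \<le> l rb \<and>
        weak_norm q (first_cols r U) \<le> su \<and> weak_norm q (first_cols r V) \<le> sv \<and>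
        invertible_mat Sx \<and> invertible_mat Sy \<and>
        max (op_norm Sx) (op_norm Sy) \<le> M \<and>
        max (op_norm (minv Sx)) (op_norm (minv Sy)) \<le> M \<and>
        kap * lam < 1 \<and> l 1 \<le> kap * lam \<and> lam \<le> l r \<and> 0 < lam)"

definition Fq ::
  "real \<Rightarrow> real \<Rightarrow> real \<Rightarrow> nat \<Rightarrow> nat \<Rightarrow> nat \<Rightarrow> real \<Rightarrow> real \<Rightarrow> real \<Rightarrow> real mat set" where
  "Fq q su sv p m r lam kap M =
     {S. covariance_mat (p + m) S \<and> (\<exists>U V l. Fq_decomp q su sv p m r lam kap M S U V l)}"

subsection \<open>Effective sparsity\<close>

text \<open>
  Here d is p or m, and s is the corresponding sparsity parameter.  The point \<open>x = 0\<close> always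
  belongs to the set; the supremum is attained, i.e. it is a maximum.
\<close>

definition eff_x :: "real \<Rightarrow> real \<Rightarrow> nat \<Rightarrow> nat \<Rightarrow> nat \<Rightarrow> real \<Rightarrow> real" where
  "eff_x q s d n r lam =
     Sup {x. 0 \<le> x \<and> x \<le> real d \<and>
             x \<le> s * (real n * lam\<^sup>2 / (real r + ln (exp 1 * real d / x))) powr (q / 2)}"

definition eff_k :: "real \<Rightarrow> real \<Rightarrow> nat \<Rightarrow> nat \<Rightarrow> nat \<Rightarrow> real \<Rightarrow> int" where
  "eff_k q s d n r lam = \<lceil>eff_x q s d n r lam\<rceil>"

definition eps_sq ::
  "real \<Rightarrow> real \<Rightarrow> real \<Rightarrow> nat \<Rightarrow> nat \<Rightarrow> nat \<Rightarrow> nat \<Rightarrow> real \<Rightarrow> real" where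
  "eps_sq q su sv n p m r lam =
     (let ku = real_of_int (eff_k q su p n r lam); kv = real_of_int (eff_k q sv m n r lam) in
        1 / (real n * lam\<^sup>2) *
        (real r * (ku + kv) + ku * ln (exp 1 * real p / ku) + kv * ln (exp 1 * real m / kv)))"

subsection \<open>Gaussian sample\<close>

text \<open>
  The centred normal law on vectors with coordinates \<open>{..<d}\<close>, given by its Lebesgue density; it is
  only used for positive definite S (every matrix in \<^const>\<open>Fq\<close> is positive definite).
  In \<open>gauss_sample\<close>, \<open>z i j\<close> is the j-th coordinate of the i-th observation \<open>(X_i', Y_i')'\<close>.
\<close>

definition mvn :: "nat \<Rightarrow> real mat \<Rightarrow> (nat \<Rightarrow> real) measure" where
  "mvn d S = density (Pi\<^sub>M {..<d} (\<lambda>_. lborel))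
     (\<lambda>z. ennreal (exp (- (vec d z \<bullet> (minv S *\<^sub>v vec d z)) / 2)
                     / sqrt ((2 * pi) ^ d * Determinant.det S)))"

definition gauss_sample :: "nat \<Rightarrow> nat \<Rightarrow> real mat \<Rightarrow> (nat \<Rightarrow> nat \<Rightarrow> real) measure" where
  "gauss_sample n d S = Pi\<^sub>M {..<n} (\<lambda>_. mvn d S)"

definition sample_cov :: "nat \<Rightarrow> nat \<Rightarrow> (nat \<Rightarrow> nat \<Rightarrow> real) \<Rightarrow> real mat" where
  "sample_cov n d z = mat d d (\<lambda>(j, k). (\<Sum>i<n. z i j * z i k) / real n)"

subsection \<open>Estimator\<close>

definition cca_feasible ::
  "nat \<Rightarrow> nat \<Rightarrow> nat \<Rightarrow> int \<Rightarrow> int \<Rightarrow> real mat \<Rightarrow> real mat \<Rightarrow> real mat \<Rightarrow> bool" where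
  "cca_feasible p m r ku kv Sh A B \<longleftrightarrow>
     A \<in> carrier_mat p r \<and> B \<in> carrier_mat m r \<and>
     A\<^sup>T * block_x p Sh * A = 1\<^sub>m r \<and> B\<^sup>T * block_y p m Sh * B = 1\<^sub>m r \<and>
     weak_norm 0 A = real_of_int ku \<and> weak_norm 0 B = real_of_int kv"

definition cca_solution ::
  "nat \<Rightarrow> nat \<Rightarrow> nat \<Rightarrow> int \<Rightarrow> int \<Rightarrow> real mat \<Rightarrow> real mat \<Rightarrow> real mat \<Rightarrow> bool" where
  "cca_solution p m r ku kv Sh A B \<longleftrightarrow>
     cca_feasible p m r ku kv Sh A B \<and>
     (\<forall>A' B'. cca_feasible p m r ku kv Sh A' B' \<longrightarrow>
        mtrace (A'\<^sup>T * block_xy p m Sh * B') \<le> mtrace (A\<^sup>T * block_xy p m Sh * B))"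

end

theory Submission
  imports Defs
begin

text \<open>
  The estimator maximises \<open>Tr (A' Hxy B)\<close>, where H is the sample covariance.  Normalising sparse
  truncations of \<open>U\<^sub>1\<close>, \<open>V\<^sub>1\<close> in the sample metric gives a feasible competitor \<open>(A\<^sub>0, B\<^sub>0)\<close>.
  For \<open>D = A B' - A\<^sub>0 B\<^sub>0'\<close>, the population objective has curvature \<open>\<lambda> \<parallel>D\<parallel>\<^sup>2\<close> at the competitor, while
  optimality bounds the same quantity by the truncation bias and by the noise \<open>H - \<Sigma>\<close> restricted to
  the at most \<open>2 k\<^sup>u + 2 k\<^sup>v\<close> coordinates supporting A, B and the truncations.  The noise is controlled
  by chi-square tails, nets and a union bound over supports.

  Concentration at the required confidence level is only available if
  \<open>C' (k\<^sup>u + k\<^sup>v + log (e p / k\<^sup>u) + log (e m / k\<^sup>v)) \<le> c n \<lambda>\<^sup>2\<close>.  Otherwise \<open>r \<le> k\<^sup>u, k\<^sup>v\<close> gives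
  \<open>r \<le> (C'/c) \<epsilon>\<^sub>n\<^sup>2\<close>, and the trivial bound of order r suffices; it needs a lower bound, however small, on
  the sparse eigenvalues of the sample covariance, which small ball estimates provide with enough
  confidence.  This case distinction makes c independent of \<open>C'\<close>.
\<close>

section \<open>Finitely supported matrices\<close>

text \<open>The obstacle is the noise \<open>inner E D\<close>, where D depends on the sample. In
  Frobenius norm the noise is small enough only against fixed matrices with r columns, such as the
  truncations. Against the random A and B only its operator norm on sparse sets of coordinates is
  under control, and a term linear in D with that bound would lose the rate. \<open>D_split\<close>
  separates the two: D is a sum of three terms with a factor \<open>A0\<close> or \<open>B0\<close>,
  which are linear in D and meet the fixed truncations, and of one product whose two factors are
  both of the order of D. The product costs the operator norm of the noise times the square of D,
  and the curvature absorbs it once that operator norm is a small multiple of \<lambda>. The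
  correlations beyond the r-th are treated alike: their directions are orthogonal to
  \<open>u\<close> and \<open>v\<close>, so their contribution is quadratic in D and the bias, and
  this is where their smallness relative to \<lambda> enters. Measuring the curvature in the sample
  metric makes both pairs exactly orthonormal, so that no first order error of normalisation appears
  there.\<close>

text \<open>
  Matrices of all sizes are embedded into one ring with inner product (without unit; \<open>idm T\<close> is
  the projection on the coordinates in T), so that products need no dimension side conditions.
  The norm is the Frobenius norm.
\<close>

typedef fmat = "{f :: nat \<Rightarrow> nat \<Rightarrow> real. \<exists>N. \<forall>i j. N \<le> i \<or> N \<le> j \<longrightarrow> f i j = 0}"
  morphisms ent Abs_fmat
  by (rule exI[of _ "\<lambda>_ _. 0"]) simp

setup_lifting type_definition_fmat

lemma fmat_eqI: "(\<And>i j. ent A i j = ent B i j) \<Longrightarrow> A = B"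
  by (metis ent_inject ext)

text \<open>A size bound. With one bound common to all matrices at hand, products and inner products
  become sums over \<open>{..<N}\<close> (\<open>ent_times\<close>,
  \<open>inner_fmat_dimb\<close>).\<close>

definition dimb :: "nat \<Rightarrow> fmat \<Rightarrow> bool" where
  "dimb N A \<longleftrightarrow> (\<forall>i j. N \<le> i \<or> N \<le> j \<longrightarrow> ent A i j = 0)"

lemma dimb_ex: "\<exists>N. dimb N A"
  using ent[of A] by (auto simp: dimb_def)

lemma dimb_mono: "dimb N A \<Longrightarrow> N \<le> N' \<Longrightarrow> dimb N' A"
  by (auto simp: dimb_def)

lemma dimb_obtain1: obtains N where "dimb N A"
  using dimb_ex by blast

lemma dimb_obtain2: obtains N where "dimb N A" "dimb N B"
  by (metis dimb_ex dimb_mono nat_le_linear)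

lemma dimb_obtain3: obtains N where "dimb N A" "dimb N B" "dimb N C"
  by (metis dimb_ex dimb_mono nat_le_linear)

section \<open>Vector space, ring and Euclidean structure\<close>

instantiation fmat :: real_vector
begin

lift_definition zero_fmat :: fmat is "\<lambda>_ _. 0" by simp

lift_definition plus_fmat :: "fmat \<Rightarrow> fmat \<Rightarrow> fmat" is "\<lambda>f g i j. f i j + g i j"
proof -
  fix f g :: "nat \<Rightarrow> nat \<Rightarrow> real"
  assume "\<exists>N. \<forall>i j. N \<le> i \<or> N \<le> j \<longrightarrow> f i j = 0" "\<exists>N. \<forall>i j. N \<le> i \<or> N \<le> j \<longrightarrow> g i j = 0"
  then obtain N N' where "\<forall>i j. N \<le> i \<or> N \<le> j \<longrightarrow> f i j = 0" "\<forall>i j. N' \<le> i \<or> N' \<le> j \<longrightarrow> g i j = 0" by blast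
  then show "\<exists>N. \<forall>i j. N \<le> i \<or> N \<le> j \<longrightarrow> f i j + g i j = 0"
    by (intro exI[of _ "max N N'"]) auto
qed

lift_definition minus_fmat :: "fmat \<Rightarrow> fmat \<Rightarrow> fmat" is "\<lambda>f g i j. f i j - g i j"
proof -
  fix f g :: "nat \<Rightarrow> nat \<Rightarrow> real"
  assume "\<exists>N. \<forall>i j. N \<le> i \<or> N \<le> j \<longrightarrow> f i j = 0" "\<exists>N. \<forall>i j. N \<le> i \<or> N \<le> j \<longrightarrow> g i j = 0"
  then obtain N N' where "\<forall>i j. N \<le> i \<or> N \<le> j \<longrightarrow> f i j = 0" "\<forall>i j. N' \<le> i \<or> N' \<le> j \<longrightarrow> g i j = 0" by blast
  then show "\<exists>N. \<forall>i j. N \<le> i \<or> N \<le> j \<longrightarrow> f i j - g i j = 0"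
    by (intro exI[of _ "max N N'"]) auto
qed

lift_definition uminus_fmat :: "fmat \<Rightarrow> fmat" is "\<lambda>f i j. - f i j" by auto

lift_definition scaleR_fmat :: "real \<Rightarrow> fmat \<Rightarrow> fmat" is "\<lambda>c f i j. c * f i j" by auto

instance
  by standard (transfer; auto simp: algebra_simps intro!: ext)+

end

lemmas ent_simps [simp] =
  zero_fmat.rep_eq plus_fmat.rep_eq minus_fmat.rep_eq uminus_fmat.rep_eq scaleR_fmat.rep_eq

lemma ent_sum: "ent (sum f I) i j = (\<Sum>x\<in>I. ent (f x) i j)"
  by (induction I rule: infinite_finite_induct) auto

lift_definition tp :: "fmat \<Rightarrow> fmat" is "\<lambda>f i j. f j i" by auto

lemma ent_tp [simp]: "ent (tp A) i j = ent A j i"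
  by (simp add: tp.rep_eq)

lift_definition idm :: "nat set \<Rightarrow> fmat" is "\<lambda>T i j. if finite T \<and> i = j \<and> i \<in> T then 1 else 0"
proof -
  fix T :: "nat set"
  show "\<exists>N. \<forall>i j. N \<le> i \<or> N \<le> j \<longrightarrow> (if finite T \<and> i = j \<and> i \<in> T then 1 else (0::real)) = 0"
  proof (cases "finite T")
    case True
    then obtain N where "\<forall>x\<in>T. x < N" using finite_nat_set_iff_bounded by blast
    then show ?thesis by (intro exI[of _ N]) auto
  qed auto
qed

lemma ent_idm: "finite T \<Longrightarrow> ent (idm T) i j = (if i = j \<and> i \<in> T then 1 else 0)"
  by (simp add: idm.rep_eq)

instantiation fmat :: ring
begin

text \<open>The sum runs over the nonzero entries in a row of the left factor, a finite set that
  requires no choice of a size.\<close>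

lift_definition times_fmat :: "fmat \<Rightarrow> fmat \<Rightarrow> fmat" is
  "\<lambda>f g i k. \<Sum>j | f i j \<noteq> 0. f i j * g j k"
proof -
  fix f g :: "nat \<Rightarrow> nat \<Rightarrow> real"
  assume "\<exists>N. \<forall>i j. N \<le> i \<or> N \<le> j \<longrightarrow> f i j = 0" "\<exists>N. \<forall>i j. N \<le> i \<or> N \<le> j \<longrightarrow> g i j = 0"
  then obtain N N' where "\<forall>i j. N \<le> i \<or> N \<le> j \<longrightarrow> f i j = 0" "\<forall>i j. N' \<le> i \<or> N' \<le> j \<longrightarrow> g i j = 0" by blast
  then show "\<exists>N. \<forall>i k. N \<le> i \<or> N \<le> k \<longrightarrow> (\<Sum>j | f i j \<noteq> 0. f i j * g j k) = 0"
    by (intro exI[of _ "max N N'"]) (auto intro!: sum.neutral)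
qed

lemma ent_times: "dimb N A \<Longrightarrow> ent (A * B) i k = (\<Sum>j<N. ent A i j * ent B j k)"
proof -
  assume "dimb N A"
  then have "{j. ent A i j \<noteq> 0} \<subseteq> {..<N}" by (auto simp: dimb_def not_le[symmetric])
  then show ?thesis unfolding times_fmat.rep_eq by (intro sum.mono_neutral_left) auto
qed

instance
proof
  fix A B C :: fmat
  obtain N where N: "dimb N A" "dimb N B" "dimb N C" by (rule dimb_obtain3)
  have NAB: "dimb N (A * B)" using N
    by (auto simp: dimb_def ent_times[OF N(1)] intro!: sum.neutral)
  show "A * B * C = A * (B * C)"
  proof (rule fmat_eqI)
    fix i l
    have "ent (A * B * C) i l = (\<Sum>k<N. \<Sum>j<N. ent A i j * ent B j k * ent C k l)"
      by (simp add: ent_times[OF NAB] ent_times[OF N(1)] sum_distrib_right)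
    also have "\<dots> = (\<Sum>j<N. \<Sum>k<N. ent A i j * ent B j k * ent C k l)" by (rule sum.swap)
    also have "\<dots> = ent (A * (B * C)) i l"
      by (simp add: ent_times[OF N(1)] ent_times[OF N(2)] sum_distrib_left mult.assoc)
    finally show "ent (A * B * C) i l = ent (A * (B * C)) i l" .
  qed
  have NAB2: "dimb N (A + B)" using N by (auto simp: dimb_def)
  show "(A + B) * C = A * C + B * C"
    by (rule fmat_eqI) (simp add: ent_times[OF NAB2] ent_times[OF N(1)] ent_times[OF N(2)] algebra_simps sum.distrib)
  show "A * (B + C) = A * B + A * C"
    by (rule fmat_eqI) (simp add: ent_times[OF N(1)] algebra_simps sum.distrib)
qed

end

lemma dimb_times: "dimb N A \<Longrightarrow> dimb N B \<Longrightarrow> dimb N (A * B)"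
  by (simp add: dimb_def ent_times[of N A])

lemma dimb_tp: "dimb N A \<Longrightarrow> dimb N (tp A)"
  by (auto simp: dimb_def)

lemma scaleR_times_left [simp]: "(c *\<^sub>R A) * (B::fmat) = c *\<^sub>R (A * B)"
proof -
  obtain N where N: "dimb N A" by (rule dimb_obtain1)
  then have "dimb N (c *\<^sub>R A)" by (auto simp: dimb_def)
  with N show ?thesis by (intro fmat_eqI) (simp add: ent_times[of N] sum_distrib_left algebra_simps)
qed

lemma scaleR_times_right [simp]: "A * (c *\<^sub>R (B::fmat)) = c *\<^sub>R (A * B)"
proof -
  obtain N where N: "dimb N A" by (rule dimb_obtain1)
  then show ?thesis by (intro fmat_eqI) (simp add: ent_times[of N] sum_distrib_left algebra_simps)
qed

lemma tp_tp [simp]: "tp (tp A) = A" by (rule fmat_eqI) simp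
lemma tp_add: "tp (A + B) = tp A + tp B" by (rule fmat_eqI) simp
lemma tp_diff: "tp (A - B) = tp A - tp B" by (rule fmat_eqI) simp
lemma tp_minus: "tp (- A) = - tp A" by (rule fmat_eqI) simp
lemma tp_scaleR: "tp (c *\<^sub>R A) = c *\<^sub>R tp A" by (rule fmat_eqI) simp
lemma tp_idm [simp]: "tp (idm T) = idm T" by (rule fmat_eqI) (auto simp: idm.rep_eq)

lemma tp_mult: "tp (A * B) = tp B * tp A"
proof -
  obtain N where N: "dimb N A" "dimb N B" by (rule dimb_obtain2)
  show ?thesis
    by (rule fmat_eqI) (simp add: ent_times[OF N(1)] ent_times[OF dimb_tp[OF N(2)]] mult.commute)
qed

lemmas tp_simps = tp_add tp_diff tp_minus tp_scaleR tp_mult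

lemma ent_idm_times: "finite T \<Longrightarrow> ent (idm T * A) i j = (if i \<in> T then ent A i j else 0)"
proof -
  assume T: "finite T"
  have eq: "{x. ent (idm T) i x \<noteq> 0} = (if i \<in> T then {i} else {})" by (auto simp: ent_idm[OF T])
  show ?thesis unfolding times_fmat.rep_eq eq by (simp add: ent_idm[OF T])
qed

lemma ent_times_idm: "finite T \<Longrightarrow> ent (A * idm T) i j = (if j \<in> T then ent A i j else 0)"
proof -
  assume "finite T"
  then have "ent (tp (idm T * tp A)) i j = (if j \<in> T then ent A i j else 0)" by (simp add: ent_idm_times)
  then show ?thesis by (simp add: tp_mult)
qed

lemma idm_idm: "finite S \<Longrightarrow> finite T \<Longrightarrow> idm S * idm T = idm (S \<inter> T)"
  by (rule fmat_eqI) (auto simp: ent_idm_times ent_idm)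

lemma idm_idem [simp]: "finite T \<Longrightarrow> idm T * idm T = idm T"
  by (simp add: idm_idm)

instantiation fmat :: real_inner
begin

definition inner_fmat :: "fmat \<Rightarrow> fmat \<Rightarrow> real" where
  "inner_fmat A B = (\<Sum>x | ent A (fst x) (snd x) \<noteq> 0. ent A (fst x) (snd x) * ent B (fst x) (snd x))"

definition norm_fmat :: "fmat \<Rightarrow> real" where "norm_fmat A = sqrt (inner A A)"
definition dist_fmat :: "fmat \<Rightarrow> fmat \<Rightarrow> real" where "dist_fmat A B = norm (A - B)"
definition sgn_fmat :: "fmat \<Rightarrow> fmat" where "sgn_fmat A = A /\<^sub>R norm A"
definition uniformity_fmat :: "(fmat \<times> fmat) filter" where
  "uniformity_fmat = (INF e\<in>{0 <..}. principal {(x, y). dist x y < e})"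
definition open_fmat :: "fmat set \<Rightarrow> bool" where
  "open_fmat U = (\<forall>x\<in>U. \<forall>\<^sub>F (x', y) in uniformity. x' = x \<longrightarrow> y \<in> U)"

lemma inner_fmat_dimb: "dimb N A \<Longrightarrow> inner A B = (\<Sum>i<N. \<Sum>j<N. ent A i j * ent B i j)"
proof -
  assume "dimb N A"
  then have sub: "{x. ent A (fst x) (snd x) \<noteq> 0} \<subseteq> {..<N} \<times> {..<N}"
    by (auto simp: dimb_def not_le[symmetric])
  have "inner A B = (\<Sum>x\<in>{..<N} \<times> {..<N}. ent A (fst x) (snd x) * ent B (fst x) (snd x))"
    unfolding inner_fmat_def using sub by (intro sum.mono_neutral_left) auto
  then show ?thesis by (simp add: sum.cartesian_product case_prod_beta)
qed

instance
proof
  fix A B C :: fmat and r :: real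
  show "dist A B = norm (A - B)" by (rule dist_fmat_def)
  show "sgn A = A /\<^sub>R norm A" by (rule sgn_fmat_def)
  show "(uniformity :: (fmat \<times> fmat) filter) = (INF e\<in>{0 <..}. principal {(x, y). dist x y < e})"
    by (rule uniformity_fmat_def)
  show "open U = (\<forall>x\<in>U. \<forall>\<^sub>F (x', y) in uniformity. x' = x \<longrightarrow> y \<in> U)" for U :: "fmat set"
    by (rule open_fmat_def)
  show "norm A = sqrt (inner A A)" by (rule norm_fmat_def)
  obtain N where N: "dimb N A" "dimb N B" "dimb N C" by (rule dimb_obtain3)
  have N2: "dimb N (A + B)" "dimb N (r *\<^sub>R A)" using N by (auto simp: dimb_def)
  show "inner A B = inner B A" by (simp add: inner_fmat_dimb[OF N(1)] inner_fmat_dimb[OF N(2)] mult.commute)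
  show "inner (A + B) C = inner A C + inner B C"
    by (simp add: inner_fmat_dimb[OF N(1)] inner_fmat_dimb[OF N(2)] inner_fmat_dimb[OF N2(1)] algebra_simps sum.distrib)
  show "inner (r *\<^sub>R A) B = r * inner A B"
    by (simp add: inner_fmat_dimb[OF N(1)] inner_fmat_dimb[OF N2(2)] sum_distrib_left mult.assoc)
  show nn: "0 \<le> inner A A" by (simp add: inner_fmat_dimb[OF N(1)] sum_nonneg)
  show "(inner A A = 0) = (A = 0)"
  proof
    assume "inner A A = 0"
    then have "\<forall>i<N. \<forall>j<N. ent A i j = 0"
      by (simp add: inner_fmat_dimb[OF N(1)] sum_nonneg_eq_0_iff sum_nonneg)
    then have "ent A i j = 0" for i j using N(1) unfolding dimb_def by (meson not_le)
    then show "A = 0" by (intro fmat_eqI) simp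
  qed (simp add: inner_fmat_def)
qed

end

lemma inner_tp: "inner (tp A) (tp B) = inner A B"
proof -
  obtain N where N: "dimb N A" by (rule dimb_obtain1)
  show ?thesis by (simp add: inner_fmat_dimb[OF N] inner_fmat_dimb[OF dimb_tp[OF N]], subst sum.swap, simp)
qed

lemma norm_tp [simp]: "norm (tp A) = norm A"
  by (simp add: norm_eq_sqrt_inner inner_tp)

lemma inner_mult_left: "inner (A * B) C = inner B (tp A * C)"
proof -
  obtain N where N: "dimb N A" "dimb N B" by (rule dimb_obtain2)
  have "inner (A * B) C = (\<Sum>i<N. \<Sum>k<N. \<Sum>j<N. ent A i j * ent B j k * ent C i k)"
    by (simp add: inner_fmat_dimb[OF dimb_times[OF N]] ent_times[OF N(1)] sum_distrib_right)
  also have "\<dots> = (\<Sum>j<N. \<Sum>k<N. \<Sum>i<N. ent A i j * ent B j k * ent C i k)"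
    by (subst (2) sum.swap, subst sum.swap, subst (2) sum.swap, simp)
  also have "\<dots> = inner B (tp A * C)"
    by (simp add: inner_fmat_dimb[OF N(2)] ent_times[OF dimb_tp[OF N(1)]] sum_distrib_left mult.assoc mult.left_commute)
  finally show ?thesis .
qed

lemma inner_mult_right: "inner (A * B) C = inner A (C * tp B)"
proof -
  have "inner (A * B) C = inner (tp B * tp A) (tp C)" using inner_tp[of "A * B" C] by (simp add: tp_mult)
  also have "\<dots> = inner (tp A) (B * tp C)" by (simp add: inner_mult_left)
  also have "\<dots> = inner A (C * tp B)" using inner_tp[of A "C * tp B"] by (simp add: tp_mult)
  finally show ?thesis .
qed

lemma inner_mult_left': "inner C (A * B) = inner (tp A * C) B"
  by (metis inner_commute inner_mult_left)

lemma inner_mult_right': "inner C (A * B) = inner (C * tp B) A"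
  by (metis inner_commute inner_mult_right)

lemma norm_mult_fmat: "norm (A * B) \<le> norm A * norm (B :: fmat)"
proof -
  obtain N where N: "dimb N A" "dimb N B" by (rule dimb_obtain2)
  have "(norm (A * B))\<^sup>2 = (\<Sum>i<N. \<Sum>k<N. (\<Sum>j<N. ent A i j * ent B j k)\<^sup>2)"
    unfolding power2_norm_eq_inner
    by (simp add: inner_fmat_dimb[OF dimb_times[OF N]] ent_times[OF N(1)] power2_eq_square)
  also have "\<dots> \<le> (\<Sum>i<N. \<Sum>k<N. (\<Sum>j<N. (ent A i j)\<^sup>2) * (\<Sum>j<N. (ent B j k)\<^sup>2))"
    by (intro sum_mono Cauchy_Schwarz_ineq_sum)
  also have "\<dots> = (\<Sum>i<N. \<Sum>j<N. (ent A i j)\<^sup>2) * (\<Sum>k<N. \<Sum>j<N. (ent B j k)\<^sup>2)"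
    by (simp add: sum_product)
  also have "(\<Sum>k<N. \<Sum>j<N. (ent B j k)\<^sup>2) = (\<Sum>j<N. \<Sum>k<N. (ent B j k)\<^sup>2)" by (rule sum.swap)
  also have "(\<Sum>i<N. \<Sum>j<N. (ent A i j)\<^sup>2) * (\<Sum>j<N. \<Sum>k<N. (ent B j k)\<^sup>2) = (norm A * norm B)\<^sup>2"
    unfolding power_mult_distrib power2_norm_eq_inner
    by (simp add: inner_fmat_dimb[OF N(1)] inner_fmat_dimb[OF N(2)] power2_eq_square)
  finally show ?thesis by (rule power2_le_imp_le) simp
qed

lemma ent_le_norm: "\<bar>ent A i j\<bar> \<le> norm A"
proof -
  obtain N0 where N0: "dimb N0 A" by (rule dimb_obtain1)
  define N where "N = Suc (max N0 (max i j))"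
  have N: "dimb N A" "i < N" "j < N" using dimb_mono[OF N0, of N] by (auto simp: N_def)
  have "(ent A i j)\<^sup>2 \<le> (\<Sum>k<N. (ent A i k)\<^sup>2)" using N by (intro member_le_sum) auto
  also have "\<dots> \<le> (\<Sum>i<N. \<Sum>k<N. (ent A i k)\<^sup>2)"
    using N by (intro member_le_sum[of i _ "\<lambda>i. \<Sum>k<N. (ent A i k)\<^sup>2"]) (auto intro: sum_nonneg)
  also have "\<dots> = (norm A)\<^sup>2" unfolding power2_norm_eq_inner
    by (simp add: inner_fmat_dimb[OF N(1)] power2_eq_square)
  finally show ?thesis by (metis abs_le_square_iff abs_norm_cancel)
qed

subsection \<open>Operator norm bounds\<close>

text \<open>The operator norm is at most c. Quantifying over matrices K instead of vectors builds in
  that a product has Frobenius norm at most operator norm times Frobenius norm;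
  \<open>opb_columns\<close> reduces the condition to vectors.\<close>

definition opb :: "real \<Rightarrow> fmat \<Rightarrow> bool" where
  "opb c A \<longleftrightarrow> (\<forall>K. norm (A * K) \<le> c * norm K)"

lemma opbD: "opb c A \<Longrightarrow> norm (A * K) \<le> c * norm K"
  by (simp add: opb_def)

lemma opb_nonneg: "opb c A \<Longrightarrow> 0 \<le> c"
proof -
  assume "opb c A"
  then have "norm (A * idm {0}) \<le> c * norm (idm {0})" by (rule opbD)
  moreover have "norm (idm {0}) \<noteq> 0"
  proof
    assume "norm (idm {0}) = 0"
    then have "ent (idm {0}) 0 0 = 0" by simp
    then show False by (simp add: ent_idm)
  qed
  ultimately show "0 \<le> c"
    by (smt (verit, best) mult_neg_pos norm_ge_zero)
qed

lemma opb_mono: "opb c A \<Longrightarrow> c \<le> c' \<Longrightarrow> opb c' A"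
  unfolding opb_def by (meson mult_right_mono norm_ge_zero order_trans)

text \<open>For \<open>X = tp A * K\<close> the squared norm equals \<open>inner K (A * X)\<close>.
  Cauchy-Schwarz and the bound for A leave a factor \<open>norm X\<close>, which cancels.\<close>

lemma opb_tp: assumes "opb c A" shows "opb c (tp A)"
  unfolding opb_def
proof
  fix K
  have "(norm (tp A * K))\<^sup>2 = inner K (A * (tp A * K))"
    by (simp add: power2_norm_eq_inner inner_mult_left)
  also have "\<dots> \<le> norm K * norm (A * (tp A * K))" by (rule norm_cauchy_schwarz)
  also have "\<dots> \<le> norm K * (c * norm (tp A * K))"
    by (intro mult_left_mono opbD[OF assms]) auto
  finally have "norm (tp A * K) * norm (tp A * K) \<le> (c * norm K) * norm (tp A * K)"
    by (simp add: power2_eq_square mult_ac)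
  then show "norm (tp A * K) \<le> c * norm K"
    using opb_nonneg[OF assms] by (cases "norm (tp A * K) = 0") (auto dest: mult_right_le_imp_le)
qed

lemma opbD': "opb c A \<Longrightarrow> norm (K * A) \<le> c * norm K"
  using opbD[OF opb_tp, of c A "tp K"] norm_tp[of "K * A"] unfolding tp_mult by simp

lemma opb_mult: "opb c A \<Longrightarrow> opb d B \<Longrightarrow> opb (c * d) (A * B)"
proof -
  assume A: "opb c A" and B: "opb d B"
  have "norm (A * B * K) \<le> c * d * norm K" for K
  proof -
    have "norm (A * (B * K)) \<le> c * norm (B * K)" by (rule opbD[OF A])
    also have "\<dots> \<le> c * (d * norm K)" by (intro mult_left_mono opbD[OF B] opb_nonneg[OF A])
    finally show ?thesis by (simp add: mult.assoc)
  qed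
  then show ?thesis by (simp add: opb_def)
qed

lemma opb_add: "opb c A \<Longrightarrow> opb d B \<Longrightarrow> opb (c + d) (A + B)"
proof -
  assume A: "opb c A" and B: "opb d B"
  have "norm ((A + B) * K) \<le> (c + d) * norm K" for K
    using norm_triangle_ineq[of "A * K" "B * K"] opbD[OF A, of K] opbD[OF B, of K]
    by (simp add: distrib_right)
  then show ?thesis by (simp add: opb_def)
qed

lemma opb_norm: "opb (norm A) A"
  unfolding opb_def using norm_mult_fmat by blast

lemma opb_idm: "finite T \<Longrightarrow> opb 1 (idm T)"
proof -
  assume T: "finite T"
  have "norm (idm T * K) \<le> norm K" for K
  proof -
    have "(norm (idm T * K))\<^sup>2 = inner K (idm T * (idm T * K))"
      by (simp add: power2_norm_eq_inner inner_mult_left)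
    also have "\<dots> = inner K (idm T * K)" using T by (simp add: mult.assoc[symmetric])
    also have "\<dots> \<le> norm K * norm (idm T * K)" by (rule norm_cauchy_schwarz)
    finally have "norm (idm T * K) * norm (idm T * K) \<le> norm K * norm (idm T * K)"
      by (simp add: power2_eq_square)
    then show ?thesis by (cases "norm (idm T * K) = 0") (auto dest: mult_right_le_imp_le)
  qed
  then show ?thesis by (simp add: opb_def)
qed

section \<open>Inverse square roots of matrices near the identity\<close>

lift_definition mkf :: "nat \<Rightarrow> nat \<Rightarrow> (nat \<Rightarrow> nat \<Rightarrow> real) \<Rightarrow> fmat" is
  "\<lambda>a b f i j. if i < a \<and> j < b then f i j else 0"
  subgoal for a b f by (rule exI[of _ "max a b"]) auto
  done

lemma ent_mkf [simp]: "ent (mkf a b f) i j = (if i < a \<and> j < b then f i j else 0)"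
  by (simp add: mkf.rep_eq)

lemma dimb_idm_left: "dimb r A \<Longrightarrow> idm {..<r} * A = A"
  by (rule fmat_eqI) (auto simp: ent_idm_times dimb_def)

lemma dimb_idm_right: "dimb r A \<Longrightarrow> A * idm {..<r} = A"
  by (rule fmat_eqI) (auto simp: ent_times_idm dimb_def)

lemma norm_le_sum_ent:
  assumes "dimb N A" shows "norm A \<le> (\<Sum>i<N. \<Sum>j<N. \<bar>ent A i j\<bar>)"
proof -
  have "(norm A)\<^sup>2 = (\<Sum>x\<in>{..<N} \<times> {..<N}. (\<lambda>(i,j). \<bar>ent A i j\<bar>) x ^ 2)"
    unfolding power2_norm_eq_inner inner_fmat_dimb[OF assms] sum.cartesian_product
    by (intro sum.cong) (auto simp: power2_eq_square)
  also have "\<dots> = (L2_set (\<lambda>(i,j). \<bar>ent A i j\<bar>) ({..<N} \<times> {..<N}))\<^sup>2"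
    unfolding L2_set_def by (subst real_sqrt_pow2) (auto intro: sum_nonneg)
  finally have "norm A = L2_set (\<lambda>(i,j). \<bar>ent A i j\<bar>) ({..<N} \<times> {..<N})"
    by (simp add: L2_set_nonneg)
  also have "\<dots> \<le> (\<Sum>x\<in>{..<N} \<times> {..<N}. (\<lambda>(i,j). \<bar>ent A i j\<bar>) x)"
    by (intro L2_set_le_sum) auto
  finally show ?thesis by (simp add: sum.cartesian_product)
qed

text \<open>The type \<open>fmat\<close> is not complete, since limits may have infinite support;
  confining the entries to an r by r block restores the completeness that Banach's fixed point
  theorem needs.\<close>

lemma complete_sym_ball: "Topological_Spaces.complete {E. dimb r E \<and> tp E = E \<and> norm E \<le> \<rho>}"
proof (rule completeI)
  fix X :: "nat \<Rightarrow> fmat"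
  assume X: "\<forall>n. X n \<in> {E. dimb r E \<and> tp E = E \<and> norm E \<le> \<rho>}" and C: "Cauchy X"
  have "Cauchy (\<lambda>n. ent (X n) i j)" for i j
  proof (rule CauchyI)
    fix e :: real assume "0 < e"
    then obtain K where K: "\<forall>a\<ge>K. \<forall>b\<ge>K. norm (X a - X b) < e" using CauchyD[OF C] by blast
    show "\<exists>K. \<forall>a\<ge>K. \<forall>b\<ge>K. norm (ent (X a) i j - ent (X b) i j) < e"
    proof (intro exI allI impI)
      fix a b assume "K \<le> a" "K \<le> b"
      then have "norm (X a - X b) < e" using K by blast
      then show "norm (ent (X a) i j - ent (X b) i j) < e" using ent_le_norm[of "X a - X b" i j] by simp
    qed
  qed
  then have cv: "convergent (\<lambda>n. ent (X n) i j)" for i j by (simp add: Cauchy_convergent_iff)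
  define E where "E = mkf r r (\<lambda>i j. lim (\<lambda>n. ent (X n) i j))"
  have dX: "dimb r (X n)" for n using X by blast
  have dE: "dimb r E" by (simp add: dimb_def E_def)
  have lim: "(\<lambda>n. ent (X n) i j) \<longlonglongrightarrow> ent E i j" for i j
  proof (cases "i < r \<and> j < r")
    case True then show ?thesis using cv[of i j] by (simp add: E_def convergent_LIMSEQ_iff)
  next
    case False
    then have "(\<lambda>n. ent (X n) i j) = (\<lambda>n. 0)" "ent E i j = 0" using dX dE by (auto simp: dimb_def not_less)
    then show ?thesis by simp
  qed
  have "(\<lambda>n. \<Sum>i<r. \<Sum>j<r. \<bar>ent (X n) i j - ent E i j\<bar>) \<longlonglongrightarrow> (\<Sum>i<r. \<Sum>j<r. \<bar>ent E i j - ent E i j\<bar>)"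
    by (intro tendsto_intros lim)
  then have z: "(\<lambda>n. \<Sum>i<r. \<Sum>j<r. \<bar>ent (X n) i j - ent E i j\<bar>) \<longlonglongrightarrow> 0" by simp
  have le: "norm (X n - E) \<le> (\<Sum>i<r. \<Sum>j<r. \<bar>ent (X n) i j - ent E i j\<bar>)" for n
    using norm_le_sum_ent[of r "X n - E"] dX dE by (simp add: dimb_def)
  have "(\<lambda>n. X n - E) \<longlonglongrightarrow> 0"
    by (rule Lim_null_comparison[OF _ z]) (use le in auto)
  then have L: "X \<longlonglongrightarrow> E" by (simp add: LIM_zero_iff)
  have "norm E \<le> \<rho>" by (rule Lim_norm_ubound[OF _ L]) (use X in auto)
  moreover have "tp E = E"
  proof (rule fmat_eqI)
    fix i j
    have "ent (X n) i j = ent (X n) j i" for n using X by (metis (mono_tags, lifting) ent_tp mem_Collect_eq)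
    then show "ent (tp E) i j = ent E i j" using lim[of i j] lim[of j i] by (simp add: LIMSEQ_unique)
  qed
  ultimately show "\<exists>l\<in>{E. dimb r E \<and> tp E = E \<and> norm E \<le> \<rho>}. X \<longlonglongrightarrow> l" using dE L by blast
qed

lemma norm_mult_le: "norm X \<le> a \<Longrightarrow> norm Y \<le> b \<Longrightarrow> norm (X * Y) \<le> a * b" for X Y :: fmat
  by (meson mult_mono norm_ge_zero norm_mult_fmat order_trans)

text \<open>
  With \<open>G = 1 + H\<close>, the equation \<open>(1 + E) G (1 + E) = 1\<close> is a fixed point equation for
  a contraction of a small ball of symmetric matrices.
\<close>

lemma inverse_sqrt_near_one:
  fixes G :: fmat
  assumes dG: "dimb r G" and sG: "tp G = G" and h: "norm (G - idm {..<r}) \<le> h" and h16: "h \<le> 1/16"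
  obtains N where "dimb r N" "tp N = N" "N * G * N = idm {..<r}" "norm (N - idm {..<r}) \<le> 2 * h"
proof -
  define I where "I = idm {..<r}"
  define H where "H = G - I"
  \<comment> \<open>The equation \<open>(I + E) * (I + H) * (I + E) = I\<close> says that 2 E plus
    the bracket vanishes; \<Phi> solves it for the linear term.\<close>
  define \<Phi> where "\<Phi> = (\<lambda>E. (-(1/2)) *\<^sub>R (H + E * H + H * E + E * E + E * H * E))"
  define S where "S = {E. dimb r E \<and> tp E = E \<and> norm E \<le> 2 * h}"
  have h0: "0 \<le> h" using h norm_ge_zero order_trans by blast
  have nH: "norm H \<le> h" using h by (simp add: H_def I_def)
  have dI: "dimb r I" by (auto simp: dimb_def I_def ent_idm)
  have dH: "dimb r H" using dG dI by (simp add: H_def dimb_def)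
  have sH: "tp H = H" by (simp add: H_def I_def tp_simps sG)
  have "\<exists>!E. E \<in> S \<and> \<Phi> E = E"
  proof (rule Banach_fix[of S "1/2"])
    show "Topological_Spaces.complete S" unfolding S_def by (rule complete_sym_ball)
    have "0 \<in> S" using h0 by (auto simp: S_def dimb_def intro: fmat_eqI)
    then show "S \<noteq> {}" by blast
    show "0 \<le> (1/2::real)" "(1/2::real) < 1" by auto
    show "\<Phi> ` S \<subseteq> S"
    proof safe
      fix E assume E: "E \<in> S"
      then have dE: "dimb r E" and sE: "tp E = E" and nE: "norm E \<le> 2 * h" by (auto simp: S_def)
      have "dimb r (\<Phi> E)" unfolding \<Phi>_def using dimb_times[OF dE dH] dimb_times[OF dH dE] dimb_times[OF dE dE]
         dimb_times[OF dimb_times[OF dE dH] dE] dH by (simp add: dimb_def)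
      moreover have "tp (\<Phi> E) = \<Phi> E"
        by (simp add: \<Phi>_def tp_simps sE sH mult.assoc)
      moreover have "norm (\<Phi> E) \<le> 2 * h"
      proof -
        have 1: "norm (E * H) \<le> 2 * h * h" "norm (H * E) \<le> h * (2 * h)" "norm (E * E) \<le> 2 * h * (2 * h)"
          using norm_mult_le[OF nE nH] norm_mult_le[OF nH nE] norm_mult_le[OF nE nE] by auto
        have 2: "norm (E * H * E) \<le> 2 * h * h * (2 * h)"
          using norm_mult_le[OF 1(1) nE] .
        have "norm (H + E * H + H * E + E * E + E * H * E) \<le> h + 2 * h * h + h * (2 * h) + 2 * h * (2 * h) + 2 * h * h * (2 * h)"
          using 1 2 nH by (intro norm_triangle_mono) auto
        also have "\<dots> = h * (1 + 8 * h + 4 * h * h)" by (simp add: algebra_simps)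
        also have "\<dots> \<le> h * (1 + 8 * (1/16) + 4 * (1/16) * (1/16))"
          using h0 h16 by (intro mult_left_mono add_mono mult_mono) auto
        finally show ?thesis using h0 by (simp add: \<Phi>_def)
      qed
      ultimately show "\<Phi> E \<in> S" by (simp add: S_def)
    qed
    show "dist (\<Phi> E) (\<Phi> F) \<le> 1/2 * dist E F" if "E \<in> S" "F \<in> S" for E F
    proof -
      have nE: "norm E \<le> 2 * h" and nF: "norm F \<le> 2 * h" using that by (auto simp: S_def)
      let ?D = "E - F"
      \<comment> \<open>The quadratic terms are telescoped:
        \<open>E * E - F * F = E * ?D + ?D * F\<close>, and similarly with H in the middle.\<close>
      have eq: "\<Phi> E - \<Phi> F = (-(1/2)) *\<^sub>R (?D * H + H * ?D + E * ?D + ?D * F + E * H * ?D + ?D * H * F)"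
        by (simp add: \<Phi>_def algebra_simps)
      have b: "norm (?D * H) \<le> norm ?D * h" "norm (H * ?D) \<le> h * norm ?D" "norm (E * ?D) \<le> 2 * h * norm ?D"
        "norm (?D * F) \<le> norm ?D * (2 * h)"
        using norm_mult_le[OF order_refl nH] norm_mult_le[OF nH order_refl] norm_mult_le[OF nE order_refl]
          norm_mult_le[OF order_refl nF] by blast+
      have b2: "norm (E * H) \<le> 2 * h * h" by (rule norm_mult_le[OF nE nH])
      have b3: "norm (E * H * ?D) \<le> 2 * h * h * norm ?D" "norm (?D * H * F) \<le> norm ?D * h * (2 * h)"
        using norm_mult_le[OF b2 order_refl] norm_mult_le[OF b(1) nF] by blast+
      have "norm (?D * H + H * ?D + E * ?D + ?D * F + E * H * ?D + ?D * H * F)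
        \<le> norm ?D * h + h * norm ?D + 2 * h * norm ?D + norm ?D * (2 * h) + 2 * h * h * norm ?D + norm ?D * h * (2 * h)"
        using b b3 by (intro norm_triangle_mono) auto
      also have "\<dots> = (6 * h + 4 * h * h) * norm ?D" by (simp add: algebra_simps)
      also have "\<dots> \<le> (6 * (1/16) + 4 * (1/16) * (1/16)) * norm ?D"
        using h0 h16 by (intro mult_right_mono add_mono mult_mono) auto
      finally have "norm (\<Phi> E - \<Phi> F) \<le> 1/2 * ((6 * (1/16) + 4 * (1/16) * (1/16)) * norm ?D)"
        unfolding eq norm_scaleR by simp
      also have "\<dots> \<le> 1/2 * (1 * norm ?D)" by (intro mult_left_mono mult_right_mono) auto
      finally show ?thesis by (simp add: dist_norm)
    qed
  qed
  then obtain E where E: "E \<in> S" and fp: "\<Phi> E = E" by blast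
  have dE: "dimb r E" and sE: "tp E = E" and nE: "norm E \<le> 2 * h" using E by (auto simp: S_def)
  have fp2: "H + E * H + H * E + E * E + E * H * E = - (E + E)"
  proof -
    have "H + E * H + H * E + E * E + E * H * E = (-2::real) *\<^sub>R \<Phi> E"
      unfolding \<Phi>_def scaleR_scaleR by simp
    also have "\<dots> = - (E + E)" unfolding fp by (simp add: scaleR_2)
    finally show ?thesis .
  qed
  have I1: "I * I = I" "I * E = E" "E * I = E" "I * H = H" "H * I = H"
    using dimb_idm_left[OF dE] dimb_idm_right[OF dE] dimb_idm_left[OF dH] dimb_idm_right[OF dH]
    by (auto simp: I_def)
  have "(I + E) * G * (I + E) = (I + E) * (I + H) * (I + E)" by (simp add: H_def)
  also have "\<dots> = I + (E + E) + (H + E * H + H * E + E * E + E * H * E)"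
    by (simp add: distrib_left distrib_right I1 mult.assoc)
  also have "\<dots> = I" by (simp add: fp2)
  finally have "(I + E) * G * (I + E) = I" .
  then show ?thesis using dE dI sE nE
    by (intro that[of "I + E"]) (auto simp: dimb_def tp_simps I_def)
qed

lemma opbD_le: "opb c A \<Longrightarrow> norm K \<le> k \<Longrightarrow> norm (A * K) \<le> c * k"
  by (meson mult_left_mono opbD opb_nonneg order_trans)

lemma opbD'_le: "opb c A \<Longrightarrow> norm K \<le> k \<Longrightarrow> norm (K * A) \<le> c * k"
  by (meson mult_left_mono opbD' opb_nonneg order_trans)

subsection \<open>Orthonormal systems for a semidefinite form\<close>

text \<open>Bessel's inequality for the form H: b is the H-orthogonal projection of K on the columns
  of A, and the form is nonnegative at \<open>K - b\<close>.\<close>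

lemma bessel_psd:
  assumes sH: "tp H = H" and psd: "\<And>K. 0 \<le> inner K (H * K)"
    and A: "tp A * H * A = idm T" and T: "finite T" and AI: "A * idm T = A"
  shows "(norm (tp A * H * K))\<^sup>2 \<le> inner K (H * K)"
proof -
  have IA: "idm T * tp A = tp A" using AI by (metis tp_idm tp_mult)
  define b where "b = A * (tp A * H * K)"
  have "0 \<le> inner (K - b) (H * (K - b))" by (rule psd)
  also have "\<dots> = inner K (H * K) - inner b (H * K) - inner K (H * b) + inner b (H * b)"
    by (simp add: algebra_simps inner_diff_left inner_diff_right)
  also have "inner b (H * K) = (norm (tp A * H * K))\<^sup>2"
    by (simp add: b_def power2_norm_eq_inner inner_mult_left mult.assoc)
  also have "inner K (H * b) = (norm (tp A * H * K))\<^sup>2"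
    by (simp add: b_def power2_norm_eq_inner inner_mult_left' mult.assoc tp_simps sH)
  also have "inner b (H * b) = inner (tp A * H * K) ((tp A * H * A) * (tp A * H * K))"
    by (simp add: b_def inner_mult_left mult.assoc)
  also have "\<dots> = (norm (tp A * H * K))\<^sup>2" unfolding A power2_norm_eq_inner
    by (simp add: mult.assoc[symmetric] IA)
  finally show ?thesis by simp
qed

lemma bessel:
  assumes pH: "H = tp Z * Z" and A: "tp A * H * A = idm T" and T: "finite T" and AI: "A * idm T = A"
  shows "(norm (tp A * H * K))\<^sup>2 \<le> inner K (H * K)"
proof (rule bessel_psd[OF _ _ A T AI])
  show "tp H = H" by (simp add: pH tp_simps)
  have "inner K (H * K) = (norm (Z * K))\<^sup>2" for K
    by (simp add: power2_norm_eq_inner pH inner_mult_left mult.assoc)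
  then show "0 \<le> inner K (H * K)" for K by simp
qed

lemma inner_sandwich: "inner (P * X * Q) C = inner X (tp P * C * tp Q)"
  by (metis inner_mult_left inner_mult_right mult.assoc)

lemma norm_idm1 [simp]: "norm (idm {i}) = 1"
proof -
  have "dimb (Suc i) (idm {i})" by (auto simp: dimb_def ent_idm)
  then have "inner (idm {i}) (idm {i}) = (\<Sum>a<Suc i. \<Sum>b<Suc i. if a = i \<and> b = i then 1 else 0)"
    by (subst inner_fmat_dimb) (auto simp: ent_idm intro!: sum.cong)
  also have "\<dots> = 1" by (simp add: sum.neutral)
  finally show ?thesis by (simp add: norm_eq_sqrt_inner)
qed

lemma inner_idm1 [simp]: "inner (idm {i}) (idm {i}) = 1"
  by (simp add: power2_norm_eq_inner[symmetric])

lemma idm_sum: "finite T \<Longrightarrow> idm T = (\<Sum>i\<in>T. idm {i})"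
  by (rule fmat_eqI) (auto simp: ent_sum ent_idm intro!: sum.neutral)

text \<open>
  The curvature of the trace functional at its maximiser: in the metric of \<open>Hx\<close> and \<open>Hy\<close>
  both pairs are orthonormal, so the diagonal entries of \<open>A0' Hx A B' Hy B0\<close> are at most 1.
\<close>

lemma curvature:
  assumes Hx: "Hx = tp Zx * Zx" and Hy: "Hy = tp Zy * Zy"
    and A: "tp A * Hx * A = idm {..<r}" "A * idm {..<r} = A"
    and B: "tp B * Hy * B = idm {..<r}" "B * idm {..<r} = B"
    and A0: "tp A0 * Hx * A0 = idm {..<r}" "A0 * idm {..<r} = A0"
    and B0: "tp B0 * Hy * B0 = idm {..<r}" "B0 * idm {..<r} = B0"
    and L: "L = (\<Sum>i<r. l i *\<^sub>R idm {i})" and l: "\<And>i. i < r \<Longrightarrow> lam \<le> l i"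
    and D: "D = A * tp B - A0 * tp B0"
  shows "inner (Hx * A0 * L * tp B0 * Hy) D \<le> - (lam / 2) * inner (Hx * D * Hy) D"
proof -
  define I where "I = idm {..<r}"
  define m where "m = tp A0 * Hx * A * (tp B * Hy * B0)"
  have sx: "tp Hx = Hx" and sy: "tp Hy = Hy" by (simp_all add: Hx Hy tp_simps)
  have I1: "I * tp A = tp A" "I * tp B = tp B" "I * tp A0 = tp A0" "I * tp B0 = tp B0"
    using A(2) B(2) A0(2) B0(2) by (metis I_def tp_idm tp_mult)+
  define d where "d = (\<lambda>i. inner (idm {i}) m)"
  have d1: "d i \<le> 1" if i: "i < r" for i
  proof -
    have "d i = inner (tp A * Hx * A0 * idm {i}) (tp B * Hy * B0 * idm {i})"
    proof -
      have "inner (idm {i}) m = inner (idm {i} * idm {i}) m" by simp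
      also have "\<dots> = inner (tp A * Hx * A0 * idm {i}) (tp B * Hy * B0 * idm {i})"
        unfolding m_def inner_mult_right[of "idm {i}" "idm {i}"]
        using inner_mult_left'[of "idm {i}" "tp A0 * Hx * A" "tp B * Hy * B0 * idm {i}"]
        by (simp add: tp_simps sx sy mult.assoc)
      finally show ?thesis by (simp add: d_def)
    qed
    also have "\<dots> \<le> norm (tp A * Hx * A0 * idm {i}) * norm (tp B * Hy * B0 * idm {i})"
      by (rule norm_cauchy_schwarz)
    also have "\<dots> \<le> 1 * 1"
    proof (intro mult_mono)
      have ii: "I * idm {i} = idm {i}" using i by (simp add: I_def idm_idm)
      have "(norm (tp A * Hx * (A0 * idm {i})))\<^sup>2 \<le> inner (A0 * idm {i}) (Hx * (A0 * idm {i}))"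
        by (rule bessel[OF Hx A(1) _ A(2)]) simp
      also have "\<dots> = inner (idm {i}) ((tp A0 * Hx * A0) * idm {i})" by (simp add: inner_mult_left mult.assoc)
      also have "\<dots> = (norm (idm {i}))\<^sup>2" using ii unfolding A0(1) by (simp add: I_def power2_norm_eq_inner)
      finally show "norm (tp A * Hx * A0 * idm {i}) \<le> 1" by (simp add: mult.assoc abs_square_le_1)
      have "(norm (tp B * Hy * (B0 * idm {i})))\<^sup>2 \<le> inner (B0 * idm {i}) (Hy * (B0 * idm {i}))"
        by (rule bessel[OF Hy B(1) _ B(2)]) simp
      also have "\<dots> = inner (idm {i}) ((tp B0 * Hy * B0) * idm {i})" by (simp add: inner_mult_left mult.assoc)
      also have "\<dots> = (norm (idm {i}))\<^sup>2" using ii unfolding B0(1) by (simp add: I_def power2_norm_eq_inner)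
      finally show "norm (tp B * Hy * B0 * idm {i}) \<le> 1" by (simp add: mult.assoc abs_square_le_1)
    qed auto
    finally show ?thesis by simp
  qed
  have iii: "inner (idm {i}) I = 1" if "i < r" for i
  proof -
    have "inner (idm {i}) I = inner (idm {i} * idm {i}) I" by simp
    also have "\<dots> = inner (idm {i}) (idm {i} * I)" by (subst inner_mult_left) simp
    also have "idm {i} * I = idm {i}" using that by (simp add: I_def idm_idm)
    finally show ?thesis by simp
  qed
  have e1: "inner (Hx * A0 * X * tp B0 * Hy) (A * tp B) = inner X m" for X
    using inner_sandwich[of "Hx * A0" X "tp B0 * Hy"] by (simp add: tp_simps sx sy m_def mult.assoc)
  have e2: "inner (Hx * A0 * X * tp B0 * Hy) (A0 * tp B0) = inner X I" for X
  proof -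
    have "inner (Hx * A0 * X * tp B0 * Hy) (A0 * tp B0) = inner X ((tp A0 * Hx * A0) * (tp B0 * Hy * B0))"
      using inner_sandwich[of "Hx * A0" X "tp B0 * Hy"] by (simp add: tp_simps sx sy mult.assoc)
    then show ?thesis unfolding A0 B0 by (simp add: I_def)
  qed
  have "inner (Hx * A0 * L * tp B0 * Hy) D = inner L m - inner L I"
    unfolding D inner_diff_right e1 e2 ..
  also have "\<dots> = - (\<Sum>i<r. l i * (1 - d i))"
    by (simp add: L inner_sum_left d_def iii algebra_simps sum_subtractf)
  also have "\<dots> \<le> - (\<Sum>i<r. lam * (1 - d i))"
    using d1 l by (intro le_imp_neg_le sum_mono mult_right_mono) auto
  finally have 1: "inner (Hx * A0 * L * tp B0 * Hy) D \<le> - (\<Sum>i<r. lam * (1 - d i))" .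
  \<comment> \<open>In the metric of Hx and Hy, both \<open>A * tp B\<close> and
    \<open>A0 * tp B0\<close> have squared length r. Hence the squared length of D is twice the sum
    of the same defects \<open>1 - d i\<close> that occur in the linear term, which explains the
    factor lam / 2.\<close>
  have q1: "inner (Hx * (A * tp B) * Hy) (A * tp B) = inner I I"
  proof -
    have "inner (Hx * A * I * (tp B * Hy)) (A * tp B) = inner I ((tp A * Hx * A) * (tp B * Hy * B))"
      using inner_sandwich[of "Hx * A" I "tp B * Hy"] by (simp add: tp_simps sx sy mult.assoc)
    then have "inner (Hx * (A * tp B) * Hy) (A * tp B) = inner I ((tp A * Hx * A) * (tp B * Hy * B))"
      using I1 A(2) by (metis I_def mult.assoc)
    then show ?thesis unfolding A B by (simp add: I_def)
  qed
  have q2: "inner (Hx * (A0 * tp B0) * Hy) (A0 * tp B0) = inner I I"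
    using e2[of I] I1 by (simp add: mult.assoc)
  have q3: "inner (Hx * (A0 * tp B0) * Hy) (A * tp B) = inner I m"
    using e1[of I] I1 by (simp add: mult.assoc)
  have q4: "inner (Hx * (A * tp B) * Hy) (A0 * tp B0) = inner I m"
    using inner_sandwich[of Hx "A * tp B" Hy "A0 * tp B0"] q3 by (simp add: sx sy inner_commute mult.assoc)
  have "inner (Hx * D * Hy) D = 2 * inner I I - 2 * inner I m"
    unfolding D by (simp add: algebra_simps inner_diff_left inner_diff_right)
      (use q1 q2 q3 q4 in \<open>simp add: mult.assoc\<close>)
  also have "\<dots> = 2 * (\<Sum>i<r. 1 - d i)"
  proof -
    have Is: "inner I X = (\<Sum>i<r. inner (idm {i}) X)" for X
      unfolding I_def by (subst idm_sum) (auto simp: inner_sum_left)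
    show ?thesis by (subst (1 2) Is) (simp add: d_def iii sum_subtractf)
  qed
  finally show ?thesis using 1 by (simp add: sum_distrib_left[symmetric])
qed

subsection \<open>The deterministic error bound\<close>

text \<open>
  One side of the problem: \<open>S\<close> and \<open>H\<close> are the population and sample covariance, \<open>u\<close> the
  true directions, \<open>w\<close> a sparse approximation of \<open>u\<close>, \<open>A\<close> the estimator, and \<open>j\<close> the
  coordinate projection on the union of the supports of \<open>w\<close> and \<open>A\<close>.
\<close>

locale side =
  fixes r :: nat and S H Z u u2 w A j :: fmat and m be om :: real
  assumes m1: "1 \<le> m" and sS: "tp S = S" and H: "H = tp Z * Z"
    and oS: "opb m S" and ou: "opb m u" and ou2: "opb m u2" and ow: "opb m w"
    and uI: "u * idm {..<r} = u" and wr: "w * idm {..<r} = w"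
    and uSu: "tp u * S * u = idm {..<r}" and u2Su: "tp u2 * S * u = 0"
    and be: "norm (w - u) \<le> be" and be0: "0 \<le> be" and om0: "0 \<le> om"
    and AHA: "tp A * H * A = idm {..<r}" and AI: "A * idm {..<r} = A"
    and tj: "tp j = j" and jj: "j * j = j" and oj: "opb 1 j" and jw: "j * w = w" and jA: "j * A = A"
    and ojH: "opb m (j * H * j)"
    and jHw: "norm (j * (H - S) * w) \<le> om"
    and lower: "\<And>K. j * K = K \<Longrightarrow> (norm K)\<^sup>2 \<le> m * (norm (Z * K))\<^sup>2"
begin

lemma sH: "tp H = H" by (simp add: H tp_simps)

lemma m0: "0 < m" using m1 by simp

lemma wj: "tp w * j = tp w" by (metis jw tj tp_mult)
lemma wj2: "tp w * (j * K) = tp w * K" by (metis wj mult.assoc)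
lemma Aj: "tp A * j = tp A" by (metis jA tj tp_mult)
text \<open>Columns that are orthonormal for H, whose form is at least 1 / m on the coordinates of
  j, have operator norm at most the square root of m, hence at most m.\<close>

lemma feasible_opb: assumes X: "tp X * H * X = idm {..<r}" and jX: "j * X = X" shows "opb m X"
  unfolding opb_def
proof
  fix K
  have "(norm (X * K))\<^sup>2 \<le> m * (norm (Z * (X * K)))\<^sup>2"
    by (rule lower) (simp add: jX mult.assoc[symmetric])
  also have "(norm (Z * (X * K)))\<^sup>2 = inner K ((tp X * H * X) * K)"
    by (simp add: power2_norm_eq_inner inner_mult_left H tp_simps mult.assoc)
  also have "\<dots> \<le> norm K * norm (idm {..<r} * K)" unfolding X by (rule norm_cauchy_schwarz)
  also have "\<dots> \<le> norm K * (1 * norm K)" by (intro mult_left_mono opbD opb_idm) auto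
  finally have "(norm (X * K))\<^sup>2 \<le> m * (norm K)\<^sup>2" using m1 by (simp add: power2_eq_square)
  also have "\<dots> \<le> m\<^sup>2 * (norm K)\<^sup>2" using m1 by (intro mult_right_mono) (auto simp: power2_eq_square)
  finally show "norm (X * K) \<le> m * norm K"
    using m1 by (simp add: power_mult_distrib[symmetric] power2_le_iff_abs_le)
qed

lemma oA: "opb m A" by (rule feasible_opb[OF AHA jA])

text \<open>The sample Gram matrix of w is compared with \<open>tp u * S * u\<close>, the identity,
  by changing H to S and then w to u, one factor at a time. The noise meets only the fixed matrix
  w.\<close>

lemma gram_near_one: "norm (tp w * H * w - idm {..<r}) \<le> m * om + 2 * m\<^sup>2 * be"
proof -
  have "tp w * H * w - idm {..<r} = tp w * (j * (H - S) * w) + (tp w * S) * (w - u) + tp (w - u) * (S * u)"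
    using wj2 by (simp add: uSu[symmetric] algebra_simps tp_simps)
  also have "norm \<dots> \<le> m * om + (m * m) * be + be * (m * m)"
  proof (intro norm_triangle_mono)
    show "norm (tp w * (j * (H - S) * w)) \<le> m * om"
      by (rule opbD_le[OF opb_tp[OF ow] jHw])
    show "norm ((tp w * S) * (w - u)) \<le> (m * m) * be"
      by (rule opbD_le[OF opb_mult[OF opb_tp[OF ow] oS] be])
    have "norm (tp (w - u) * (S * u)) \<le> (m * m) * norm (tp (w - u))"
      by (rule opbD'[OF opb_mult[OF oS ou]])
    also have "\<dots> \<le> (m * m) * be" using be m1 by (intro mult_left_mono) auto
    finally show "norm (tp (w - u) * (S * u)) \<le> be * (m * m)" by (simp add: mult.commute)
  qed
  finally show ?thesis by (simp add: power2_eq_square mult_ac)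
qed

end

text \<open>N is the inverse square root of the sample Gram matrix of w, so that
  \<open>w * N\<close> is feasible and keeps the row support of w. The number \<rho> collects bias
  and noise; the error is finally bounded by a multiple of it.\<close>

locale side_normalised = side +
  fixes N :: fmat and \<rho> :: real
  assumes dN: "dimb r N" and sN: "tp N = N" and NGN: "N * (tp w * H * w) * N = idm {..<r}"
    and N1: "norm (N - idm {..<r}) \<le> 4 * m\<^sup>2 * \<rho>" and N16: "4 * m\<^sup>2 * \<rho> \<le> 1"
    and be_om: "be + om \<le> \<rho>"
begin

definition "A0 = w * N"

lemma rho0: "0 \<le> \<rho>" using be_om be0 om0 by simp

lemma m_power_mono: "a \<le> b \<Longrightarrow> m ^ a \<le> m ^ b"
  using m1 by (simp add: power_increasing)

lemma A0HA0: "tp A0 * H * A0 = idm {..<r}"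
  using NGN by (simp add: A0_def tp_simps sN mult.assoc)

lemma A0I: "A0 * idm {..<r} = A0"
  using dN by (simp add: A0_def mult.assoc dimb_idm_right)

lemma jA0: "j * A0 = A0" by (simp add: A0_def mult.assoc[symmetric] jw)

lemma A0j: "tp A0 * j = tp A0" by (metis jA0 tj tp_mult)

lemma oA0: "opb m A0" by (rule feasible_opb[OF A0HA0 jA0])

lemma oN: "opb 2 N"
proof -
  have "opb (1 + norm (N - idm {..<r})) (idm {..<r} + (N - idm {..<r}))"
    by (intro opb_add opb_idm opb_norm) simp
  moreover have "idm {..<r} + (N - idm {..<r}) = N" by simp
  ultimately show ?thesis using opb_mono[of "1 + norm (N - idm {..<r})" N 2] N1 N16 by simp
qed

lemma wN: "w * (N - idm {..<r}) = A0 - w" by (simp add: A0_def algebra_simps wr)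

lemma A0_w: "norm (A0 - w) \<le> 4 * m ^ 3 * \<rho>"
proof -
  have "norm (w * (N - idm {..<r})) \<le> m * (4 * m\<^sup>2 * \<rho>)"
    by (rule opbD_le[OF ow N1])
  then show ?thesis unfolding wN by (simp add: power2_eq_square power3_eq_cube mult_ac)
qed

lemma A0_u: "norm (A0 - u) \<le> 5 * m ^ 3 * \<rho>"
proof -
  have "norm (A0 - u) \<le> norm (A0 - w) + norm (w - u)"
    using norm_triangle_ineq[of "A0 - w" "w - u"] by simp
  also have "\<dots> \<le> 4 * m ^ 3 * \<rho> + \<rho>" using A0_w be be_om om0 by simp
  finally have "norm (A0 - u) \<le> 4 * m ^ 3 * \<rho> + \<rho>" .
  moreover have "1 * \<rho> \<le> m ^ 3 * \<rho>" using m_power_mono[of 0 3] rho0 by (intro mult_right_mono) auto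
  ultimately show ?thesis by simp
qed

text \<open>Passing from u to w, from S to H and from w to A0 costs bias, noise and normalisation
  error respectively, each of order \<rho>.\<close>

lemma signal_diff: "norm (j * (S * u - H * A0)) \<le> 5 * m ^ 4 * \<rho>"
proof -
  have "j * (S * u - H * A0) = (j * S) * (u - w) - j * (H - S) * w - (j * H * j) * (A0 - w)"
    using jA0 jw by (simp add: algebra_simps)
  also have "norm \<dots> \<le> m * be + om + m * (4 * m ^ 3 * \<rho>)"
  proof (intro order_trans[OF norm_triangle_ineq4] add_mono)
    have "norm ((j * S) * (u - w)) \<le> (1 * m) * norm (u - w)" by (rule opbD[OF opb_mult[OF oj oS]])
    also have "\<dots> \<le> m * be" using be m1 by (simp add: norm_minus_commute)
    finally show "norm ((j * S) * (u - w)) \<le> m * be" .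
    show "norm (j * (H - S) * w) \<le> om" by (rule jHw)
    show "norm ((j * H * j) * (A0 - w)) \<le> m * (4 * m ^ 3 * \<rho>)"
      by (rule opbD_le[OF ojH A0_w])
  qed
  also have "\<dots> \<le> m * be + m * om + m * (4 * m ^ 3 * \<rho>)" using m1 om0 by (simp add: mult_le_cancel_right1)
  also have "\<dots> \<le> m * \<rho> + 4 * m ^ 4 * \<rho>"
  proof -
    have "m * (be + om) \<le> m * \<rho>" using be_om m1 by (intro mult_left_mono) auto
    then show ?thesis by (simp add: power4_eq_xxxx power3_eq_cube algebra_simps)
  qed
  finally have "norm (j * (S * u - H * A0)) \<le> m * \<rho> + 4 * m ^ 4 * \<rho>" .
  moreover have "m * \<rho> \<le> m ^ 4 * \<rho>" using m_power_mono[of 1 4] rho0 by (intro mult_right_mono) auto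
  ultimately show ?thesis by simp
qed

text \<open>Since u2 is S-orthogonal to u, it sees A0 only through the bias
  \<open>w - u\<close>.\<close>

lemma residual_A0: "norm (tp u2 * S * A0) \<le> 2 * m\<^sup>2 * \<rho>"
proof -
  have "tp u2 * S * A0 = (tp u2 * S) * (w - u) * N"
    using u2Su by (simp add: A0_def left_diff_distrib right_diff_distrib) (simp add: mult.assoc)
  also have "norm \<dots> \<le> 2 * norm ((tp u2 * S) * (w - u))" by (rule opbD'[OF oN])
  also have "\<dots> \<le> 2 * ((m * m) * norm (w - u))"
    using opbD[OF opb_mult[OF opb_tp[OF ou2] oS]] by simp
  also have "\<dots> \<le> 2 * ((m * m) * \<rho>)" using be be_om om0 m1 by (intro mult_left_mono) auto
  finally show ?thesis by (simp add: power2_eq_square)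
qed

text \<open>Bessel's inequality in the sample metric; the support condition on K brings in the form
  \<open>j * H * j\<close>, which is bounded.\<close>

lemma proj_bound: assumes "j * K = K" shows "norm (tp A0 * H * K) \<le> m * norm K"
proof -
  have "(norm (tp A0 * H * K))\<^sup>2 \<le> inner K (H * K)"
    by (rule bessel[OF H A0HA0 _ A0I]) simp
  also have "\<dots> = inner (j * K) (H * (j * K))" by (simp add: assms)
  also have "\<dots> = inner K ((j * H * j) * K)" by (simp add: inner_mult_left tj mult.assoc)
  also have "\<dots> \<le> norm K * norm ((j * H * j) * K)" by (rule norm_cauchy_schwarz)
  also have "\<dots> \<le> norm K * (m * norm K)" by (intro mult_left_mono opbD[OF ojH]) auto
  also have "\<dots> \<le> (m * norm K)\<^sup>2"
  proof -
    have "m * ((norm K)\<^sup>2) \<le> m\<^sup>2 * (norm K)\<^sup>2" using m1 by (intro mult_right_mono) (auto simp: power2_eq_square)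
    then show ?thesis by (simp add: power2_eq_square mult_ac)
  qed
  finally show ?thesis by (rule power2_le_imp_le) (use m0 in simp)
qed

end

text \<open>L carries the leading correlations and L2 the remaining ones. The cross noise is
  controlled twice: by eta in operator norm, uniformly on the support, and by lam * \<rho> in
  Frobenius norm against the fixed truncations. The last two assumptions are what makes quadratic
  error terms smaller than the curvature.\<close>

locale two_sided =
  X: side_normalised r Sx Hx Zx u u2 wu A jx m bu om Nu \<rho> +
  Y: side_normalised r Sy Hy Zy v v2 wv B jy m bv om Nv \<rho>
  for r :: nat and Sx Hx Zx u u2 wu A jx Sy Hy Zy v v2 wv B jy :: fmat
    and m bu bv om :: real and Nu Nv :: fmat and \<rho> :: real +
  fixes Sxy Hxy L L2 :: fmat and l :: "nat \<Rightarrow> real" and lam kap eta c :: real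
  assumes Sxy: "Sxy = Sx * (u * L * tp v + u2 * L2 * tp v2) * Sy"
    and L: "L = (\<Sum>i<r. l i *\<^sub>R idm {i})" and l: "\<And>i. i < r \<Longrightarrow> lam \<le> l i"
    and oL: "opb (kap * lam) L" and oL2: "opb (c * lam) L2" and c0: "0 \<le> c" and lam0: "0 < lam"
    and kap1: "1 \<le> kap"
    and eta: "opb eta (jx * (Hxy - Sxy) * jy)" and eta0: "0 \<le> eta"
    and xw: "norm (jx * (Hxy - Sxy) * wv) \<le> lam * \<rho>" and yw: "norm (jy * tp (Hxy - Sxy) * wu) \<le> lam * \<rho>"
    and opt: "inner Hxy (X.A0 * tp Y.A0) \<le> inner Hxy (A * tp B)"
    and c_small: "256 * m ^ 12 * c \<le> 1" and eta_small: "64 * m ^ 12 * eta \<le> lam"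
begin

abbreviation "A0 \<equiv> X.A0"
abbreviation "B0 \<equiv> Y.A0"
definition "D = A * tp B - A0 * tp B0"
definition "E = Hxy - Sxy"
abbreviation "x \<equiv> norm D"

lemmas m0 = X.m0
lemmas rho0 = X.rho0

lemma jD: "jx * D = D" by (simp add: D_def right_diff_distrib mult.assoc[symmetric] X.jA X.jA0)
lemma Dj: "D * jy = D" by (simp add: D_def left_diff_distrib mult.assoc Y.Aj Y.A0j)
lemma jD2: "jx * (D * K) = D * K" by (simp add: jD mult.assoc[symmetric])
lemma jtD: "jy * tp D = tp D" by (metis Dj Y.tj tp_mult)

lemma xw2: "norm (tp A0 * E * jy) \<le> 2 * (lam * \<rho>)"
proof -
  have "norm (tp A0 * E * jy) = norm (tp (tp A0 * E * jy))" by simp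
  also have "tp (tp A0 * E * jy) = (jy * tp E * wu) * Nu"
    by (simp add: tp_simps Y.tj X.A0_def mult.assoc)
  also have "norm \<dots> \<le> 2 * (lam * \<rho>)" by (rule opbD'_le[OF X.oN]) (use yw in \<open>simp add: E_def\<close>)
  finally show ?thesis .
qed

lemma yw2: "norm (jx * E * B0) \<le> 2 * (lam * \<rho>)"
proof -
  have "jx * E * B0 = (jx * E * wv) * Nv" by (simp add: Y.A0_def mult.assoc)
  also have "norm \<dots> \<le> 2 * (lam * \<rho>)" by (rule opbD'_le[OF Y.oN]) (use xw in \<open>simp add: E_def\<close>)
  finally show ?thesis .
qed

text \<open>In the sample metric \<open>A0 * P\<close> is the projection of D on the columns of A0,
  and \<open>Q * tp B0\<close> is the corresponding projection on the right.\<close>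

definition "P = tp A0 * Hx * D"
definition "Q = D * Hy * B0"

lemma nP: "norm P \<le> m * x" unfolding P_def by (rule X.proj_bound[OF jD])

lemma nQ: "norm Q \<le> m * x"
proof -
  have "norm Q = norm (tp B0 * Hy * tp D)" unfolding Q_def
    by (subst norm_tp[symmetric]) (simp add: tp_simps Y.sH mult.assoc del: norm_tp)
  also have "\<dots> \<le> m * norm (tp D)" by (rule Y.proj_bound[OF jtD])
  finally show ?thesis by simp
qed

lemma Pj: "P * jy = P" by (simp add: P_def mult.assoc Dj)
lemma jQ: "jx * Q = Q" by (simp add: Q_def mult.assoc jD2)

lemma noise_left: "\<bar>inner E (A0 * P)\<bar> \<le> 2 * m * lam * \<rho> * x"
proof -
  have "inner E (A0 * P) = inner (tp A0 * E * jy) P"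
    by (metis Pj Y.tj inner_mult_left' inner_mult_right' mult.assoc)
  then have "\<bar>inner E (A0 * P)\<bar> \<le> norm (tp A0 * E * jy) * norm P" by (simp add: Cauchy_Schwarz_ineq2)
  also have "\<dots> \<le> (2 * (lam * \<rho>)) * (m * x)" by (intro mult_mono xw2 nP) (use lam0 rho0 in auto)
  finally show ?thesis by (simp add: mult_ac)
qed

lemma noise_right: "\<bar>inner E (Q * tp B0)\<bar> \<le> 2 * m * lam * \<rho> * x"
proof -
  have "inner E (Q * tp B0) = inner (jx * E * B0) Q"
    by (metis jQ X.tj tp_tp inner_mult_left' inner_mult_right' mult.assoc)
  then have "\<bar>inner E (Q * tp B0)\<bar> \<le> norm (jx * E * B0) * norm Q" by (simp add: Cauchy_Schwarz_ineq2)
  also have "\<dots> \<le> (2 * (lam * \<rho>)) * (m * x)" by (intro mult_mono yw2 nQ) (use lam0 rho0 in auto)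
  finally show ?thesis by (simp add: mult_ac)
qed

lemma noise_both: "\<bar>inner E (A0 * P * Hy * B0 * tp B0)\<bar> \<le> 2 * m ^ 4 * lam * \<rho> * x"
proof -
  have "A0 * P * Hy * B0 * tp B0 = A0 * (P * ((jy * Hy * jy) * B0 * tp B0)) * jy"
    by (simp add: mult.assoc Y.A0j Y.jA0) (simp add: mult.assoc[symmetric] Pj)
  then have "inner E (A0 * P * Hy * B0 * tp B0) = inner (tp A0 * E * jy) (P * ((jy * Hy * jy) * B0 * tp B0))"
    using inner_sandwich[of A0 "P * ((jy * Hy * jy) * B0 * tp B0)" jy E] by (simp add: Y.tj inner_commute)
  then have "\<bar>inner E (A0 * P * Hy * B0 * tp B0)\<bar> \<le> norm (tp A0 * E * jy) * norm (P * ((jy * Hy * jy) * B0 * tp B0))"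
    by (simp add: Cauchy_Schwarz_ineq2)
  also have "\<dots> \<le> (2 * (lam * \<rho>)) * ((m * m * m) * (m * x))"
    by (intro mult_mono xw2 opbD'_le opb_mult Y.ojH Y.oA0 opb_tp nP) (use lam0 rho0 in auto)
  finally show ?thesis by (simp add: power4_eq_xxxx mult_ac)
qed

text \<open>F and G are the components of A and B orthogonal to A0 and B0 in the sample metric
  (\<open>F_eq\<close>, \<open>G_eq\<close>). This form through D shows instead that they are of the
  order of D.\<close>

definition "F = D * Hy * B - A0 * (P * Hy * B)"
definition "G = tp D * Hx * A - B0 * (tp Q * Hx * A)"

text \<open>\<open>tp B * Hy * B\<close> is the identity, so A is recovered from
  \<open>A * tp B\<close>. The pair (A, B) is determined only up to a common rotation, hence A need
  not be near A0; but it lies within the order of D of the column span of A0.\<close>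

lemma A_decomp: "A = D * Hy * B + A0 * tp B0 * Hy * B"
proof -
  have "D * Hy * B + A0 * tp B0 * Hy * B = A * (tp B * Hy * B)"
    by (simp add: D_def algebra_simps)
  then show ?thesis by (simp add: Y.AHA X.AI)
qed

lemma B_decomp: "B = tp D * Hx * A + B0 * tp A0 * Hx * A"
proof -
  have "tp D * Hx * A + B0 * tp A0 * Hx * A = B * (tp A * Hx * A)"
    by (simp add: D_def algebra_simps tp_simps)
  then show ?thesis by (simp add: X.AHA Y.AI)
qed

lemma proj_A0: "A0 * (tp A0 * Hx * (A0 * K)) = A0 * K"
  using X.A0HA0 X.A0I by (metis mult.assoc)
lemma proj_B0: "B0 * (tp B0 * Hy * (B0 * K)) = B0 * K"
  using Y.A0HA0 Y.A0I by (metis mult.assoc)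
lemma proj_B0': "K * tp B0 * Hy * B0 * tp B0 = K * tp B0"
  using Y.A0HA0 Y.A0I by (metis mult.assoc tp_idm tp_mult)

lemma F_eq: "F = A - A0 * (tp A0 * Hx * A)"
proof -
  have "A - A0 * (tp A0 * Hx * A) = (D * Hy * B + A0 * (tp B0 * Hy * B))
      - A0 * (tp A0 * Hx * (D * Hy * B + A0 * (tp B0 * Hy * B)))"
    using A_decomp by (simp add: mult.assoc)
  also have "\<dots> = F" using proj_A0[of "tp B0 * Hy * B"]
    by (simp add: F_def P_def distrib_left mult.assoc)
  finally show ?thesis ..
qed

lemma G_eq: "G = B - B0 * (tp B0 * Hy * B)"
proof -
  have "B - B0 * (tp B0 * Hy * B) = (tp D * Hx * A + B0 * (tp A0 * Hx * A))
      - B0 * (tp B0 * Hy * (tp D * Hx * A + B0 * (tp A0 * Hx * A)))"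
    using B_decomp by (simp add: mult.assoc)
  also have "\<dots> = G" using proj_B0[of "tp A0 * Hx * A"]
    by (simp add: G_def Q_def distrib_left mult.assoc tp_simps Y.sH)
  finally show ?thesis ..
qed

text \<open>With p and p' the projections on A0 and B0, this is D = p D + D p' - p D p' + (1 - p) D
  (1 - p'). The complements annihilate \<open>A0 * tp B0\<close>, so the last term is the product of
  the components F and G of A and B.\<close>

lemma D_split: "D = A0 * P + Q * tp B0 - A0 * P * Hy * B0 * tp B0 + F * tp G"
proof -
  have 1: "A0 * P = A0 * (tp A0 * Hx * A) * tp B - A0 * tp B0"
    using proj_A0[of "tp B0"] by (simp add: P_def D_def right_diff_distrib mult.assoc)
  have 2: "Q * tp B0 = A * (tp B * Hy * B0) * tp B0 - A0 * tp B0"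
    using proj_B0'[of A0] by (simp add: Q_def D_def left_diff_distrib mult.assoc)
  have 3: "A0 * P * Hy * B0 * tp B0 = A0 * (tp A0 * Hx * A) * (tp B * Hy * B0) * tp B0 - A0 * tp B0"
    unfolding 1 using proj_B0'[of A0] by (simp add: left_diff_distrib mult.assoc)
  have 4: "F * tp G = A * tp B - A * (tp B * Hy * B0) * tp B0 - A0 * (tp A0 * Hx * A) * tp B
    + A0 * (tp A0 * Hx * A) * (tp B * Hy * B0) * tp B0"
    unfolding F_eq G_eq by (simp add: tp_simps Y.sH algebra_simps)
  show ?thesis by (subst 4, subst 3, subst 2, subst 1) (simp add: D_def)
qed

lemma nF: "norm F \<le> 2 * m ^ 5 * x"
proof -
  have DHB: "D * Hy * B = D * ((jy * Hy * jy) * B)"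
    by (simp add: mult.assoc Y.jA) (simp add: mult.assoc[symmetric] Dj)
  have n1: "norm (D * Hy * B) \<le> (m * m) * x"
    unfolding DHB by (intro opbD'_le opb_mult Y.ojH Y.oA) simp
  have "P * Hy * B = P * ((jy * Hy * jy) * B)"
    by (simp add: mult.assoc Y.jA) (simp add: mult.assoc[symmetric] Pj)
  then have n2: "norm (A0 * (P * Hy * B)) \<le> m * ((m * m) * (m * x))"
    by (simp, intro opbD_le[OF X.oA0] opbD'_le opb_mult Y.ojH Y.oA nP)
  have "norm F \<le> (m * m) * x + m * ((m * m) * (m * x))"
    unfolding F_def by (rule order_trans[OF norm_triangle_ineq4 add_mono[OF n1 n2]])
  also have "\<dots> = m ^ 2 * x + m ^ 4 * x" by (simp add: power2_eq_square power4_eq_xxxx mult_ac)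
  also have "\<dots> \<le> m ^ 5 * x + m ^ 5 * x"
    by (intro add_mono mult_right_mono X.m_power_mono) auto
  finally show ?thesis by simp
qed

lemma nG: "norm G \<le> 2 * m ^ 5 * x"
proof -
  have DHB: "tp D * Hx * A = tp D * ((jx * Hx * jx) * A)"
    using jD X.tj by (simp add: mult.assoc X.jA) (metis mult.assoc tp_mult)
  have n1: "norm (tp D * Hx * A) \<le> (m * m) * x"
    unfolding DHB by (intro opbD'_le opb_mult X.ojH X.oA) simp
  have "tp Q * Hx * A = tp Q * ((jx * Hx * jx) * A)"
    using jQ X.tj by (simp add: mult.assoc X.jA) (metis mult.assoc tp_mult)
  then have n2: "norm (B0 * (tp Q * Hx * A)) \<le> m * ((m * m) * (m * x))"
    by (simp, intro opbD_le[OF Y.oA0] opbD'_le opb_mult X.ojH X.oA) (simp add: nQ)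
  have "norm G \<le> (m * m) * x + m * ((m * m) * (m * x))"
    unfolding G_def by (rule order_trans[OF norm_triangle_ineq4 add_mono[OF n1 n2]])
  also have "\<dots> = m ^ 2 * x + m ^ 4 * x" by (simp add: power2_eq_square power4_eq_xxxx mult_ac)
  also have "\<dots> \<le> m ^ 5 * x + m ^ 5 * x"
    by (intro add_mono mult_right_mono X.m_power_mono) auto
  finally show ?thesis by simp
qed

lemma noise: "inner E D \<le> 6 * m ^ 4 * lam * \<rho> * x + 4 * m ^ 10 * eta * x\<^sup>2"
proof -
  \<comment> \<open>F and G live on the chosen coordinates, so the noise may be replaced by its
    restriction, whose operator norm is at most eta.\<close>
  have jF: "jx * F = F" unfolding F_eq by (simp add: right_diff_distrib mult.assoc[symmetric] X.jA X.jA0)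
  have jG: "jy * G = G" unfolding G_eq by (simp add: right_diff_distrib mult.assoc[symmetric] Y.jA Y.jA0)
  have "inner E (F * tp G) = inner ((jx * E * jy) * G) F"
    by (metis jF jG X.tj tp_tp inner_mult_left' inner_mult_right' mult.assoc)
  also have "\<dots> \<le> norm ((jx * E * jy) * G) * norm F" by (rule norm_cauchy_schwarz)
  also have "\<dots> \<le> (eta * (2 * m ^ 5 * x)) * (2 * m ^ 5 * x)"
    by (intro mult_mono opbD_le[OF eta[folded E_def]] nF nG) (use eta0 m0 in auto)
  also have "\<dots> = 4 * m ^ 10 * eta * x\<^sup>2" by (simp add: eval_nat_numeral mult_ac)
  finally have q: "inner E (F * tp G) \<le> 4 * m ^ 10 * eta * x\<^sup>2" .
  have "m * (lam * \<rho> * x) \<le> m ^ 4 * (lam * \<rho> * x)"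
    using X.m_power_mono[of 1 4] lam0 rho0 by (intro mult_right_mono) auto
  then have "2 * m * lam * \<rho> * x \<le> 2 * m ^ 4 * lam * \<rho> * x" by (simp add: mult_ac)
  moreover have "inner E D = inner E (A0 * P) + inner E (Q * tp B0) - inner E (A0 * P * Hy * B0 * tp B0) + inner E (F * tp G)"
    by (subst D_split) (simp add: inner_add_right inner_diff_right)
  ultimately show ?thesis using noise_left noise_right noise_both q by linarith
qed

lemma m45: "m ^ 4 \<le> 2 * m ^ 5"
proof -
  have "m ^ 4 \<le> m ^ 5" "0 < m ^ 5" using X.m_power_mono[of 4 5] m0 by simp_all
  then show ?thesis by linarith
qed

text \<open>The remaining correlations enter through the product of \<open>tp u2 * Sx * A\<close>
  and \<open>tp v2 * Sy * B\<close>. By \<open>A_decomp\<close> and \<open>B_decomp\<close> each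
  factor is of order x + \<rho>, because it would be of order \<rho> for A0 or B0. Two small factors
  give a quadratic term.\<close>

lemma residual: "inner (Sx * (u2 * L2 * tp v2) * Sy) D \<le> 8 * c * lam * m ^ 10 * (x + \<rho>)\<^sup>2"
proof -
  have e: "inner (Sx * (u2 * L2 * tp v2) * Sy) (K1 * tp K2) = inner (L2 * (tp v2 * Sy * K2)) (tp u2 * Sx * K1)" for K1 K2
  proof -
    have "inner ((Sx * u2) * L2 * (tp v2 * Sy)) (K1 * tp K2) = inner L2 ((tp u2 * Sx * K1) * tp (tp v2 * Sy * K2))"
      using inner_sandwich[of "Sx * u2" L2 "tp v2 * Sy"] by (simp add: tp_simps X.sS Y.sS mult.assoc)
    also have "\<dots> = inner (L2 * (tp v2 * Sy * K2)) (tp u2 * Sx * K1)" by (simp add: inner_mult_right')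
    finally show ?thesis by (simp add: mult.assoc)
  qed
  have b: "\<bar>inner (Sx * (u2 * L2 * tp v2) * Sy) (K1 * tp K2)\<bar> \<le> (c * lam * b2) * b1"
    if "norm (tp u2 * Sx * K1) \<le> b1" "norm (tp v2 * Sy * K2) \<le> b2" for K1 K2 b1 b2
  proof -
    have "\<bar>inner (Sx * (u2 * L2 * tp v2) * Sy) (K1 * tp K2)\<bar> \<le> norm (L2 * (tp v2 * Sy * K2)) * norm (tp u2 * Sx * K1)"
      unfolding e by (rule Cauchy_Schwarz_ineq2)
    also have "\<dots> \<le> (c * lam * b2) * b1"
    proof (intro mult_mono opbD_le[OF oL2] that)
      have "0 \<le> b2" using that(2) norm_ge_zero order_trans by blast
      then show "0 \<le> c * lam * b2" using c0 lam0 by simp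
    qed simp
    finally show ?thesis .
  qed
  have uA: "norm (tp u2 * Sx * A) \<le> 2 * m ^ 5 * (x + \<rho>)"
  proof -
    have "tp u2 * Sx * A = (tp u2 * Sx) * (D * ((jy * Hy * jy) * B)) + (tp u2 * Sx * A0) * (tp B0 * (jy * Hy * jy) * B)"
      by (subst A_decomp) (simp add: algebra_simps Y.jA, metis (no_types, lifting) Dj Y.A0j mult.assoc)
    also have "norm \<dots> \<le> (m * m) * ((m * m) * x) + (m * m * m) * (2 * m\<^sup>2 * \<rho>)"
      by (intro norm_triangle_mono opbD_le opb_mult opb_tp X.ou2 X.oS opbD'_le Y.ojH Y.oA Y.oA0 X.residual_A0) simp
    also have "\<dots> = m ^ 4 * x + 2 * m ^ 5 * \<rho>" by (simp add: power2_eq_square eval_nat_numeral mult_ac)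
    also have "m ^ 4 * x \<le> 2 * m ^ 5 * x" by (intro mult_right_mono m45) auto
    finally show ?thesis by (simp add: distrib_left)
  qed
  have vB: "norm (tp v2 * Sy * B) \<le> 2 * m ^ 5 * (x + \<rho>)"
  proof -
    have "tp v2 * Sy * B = (tp v2 * Sy) * (tp D * ((jx * Hx * jx) * A)) + (tp v2 * Sy * B0) * (tp A0 * (jx * Hx * jx) * A)"
      by (subst B_decomp) (simp add: algebra_simps X.jA, metis (no_types, lifting) jD X.tj tp_mult X.A0j mult.assoc)
    also have "norm \<dots> \<le> (m * m) * ((m * m) * x) + (m * m * m) * (2 * m\<^sup>2 * \<rho>)"
      by (intro norm_triangle_mono opbD_le opb_mult opb_tp Y.ou2 Y.oS opbD'_le X.ojH X.oA X.oA0 Y.residual_A0) simp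
    also have "\<dots> = m ^ 4 * x + 2 * m ^ 5 * \<rho>" by (simp add: power2_eq_square eval_nat_numeral mult_ac)
    also have "m ^ 4 * x \<le> 2 * m ^ 5 * x" by (intro mult_right_mono m45) auto
    finally show ?thesis by (simp add: distrib_left)
  qed
  have r5: "2 * m\<^sup>2 * \<rho> \<le> 2 * m ^ 5 * (x + \<rho>)"
    using X.m_power_mono[of 2 5] m0 rho0 by (intro mult_mono) auto
  have 1: "\<bar>inner (Sx * (u2 * L2 * tp v2) * Sy) (A * tp B)\<bar> \<le> (c * lam * (2 * m ^ 5 * (x + \<rho>))) * (2 * m ^ 5 * (x + \<rho>))"
    by (rule b[OF uA vB])
  have 2: "\<bar>inner (Sx * (u2 * L2 * tp v2) * Sy) (A0 * tp B0)\<bar> \<le> (c * lam * (2 * m ^ 5 * (x + \<rho>))) * (2 * m ^ 5 * (x + \<rho>))"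
    by (rule b[OF order_trans[OF X.residual_A0 r5] order_trans[OF Y.residual_A0 r5]])
  have "inner (Sx * (u2 * L2 * tp v2) * Sy) D \<le> 2 * ((c * lam * (2 * m ^ 5 * (x + \<rho>))) * (2 * m ^ 5 * (x + \<rho>)))"
    using 1 2 by (simp add: D_def inner_diff_right)
  also have "\<dots> = 8 * c * lam * m ^ 10 * (x + \<rho>)\<^sup>2"
  proof -
    have "2 * ((c * lam * (2 * m ^ 5 * y)) * (2 * m ^ 5 * y)) = 8 * c * lam * m ^ 10 * y\<^sup>2" for y
      by (simp add: eval_nat_numeral mult_ac)
    then show ?thesis .
  qed
  finally show ?thesis .
qed

text \<open>The population signal is replaced by the one for which \<open>curvature\<close> holds,
  one side at a time. As D is supported on jx and jy, only the restricted differences of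
  \<open>signal_diff\<close> matter.\<close>

lemma signal: "inner (Sx * (u * L * tp v) * Sy) D
  \<le> inner (Hx * A0 * L * tp B0 * Hy) D + 10 * m ^ 6 * kap * lam * \<rho> * x"
proof -
  let ?a = "jx * (Sx * u - Hx * A0)" and ?b = "jy * (Sy * v - Hy * B0)"
  have "inner (Sx * (u * L * tp v) * Sy) D - inner (Hx * A0 * L * tp B0 * Hy) D
    = inner ((Sx * u - Hx * A0) * L * (tp v * Sy)) D + inner ((Hx * A0) * L * tp (Sy * v - Hy * B0)) D"
  proof -
    have "Sx * (u * L * tp v) * Sy - Hx * A0 * L * tp B0 * Hy
      = (Sx * u - Hx * A0) * L * (tp v * Sy) + (Hx * A0) * L * tp (Sy * v - Hy * B0)"
      by (simp add: algebra_simps tp_simps Y.sH Y.sS)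
    then show ?thesis by (metis inner_add_left inner_diff_left)
  qed
  moreover have "inner ((Sx * u - Hx * A0) * L * (tp v * Sy)) D = inner (?a * (L * (tp v * Sy))) D"
    by (metis jD X.tj inner_mult_left mult.assoc)
  moreover have "inner (?a * (L * (tp v * Sy))) D \<le> (5 * m ^ 6 * kap * lam * \<rho>) * x"
  proof -
    have "norm (?a * (L * (tp v * Sy))) \<le> (kap * lam * (m * m)) * (5 * m ^ 4 * \<rho>)"
      by (intro opbD'_le opb_mult oL opb_tp Y.ou Y.oS X.signal_diff)
    also have "\<dots> = 5 * m ^ 6 * kap * lam * \<rho>" by (simp add: eval_nat_numeral mult_ac)
    finally show ?thesis
      using norm_cauchy_schwarz mult_right_mono norm_ge_zero order_trans by metis
  qed
  moreover have "inner ((Hx * A0) * L * tp (Sy * v - Hy * B0)) D = inner ((jx * Hx * jx) * A0 * L * tp ?b) D"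
  proof -
    have "inner ((jx * Hx * jx) * A0 * L * tp ?b) D = inner (jx * ((Hx * A0) * L * tp (Sy * v - Hy * B0)) * jy) D"
      using X.jA0 Y.tj by (simp add: tp_mult mult.assoc)
    then show ?thesis using inner_sandwich[of jx _ jy D] jD Dj X.tj Y.tj by simp
  qed
  moreover have "inner ((jx * Hx * jx) * A0 * L * tp ?b) D \<le> (5 * m ^ 6 * kap * lam * \<rho>) * x"
  proof -
    have "norm ((jx * Hx * jx) * A0 * L * tp ?b) \<le> (m * m * (kap * lam)) * (5 * m ^ 4 * \<rho>)"
      by (intro opbD_le opb_mult oL X.ojH X.oA0) (simp add: Y.signal_diff)
    also have "\<dots> = 5 * m ^ 6 * kap * lam * \<rho>" by (simp add: eval_nat_numeral mult_ac)
    finally show ?thesis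
      using norm_cauchy_schwarz mult_right_mono norm_ge_zero order_trans by metis
  qed
  ultimately show ?thesis by (simp add: algebra_simps)
qed

text \<open>The restricted lower eigenvalue bound is applied once on each side of D, whence the
  square of m.\<close>

lemma metric_lower: "x\<^sup>2 \<le> m\<^sup>2 * inner (Hx * D * Hy) D"
proof -
  have "x\<^sup>2 = (norm (tp D))\<^sup>2" by simp
  also have "\<dots> \<le> m * (norm (Zy * tp D))\<^sup>2" by (rule Y.lower[OF jtD])
  also have "(norm (Zy * tp D))\<^sup>2 = (norm (D * tp Zy))\<^sup>2"
    by (subst norm_tp[symmetric]) (simp add: tp_mult del: norm_tp)
  also have "m * (norm (D * tp Zy))\<^sup>2 \<le> m * (m * (norm (Zx * (D * tp Zy)))\<^sup>2)"
    by (intro mult_left_mono X.lower) (use m0 jD2 in auto)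
  also have "(norm (Zx * (D * tp Zy)))\<^sup>2 = inner (Hx * D * Hy) D"
    unfolding power2_norm_eq_inner X.H Y.H
    by (metis inner_mult_left inner_mult_right mult.assoc tp_tp)
  finally show ?thesis by (simp add: power2_eq_square mult_ac)
qed

text \<open>Optimality gives \<open>0 \<le> inner Hxy D\<close>. Splitting Hxy into noise, leading
  signal and remaining correlations turns this into a quadratic inequality for x. If x were large
  compared with \<rho>, all error terms together would stay below the curvature.\<close>

lemma D_bound: "x \<le> 64 * m ^ 8 * kap * \<rho>"
proof (rule ccontr)
  assume "\<not> ?thesis"
  then have big: "64 * m ^ 8 * kap * \<rho> < x" by simp
  have km: "1 \<le> m ^ 8 * kap" using mult_mono[of 1 "m ^ 8" 1 kap] X.m_power_mono[of 0 8] kap1 m0 by simp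
  have x0: "0 < x" proof -
    have "0 \<le> 64 * m ^ 8 * kap * \<rho>" using rho0 m0 kap1 by simp
    then show ?thesis using big by linarith
  qed
  have rx: "\<rho> \<le> x"
  proof -
    have "1 * \<rho> \<le> (64 * (m ^ 8 * kap)) * \<rho>" using km rho0 by (intro mult_right_mono) auto
    then show ?thesis using big by (simp add: mult.assoc)
  qed
  define q where "q = (x + \<rho>)\<^sup>2"
  have "0 \<le> inner Hxy D" using opt by (simp add: D_def inner_diff_right)
  also have "inner Hxy D = inner E D + inner (Sx * (u * L * tp v) * Sy) D + inner (Sx * (u2 * L2 * tp v2) * Sy) D"
  proof -
    have "Hxy = E + Sxy" by (simp add: E_def)
    moreover have "Sxy = Sx * (u * L * tp v) * Sy + Sx * (u2 * L2 * tp v2) * Sy"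
      by (subst Sxy) (simp add: algebra_simps)
    ultimately have "inner Hxy D = inner E D + inner (Sx * (u * L * tp v) * Sy + Sx * (u2 * L2 * tp v2) * Sy) D"
      by (metis inner_add_left)
    then show ?thesis by (simp only: inner_add_left add.assoc)
  qed
  also have "\<dots> \<le> (6 * m ^ 4 * lam * \<rho> * x + 4 * m ^ 10 * eta * x\<^sup>2)
      + (- (lam / 2) * inner (Hx * D * Hy) D + 10 * m ^ 6 * kap * lam * \<rho> * x)
      + 8 * c * lam * m ^ 10 * (x + \<rho>)\<^sup>2"
    using noise residual signal
      curvature[OF X.H Y.H X.AHA X.AI Y.AHA Y.AI X.A0HA0 X.A0I Y.A0HA0 Y.A0I L l D_def] by linarith
  finally have "(lam / 2) * inner (Hx * D * Hy) D \<le> 6 * m ^ 4 * lam * \<rho> * x + 4 * m ^ 10 * eta * x\<^sup>2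
      + 10 * m ^ 6 * kap * lam * \<rho> * x + 8 * c * lam * m ^ 10 * (x + \<rho>)\<^sup>2" by simp
  then have "m\<^sup>2 * ((lam / 2) * inner (Hx * D * Hy) D) \<le> m\<^sup>2 * (6 * m ^ 4 * lam * \<rho> * x + 4 * m ^ 10 * eta * x\<^sup>2
      + 10 * m ^ 6 * kap * lam * \<rho> * x + 8 * c * lam * m ^ 10 * (x + \<rho>)\<^sup>2)"
    by (intro mult_left_mono) auto
  moreover have "(lam / 2) * x\<^sup>2 \<le> (lam / 2) * (m\<^sup>2 * inner (Hx * D * Hy) D)"
    using metric_lower lam0 by (intro mult_left_mono) auto
  ultimately have 1: "(lam / 2) * x\<^sup>2 \<le> m\<^sup>2 * (6 * m ^ 4 * lam * \<rho> * x + 4 * m ^ 10 * eta * x\<^sup>2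
      + 10 * m ^ 6 * kap * lam * \<rho> * x + 8 * c * lam * m ^ 10 * (x + \<rho>)\<^sup>2)"
    by (simp add: mult_ac)
  also have "\<dots> = lam * (6 * m ^ 6 * \<rho> * x + 10 * m ^ 8 * kap * \<rho> * x + 8 * c * m ^ 12 * (x + \<rho>)\<^sup>2) + 4 * m ^ 12 * eta * x\<^sup>2"
    unfolding q_def[symmetric] by (simp add: eval_nat_numeral algebra_simps)
  also have "\<dots> \<le> lam * (6 * (m ^ 8 * kap * \<rho> * x) + 10 * (m ^ 8 * kap * \<rho> * x) + (1/32) * (x + \<rho>)\<^sup>2) + (lam / 16) * x\<^sup>2"
  proof (intro add_mono mult_left_mono)
    have "m ^ 6 * 1 \<le> m ^ 8 * kap" using X.m_power_mono[of 6 8] kap1 m0 by (intro mult_mono) auto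
    then show "6 * m ^ 6 * \<rho> * x \<le> 6 * (m ^ 8 * kap * \<rho> * x)"
      using mult_right_mono[of "m ^ 6 * 1" "m ^ 8 * kap" "\<rho> * x"] rho0 by (simp add: mult.assoc)
    show "10 * m ^ 8 * kap * \<rho> * x \<le> 10 * (m ^ 8 * kap * \<rho> * x)" by simp
    show "8 * c * m ^ 12 * (x + \<rho>)\<^sup>2 \<le> (1/32) * (x + \<rho>)\<^sup>2"
      using c_small by (intro mult_right_mono) (auto simp: mult_ac)
    show "4 * m ^ 12 * eta * x\<^sup>2 \<le> (lam / 16) * x\<^sup>2"
      using eta_small by (intro mult_right_mono) (auto simp: mult_ac)
  qed (use lam0 in auto)
  finally have "lam * (x\<^sup>2 / 2) \<le> lam * (16 * (m ^ 8 * kap * \<rho> * x) + (1/32) * (x + \<rho>)\<^sup>2 + x\<^sup>2 / 16)"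
    unfolding q_def[symmetric] by (simp add: algebra_simps)
  then have "x\<^sup>2 / 2 \<le> 16 * (m ^ 8 * kap * \<rho> * x) + (1/32) * (x + \<rho>)\<^sup>2 + x\<^sup>2 / 16" using lam0 by simp
  moreover have "(x + \<rho>)\<^sup>2 \<le> 4 * x\<^sup>2" using power_mono[of "x + \<rho>" "2 * x" 2] rx rho0 by (simp add: power_mult_distrib)
  moreover have "64 * (m ^ 8 * kap * \<rho> * x) < x\<^sup>2" using mult_strict_right_mono[OF big x0] by (simp add: power2_eq_square)
  moreover have "0 < x\<^sup>2" using x0 by simp
  \<comment> \<open>The three error terms are bounded by 1/4, 1/8 and 1/16 of the square of x, which
    add up to less than 1/2.\<close>
  ultimately show False by linarith
qed

theorem estimation_error: "norm (A * tp B - u * tp v) \<le> 74 * m ^ 8 * kap * \<rho>"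
proof -
  have "A * tp B - u * tp v = D + (A0 - u) * tp B0 + u * tp (B0 - v)"
    by (simp add: D_def algebra_simps tp_simps)
  also have "norm \<dots> \<le> 64 * m ^ 8 * kap * \<rho> + m * (5 * m ^ 3 * \<rho>) + m * (5 * m ^ 3 * \<rho>)"
    by (intro norm_triangle_mono D_bound opbD'_le[OF opb_tp[OF Y.oA0]] opbD_le[OF X.ou] X.A0_u) (simp add: Y.A0_u)
  also have "\<dots> = 64 * m ^ 8 * kap * \<rho> + 10 * (m ^ 4 * 1) * \<rho>" by (simp add: eval_nat_numeral mult_ac)
  also have "\<dots> \<le> 64 * m ^ 8 * kap * \<rho> + 10 * (m ^ 8 * kap) * \<rho>"
    using X.m_power_mono[of 4 8] m0 kap1 rho0 by (intro add_left_mono mult_right_mono mult_left_mono mult_mono) auto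
  finally show ?thesis by (simp add: mult_ac)
qed

end

section \<open>Gaussian integrals\<close>

definition qf :: "nat \<Rightarrow> (nat \<Rightarrow> nat \<Rightarrow> real) \<Rightarrow> (nat \<Rightarrow> real) \<Rightarrow> real" where
  "qf d Q z = (\<Sum>i<d. \<Sum>j<d. Q i j * z i * z j)"

definition schur :: "nat \<Rightarrow> (nat \<Rightarrow> nat \<Rightarrow> real) \<Rightarrow> nat \<Rightarrow> nat \<Rightarrow> real" where
  "schur d Q i j = Q i j - Q i d * Q d j / Q d d"

text \<open>The product of the pivots of symmetric elimination, hence the determinant
  (\<open>det_piv\<close>). The recursion eliminates the last coordinate, in step with integrating
  it out.\<close>

primrec piv :: "nat \<Rightarrow> (nat \<Rightarrow> nat \<Rightarrow> real) \<Rightarrow> real" where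
  "piv 0 Q = 1"
| "piv (Suc d) Q = Q d d * piv d (schur d Q)"

primrec pivpos :: "nat \<Rightarrow> (nat \<Rightarrow> nat \<Rightarrow> real) \<Rightarrow> bool" where
  "pivpos 0 Q \<longleftrightarrow> True"
| "pivpos (Suc d) Q \<longleftrightarrow> 0 < Q d d \<and> pivpos d (schur d Q)"

definition symf :: "nat \<Rightarrow> (nat \<Rightarrow> nat \<Rightarrow> real) \<Rightarrow> bool" where
  "symf d Q \<longleftrightarrow> (\<forall>i<d. \<forall>j<d. Q i j = Q j i)"

definition pdf :: "nat \<Rightarrow> (nat \<Rightarrow> nat \<Rightarrow> real) \<Rightarrow> bool" where
  "pdf d Q \<longleftrightarrow> (\<forall>z. (\<exists>i<d. z i \<noteq> 0) \<longrightarrow> 0 < qf d Q z)"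

lemma piv_pos: "pivpos d Q \<Longrightarrow> 0 < piv d Q"
  by (induction d arbitrary: Q) auto

lemma symf_schur: "symf (Suc d) Q \<Longrightarrow> symf d (schur d Q)"
  by (auto simp: symf_def schur_def)

lemma piv_cong: "(\<And>i j. i < d \<Longrightarrow> j < d \<Longrightarrow> Q i j = Q' i j) \<Longrightarrow> piv d Q = piv d Q'"
proof (induction d arbitrary: Q Q')
  case (Suc d)
  have "piv d (schur d Q) = piv d (schur d Q')" by (rule Suc.IH) (simp add: schur_def Suc.prems)
  then show ?case by (simp add: Suc.prems)
qed simp

text \<open>Completing the square in the last variable leaves the Schur complement as quadratic form
  in the others.\<close>

lemma qf_Suc:
  assumes "symf (Suc d) Q" "Q d d \<noteq> 0"
  shows "qf (Suc d) Q z = Q d d * (z d + (\<Sum>i<d. Q i d * z i) / Q d d)\<^sup>2 + qf d (schur d Q) z"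
proof -
  define b where "b = (\<Sum>i<d. Q i d * z i)"
  have b': "(\<Sum>j<d. Q d j * z j) = b" unfolding b_def using assms(1) by (intro sum.cong) (auto simp: symf_def)
  have "qf (Suc d) Q z = (\<Sum>i<d. \<Sum>j<d. Q i j * z i * z j) + (\<Sum>i<d. Q i d * z i) * z d + z d * (\<Sum>j<d. Q d j * z j) + Q d d * (z d)\<^sup>2"
    by (simp add: qf_def sum.distrib sum_distrib_left sum_distrib_right power2_eq_square algebra_simps)
  also have "\<dots> = (\<Sum>i<d. \<Sum>j<d. Q i j * z i * z j) + 2 * b * z d + Q d d * (z d)\<^sup>2"
    by (simp add: b' b_def[symmetric])
  finally have 1: "qf (Suc d) Q z = (\<Sum>i<d. \<Sum>j<d. Q i j * z i * z j) + 2 * b * z d + Q d d * (z d)\<^sup>2" .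
  have "qf d (schur d Q) z = (\<Sum>i<d. \<Sum>j<d. Q i j * z i * z j) - (\<Sum>i<d. \<Sum>j<d. (Q i d * z i) * (Q d j * z j) / Q d d)"
    by (simp add: qf_def schur_def sum_subtractf[symmetric] algebra_simps)
  also have "(\<Sum>i<d. \<Sum>j<d. (Q i d * z i) * (Q d j * z j) / Q d d) = b * b / Q d d"
  proof -
    have "b * b / Q d d = (\<Sum>i<d. Q i d * z i) * (\<Sum>j<d. Q d j * z j) / Q d d" unfolding b' by (simp add: b_def)
    then show ?thesis by (simp add: sum_product sum_divide_distrib)
  qed
  finally have 2: "qf d (schur d Q) z = (\<Sum>i<d. \<Sum>j<d. Q i j * z i * z j) - b * b / Q d d" .
  show ?thesis unfolding 1 2 b_def[symmetric] using assms(2) by (simp add: power2_eq_square field_simps)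
qed

lemma pdf_pivpos: "symf d Q \<Longrightarrow> pdf d Q \<Longrightarrow> pivpos d Q"
proof (induction d arbitrary: Q)
  case (Suc d)
  have "0 < qf (Suc d) Q (\<lambda>i. if i = d then 1 else 0)" using Suc.prems(2) by (auto simp: pdf_def)
  also have "qf (Suc d) Q (\<lambda>i. if i = d then 1 else 0) = Q d d"
    by (simp add: qf_def if_distrib sum.delta cong: if_cong)
  finally have q: "0 < Q d d" .
  have "pdf d (schur d Q)" unfolding pdf_def
  proof (intro allI impI)
    fix z :: "nat \<Rightarrow> real" assume z: "\<exists>i<d. z i \<noteq> 0"
    \<comment> \<open>The last coordinate is chosen to make the completed square vanish.\<close>
    define z' where "z' = z(d := - (\<Sum>i<d. Q i d * z i) / Q d d)"
    have "\<exists>i<Suc d. z' i \<noteq> 0" using z unfolding z'_def by (metis fun_upd_other less_Suc_eq order_less_irrefl)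
    then have "0 < qf (Suc d) Q z'" using Suc.prems(2) by (auto simp: pdf_def)
    also have "\<dots> = Q d d * (z' d + (\<Sum>i<d. Q i d * z' i) / Q d d)\<^sup>2 + qf d (schur d Q) z'"
      using q by (intro qf_Suc Suc.prems) auto
    also have "\<dots> = qf d (schur d Q) z"
      by (simp add: z'_def qf_def)
    finally show "0 < qf d (schur d Q) z" .
  qed
  then show ?case using q Suc.IH[OF symf_schur[OF Suc.prems(1)]] by simp
qed simp

lemma nn_integral_gauss1:
  assumes q: "0 < q"
  shows "(\<integral>\<^sup>+y. ennreal (exp (- (q * (y + b)\<^sup>2) / 2)) \<partial>lborel) = ennreal (sqrt (2 * pi / q))"
proof -
  let ?s = "1 / sqrt q"
  have s: "0 < ?s" using q by simp
  have 1: "(\<integral>\<^sup>+y. ennreal (normal_density (-b) ?s y) \<partial>lborel) = 1"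
    using nn_integral_eq_integral[OF integrable_normal_density[OF s, of "-b"]] by (simp add: integral_normal_density[OF s])
  have "exp (- (q * (y + b)\<^sup>2) / 2) = sqrt (2 * pi / q) * normal_density (-b) ?s y" for y
    using q by (simp add: normal_density_def power_divide real_sqrt_divide real_sqrt_mult field_simps)
  then have "(\<integral>\<^sup>+y. ennreal (exp (- (q * (y + b)\<^sup>2) / 2)) \<partial>lborel)
    = (\<integral>\<^sup>+y. ennreal (sqrt (2 * pi / q)) * ennreal (normal_density (-b) ?s y) \<partial>lborel)"
    using q by (simp add: ennreal_mult)
  also have "\<dots> = ennreal (sqrt (2 * pi / q)) * 1"
    unfolding 1[symmetric] by (rule nn_integral_cmult) auto
  finally show ?thesis by simp
qed

lemma qf_measurable [measurable]:
  "qf d Q \<in> borel_measurable (Pi\<^sub>M {..<d} (\<lambda>_. lborel :: real measure))"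
  unfolding qf_def[abs_def] by measurable

text \<open>One coordinate is integrated at a time: the others only shift the centre of the
  innermost integral, and so do not influence its value.\<close>

lemma nn_integral_gauss:
  assumes "symf d Q" "pivpos d Q"
  shows "(\<integral>\<^sup>+z. ennreal (exp (- qf d Q z / 2)) \<partial>(Pi\<^sub>M {..<d} (\<lambda>_. lborel))) = ennreal (sqrt ((2 * pi) ^ d / piv d Q))"
  using assms
proof (induction d arbitrary: Q)
  case 0
  interpret product_sigma_finite "\<lambda>_::nat. lborel :: real measure" by standard
  show ?case by (simp add: qf_def PiM_empty)
next
  case (Suc d)
  interpret P: product_sigma_finite "\<lambda>_::nat. lborel :: real measure" by standard
  have q: "0 < Q d d" and pp: "pivpos d (schur d Q)" using Suc.prems by auto
  have [measurable]: "qf (Suc d) Q \<in> borel_measurable (Pi\<^sub>M (insert d {..<d}) (\<lambda>_. lborel))"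
    using qf_measurable[of "Suc d" Q] by (simp add: lessThan_Suc)
  have "(\<integral>\<^sup>+z. ennreal (exp (- qf (Suc d) Q z / 2)) \<partial>(Pi\<^sub>M {..<Suc d} (\<lambda>_. lborel)))
    = (\<integral>\<^sup>+z. ennreal (exp (- qf (Suc d) Q z / 2)) \<partial>(Pi\<^sub>M (insert d {..<d}) (\<lambda>_. lborel)))"
    by (simp add: lessThan_Suc)
  also have "\<dots> = (\<integral>\<^sup>+x. (\<integral>\<^sup>+y. ennreal (exp (- qf (Suc d) Q (x(d := y)) / 2)) \<partial>lborel) \<partial>(Pi\<^sub>M {..<d} (\<lambda>_. lborel)))"
    by (rule P.product_nn_integral_insert) (auto, measurable)
  also have "\<dots> = (\<integral>\<^sup>+x. ennreal (exp (- qf d (schur d Q) x / 2)) * ennreal (sqrt (2 * pi / Q d d)) \<partial>(Pi\<^sub>M {..<d} (\<lambda>_. lborel)))"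
  proof (rule nn_integral_cong)
    fix x :: "nat \<Rightarrow> real"
    have eq: "qf (Suc d) Q (x(d := y)) = Q d d * (y + (\<Sum>i<d. Q i d * x i) / Q d d)\<^sup>2 + qf d (schur d Q) x" for y
      using qf_Suc[OF Suc.prems(1), of "x(d := y)"] q by (simp add: qf_def)
    have "(\<integral>\<^sup>+y. ennreal (exp (- qf (Suc d) Q (x(d := y)) / 2)) \<partial>lborel)
      = (\<integral>\<^sup>+y. ennreal (exp (- qf d (schur d Q) x / 2)) * ennreal (exp (- (Q d d * (y + (\<Sum>i<d. Q i d * x i) / Q d d)\<^sup>2) / 2)) \<partial>lborel)"
      unfolding eq by (intro nn_integral_cong) (simp add: ennreal_mult[symmetric] exp_add[symmetric] field_simps)
    also have "\<dots> = ennreal (exp (- qf d (schur d Q) x / 2)) * ennreal (sqrt (2 * pi / Q d d))"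
      by (subst nn_integral_cmult, measurable) (simp only: nn_integral_gauss1[OF q])
    finally show "(\<integral>\<^sup>+y. ennreal (exp (- qf (Suc d) Q (x(d := y)) / 2)) \<partial>lborel)
      = ennreal (exp (- qf d (schur d Q) x / 2)) * ennreal (sqrt (2 * pi / Q d d))" .
  qed
  also have "\<dots> = ennreal (sqrt ((2 * pi) ^ d / piv d (schur d Q))) * ennreal (sqrt (2 * pi / Q d d))"
    by (subst nn_integral_multc, measurable) (simp only: Suc.IH[OF symf_schur[OF Suc.prems(1)] pp])
  also have "\<dots> = ennreal (sqrt ((2 * pi) ^ Suc d / piv (Suc d) Q))"
    using q piv_pos[OF pp] by (subst ennreal_mult[symmetric]) (auto simp: real_sqrt_mult[symmetric] field_simps)
  finally show ?case .
qed

lemma det_piv: "pivpos d Q \<Longrightarrow> Determinant.det (mat d d (\<lambda>(i, j). Q i j)) = piv d Q"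
proof (induction d arbitrary: Q)
  case (Suc d)
  have q: "Q d d \<noteq> 0" and pp: "pivpos d (schur d Q)" using Suc.prems by auto
  define M where "M = mat (Suc d) (Suc d) (\<lambda>(i, j). Q i j)"
  \<comment> \<open>Multiplication by E performs the column operations that clear the last row of M
    off the diagonal. E is lower triangular with unit diagonal, so the determinant is
    unchanged.\<close>
  define E where "E = mat (Suc d) (Suc d) (\<lambda>(i, j). if i = j then 1 else if i = d then - Q d j / Q d d else (0::real))"
  define A where "A = mat d d (\<lambda>(i, j). schur d Q i j)"
  define b where "b = mat d 1 (\<lambda>(i, j). Q i d)"
  define c where "c = mat 1 1 (\<lambda>(i, j). Q d d)"
  have ME: "M * E = four_block_mat A b (0\<^sub>m 1 d) c"
  proof (rule eq_matI)
    fix i j assume "i < dim_row (four_block_mat A b (0\<^sub>m 1 d) c)" "j < dim_col (four_block_mat A b (0\<^sub>m 1 d) c)"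
    then have ij: "i < Suc d" "j < Suc d" by (auto simp: A_def c_def)
    have "(M * E) $$ (i, j) = (\<Sum>k<Suc d. Q i k * (if k = j then 1 else if k = d then - Q d j / Q d d else 0))"
      using ij by (simp add: M_def E_def scalar_prod_def lessThan_atLeast0 del: sum.op_ivl_Suc)
    also have "\<dots> = (\<Sum>k<d. Q i k * (if k = j then 1 else 0)) + Q i d * (if d = j then 1 else - Q d j / Q d d)"
      by (auto intro!: sum.cong)
    also have "(\<Sum>k<d. Q i k * (if k = j then 1 else 0)) = (if j < d then Q i j else 0)"
      by (simp add: if_distrib sum.delta' cong: if_cong)
    finally show "(M * E) $$ (i, j) = four_block_mat A b (0\<^sub>m 1 d) c $$ (i, j)"
      using ij q by (auto simp: four_block_mat_def Let_def A_def b_def c_def schur_def less_Suc_eq)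
  qed (auto simp: M_def E_def A_def c_def)
  have "Determinant.det M * Determinant.det E = Determinant.det (M * E)"
    by (rule det_mult[symmetric, of _ "Suc d"]) (auto simp: M_def E_def)
  also have "\<dots> = Determinant.det A * Determinant.det c"
    unfolding ME by (rule det_four_block_mat_lower_left_zero) (auto simp: A_def b_def c_def)
  also have "Determinant.det A = piv d (schur d Q)" unfolding A_def by (rule Suc.IH[OF pp])
  also have "Determinant.det c = Q d d" by (simp add: c_def det_single)
  also have "Determinant.det E = 1"
  proof -
    have "Determinant.det E = prod_list (diag_mat E)"
      by (rule det_lower_triangular[of "Suc d"]) (auto simp: E_def)
    also have "diag_mat E = map (\<lambda>_. 1) [0..<Suc d]" by (auto simp: diag_mat_def E_def)
    also have "prod_list (map (\<lambda>_. 1::real) [0..<Suc d]) = 1" by (induction d) auto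
    finally show ?thesis .
  qed
  finally show ?case by (simp add: M_def mult.commute)
qed simp

lemma cholesky: "symf d Q \<Longrightarrow> pivpos d Q \<Longrightarrow> \<exists>L. \<forall>i<d. \<forall>j<d. Q i j = (\<Sum>k<d. L i k * L j (k::nat))"
proof (induction d arbitrary: Q)
  case (Suc d)
  have q: "0 < Q d d" using Suc.prems by simp
  obtain L where L: "\<forall>i<d. \<forall>j<d. schur d Q i j = (\<Sum>k<d. L i k * L j k)"
    using Suc.IH[OF symf_schur[OF Suc.prems(1)]] Suc.prems(2) by auto
  define L' where "L' = (\<lambda>i k. if k = d then Q i d / sqrt (Q d d) else if i = d then 0 else L i k)"
  have "Q i j = (\<Sum>k<Suc d. L' i k * L' j k)" if "i < Suc d" "j < Suc d" for i j
  proof -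
    have s: "Q d j = Q j d" using Suc.prems(1) that by (simp add: symf_def)
    have "(\<Sum>k<Suc d. L' i k * L' j k) = (\<Sum>k<d. L' i k * L' j k) + Q i d * Q j d / Q d d"
      using q by (simp add: L'_def)
    also have "(\<Sum>k<d. L' i k * L' j k) = (if i = d \<or> j = d then 0 else schur d Q i j)"
      using L that by (auto simp: L'_def intro!: sum.neutral)
    finally show ?thesis using q s that by (auto simp: schur_def)
  qed
  then show ?case by blast
qed simp

text \<open>This bounds ln det (1 - X) from below by - tr X - 2 |X|^2, by elimination instead of
  eigenvalues. The Schur complement of 1 - X is 1 - Y with Y a rank one update of X. The squared
  norm falls from \<open>f + 2 * s + a\<^sup>2\<close> to at most f + s, and this pays for the
  increase c * s of the trace; the pivot 1 - a pays for itself.\<close>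

lemma piv_one_minus_lower:
  assumes "symf d X" "(\<Sum>i<d. \<Sum>j<d. (X i j)\<^sup>2) \<le> 1/64"
  shows "pivpos d (\<lambda>i j. (if i = j then 1 else 0) - X i j) \<and>
    exp (- (\<Sum>i<d. X i i) - 2 * (\<Sum>i<d. \<Sum>j<d. (X i j)\<^sup>2)) \<le> piv d (\<lambda>i j. (if i = j then 1 else 0) - X i j)"
  using assms
proof (induction d arbitrary: X)
  case (Suc d)
  define a where "a = X d d"
  define s where "s = (\<Sum>i<d. (X i d)\<^sup>2)"
  define f where "f = (\<Sum>i<d. \<Sum>j<d. (X i j)\<^sup>2)"
  define c where "c = 1 / (1 - a)"
  define Y where "Y = (\<lambda>i j. X i j + c * (X i d * X j d))"
  have s': "(\<Sum>j<d. (X d j)\<^sup>2) = s" unfolding s_def using Suc.prems(1) by (intro sum.cong) (auto simp: symf_def)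
  have F: "(\<Sum>i<Suc d. \<Sum>j<Suc d. (X i j)\<^sup>2) = f + 2 * s + a\<^sup>2"
    using s' by (simp add: sum.distrib f_def s_def a_def)
  have f0: "0 \<le> f" and s0: "0 \<le> s" by (auto simp: f_def s_def intro!: sum_nonneg)
  have le: "f + 2 * s + a\<^sup>2 \<le> 1/64" using Suc.prems(2) F by simp
  have "a\<^sup>2 \<le> (1/8)\<^sup>2" using le f0 s0 by (simp add: power2_eq_square)
  then have a8: "\<bar>a\<bar> \<le> 1/8" by (metis abs_le_square_iff abs_of_nonneg zero_le_divide_1_iff zero_le_numeral)
  have c: "0 < c" "c \<le> 8/7" using a8 by (auto simp: c_def field_simps)
  define t where "t = (\<Sum>i<d. \<Sum>j<d. X i j * (X i d * X j d))"
  have t: "\<bar>t\<bar> \<le> s / 8"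
  proof -
    have "t\<^sup>2 \<le> f * (s * s)"
    proof -
      have "t\<^sup>2 = (\<Sum>p\<in>{..<d}\<times>{..<d}. X (fst p) (snd p) * (X (fst p) d * X (snd p) d))\<^sup>2"
        by (simp add: t_def sum.cartesian_product case_prod_beta)
      also have "\<dots> \<le> (\<Sum>p\<in>{..<d}\<times>{..<d}. (X (fst p) (snd p))\<^sup>2) * (\<Sum>p\<in>{..<d}\<times>{..<d}. (X (fst p) d * X (snd p) d)\<^sup>2)"
        by (rule Cauchy_Schwarz_ineq_sum)
      also have "(\<Sum>p\<in>{..<d}\<times>{..<d}. (X (fst p) (snd p))\<^sup>2) = f"
        by (simp add: f_def sum.cartesian_product case_prod_beta)
      also have "(\<Sum>p\<in>{..<d}\<times>{..<d}. (X (fst p) d * X (snd p) d)\<^sup>2) = s * s"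
        by (simp add: s_def sum_product sum.cartesian_product case_prod_beta power_mult_distrib)
      finally show ?thesis .
    qed
    also have "\<dots> \<le> (1/64) * (s * s)" using le s0 zero_le_power2[of a] by (intro mult_right_mono) (linarith, simp)
    finally have "t\<^sup>2 \<le> (s / 8)\<^sup>2" by (simp add: power2_eq_square)
    then show ?thesis using s0 by (metis abs_le_square_iff abs_of_nonneg zero_le_divide_iff zero_le_numeral)
  qed
  have FY: "(\<Sum>i<d. \<Sum>j<d. (Y i j)\<^sup>2) = f + 2 * c * t + c\<^sup>2 * (s * s)"
  proof -
    have "(\<Sum>i<d. \<Sum>j<d. (Y i j)\<^sup>2) = (\<Sum>i<d. \<Sum>j<d. (X i j)\<^sup>2 + 2 * c * (X i j * (X i d * X j d)) + c\<^sup>2 * ((X i d)\<^sup>2 * (X j d)\<^sup>2))"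
      by (intro sum.cong) (auto simp: Y_def power2_eq_square algebra_simps)
    moreover have "c\<^sup>2 * (s * s) = (\<Sum>i<d. \<Sum>j<d. c\<^sup>2 * ((X i d)\<^sup>2 * (X j d)\<^sup>2))"
    proof -
      have "s * s = (\<Sum>i<d. \<Sum>j<d. (X i d)\<^sup>2 * (X j d)\<^sup>2)" by (simp add: s_def sum_product)
      then show ?thesis by (simp only: sum_distrib_left)
    qed
    ultimately show ?thesis by (simp only: sum.distrib f_def t_def sum_distrib_left)
  qed
  have ct: "2 * c * t \<le> (2/7) * s"
  proof -
    have "2 * c * t \<le> 2 * c * (s / 8)" using t c by (intro mult_left_mono) auto
    also have "\<dots> \<le> 2 * (8/7) * (s / 8)" using c s0 by (intro mult_right_mono mult_left_mono) auto
    finally show ?thesis by simp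
  qed
  have s128: "s \<le> 1/128" using le f0 zero_le_power2[of a] by linarith
  have cs: "c\<^sup>2 * (s * s) \<le> (1/8) * s"
  proof -
    have "c\<^sup>2 * (s * s) \<le> (8/7)\<^sup>2 * ((1/128) * s)"
      using c s0 s128 by (intro mult_mono power_mono mult_right_mono) auto
    also have "\<dots> \<le> (1/8) * s" using s0 by (simp add: power2_eq_square)
    finally show ?thesis .
  qed
  have FYle: "(\<Sum>i<d. \<Sum>j<d. (Y i j)\<^sup>2) \<le> f + s" unfolding FY using ct cs s0 by linarith
  have symY: "symf d Y" using Suc.prems(1) by (auto simp: symf_def Y_def)
  have FY64: "(\<Sum>i<d. \<Sum>j<d. (Y i j)\<^sup>2) \<le> 1/64" using FYle le s0 by (smt (verit) zero_le_power2)
  have IH: "pivpos d (\<lambda>i j. (if i = j then 1 else 0) - Y i j)"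
    "exp (- (\<Sum>i<d. Y i i) - 2 * (\<Sum>i<d. \<Sum>j<d. (Y i j)\<^sup>2)) \<le> piv d (\<lambda>i j. (if i = j then 1 else 0) - Y i j)"
    using Suc.IH[OF symY FY64] by auto
  have sch: "schur d (\<lambda>i j. (if i = j then 1 else 0) - X i j) i j = (if i = j then 1 else 0) - Y i j" if "i < d" "j < d" for i j
    using Suc.prems(1) that by (simp add: schur_def Y_def c_def a_def symf_def)
  have pp_cong: "pivpos d Q \<longleftrightarrow> pivpos d Q'" if "\<And>i j. i < d \<Longrightarrow> j < d \<Longrightarrow> Q i j = Q' i j" for Q Q' and d :: nat
    using that
  proof (induction d arbitrary: Q Q')
    case (Suc d)
    have "pivpos d (schur d Q) = pivpos d (schur d Q')" by (rule Suc.IH) (simp add: schur_def Suc.prems)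
    then show ?case by (simp add: Suc.prems)
  qed simp
  have piv_eq: "piv d (schur d (\<lambda>i j. (if i = j then 1 else 0) - X i j)) = piv d (\<lambda>i j. (if i = j then 1 else 0) - Y i j)"
    by (rule piv_cong) (rule sch)
  have pp_eq: "pivpos d (schur d (\<lambda>i j. (if i = j then 1 else 0) - X i j))"
    using pp_cong[of d "schur d (\<lambda>i j. (if i = j then 1 else 0) - X i j)" "\<lambda>i j. (if i = j then 1 else 0) - Y i j"] sch IH(1) by blast
  have tr: "(\<Sum>i<d. Y i i) = (\<Sum>i<d. X i i) + c * s"
    by (simp add: Y_def s_def sum.distrib sum_distrib_left power2_eq_square)
  have ea: "exp (- a - 2 * a\<^sup>2) \<le> 1 - a"
  proof -
    have "\<bar>ln (1 + (- a)) - (- a)\<bar> \<le> 2 * (- a)\<^sup>2"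
      using a8 by (intro abs_ln_one_plus_x_minus_x_bound) auto
    then have "- a - 2 * a\<^sup>2 \<le> ln (1 - a)" by simp
    then show ?thesis using a8 by (subst (asm) ln_ge_iff) auto
  qed
  have cs2: "c * s \<le> (8/7) * s" using c s0 by (intro mult_right_mono) auto
  have "exp (- (\<Sum>i<Suc d. X i i) - 2 * (\<Sum>i<Suc d. \<Sum>j<Suc d. (X i j)\<^sup>2))
      \<le> exp ((- a - 2 * a\<^sup>2) + (- (\<Sum>i<d. Y i i) - 2 * (\<Sum>i<d. \<Sum>j<d. (Y i j)\<^sup>2)))"
    unfolding F tr using FYle cs2 s0 by (simp add: a_def[symmetric])
  also have "\<dots> = exp (- a - 2 * a\<^sup>2) * exp (- (\<Sum>i<d. Y i i) - 2 * (\<Sum>i<d. \<Sum>j<d. (Y i j)\<^sup>2))"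
    by (rule exp_add)
  also have "\<dots> \<le> (1 - a) * piv d (\<lambda>i j. (if i = j then 1 else 0) - Y i j)"
    using ea IH(2) a8 by (intro mult_mono) auto
  finally show ?case using a8 piv_eq pp_eq by (simp add: a_def[symmetric])
qed simp

text \<open>The matrix determinant lemma. Elimination reproduces a rank one perturbation of the
  identity and only divides t by the pivot.\<close>

lemma piv_rank_one:
  assumes "0 \<le> t"
  shows "piv d (\<lambda>i j. (if i = j then 1 else 0) + t * (w i * w j)) = 1 + t * (\<Sum>i<d. (w i)\<^sup>2)"
  using assms
proof (induction d arbitrary: t)
  case (Suc d)
  let ?q = "1 + t * (w d)\<^sup>2"
  have q: "0 < ?q" using Suc.prems by (simp add: add_pos_nonneg)
  have "piv d (schur d (\<lambda>i j. (if i = j then 1 else 0) + t * (w i * w j))) =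
      piv d (\<lambda>i j. (if i = j then 1 else 0) + (t / ?q) * (w i * w j))"
  proof (rule piv_cong)
    fix i j assume "i < d" "j < d"
    then show "schur d (\<lambda>i j. (if i = j then 1 else 0) + t * (w i * w j)) i j
      = (if i = j then 1 else 0) + (t / ?q) * (w i * w j)"
      using q by (simp add: schur_def field_simps power2_eq_square)
  qed
  also have "\<dots> = 1 + (t / ?q) * (\<Sum>i<d. (w i)\<^sup>2)"
    by (rule Suc.IH) (use Suc.prems q in simp)
  finally show ?case using q by (simp add: field_simps power2_eq_square)
qed simp

section \<open>Dense matrices as finitely supported matrices\<close>

definition emb :: "real mat \<Rightarrow> fmat" where
  "emb A = mkf (dim_row A) (dim_col A) (\<lambda>i j. A $$ (i, j))"

definition to_mat :: "nat \<Rightarrow> fmat \<Rightarrow> real mat" where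
  "to_mat d A = mat d d (\<lambda>(i, j). ent A i j)"

definition cv :: "nat \<Rightarrow> (nat \<Rightarrow> real) \<Rightarrow> fmat" where
  "cv d z = mkf d 1 (\<lambda>i _. z i)"

lemma ent_emb: "ent (emb A) i j = (if i < dim_row A \<and> j < dim_col A then A $$ (i, j) else 0)"
  by (simp add: emb_def)

lemma dimb_emb: "A \<in> carrier_mat d d \<Longrightarrow> dimb d (emb A)"
  by (auto simp: dimb_def ent_emb)

lemma emb_mult: "A \<in> carrier_mat a k \<Longrightarrow> B \<in> carrier_mat k b \<Longrightarrow> emb (A * B) = emb A * emb B"
proof (rule fmat_eqI)
  fix i j assume A: "A \<in> carrier_mat a k" and B: "B \<in> carrier_mat k b"
  define N where "N = max a (max k b)"
  have "dimb N (emb A)" using A by (auto simp: dimb_def ent_emb N_def)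
  then have "ent (emb A * emb B) i j = (\<Sum>l<N. ent (emb A) i l * ent (emb B) l j)" by (rule ent_times)
  also have "\<dots> = (\<Sum>l<k. ent (emb A) i l * ent (emb B) l j)"
    by (rule sum.mono_neutral_right) (use A in \<open>auto simp: ent_emb N_def\<close>)
  also have "\<dots> = ent (emb (A * B)) i j"
    using A B by (auto simp: ent_emb scalar_prod_def lessThan_atLeast0 intro!: sum.cong)
  finally show "ent (emb (A * B)) i j = ent (emb A * emb B) i j" ..
qed

lemma emb_transpose: "emb (A\<^sup>T) = tp (emb A)"
  by (rule fmat_eqI) (auto simp: ent_emb)

lemma emb_one: "emb (1\<^sub>m n) = idm {..<n}"
  by (rule fmat_eqI) (auto simp: ent_emb ent_idm)

lemma emb_minus: "A \<in> carrier_mat a b \<Longrightarrow> B \<in> carrier_mat a b \<Longrightarrow> emb (A - B) = emb A - emb B"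
  by (rule fmat_eqI) (auto simp: ent_emb)

lemma to_mat_emb: "A \<in> carrier_mat d d \<Longrightarrow> to_mat d (emb A) = A"
  by (rule eq_matI) (auto simp: to_mat_def ent_emb)

lemma emb_to_mat: "dimb d A \<Longrightarrow> emb (to_mat d A) = A"
  by (rule fmat_eqI) (auto simp: to_mat_def ent_emb dimb_def)

lemma to_mat_carrier [simp]: "to_mat d A \<in> carrier_mat d d"
  by (simp add: to_mat_def)

lemma to_mat_mult: "dimb d A \<Longrightarrow> to_mat d (A * B) = to_mat d A * to_mat d B"
  by (rule eq_matI) (auto simp: to_mat_def ent_times scalar_prod_def lessThan_atLeast0)

lemma to_mat_one: "to_mat d (idm {..<d}) = 1\<^sub>m d"
  by (rule eq_matI) (auto simp: to_mat_def ent_idm)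

lemma one_sided_inverse:
  assumes "dimb d A" "dimb d B" "A * B = idm {..<d}" shows "B * A = idm {..<d}"
proof -
  have "to_mat d A * to_mat d B = 1\<^sub>m d" using assms by (metis to_mat_mult to_mat_one)
  then have "to_mat d B * to_mat d A = 1\<^sub>m d" by (rule mat_mult_left_right_inverse[rotated 2]) auto
  then have "to_mat d (B * A) = to_mat d (idm {..<d})" using assms by (metis to_mat_mult to_mat_one)
  moreover have "dimb d (idm {..<d})" by (auto simp: dimb_def ent_idm)
  ultimately show ?thesis using assms dimb_times emb_to_mat by metis
qed

lemma dimb_idm: "dimb d (idm {..<d})" by (auto simp: dimb_def ent_idm)

lemma dimb_algebra: "dimb d A \<Longrightarrow> dimb d B \<Longrightarrow> dimb d (A - B)" "dimb d A \<Longrightarrow> dimb d (c *\<^sub>R A)"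
  "dimb d A \<Longrightarrow> dimb d B \<Longrightarrow> dimb d (A + B)"
  by (auto simp: dimb_def)

lemma qf_inner:
  assumes "dimb d A" shows "qf d (ent A) z = inner (cv d z) (A * cv d z)"
proof (cases "d = 0")
  case True
  then have "cv d z = 0" by (intro fmat_eqI) (simp add: cv_def)
  then show ?thesis using True by (simp add: qf_def)
next
  case False
  have dc: "dimb d (cv d z)" using False by (auto simp: dimb_def cv_def)
  have "inner (cv d z) (A * cv d z) = (\<Sum>i<d. \<Sum>j<d. ent (cv d z) i j * ent (A * cv d z) i j)"
    by (rule inner_fmat_dimb[OF dc])
  also have "\<dots> = (\<Sum>i<d. \<Sum>j\<in>{0}. ent (cv d z) i j * ent (A * cv d z) i j)"
    by (intro sum.cong sum.mono_neutral_right) (use False in \<open>auto simp: cv_def\<close>)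
  also have "\<dots> = qf d (ent A) z"
    by (simp add: qf_def ent_times[OF assms] cv_def sum_distrib_left mult_ac cong: sum.cong_simp)
  finally show ?thesis ..
qed

lemma inner_cv: "inner (cv d z) A = (\<Sum>i<d. z i * ent A i 0)"
proof -
  have dc: "dimb (Suc d) (cv d z)" by (auto simp: dimb_def cv_def)
  have "inner (cv d z) A = (\<Sum>i<Suc d. \<Sum>j<Suc d. ent (cv d z) i j * ent A i j)"
    by (rule inner_fmat_dimb[OF dc])
  also have "\<dots> = (\<Sum>i<d. \<Sum>j\<in>{0}. ent (cv d z) i j * ent A i j)"
    by (intro sum.mono_neutral_cong_right sum.mono_neutral_right) (auto simp: cv_def)
  finally show ?thesis by (simp add: cv_def cong: sum.cong_simp)
qed

lemma norm_cv: "(norm (cv d z))\<^sup>2 = (\<Sum>i<d. (z i)\<^sup>2)"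
  unfolding power2_norm_eq_inner inner_cv by (simp add: cv_def power2_eq_square)

lemma cv_ent: "(\<And>i j. d \<le> i \<or> 1 \<le> j \<Longrightarrow> ent A i j = 0) \<Longrightarrow> cv d (\<lambda>i. ent A i 0) = A"
  by (rule fmat_eqI) (auto simp: cv_def not_less)

lemma mult_cv: "dimb d A \<Longrightarrow> cv d (\<lambda>i. ent (A * cv d z) i 0) = A * cv d z"
  by (rule cv_ent) (auto simp: ent_times dimb_def cv_def)

section \<open>Moment generating function and concentration of quadratic forms\<close>

locale gauss =
  fixes d :: nat and S :: "real mat"
  assumes Sc: "S \<in> carrier_mat d d" and Ssym: "S\<^sup>T = S" and Spd: "pdf d (ent (emb S))"
begin

definition "Sf = emb S"

lemma dS: "dimb d Sf" unfolding Sf_def by (rule dimb_emb[OF Sc])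
lemma tS: "tp Sf = Sf" unfolding Sf_def by (metis Ssym emb_transpose)

lemma symS: "symf d (ent Sf)" unfolding symf_def using tS by (metis ent_tp)

lemma ppS: "pivpos d (ent Sf)" by (rule pdf_pivpos[OF symS Spd[folded Sf_def]])

lemma detS: "0 < Determinant.det S"
proof -
  have "Determinant.det (to_mat d Sf) = piv d (ent Sf)" unfolding to_mat_def by (rule det_piv[OF ppS])
  then show ?thesis using piv_pos[OF ppS] to_mat_emb[OF Sc] by (simp add: Sf_def)
qed

lemma minv: "minv S \<in> carrier_mat d d" "Sf * emb (minv S) = idm {..<d}" "emb (minv S) * Sf = idm {..<d}"
proof -
  have "S \<in> Units (ring_mat TYPE(real) d undefined)" using detS by (intro det_non_zero_imp_unit[OF Sc]) auto
  then obtain B where "mat_inverse S = Some B" using mat_inverse(1)[OF Sc] by fastforce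
  then have B: "S * minv S = 1\<^sub>m d" "minv S * S = 1\<^sub>m d" and c: "minv S \<in> carrier_mat d d"
    using mat_inverse(2)[OF Sc] by (auto simp: minv_def)
  show "minv S \<in> carrier_mat d d" by (rule c)
  show "Sf * emb (minv S) = idm {..<d}" "emb (minv S) * Sf = idm {..<d}"
    using B emb_mult[OF Sc c] emb_mult[OF c Sc] by (auto simp: Sf_def emb_one)
qed

definition "Sinv = emb (minv S)"

lemma dSi: "dimb d Sinv" unfolding Sinv_def by (rule dimb_emb[OF minv(1)])

lemma SSi: "Sf * Sinv = idm {..<d}" "Sinv * Sf = idm {..<d}" using minv by (auto simp: Sinv_def)

lemma tSi: "tp Sinv = Sinv"
proof -
  have "tp Sinv * Sf = idm {..<d}" using SSi(1) tS by (metis tp_idm tp_mult)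
  then have "tp Sinv * Sf * Sinv = Sinv" using dimb_idm_left[OF dSi] by simp
  then show ?thesis using dimb_idm_right[OF dimb_tp[OF dSi]] by (simp add: SSi mult.assoc)
qed

text \<open>A Cholesky type factor of the covariance. Conjugation by it turns the form in the
  Gaussian density into the identity, so that the determinants below are those of perturbations of
  the identity.\<close>

definition "L = (SOME L. dimb d L \<and> L * tp L = Sf)"

lemma L: "dimb d L" "L * tp L = Sf"
proof -
  obtain l where l: "\<forall>i<d. \<forall>j<d. ent Sf i j = (\<Sum>k<d. l i k * l j k)" using cholesky[OF symS ppS] by blast
  have D: "dimb d (mkf d d l)" by (auto simp: dimb_def)
  have "mkf d d l * tp (mkf d d l) = Sf"
  proof (rule fmat_eqI)
    fix i j
    show "ent (mkf d d l * tp (mkf d d l)) i j = ent Sf i j"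
    proof (cases "i < d \<and> j < d")
      case True
      then show ?thesis using l by (simp add: ent_times[OF D])
    next
      case False
      then have "ent Sf i j = 0" using dS by (auto simp: dimb_def not_less)
      then show ?thesis using False by (auto simp: ent_times[OF D])
    qed
  qed
  then have "\<exists>L. dimb d L \<and> L * tp L = Sf" using D by blast
  then show "dimb d L" "L * tp L = Sf" unfolding L_def by (metis (mono_tags, lifting) someI_ex)+
qed

lemma LLSi: "L * (tp L * Sinv) = idm {..<d}"
  by (metis L(2) SSi(1) mult.assoc)

lemma LSiL: "tp L * Sinv * L = idm {..<d}"
  by (rule one_sided_inverse[OF L(1) dimb_times[OF dimb_tp[OF L(1)] dSi] LLSi])

text \<open>The exponent of the density absorbs B, which leaves a Gaussian integral for
  \<open>Q = Sinv - 2 *\<^sub>R B\<close>. Its determinant times that of S is the determinant of the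
  conjugate of Q by L.\<close>

lemma mgf:
  assumes dB: "dimb d B" and tB: "tp B = B"
    and pd: "pdf d (ent (idm {..<d} - 2 *\<^sub>R (tp L * B * L)))"
  shows "(\<integral>\<^sup>+z. ennreal (exp (qf d (ent B) z)) \<partial>mvn d S)
    = ennreal (1 / sqrt (piv d (ent (idm {..<d} - 2 *\<^sub>R (tp L * B * L)))))"
proof -
  define Q where "Q = Sinv - 2 *\<^sub>R B"
  define Y where "Y = idm {..<d} - 2 *\<^sub>R (tp L * B * L)"
  have dQ: "dimb d Q" unfolding Q_def by (intro dimb_algebra dSi dB)
  have dY: "dimb d Y" unfolding Y_def by (intro dimb_algebra dimb_times dimb_tp L(1) dB dimb_idm)
  have LQL: "tp L * Q * L = Y" by (simp add: Q_def Y_def LSiL[symmetric] algebra_simps)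
  have tQ: "tp Q = Q" by (simp add: Q_def tp_simps tSi tB)
  have tY: "tp Y = Y" by (simp add: Y_def tp_simps tB mult.assoc)
  have sQ: "symf d (ent Q)" unfolding symf_def using tQ by (metis ent_tp)
  have sY: "symf d (ent Y)" unfolding symf_def using tY by (metis ent_tp)
  have pQ: "pdf d (ent Q)" unfolding pdf_def
  proof (intro allI impI)
    fix z :: "nat \<Rightarrow> real" assume z: "\<exists>i<d. z i \<noteq> 0"
    \<comment> \<open>The whitened vector, with \<open>L * cv d w = cv d z\<close>; positivity of Y
      at w is positivity of Q at z.\<close>
    define w where "w = (\<lambda>i. ent (tp L * Sinv * cv d z) i 0)"
    have cw: "cv d w = tp L * Sinv * cv d z" unfolding w_def
      by (rule mult_cv) (intro dimb_times dimb_tp L(1) dSi)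
    have Lw: "L * cv d w = cv d z"
    proof -
      have "L * cv d w = (L * (tp L * Sinv)) * cv d z" by (simp add: cw mult.assoc)
      also have "\<dots> = cv d z" unfolding LLSi by (rule fmat_eqI) (auto simp: ent_idm_times cv_def)
      finally show ?thesis .
    qed
    have "\<exists>i<d. w i \<noteq> 0"
    proof (rule ccontr)
      assume "\<not> ?thesis"
      then have "cv d w = 0" by (intro fmat_eqI) (auto simp: cv_def)
      then have "cv d z = 0" using Lw by simp
      then have "ent (cv d z) i 0 = 0" for i by simp
      moreover have "ent (cv d z) i 0 = z i" if "i < d" for i using that by (simp add: cv_def)
      ultimately have "z i = 0" if "i < d" for i using that by metis
      then show False using z by blast
    qed
    then have "0 < qf d (ent Y) w" using pd by (simp add: pdf_def Y_def)
    also have "\<dots> = inner (cv d w) ((tp L * Q * L) * cv d w)" by (simp add: qf_inner[OF dY] LQL)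
    also have "\<dots> = inner (L * cv d w) (Q * (L * cv d w))" by (simp add: inner_mult_left mult.assoc)
    also have "\<dots> = qf d (ent Q) z" by (simp add: Lw qf_inner[OF dQ])
    finally show "0 < qf d (ent Q) z" .
  qed
  have ppQ: "pivpos d (ent Q)" by (rule pdf_pivpos[OF sQ pQ])
  have ppY: "pivpos d (ent Y)" by (rule pdf_pivpos[OF sY]) (use pd in \<open>simp add: Y_def\<close>)
  have det: "Determinant.det S * piv d (ent Q) = piv d (ent Y)"
  proof -
    have "piv d (ent Y) = Determinant.det (to_mat d Y)" unfolding to_mat_def by (rule det_piv[OF ppY, symmetric])
    also have "to_mat d Y = to_mat d (tp L) * to_mat d Q * to_mat d L"
      unfolding LQL[symmetric] using L(1) dQ dimb_tp dimb_times by (simp add: to_mat_mult)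
    also have "Determinant.det \<dots> = Determinant.det (to_mat d (tp L)) * Determinant.det (to_mat d Q) * Determinant.det (to_mat d L)"
    proof -
      have dm: "Determinant.det (A * B) = Determinant.det A * Determinant.det B"
        if "A \<in> carrier_mat d d" "B \<in> carrier_mat d d" for A B :: "real mat"
        using that by (rule det_mult)
      have c: "to_mat d (tp L) * to_mat d Q \<in> carrier_mat d d" by (rule mult_carrier_mat[of _ d d]) simp_all
      show ?thesis by (simp add: dm[OF c] dm)
    qed
    also have "\<dots> = Determinant.det (to_mat d L * to_mat d (tp L)) * Determinant.det (to_mat d Q)"
      by (subst det_mult[of "to_mat d L" d "to_mat d (tp L)"]) simp_all
    also have "to_mat d L * to_mat d (tp L) = S" using L to_mat_mult to_mat_emb[OF Sc] by (metis Sf_def)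
    also have "Determinant.det (to_mat d Q) = piv d (ent Q)" unfolding to_mat_def by (rule det_piv[OF ppQ])
    finally show ?thesis ..
  qed
  define c where "c = 1 / sqrt ((2 * pi) ^ d * Determinant.det S)"
  have c0: "0 \<le> c" using detS by (simp add: c_def)
  have dens: "vec d z \<bullet> (minv S *\<^sub>v vec d z) = qf d (ent Sinv) z" for z :: "nat \<Rightarrow> real"
    using minv(1) by (auto simp: qf_def Sinv_def ent_emb scalar_prod_def lessThan_atLeast0 sum_distrib_left mult_ac intro!: sum.cong)
  have "(\<integral>\<^sup>+z. ennreal (exp (qf d (ent B) z)) \<partial>mvn d S)
    = (\<integral>\<^sup>+z. ennreal (exp (- qf d (ent Sinv) z / 2) * c) * ennreal (exp (qf d (ent B) z)) \<partial>(Pi\<^sub>M {..<d} (\<lambda>_. lborel)))"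
    unfolding mvn_def dens c_def by (subst nn_integral_density) (auto simp: mult.commute)
  also have "\<dots> = (\<integral>\<^sup>+z. ennreal c * ennreal (exp (- qf d (ent Q) z / 2)) \<partial>(Pi\<^sub>M {..<d} (\<lambda>_. lborel)))"
  proof (rule nn_integral_cong)
    fix z
    have "qf d (ent Q) z = qf d (ent Sinv) z - 2 * qf d (ent B) z"
      by (simp add: qf_def Q_def algebra_simps sum_subtractf sum_distrib_left)
    then have "- qf d (ent Sinv) z / 2 + qf d (ent B) z = - qf d (ent Q) z / 2" by simp
    then have "exp (- qf d (ent Sinv) z / 2) * exp (qf d (ent B) z) = exp (- qf d (ent Q) z / 2)"
      by (simp add: exp_add[symmetric])
    then show "ennreal (exp (- qf d (ent Sinv) z / 2) * c) * ennreal (exp (qf d (ent B) z))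
      = ennreal c * ennreal (exp (- qf d (ent Q) z / 2))"
      using c0 by (simp add: ennreal_mult[symmetric] mult_ac)
  qed
  also have "\<dots> = ennreal c * ennreal (sqrt ((2 * pi) ^ d / piv d (ent Q)))"
    by (subst nn_integral_cmult, measurable) (simp only: nn_integral_gauss[OF sQ ppQ])
  also have "\<dots> = ennreal (1 / sqrt (piv d (ent Y)))"
    using c0 detS piv_pos[OF ppQ]
    by (simp add: ennreal_mult[symmetric] det[symmetric] c_def real_sqrt_mult real_sqrt_divide)
  finally show ?thesis by (simp add: Y_def)
qed

text \<open>The exponent is negative, so the transform is finite for every t.
  \<open>small_ball\<close> needs large t, which the smallness condition of \<open>mgf_bound\<close>
  would exclude. The case t = 0 yields the total mass of the density.\<close>

lemma mgf_rank_one: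
  assumes t: "0 \<le> t"
  shows "(\<integral>\<^sup>+z. ennreal (exp (- t * (\<Sum>i<d. v i * z i)\<^sup>2)) \<partial>mvn d S)
    = ennreal (1 / sqrt (1 + 2 * t * inner (cv d v) (Sf * cv d v)))"
\<comment> \<open>\<open>cv d v\<close> occupies column 0, which belongs to a d by d block only if d
  is positive.\<close>
proof (cases "d = 0")
  case True
  have dB: "dimb d 0" by (simp add: dimb_def)
  show ?thesis using mgf[OF dB] True by (simp add: pdf_def qf_def inner_cv tp_scaleR[of 0, simplified])
next
  case False
  define B where "B = (- t) *\<^sub>R (cv d v * tp (cv d v))"
  define w where "w = (\<lambda>i. ent (tp L * cv d v) i 0)"
  have dc: "dimb d (cv d v)" using False by (auto simp: dimb_def cv_def)
  have dB: "dimb d B" unfolding B_def by (intro dimb_algebra dimb_times dimb_tp dc)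
  have tB: "tp B = B" by (simp add: B_def tp_simps)
  have cw: "cv d w = tp L * cv d v" unfolding w_def by (rule mult_cv[OF dimb_tp[OF L(1)]])
  have eq: "tp L * B * L = (- t) *\<^sub>R (cv d w * tp (cv d w))"
    unfolding B_def cw by (simp add: tp_simps mult.assoc)
  have ew: "ent (cv d w * tp (cv d w)) i j = w i * w j" if "i < d" "j < d" for i j
  proof -
    have "dimb d (cv d w)" using False by (auto simp: dimb_def cv_def)
    then have "ent (cv d w * tp (cv d w)) i j = (\<Sum>k<d. ent (cv d w) i k * ent (cv d w) j k)"
      by (simp add: ent_times)
    also have "\<dots> = (\<Sum>k\<in>{0}. ent (cv d w) i k * ent (cv d w) j k)"
      by (rule sum.mono_neutral_right) (use False in \<open>auto simp: cv_def\<close>)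
    finally show ?thesis using that by (simp add: cv_def)
  qed
  define Y where "Y = idm {..<d} - 2 *\<^sub>R (tp L * B * L)"
  have eY: "ent Y i j = (if i = j then 1 else 0) + 2 * t * (w i * w j)" if "i < d" "j < d" for i j
    using that ew[OF that] by (simp add: Y_def eq ent_idm)
  have qB: "qf d (ent B) z = - t * (\<Sum>i<d. v i * z i)\<^sup>2" for z
  proof -
    have "qf d (ent B) z = - t * inner (cv d z) (cv d v * (tp (cv d v) * cv d z))"
      by (simp add: qf_inner[OF dB]) (simp add: B_def mult.assoc)
    also have "inner (cv d z) (cv d v * (tp (cv d v) * cv d z)) = (norm (tp (cv d v) * cv d z))\<^sup>2"
      by (simp add: inner_mult_left' power2_norm_eq_inner)
    also have "tp (cv d v) * cv d z = (\<Sum>i<d. v i * z i) *\<^sub>R idm {0}"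
      by (rule fmat_eqI, subst ent_times[OF dimb_tp[OF dc]]) (auto simp: cv_def ent_idm intro!: sum.neutral)
    finally show ?thesis by (simp add: power_mult_distrib)
  qed
  have pd: "pdf d (ent Y)" unfolding pdf_def
  proof (intro allI impI)
    fix z :: "nat \<Rightarrow> real" assume z: "\<exists>i<d. z i \<noteq> 0"
    have "qf d (ent Y) z = (\<Sum>i<d. \<Sum>j<d. (if i = j then z i * z j else 0) + 2 * t * ((w i * z i) * (w j * z j)))"
      unfolding qf_def by (intro sum.cong) (auto simp: eY algebra_simps)
    also have "\<dots> = (\<Sum>i<d. (z i)\<^sup>2) + 2 * t * (\<Sum>i<d. w i * z i)\<^sup>2"
      by (simp add: sum.distrib sum_distrib_left[symmetric] power2_eq_square sum_product)
    also have "\<dots> > 0"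
    proof -
      have "0 < (\<Sum>i<d. (z i)\<^sup>2)" using z by (auto intro!: sum_pos2)
      then show ?thesis using t by (simp add: add_pos_nonneg)
    qed
    finally show "0 < qf d (ent Y) z" .
  qed
  have "piv d (ent Y) = piv d (\<lambda>i j. (if i = j then 1 else 0) + 2 * t * (w i * w j))"
    by (rule piv_cong) (rule eY)
  also have "\<dots> = 1 + 2 * t * (\<Sum>i<d. (w i)\<^sup>2)" by (rule piv_rank_one) (use t in simp)
  also have "(\<Sum>i<d. (w i)\<^sup>2) = inner (cv d v) (Sf * cv d v)"
    by (simp add: norm_cv[symmetric] cw power2_norm_eq_inner inner_mult_left L(2)[symmetric] mult.assoc)
  finally have "piv d (ent Y) = 1 + 2 * t * inner (cv d v) (Sf * cv d v)" .
  then show ?thesis using mgf[OF dB tB pd[unfolded Y_def]] by (simp add: qB Y_def)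
qed

lemma prob_mvn: "prob_space (mvn d S)"
proof
  have "emeasure (mvn d S) (space (mvn d S)) = (\<integral>\<^sup>+z. 1 \<partial>mvn d S)" by simp
  also have "\<dots> = 1" using mgf_rank_one[of 0 "\<lambda>_. 0"] by simp
  finally show "emeasure (mvn d S) (space (mvn d S)) = 1" .
qed

text \<open>The conjugated matrix X has norm at most 2 |s| M |B|, hence at most 1/8, and
  \<open>piv_one_minus_lower\<close> applies. Its trace term is twice the mean of the quadratic
  form, and the square root halves both exponents.\<close>

lemma mgf_bound:
  assumes dB: "dimb d B" and tB: "tp B = B"
    and up: "\<And>K. inner K (Sf * K) \<le> M * (norm K)\<^sup>2" and M0: "0 \<le> M"
    and s: "\<bar>s\<bar> * M * norm B \<le> 1/16"
  shows "(\<integral>\<^sup>+z. ennreal (exp (s * qf d (ent B) z)) \<partial>mvn d S)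
    \<le> ennreal (exp (s * inner B Sf + 4 * (s * M * norm B)\<^sup>2))"
proof -
  define X where "X = 2 *\<^sub>R (tp L * (s *\<^sub>R B) * L)"
  have nL: "norm (tp L * K) \<le> sqrt M * norm K" for K
  proof -
    have "(norm (tp L * K))\<^sup>2 = inner K (Sf * K)"
      by (simp add: power2_norm_eq_inner inner_mult_left L(2)[symmetric] mult.assoc)
    also have "\<dots> \<le> (sqrt M * norm K)\<^sup>2" using up[of K] M0 by (simp add: power_mult_distrib)
    finally show ?thesis using M0 by (simp add: power2_le_iff_abs_le)
  qed
  have nX: "norm X \<le> 2 * (\<bar>s\<bar> * M * norm B)"
  proof -
    have "norm (tp L * (B * L)) \<le> sqrt M * norm (B * L)" by (rule nL)
    also have "norm (B * L) = norm (tp L * B)" by (subst norm_tp[symmetric]) (simp add: tp_mult tB del: norm_tp)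
    also have "sqrt M * norm (tp L * B) \<le> sqrt M * (sqrt M * norm B)" using M0 by (intro mult_left_mono nL) auto
    also have "\<dots> = M * norm B" using M0 by simp
    finally have "2 * \<bar>s\<bar> * norm (tp L * (B * L)) \<le> 2 * \<bar>s\<bar> * (M * norm B)" by (intro mult_left_mono) auto
    then show ?thesis by (simp add: X_def mult.assoc)
  qed
  have dX: "dimb d X" unfolding X_def by (intro dimb_algebra dimb_times dimb_tp L(1) dB)
  have tX: "tp X = X" by (simp add: X_def tp_simps tB mult.assoc)
  have sX: "symf d (ent X)" unfolding symf_def using tX by (metis ent_tp)
  have FX: "(\<Sum>i<d. \<Sum>j<d. (ent X i j)\<^sup>2) = (norm X)\<^sup>2"
    by (simp add: power2_norm_eq_inner inner_fmat_dimb[OF dX]) (simp add: power2_eq_square)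
  have nX8: "norm X \<le> 1/8" using nX s by simp
  have nX64: "(norm X)\<^sup>2 \<le> 1/64" using power_mono[OF nX8, of 2] by (simp add: power2_eq_square)
  define Y where "Y = idm {..<d} - X"
  have dY: "dimb d Y" unfolding Y_def by (intro dimb_algebra dimb_idm dX)
  have trX: "(\<Sum>i<d. ent X i i) = 2 * s * inner B Sf"
  proof -
    have "(\<Sum>i<d. ent X i i) = inner (idm {..<d}) X"
    proof -
      have "inner (idm {..<d}) X = (\<Sum>i<d. \<Sum>j<d. if i = j then ent X i j else 0)"
        unfolding inner_fmat_dimb[OF dimb_idm] by (intro sum.cong) (auto simp: ent_idm)
      then show ?thesis by simp
    qed
    also have "\<dots> = 2 * s * inner (tp L * B * L) (idm {..<d})" by (simp add: X_def inner_commute)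
    also have "inner (tp L * B * L) (idm {..<d}) = inner B (L * idm {..<d} * tp L)"
      using inner_sandwich[of "tp L" B L "idm {..<d}"] by simp
    also have "L * idm {..<d} * tp L = Sf" using L dimb_idm_right by metis
    finally show ?thesis .
  qed
  have pd: "pdf d (ent Y)" unfolding pdf_def
  proof (intro allI impI)
    fix z :: "nat \<Rightarrow> real" assume z: "\<exists>i<d. z i \<noteq> 0"
    have n0: "0 < norm (cv d z)"
    proof -
      have "0 < (\<Sum>i<d. (z i)\<^sup>2)" using z by (auto intro!: sum_pos2)
      then show ?thesis unfolding norm_cv[symmetric] by simp
    qed
    have "idm {..<d} * cv d z = cv d z" by (rule fmat_eqI) (auto simp: ent_idm_times cv_def)
    then have "qf d (ent Y) z = (norm (cv d z))\<^sup>2 - inner (cv d z) (X * cv d z)"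
      by (simp add: qf_inner[OF dY]) (simp add: Y_def left_diff_distrib inner_diff_right power2_norm_eq_inner)
    also have "\<dots> \<ge> (norm (cv d z))\<^sup>2 - norm (cv d z) * ((1/8) * norm (cv d z))"
      using norm_cauchy_schwarz[of "cv d z" "X * cv d z"] norm_mult_fmat[of X "cv d z"] nX8
      by (smt (verit, best) mult_left_mono mult_right_mono norm_ge_zero)
    finally have "(7/8) * (norm (cv d z))\<^sup>2 \<le> qf d (ent Y) z" by (simp add: power2_eq_square)
    moreover have "0 < (7/8) * (norm (cv d z))\<^sup>2" using n0 by simp
    ultimately show "0 < qf d (ent Y) z" by linarith
  qed
  have qs: "qf d (ent (s *\<^sub>R B)) z = s * qf d (ent B) z" for z
    by (simp add: qf_def sum_distrib_left mult.assoc)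
  have piv_eq: "piv d (ent Y) = piv d (\<lambda>i j. (if i = j then 1 else 0) - ent X i j)"
    by (rule piv_cong) (simp add: Y_def ent_idm)
  have lo: "exp (- (2 * s * inner B Sf) - 2 * (norm X)\<^sup>2) \<le> piv d (ent Y)"
    using piv_one_minus_lower[OF sX] nX64 unfolding FX trX piv_eq by blast
  have "(\<integral>\<^sup>+z. ennreal (exp (s * qf d (ent B) z)) \<partial>mvn d S) = ennreal (1 / sqrt (piv d (ent Y)))"
    unfolding qs[symmetric] Y_def X_def
    by (rule mgf) (use dimb_algebra(2)[OF dB] pd[unfolded Y_def X_def] tB in \<open>simp_all only: tp_scaleR\<close>)
  also have "\<dots> \<le> ennreal (exp (s * inner B Sf + 4 * (s * M * norm B)\<^sup>2))"
  proof (rule ennreal_leI)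
    have "sqrt (exp (- (2 * s * inner B Sf) - 2 * (norm X)\<^sup>2)) \<le> sqrt (piv d (ent Y))"
      using lo by (rule real_sqrt_le_mono)
    moreover have "sqrt (exp (- (2 * s * inner B Sf) - 2 * (norm X)\<^sup>2)) = exp (- (s * inner B Sf) - (norm X)\<^sup>2)"
      by (rule real_sqrt_unique) (simp_all add: power2_eq_square exp_add[symmetric])
    ultimately have h: "exp (- (s * inner B Sf) - (norm X)\<^sup>2) \<le> sqrt (piv d (ent Y))" by simp
    then have "1 / sqrt (piv d (ent Y)) \<le> 1 / exp (- (s * inner B Sf) - (norm X)\<^sup>2)"
    proof -
      have "0 < sqrt (piv d (ent Y))" by (rule order_less_le_trans[OF exp_gt_zero h])
      then show ?thesis using h by (intro divide_left_mono mult_pos_pos) auto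
    qed
    also have "\<dots> = exp (s * inner B Sf + (norm X)\<^sup>2)"
      by (simp add: exp_minus[symmetric] inverse_eq_divide[symmetric])
    also have "\<dots> \<le> exp (s * inner B Sf + 4 * (s * M * norm B)\<^sup>2)"
    proof -
      have "(norm X)\<^sup>2 \<le> (2 * (\<bar>s\<bar> * M * norm B))\<^sup>2" using nX by (intro power_mono) auto
      also have "\<dots> = 4 * (s * M * norm B)\<^sup>2" by (simp add: power_mult_distrib)
      finally show ?thesis by simp
    qed
    finally show "1 / sqrt (piv d (ent Y)) \<le> exp (s * inner B Sf + 4 * (s * M * norm B)\<^sup>2)" .
  qed
  finally show ?thesis .
qed

end

section \<open>Tail bounds for linear functionals of the sample covariance\<close>

definition cov :: "nat \<Rightarrow> nat \<Rightarrow> (nat \<Rightarrow> nat \<Rightarrow> real) \<Rightarrow> fmat" where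
  "cov n d z = emb (sample_cov n d z)"

lemma cov_inner:
  assumes "dimb d B" shows "inner B (cov n d z) = (\<Sum>i<n. qf d (ent B) (z i)) / real n"
proof -
  have "inner B (cov n d z) = (\<Sum>j<d. \<Sum>k<d. (\<Sum>i<n. ent B j k * z i j * z i k) / real n)"
    unfolding inner_fmat_dimb[OF assms]
    by (intro sum.cong refl) (simp add: cov_def sample_cov_def ent_emb sum_distrib_left mult.assoc)
  also have "\<dots> = (\<Sum>j<d. \<Sum>k<d. \<Sum>i<n. ent B j k * z i j * z i k) / real n"
    by (simp add: sum_divide_distrib)
  also have "(\<Sum>j<d. \<Sum>k<d. \<Sum>i<n. ent B j k * z i j * z i k) = (\<Sum>i<n. qf d (ent B) (z i))"
    unfolding qf_def by (subst (2) sum.swap, subst sum.swap) simp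
  finally show ?thesis .
qed

context gauss
begin

lemma qf_measurable_mvn [measurable]: "qf d Q \<in> borel_measurable (mvn d S)"
  using qf_measurable by (simp add: mvn_def)

abbreviation "GS n \<equiv> gauss_sample n d S"

lemma prob_GS: "prob_space (GS n)"
  unfolding gauss_sample_def by (intro prob_space_PiM prob_mvn)

lemma cov_measurable: "dimb d B \<Longrightarrow> (\<lambda>z. inner B (cov n d z)) \<in> borel_measurable (GS n)"
proof -
  assume B: "dimb d B"
  have "(\<lambda>z. qf d Q (z i)) \<in> borel_measurable (Pi\<^sub>M {..<n} (\<lambda>_. mvn d S))" if "i < n" for i Q
    using measurable_compose[OF measurable_component_singleton[of i "{..<n}" "\<lambda>_. mvn d S"] qf_measurable_mvn] that
    by simp
  then show ?thesis unfolding cov_inner[OF B] gauss_sample_def by measurable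
qed

lemma chernoff:
  assumes g: "g \<in> borel_measurable (mvn d S)" and a: "(\<integral>\<^sup>+z. ennreal (exp (g z)) \<partial>mvn d S) \<le> ennreal (exp a)"
  shows "measure (GS n) {z \<in> space (GS n). c \<le> (\<Sum>i<n. g (z i))} \<le> exp (real n * a - c)"
proof -
  interpret P: prob_space "GS n" by (rule prob_GS)
  interpret product_sigma_finite "\<lambda>_::nat. mvn d S"
    by (rule product_sigma_finite.intro, rule prob_space_imp_sigma_finite, rule prob_mvn)
  have [measurable]: "(\<lambda>z. g (z i)) \<in> borel_measurable (Pi\<^sub>M {..<n} (\<lambda>_. mvn d S))" if "i < n" for i
    using measurable_compose[OF measurable_component_singleton[of i "{..<n}" "\<lambda>_. mvn d S"] g] that by simp
  have m: "(\<lambda>z. \<Sum>i<n. g (z i)) \<in> borel_measurable (GS n)"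
    unfolding gauss_sample_def by measurable
  have A: "{z \<in> space (GS n). c \<le> (\<Sum>i<n. g (z i))} \<in> sets (GS n)" (is "?A \<in> _") using m by measurable
  have "emeasure (GS n) ?A = (\<integral>\<^sup>+z. indicator ?A z \<partial>GS n)" using A by simp
  also have "\<dots> \<le> (\<integral>\<^sup>+z. ennreal (exp (- c)) * (\<Prod>i<n. ennreal (exp (g (z i)))) \<partial>GS n)"
  proof (rule nn_integral_mono)
    fix z
    have "ennreal (exp (- c)) * (\<Prod>i<n. ennreal (exp (g (z i)))) = ennreal (exp ((\<Sum>i<n. g (z i)) - c))"
      by (simp add: prod_ennreal exp_sum[symmetric] ennreal_mult[symmetric] exp_add[symmetric])
    then show "indicator ?A z \<le> ennreal (exp (- c)) * (\<Prod>i<n. ennreal (exp (g (z i))))"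
      by (auto simp: indicator_def)
  qed
  also have "\<dots> = ennreal (exp (- c)) * (\<integral>\<^sup>+z. (\<Prod>i<n. ennreal (exp (g (z i)))) \<partial>GS n)"
    unfolding gauss_sample_def by (rule nn_integral_cmult) measurable
  also have "(\<integral>\<^sup>+z. (\<Prod>i<n. ennreal (exp (g (z i)))) \<partial>GS n) = (\<Prod>i<n. \<integral>\<^sup>+z. ennreal (exp (g z)) \<partial>mvn d S)"
    unfolding gauss_sample_def using g by (intro product_nn_integral_prod) auto
  also have "\<dots> \<le> (\<Prod>i<n. ennreal (exp a))"
  proof -
    have "x ^ n \<le> y ^ n" if "x \<le> y" for x y :: ennreal
      using that by (induction n) (auto intro: mult_mono)
    then show ?thesis using a by simp
  qed
  also have "ennreal (exp (- c)) * (\<Prod>i<n. ennreal (exp a)) = ennreal (exp (real n * a - c))"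
    by (simp add: ennreal_power exp_of_nat_mult[symmetric] ennreal_mult[symmetric] exp_add[symmetric])
  finally have "emeasure (GS n) ?A \<le> ennreal (exp (real n * a - c))"
    by (simp add: mult_left_mono)
  then show ?thesis by (simp add: P.emeasure_eq_measure)
qed

lemma tail_upper:
  assumes dB: "dimb d B" and tB: "tp B = B" and nB: "norm B \<le> 1"
    and up: "\<And>K. inner K (Sf * K) \<le> M * (norm K)\<^sup>2" and M1: "1 \<le> M" and eta: "0 < eta" and n: "0 < n"
  shows "measure (GS n) {z \<in> space (GS n). eta \<le> inner B (cov n d z) - inner B Sf}
    \<le> exp (- (real n * min eta (eta\<^sup>2) / (32 * M\<^sup>2)))"
proof -
  \<comment> \<open>For small eta this minimises \<open>4 * (s * M)\<^sup>2 - s * eta\<close>; for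
    large eta it is the largest s that \<open>mgf_bound\<close> admits. The two regimes are the two
    arguments of the minimum.\<close>
  define s where "s = (if eta \<le> M / 2 then eta / (8 * M\<^sup>2) else 1 / (16 * M))"
  have s0: "0 < s" using eta M1 by (simp add: s_def)
  have sM: "s * M \<le> 1/16" using M1 by (auto simp: s_def power2_eq_square field_simps)
  have "s * M * norm B \<le> (1/16) * 1" using sM nB s0 M1 by (intro mult_mono) auto
  then have sB: "\<bar>s\<bar> * M * norm B \<le> 1/16" using s0 by simp
  have key: "4 * (s * M)\<^sup>2 - s * eta \<le> - (min eta (eta\<^sup>2) / (32 * M\<^sup>2))"
  proof (cases "eta \<le> M / 2")
    case True
    have "4 * (s * M)\<^sup>2 - s * eta = - (eta\<^sup>2 / (16 * M\<^sup>2))"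
      using M1 True by (simp add: s_def power2_eq_square field_simps)
    also have "\<dots> \<le> - (eta\<^sup>2 / (32 * M\<^sup>2))" using M1 by (simp add: divide_left_mono)
    also have "\<dots> \<le> - (min eta (eta\<^sup>2) / (32 * M\<^sup>2))" by (simp add: divide_right_mono)
    finally show ?thesis .
  next
    case False
    have "4 * (s * M)\<^sup>2 - s * eta = 1/64 - eta / (16 * M)"
      using M1 False by (simp add: s_def power2_eq_square field_simps)
    also have "\<dots> \<le> - (eta / (32 * M))" using M1 False by (simp add: field_simps)
    also have "\<dots> \<le> - (eta / (32 * M\<^sup>2))" using M1 eta by (simp add: power2_eq_square divide_left_mono)
    also have "\<dots> \<le> - (min eta (eta\<^sup>2) / (32 * M\<^sup>2))" by (simp add: divide_right_mono)
    finally show ?thesis .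
  qed
  have a: "(\<integral>\<^sup>+z. ennreal (exp (s * qf d (ent B) z)) \<partial>mvn d S) \<le> ennreal (exp (s * inner B Sf + 4 * (s * M)\<^sup>2))"
  proof -
    have "(s * M * norm B)\<^sup>2 \<le> (s * M * 1)\<^sup>2" using s0 M1 nB by (intro power_mono mult_left_mono) auto
    then show ?thesis
      using order_trans[OF mgf_bound[OF dB tB up _ sB]] M1 by (simp add: ennreal_leI)
  qed
  have "{z \<in> space (GS n). eta \<le> inner B (cov n d z) - inner B Sf}
    = {z \<in> space (GS n). s * real n * (inner B Sf + eta) \<le> (\<Sum>i<n. s * qf d (ent B) (z i))}"
  proof -
    have "eta \<le> inner B (cov n d z) - inner B Sf \<longleftrightarrow> s * real n * (inner B Sf + eta) \<le> (\<Sum>i<n. s * qf d (ent B) (z i))" for z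
    proof -
      have "(\<Sum>i<n. s * qf d (ent B) (z i)) = s * real n * inner B (cov n d z)"
        using n by (simp add: cov_inner[OF dB] sum_distrib_left[symmetric])
      moreover have "s * real n * (inner B Sf + eta) \<le> s * real n * inner B (cov n d z) \<longleftrightarrow> inner B Sf + eta \<le> inner B (cov n d z)"
        using s0 n by simp
      ultimately show ?thesis by auto
    qed
    then show ?thesis by simp
  qed
  also have "measure (GS n) \<dots> \<le> exp (real n * (s * inner B Sf + 4 * (s * M)\<^sup>2) - s * real n * (inner B Sf + eta))"
    by (rule chernoff[OF _ a]) measurable
  also have "\<dots> = exp (real n * (4 * (s * M)\<^sup>2 - s * eta))" by (simp add: algebra_simps)
  also have "\<dots> \<le> exp (real n * (- (min eta (eta\<^sup>2) / (32 * M\<^sup>2))))"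
    by (simp only: exp_le_cancel_iff) (rule mult_left_mono[OF key], simp)
  finally show ?thesis by simp
qed

lemma tail:
  assumes dB: "dimb d B" and nB: "norm B \<le> 1"
    and up: "\<And>K. inner K (Sf * K) \<le> M * (norm K)\<^sup>2" and M1: "1 \<le> M" and eta: "0 < eta" and n: "0 < n"
  shows "measure (GS n) {z \<in> space (GS n). eta \<le> \<bar>inner B (cov n d z - Sf)\<bar>}
    \<le> 2 * exp (- (real n * min eta (eta\<^sup>2) / (32 * M\<^sup>2)))"
proof -
  interpret P: prob_space "GS n" by (rule prob_GS)
  \<comment> \<open>The deviation of the covariance is symmetric, so it sees only the symmetric part
    of B, while \<open>mgf_bound\<close> requires a symmetric matrix.\<close>
  define C where "C = (1/2) *\<^sub>R (B + tp B)"
  have dC: "dimb d C" unfolding C_def by (intro dimb_algebra dB dimb_tp)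
  have tC: "tp C = C" by (simp add: C_def tp_simps add.commute)
  have nC: "norm C \<le> 1" using norm_triangle_ineq[of B "tp B"] nB by (simp add: C_def)
  have tcov: "tp (cov n d z) = cov n d z" for z
    by (rule fmat_eqI) (auto simp: cov_def sample_cov_def ent_emb mult.commute)
  have sym: "inner C A = inner B A" if "tp A = A" for A
    using inner_tp[of B A] that by (simp add: C_def inner_add_left)
  have eq: "inner B (cov n d z - Sf) = inner C (cov n d z) - inner C Sf" for z
    by (simp add: inner_diff_right sym tcov tS)
  have m1: "{z \<in> space (GS n). eta \<le> inner C' (cov n d z) - inner C' Sf} \<in> sets (GS n)" if "dimb d C'" for C'
    using cov_measurable[OF that, of n] by measurable
  have dC': "dimb d (- C)" "tp (- C) = - C" "norm (- C) \<le> 1" using dC tC nC by (auto simp: dimb_def tp_simps)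
  have "{z \<in> space (GS n). eta \<le> \<bar>inner B (cov n d z - Sf)\<bar>} \<subseteq>
     {z \<in> space (GS n). eta \<le> inner C (cov n d z) - inner C Sf} \<union>
     {z \<in> space (GS n). eta \<le> inner (- C) (cov n d z) - inner (- C) Sf}"
    unfolding eq by auto
  then have "measure (GS n) {z \<in> space (GS n). eta \<le> \<bar>inner B (cov n d z - Sf)\<bar>} \<le>
     measure (GS n) ({z \<in> space (GS n). eta \<le> inner C (cov n d z) - inner C Sf} \<union>
     {z \<in> space (GS n). eta \<le> inner (- C) (cov n d z) - inner (- C) Sf})"
    by (intro P.finite_measure_mono sets.Un m1 dC dC')
  also have "\<dots> \<le> measure (GS n) {z \<in> space (GS n). eta \<le> inner C (cov n d z) - inner C Sf} +
     measure (GS n) {z \<in> space (GS n). eta \<le> inner (- C) (cov n d z) - inner (- C) Sf}"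
    by (intro measure_Un_le m1 dC dC')
  also have "\<dots> \<le> exp (- (real n * min eta (eta\<^sup>2) / (32 * M\<^sup>2))) + exp (- (real n * min eta (eta\<^sup>2) / (32 * M\<^sup>2)))"
    by (intro add_mono tail_upper[OF dC tC nC up M1 eta n] tail_upper[OF dC' up M1 eta n])
  finally show ?thesis by simp
qed

text \<open>The bound is (e tau / g)^(n/2). It can be made as small as desired by lowering tau, and
  so allows any confidence level, unlike a deviation bound with fixed relative error.\<close>

lemma small_ball:
  assumes g: "g \<le> inner (cv d v) (Sf * cv d v)" and g0: "0 < g" and tau: "0 < tau" and n: "0 < n"
  shows "measure (GS n) {z \<in> space (GS n). inner (cv d v) (cov n d z * cv d v) \<le> tau}
    \<le> exp (- (real n / 2) * (ln (g / tau) - 1))"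
proof -
  \<comment> \<open>With this t the Markov factor exp (t n tau) is exp (n / 2), while the transform
    contributes at most (tau / g)^(n/2).\<close>
  define t where "t = 1 / (2 * tau)"
  have t0: "0 < t" using tau by (simp add: t_def)
  have qv: "inner (cv d v) (cov n d z * cv d v) = (\<Sum>i<n. (\<Sum>j<d. v j * z i j)\<^sup>2) / real n" for z
  proof -
    have dc: "dimb d (cov n d z)" unfolding cov_def by (rule dimb_emb) (simp add: sample_cov_def)
    have "inner (cv d v) (cov n d z * cv d v) = (\<Sum>j<d. \<Sum>k<d. (\<Sum>i<n. z i j * z i k) / real n * v j * v k)"
      by (simp add: qf_inner[OF dc, symmetric] qf_def) (simp add: cov_def sample_cov_def ent_emb)
    also have "\<dots> = (\<Sum>j<d. \<Sum>k<d. \<Sum>i<n. (v j * z i j) * (v k * z i k)) / real n"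
      by (simp add: sum_divide_distrib sum_distrib_left sum_distrib_right mult_ac)
    also have "(\<Sum>j<d. \<Sum>k<d. \<Sum>i<n. (v j * z i j) * (v k * z i k)) = (\<Sum>i<n. \<Sum>j<d. \<Sum>k<d. (v j * z i j) * (v k * z i k))"
      by (subst (2) sum.swap, subst sum.swap) simp
    also have "\<dots> = (\<Sum>i<n. (\<Sum>j<d. v j * z i j)\<^sup>2)" by (simp add: power2_eq_square sum_product)
    finally show ?thesis .
  qed
  have a: "(\<integral>\<^sup>+z. ennreal (exp (- t * (\<Sum>i<d. v i * z i)\<^sup>2)) \<partial>mvn d S) \<le> ennreal (exp (- ln (g / tau) / 2))"
  proof -
    have "g / tau \<le> 1 + 2 * t * inner (cv d v) (Sf * cv d v)"
      using g tau by (simp add: t_def field_simps)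
    then have "sqrt (g / tau) \<le> sqrt (1 + 2 * t * inner (cv d v) (Sf * cv d v))" by simp
    moreover have "0 < sqrt (g / tau)" using g0 tau by simp
    ultimately have "1 / sqrt (1 + 2 * t * inner (cv d v) (Sf * cv d v)) \<le> 1 / sqrt (g / tau)"
      by (intro divide_left_mono mult_pos_pos) auto
    also have "\<dots> = exp (- ln (g / tau) / 2)"
    proof -
      have "sqrt (g / tau) = exp (ln (g / tau) / 2)"
        using g0 tau by (intro real_sqrt_unique) (simp_all add: power2_eq_square exp_add[symmetric])
      then show ?thesis by (simp add: exp_minus inverse_eq_divide)
    qed
    finally show ?thesis using t0 by (subst mgf_rank_one) (auto intro: ennreal_leI)
  qed
  have m: "(\<lambda>z. - t * (\<Sum>i<d. v i * z i)\<^sup>2) \<in> borel_measurable (mvn d S)"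
  proof -
    have "(\<lambda>z. - t * (\<Sum>i<d. v i * z i)\<^sup>2) = (\<lambda>z. - t * qf d (\<lambda>i j. v i * v j) z)"
      by (simp add: qf_def power2_eq_square sum_product mult_ac)
    then show ?thesis by simp
  qed
  have "{z \<in> space (GS n). inner (cv d v) (cov n d z * cv d v) \<le> tau}
    = {z \<in> space (GS n). - t * real n * tau \<le> (\<Sum>i<n. - t * (\<Sum>j<d. v j * z i j)\<^sup>2)}"
    using t0 n by (simp add: qv sum_distrib_left[symmetric] sum_negf field_simps)
  also have "measure (GS n) \<dots> \<le> exp (real n * (- ln (g / tau) / 2) - (- t * real n * tau))"
    by (rule chernoff[OF m a])
  also have "real n * (- ln (g / tau) / 2) - (- t * real n * tau) = - (real n / 2) * (ln (g / tau) - 1)"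
    using tau by (simp add: t_def field_simps)
  finally show ?thesis .
qed

end

section \<open>Nets and union bounds\<close>

text \<open>Comparison with the integral of the exponential. The subtracted term makes the induction
  telescope and leaves a bound uniform in K.\<close>

lemma sum_exp_abs_int:
  fixes \<delta> :: real assumes "0 < \<delta>"
  shows "(\<Sum>z\<in>{- int K..int K}. exp (- \<delta> * real_of_int \<bar>z\<bar>)) \<le> 1 + 2 * (1 - exp (- \<delta> * real K)) / \<delta>"
proof (induction K)
  case (Suc K)
  let ?h = "\<lambda>z. exp (- \<delta> * real_of_int \<bar>z\<bar>)"
  have set: "{- int (Suc K)..int (Suc K)} = insert (- int (Suc K)) (insert (int (Suc K)) {- int K..int K})" by auto
  have "sum ?h {- int (Suc K)..int (Suc K)} = 2 * exp (- \<delta> * real (Suc K)) + sum ?h {- int K..int K}"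
    unfolding set by simp
  moreover have "\<delta> * exp (- \<delta> * real (Suc K)) \<le> exp (- \<delta> * real K) - exp (- \<delta> * real (Suc K))"
  proof -
    have "exp (- \<delta> * real K) = exp \<delta> * exp (- \<delta> * real (Suc K))" by (simp add: exp_add[symmetric] algebra_simps)
    moreover have "(1 + \<delta>) * exp (- \<delta> * real (Suc K)) \<le> exp \<delta> * exp (- \<delta> * real (Suc K))"
      by (intro mult_right_mono exp_ge_add_one_self) auto
    ultimately show ?thesis by (simp add: distrib_right)
  qed
  then have "2 * exp (- \<delta> * real (Suc K)) \<le> 2 * (exp (- \<delta> * real K) - exp (- \<delta> * real (Suc K))) / \<delta>"
    using assms by (simp add: field_simps)
  ultimately show ?case using Suc.IH by (simp add: diff_divide_distrib)
qed simp

text \<open>A Chernoff argument for counting: each admissible point has weight exp (|I| - \<delta>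
  times its l1 norm) at least 1, and the total weight factorises over the coordinates. The box only
  makes the set finite; the bound does not depend on K.\<close>

lemma lattice_count:
  fixes I :: "'a set" and \<delta> :: real and K :: nat
  assumes I: "finite I" and \<delta>: "0 < \<delta>"
  defines "X \<equiv> {x \<in> PiE I (\<lambda>_. {- int K..int K}). (\<Sum>i\<in>I. real_of_int \<bar>x i\<bar>) \<le> real (card I) / \<delta>}"
  shows "finite X" "real (card X) \<le> (exp 1 * (1 + 2 / \<delta>)) ^ card I"
proof -
  let ?P = "PiE I (\<lambda>_. {- int K..int K})"
  have fP: "finite ?P" using I by (intro finite_PiE) auto
  then show fX: "finite X" by (simp add: X_def)
  have "real (card X) = (\<Sum>x\<in>X. 1)" by simp
  also have "\<dots> \<le> (\<Sum>x\<in>X. exp (real (card I)) * (\<Prod>i\<in>I. exp (- \<delta> * real_of_int \<bar>x i\<bar>)))"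
  proof (rule sum_mono)
    fix x assume "x \<in> X"
    then have "\<delta> * (\<Sum>i\<in>I. real_of_int \<bar>x i\<bar>) \<le> real (card I)" using \<delta> by (simp add: X_def field_simps)
    moreover have "exp (real (card I)) * (\<Prod>i\<in>I. exp (- \<delta> * real_of_int \<bar>x i\<bar>))
      = exp (real (card I) - \<delta> * (\<Sum>i\<in>I. real_of_int \<bar>x i\<bar>))"
      using I by (simp add: exp_sum[symmetric] exp_add[symmetric] sum_negf sum_distrib_left)
    ultimately show "1 \<le> exp (real (card I)) * (\<Prod>i\<in>I. exp (- \<delta> * real_of_int \<bar>x i\<bar>))" by simp
  qed
  also have "\<dots> \<le> (\<Sum>x\<in>?P. exp (real (card I)) * (\<Prod>i\<in>I. exp (- \<delta> * real_of_int \<bar>x i\<bar>)))"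
    using fP by (intro sum_mono2) (auto simp: X_def intro!: mult_nonneg_nonneg prod_nonneg)
  also have "\<dots> = exp (real (card I)) * (\<Prod>i\<in>I. \<Sum>z\<in>{- int K..int K}. exp (- \<delta> * real_of_int \<bar>z\<bar>))"
    using I by (subst prod_sum_PiE) (auto simp: sum_distrib_left)
  also have "\<dots> \<le> exp (real (card I)) * (\<Prod>i\<in>I. 1 + 2 / \<delta>)"
  proof (intro mult_left_mono prod_mono conjI sum_nonneg)
    have "2 * (1 - exp (- \<delta> * real K)) / \<delta> \<le> 2 / \<delta>" using \<delta> by (intro divide_right_mono) auto
    then show "(\<Sum>z\<in>{- int K..int K}. exp (- \<delta> * real_of_int \<bar>z\<bar>)) \<le> 1 + 2 / \<delta>"
      using sum_exp_abs_int[OF \<delta>, of K] by linarith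
  qed auto
  also have "\<dots> = (exp 1 * (1 + 2 / \<delta>)) ^ card I"
    by (simp add: power_mult_distrib exp_of_nat_mult[symmetric])
  finally show "real (card X) \<le> (exp 1 * (1 + 2 / \<delta>)) ^ card I" .
qed

text \<open>
  The net consists of rounded lattice points; rounding is towards zero, so that it does not
  leave the unit ball.
\<close>

lemma euclidean_net:
  fixes I :: "'a set" and \<delta> :: real
  assumes I: "finite I" and \<delta>: "0 < \<delta>"
  obtains Y :: "('a \<Rightarrow> real) set" where "finite Y" "real (card Y) \<le> (exp 1 * (1 + 2 / \<delta>)) ^ card I"
    "\<And>y. y \<in> Y \<Longrightarrow> (\<Sum>i\<in>I. (y i)\<^sup>2) \<le> 1"
    "\<And>v. (\<Sum>i\<in>I. (v i)\<^sup>2) \<le> 1 \<Longrightarrow> \<exists>y\<in>Y. (\<Sum>i\<in>I. (v i - y i)\<^sup>2) \<le> \<delta>\<^sup>2"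
proof (cases "I = {}")
  case True
  show thesis by (rule that[of "{\<lambda>_. 0}"]) (use True in auto)
next
  case False
  define k where "k = real (card I)"
  have k: "0 < k" using I False by (simp add: k_def card_gt_0_iff)
  \<comment> \<open>Mesh for which rounding all k coordinates by at most h moves the point by at
    most \<delta>.\<close>
  define h where "h = \<delta> / sqrt k"
  have h: "0 < h" using \<delta> k by (simp add: h_def)
  define K where "K = nat \<lceil>k / \<delta>\<rceil>"
  define X where "X = {x \<in> PiE I (\<lambda>_. {- int K..int K}). (\<Sum>i\<in>I. real_of_int \<bar>x i\<bar>) \<le> real (card I) / \<delta>}"
  define f where "f = (\<lambda>(x :: 'a \<Rightarrow> int) i. h * real_of_int (x i))"
  define Y where "Y = {y \<in> f ` X. (\<Sum>i\<in>I. (y i)\<^sup>2) \<le> 1}"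
  have fX: "finite X" and cX: "real (card X) \<le> (exp 1 * (1 + 2 / \<delta>)) ^ card I"
    using lattice_count[OF I \<delta>, of K] by (auto simp: X_def)
  show thesis
  proof (rule that[of Y])
    show "finite Y" using fX by (simp add: Y_def)
    have "card Y \<le> card (f ` X)" using fX by (intro card_mono) (auto simp: Y_def)
    also have "\<dots> \<le> card X" by (rule card_image_le[OF fX])
    finally show "real (card Y) \<le> (exp 1 * (1 + 2 / \<delta>)) ^ card I" using cX by linarith
    show "(\<Sum>i\<in>I. (y i)\<^sup>2) \<le> 1" if "y \<in> Y" for y using that by (simp add: Y_def)
    fix v :: "'a \<Rightarrow> real" assume v: "(\<Sum>i\<in>I. (v i)\<^sup>2) \<le> 1"
    define a where "a = (\<lambda>i. \<lfloor>\<bar>v i\<bar> / h\<rfloor>)"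
    define x where "x = restrict (\<lambda>i. if 0 \<le> v i then a i else - a i) I"
    have a0: "0 \<le> a i" for i using h by (simp add: a_def)
    have ha: "h * real_of_int (a i) \<le> \<bar>v i\<bar>" for i
    proof -
      have "real_of_int (a i) \<le> \<bar>v i\<bar> / h" unfolding a_def by (rule of_int_floor_le)
      then show ?thesis using h by (simp add: field_simps)
    qed
    have ha2: "\<bar>v i\<bar> \<le> h * real_of_int (a i) + h" for i
    proof -
      have "\<bar>v i\<bar> / h \<le> real_of_int (a i) + 1" unfolding a_def by linarith
      then show ?thesis using h by (simp add: field_simps)
    qed
    have ax: "\<bar>x i\<bar> = a i" if "i \<in> I" for i using a0[of i] that by (simp add: x_def)
    \<comment> \<open>The l1 norm is at most the square root of k by Cauchy-Schwarz; divided by the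
      mesh h it becomes k / \<delta>, the bound in the definition of X.\<close>
    have "(\<Sum>i\<in>I. \<bar>v i\<bar>) \<le> sqrt k"
    proof -
      have "(\<Sum>i\<in>I. \<bar>v i\<bar> * 1)\<^sup>2 \<le> (\<Sum>i\<in>I. \<bar>v i\<bar>\<^sup>2) * (\<Sum>i\<in>I. 1\<^sup>2)" by (rule Cauchy_Schwarz_ineq_sum)
      also have "\<dots> \<le> 1 * k" using v by (intro mult_mono) (auto simp: k_def)
      finally show ?thesis by (intro real_le_rsqrt) simp
    qed
    then have "(\<Sum>i\<in>I. h * real_of_int (a i)) \<le> sqrt k" using sum_mono[of I "\<lambda>i. h * real_of_int (a i)" "\<lambda>i. \<bar>v i\<bar>"] ha by force
    then have "(\<Sum>i\<in>I. real_of_int (a i)) \<le> sqrt k / h" using h by (simp add: sum_distrib_left[symmetric] field_simps)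
    also have "sqrt k / h = k / \<delta>" using k \<delta> by (simp add: h_def)
    finally have sa: "(\<Sum>i\<in>I. real_of_int (a i)) \<le> k / \<delta>" .
    have aK: "a i \<le> int K" if "i \<in> I" for i
    proof -
      have "real_of_int (a i) \<le> (\<Sum>i\<in>I. real_of_int (a i))" using I that a0 by (intro member_le_sum) auto
      also have "\<dots> \<le> k / \<delta>" by (rule sa)
      also have "k / \<delta> \<le> real_of_int \<lceil>k / \<delta>\<rceil>" by simp
      finally have "a i \<le> \<lceil>k / \<delta>\<rceil>" by simp
      moreover have "0 \<le> \<lceil>k / \<delta>\<rceil>" using divide_pos_pos[OF k \<delta>] by linarith
      ultimately show ?thesis by (simp add: K_def)
    qed
    have "x \<in> PiE I (\<lambda>_. {- int K..int K})"
    proof (rule PiE_I)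
      fix i assume "i \<in> I" then show "x i \<in> {- int K..int K}" using aK[of i] ax[of i] by auto
    qed (simp add: x_def)
    moreover have "(\<Sum>i\<in>I. real_of_int \<bar>x i\<bar>) = (\<Sum>i\<in>I. real_of_int (a i))" by (intro sum.cong) (simp_all add: ax)
    ultimately have xX: "x \<in> X" using sa by (simp add: X_def k_def)
    have fx: "\<bar>f x i\<bar> \<le> \<bar>v i\<bar> \<and> \<bar>v i - f x i\<bar> \<le> h" if "i \<in> I" for i
    proof -
      have "f x i = (if 0 \<le> v i then h * real_of_int (a i) else - (h * real_of_int (a i)))"
        using that by (simp add: f_def x_def)
      moreover have "0 \<le> h * real_of_int (a i)" using h a0[of i] by simp
      ultimately show ?thesis using ha[of i] ha2[of i] by (auto split: if_splits)
    qed
    have "(\<Sum>i\<in>I. (f x i)\<^sup>2) \<le> (\<Sum>i\<in>I. (v i)\<^sup>2)" using fx by (intro sum_mono) (simp add: abs_le_square_iff)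
    then have fY: "f x \<in> Y" using xX v by (simp add: Y_def)
    have "(\<Sum>i\<in>I. (v i - f x i)\<^sup>2) \<le> (\<Sum>i\<in>I. h\<^sup>2)"
      using fx h by (intro sum_mono) (simp add: abs_le_square_iff[symmetric])
    also have "\<dots> = \<delta>\<^sup>2" using k by (simp add: h_def power_divide k_def)
    finally show "\<exists>y\<in>Y. (\<Sum>i\<in>I. (v i - y i)\<^sup>2) \<le> \<delta>\<^sup>2" using fY by blast
  qed
qed

section \<open>Nets of matrices with prescribed support\<close>

definition suppd :: "(nat \<times> nat) set \<Rightarrow> fmat \<Rightarrow> bool" where
  "suppd P A \<longleftrightarrow> (\<forall>i j. (i, j) \<notin> P \<longrightarrow> ent A i j = 0)"

lift_definition mkp :: "(nat \<times> nat) set \<Rightarrow> (nat \<times> nat \<Rightarrow> real) \<Rightarrow> fmat" is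
  "\<lambda>P f i j. if finite P \<and> (i, j) \<in> P then f (i, j) else 0"
proof -
  fix P :: "(nat \<times> nat) set" and f :: "nat \<times> nat \<Rightarrow> real"
  show "\<exists>N. \<forall>i j. N \<le> i \<or> N \<le> j \<longrightarrow> (if finite P \<and> (i, j) \<in> P then f (i, j) else 0) = 0"
  proof (cases "finite P")
    case True
    then have "finite (fst ` P \<union> snd ` P)" by simp
    then obtain N where N: "\<forall>x\<in>fst ` P \<union> snd ` P. x < N" using finite_nat_set_iff_bounded by blast
    have "(i, j) \<notin> P" if "N \<le> i \<or> N \<le> j" for i j
      using N that by (metis UnI1 UnI2 fst_conv image_eqI not_le snd_conv)
    then show ?thesis by (intro exI[of _ N]) simp
  qed simp
qed

lemma ent_mkp: "finite P \<Longrightarrow> ent (mkp P f) i j = (if (i, j) \<in> P then f (i, j) else 0)"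
  by (simp add: mkp.rep_eq)

lemma norm_suppd:
  assumes "finite P" "suppd P A" shows "(norm A)\<^sup>2 = (\<Sum>x\<in>P. (ent A (fst x) (snd x))\<^sup>2)"
proof -
  have "(norm A)\<^sup>2 = (\<Sum>x | ent A (fst x) (snd x) \<noteq> 0. (ent A (fst x) (snd x))\<^sup>2)"
    unfolding power2_norm_eq_inner inner_fmat_def by (simp add: power2_eq_square)
  also have "\<dots> = (\<Sum>x\<in>P. (ent A (fst x) (snd x))\<^sup>2)"
  proof (rule sum.mono_neutral_left[OF assms(1)])
    show "{x. ent A (fst x) (snd x) \<noteq> 0} \<subseteq> P"
      using assms(2) unfolding suppd_def by (metis (mono_tags, lifting) mem_Collect_eq prod.collapse subsetI)
  qed auto
  finally show ?thesis .
qed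

lemma net_exists:
  assumes P: "finite P" and \<delta>: "0 < \<delta>"
  shows "\<exists>Y. finite Y \<and> real (card Y) \<le> (exp 1 * (1 + 2 / \<delta>)) ^ card P \<and>
    (\<forall>y\<in>Y. suppd P y \<and> norm y \<le> 1) \<and> (\<forall>v. suppd P v \<and> norm v \<le> 1 \<longrightarrow> (\<exists>y\<in>Y. norm (v - y) \<le> \<delta>))"
proof -
  obtain Y0 :: "(nat \<times> nat \<Rightarrow> real) set" where Y0: "finite Y0" "real (card Y0) \<le> (exp 1 * (1 + 2 / \<delta>)) ^ card P"
    "\<And>y. y \<in> Y0 \<Longrightarrow> (\<Sum>i\<in>P. (y i)\<^sup>2) \<le> 1"
    "\<And>v. (\<Sum>i\<in>P. (v i)\<^sup>2) \<le> 1 \<Longrightarrow> \<exists>y\<in>Y0. (\<Sum>i\<in>P. (v i - y i)\<^sup>2) \<le> \<delta>\<^sup>2"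
    by (rule euclidean_net[OF P \<delta>]) (rule that)
  have s: "suppd P (mkp P f)" for f by (simp add: suppd_def ent_mkp P)
  show ?thesis
  proof (intro exI[of _ "mkp P ` Y0"] conjI ballI allI impI)
    show "finite (mkp P ` Y0)" using Y0 by simp
    show "real (card (mkp P ` Y0)) \<le> (exp 1 * (1 + 2 / \<delta>)) ^ card P"
      using card_image_le[OF Y0(1), of "mkp P"] Y0(2) by linarith
    fix y assume "y \<in> mkp P ` Y0"
    then obtain f where f: "f \<in> Y0" "y = mkp P f" by blast
    show "suppd P y" using s f by simp
    have "(norm y)\<^sup>2 = (\<Sum>i\<in>P. (f i)\<^sup>2)" using norm_suppd[OF P s, of f] f(2) P by (simp add: ent_mkp)
    then have "(norm y)\<^sup>2 \<le> 1\<^sup>2" using Y0(3)[OF f(1)] by simp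
    then show "norm y \<le> 1" by (rule power2_le_imp_le) simp
  next
    fix v assume v: "suppd P v \<and> norm v \<le> 1"
    have "(norm v)\<^sup>2 \<le> 1\<^sup>2" using v by (intro power_mono) auto
    then have "(\<Sum>x\<in>P. (ent v (fst x) (snd x))\<^sup>2) \<le> 1" using norm_suppd[OF P] v by simp
    then obtain f where f: "f \<in> Y0" "(\<Sum>x\<in>P. (ent v (fst x) (snd x) - f x)\<^sup>2) \<le> \<delta>\<^sup>2"
      using Y0(4)[of "\<lambda>x. ent v (fst x) (snd x)"] by blast
    have "suppd P (v - mkp P f)" using v s[of f] by (simp add: suppd_def)
    then have "(norm (v - mkp P f))\<^sup>2 = (\<Sum>x\<in>P. (ent v (fst x) (snd x) - f x)\<^sup>2)"
      using norm_suppd[OF P] P by (simp add: ent_mkp)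
    then have "(norm (v - mkp P f))\<^sup>2 \<le> \<delta>\<^sup>2" using f(2) by simp
    then have "norm (v - mkp P f) \<le> \<delta>" by (rule power2_le_imp_le) (use \<delta> in simp)
    then show "\<exists>y\<in>mkp P ` Y0. norm (v - y) \<le> \<delta>" using f(1) by blast
  qed
qed

text \<open>One net is fixed for each support, so that the union bounds and the deterministic
  arguments refer to the same points, chosen independently of the sample.\<close>

definition net :: "real \<Rightarrow> (nat \<times> nat) set \<Rightarrow> fmat set" where
  "net \<delta> P = (SOME Y. finite Y \<and> real (card Y) \<le> (exp 1 * (1 + 2 / \<delta>)) ^ card P \<and>
    (\<forall>y\<in>Y. suppd P y \<and> norm y \<le> 1) \<and> (\<forall>v. suppd P v \<and> norm v \<le> 1 \<longrightarrow> (\<exists>y\<in>Y. norm (v - y) \<le> \<delta>)))"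

lemma net:
  assumes "finite P" "0 < \<delta>"
  shows "finite (net \<delta> P)" "real (card (net \<delta> P)) \<le> (exp 1 * (1 + 2 / \<delta>)) ^ card P"
    "\<And>y. y \<in> net \<delta> P \<Longrightarrow> suppd P y" "\<And>y. y \<in> net \<delta> P \<Longrightarrow> norm y \<le> 1"
    "\<And>v. suppd P v \<Longrightarrow> norm v \<le> 1 \<Longrightarrow> \<exists>y\<in>net \<delta> P. norm (v - y) \<le> \<delta>"
proof -
  note * = someI_ex[OF net_exists[OF assms], folded net_def]
  show "finite (net \<delta> P)" "real (card (net \<delta> P)) \<le> (exp 1 * (1 + 2 / \<delta>)) ^ card P" using * by auto
  show "suppd P y" "norm y \<le> 1" if "y \<in> net \<delta> P" for y using * that by auto
  show "\<exists>y\<in>net \<delta> P. norm (v - y) \<le> \<delta>" if "suppd P v" "norm v \<le> 1" for v using * that by auto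
qed

lemma norm_le_net:
  assumes P: "finite P" and x: "suppd P x" and b: "\<And>y. y \<in> net (1/2) P \<Longrightarrow> \<bar>inner x y\<bar> \<le> b"
  shows "norm x \<le> 2 * b"
proof (cases "x = 0")
  case True
  have "suppd P (0 :: fmat)" by (simp add: suppd_def)
  then obtain y where "y \<in> net (1/2) P" using net(5)[OF P, of "1/2" 0] by auto
  then show ?thesis using b[of y] True by simp
next
  case False
  define v where "v = (1 / norm x) *\<^sub>R x"
  have nv: "norm v = 1" using False by (simp add: v_def)
  have "suppd P v" using x by (simp add: suppd_def v_def)
  then obtain y where y: "y \<in> net (1/2) P" "norm (v - y) \<le> 1/2" using net(5)[OF P, of "1/2" v] nv by auto
  have "norm x = inner x v" using False by (simp add: v_def power2_norm_eq_inner[symmetric] power2_eq_square)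
  also have "\<dots> = inner x y + inner x (v - y)" by (simp add: inner_diff_right)
  also have "\<dots> \<le> b + norm x * (1/2)"
    using b[OF y(1)] norm_cauchy_schwarz[of x "v - y"] mult_left_mono[OF y(2) norm_ge_zero[of x]] by linarith
  finally show ?thesis by simp
qed

text \<open>Squared Frobenius norms add over columns. Hence bounds proved for single columns, the
  vectors covered by the nets on \<open>T \<times> {0}\<close>, extend to all matrices.\<close>

lemma norm_mult_columns:
  assumes N: "dimb N A" "dimb N K"
  shows "(norm (A * K))\<^sup>2 = (\<Sum>j<N. (norm (A * cv N (\<lambda>i. ent K i j)))\<^sup>2)"
    and "(norm K)\<^sup>2 = (\<Sum>j<N. (norm (cv N (\<lambda>i. ent K i j)))\<^sup>2)"
proof -
  have col: "(norm B)\<^sup>2 = (\<Sum>j<N. (norm (cv N (\<lambda>i. ent B i j)))\<^sup>2)" if "dimb N B" for B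
  proof -
    have "(norm B)\<^sup>2 = (\<Sum>i<N. \<Sum>j<N. (ent B i j)\<^sup>2)"
      unfolding power2_norm_eq_inner inner_fmat_dimb[OF that] by (simp add: power2_eq_square)
    also have "\<dots> = (\<Sum>j<N. \<Sum>i<N. (ent B i j)\<^sup>2)" by (rule sum.swap)
    finally show ?thesis by (simp only: norm_cv)
  qed
  have mul: "A * cv N (\<lambda>i. ent K i j) = cv N (\<lambda>i. ent (A * K) i j)" for j
  proof (rule fmat_eqI)
    fix i k
    have "N \<le> i \<Longrightarrow> ent A i l = 0" for l using N(1) by (simp add: dimb_def)
    then show "ent (A * cv N (\<lambda>i. ent K i j)) i k = ent (cv N (\<lambda>i. ent (A * K) i j)) i k"
      by (auto simp: ent_times[OF N(1)] cv_def not_less)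
  qed
  show "(norm (A * K))\<^sup>2 = (\<Sum>j<N. (norm (A * cv N (\<lambda>i. ent K i j)))\<^sup>2)"
    by (subst col[OF dimb_times[OF N]]) (simp add: mul)
  show "(norm K)\<^sup>2 = (\<Sum>j<N. (norm (cv N (\<lambda>i. ent K i j)))\<^sup>2)" by (rule col[OF N(2)])
qed

lemma opb_columns:
  assumes c: "0 \<le> c" and A: "\<And>d z. norm (A * cv d z) \<le> c * norm (cv d z)"
  shows "opb c A"
  unfolding opb_def
proof
  fix K
  obtain N where N: "dimb N A" "dimb N K" by (rule dimb_obtain2)
  have "(norm (A * K))\<^sup>2 \<le> (\<Sum>j<N. (c * norm (cv N (\<lambda>i. ent K i j)))\<^sup>2)"
    unfolding norm_mult_columns(1)[OF N] by (intro sum_mono power_mono A) auto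
  also have "\<dots> = (c * norm K)\<^sup>2"
    by (simp add: power_mult_distrib sum_distrib_left[symmetric] norm_mult_columns(2)[OF N])
  finally show "norm (A * K) \<le> c * norm K" by (rule power2_le_imp_le) (use c in simp)
qed

lemma suppd_idm_cv: "finite T \<Longrightarrow> suppd (T \<times> {0}) (idm T * cv d z)"
  by (auto simp: suppd_def ent_idm_times cv_def)

text \<open>The net is used once on each side of E, with a loss of a factor 2 each time
  (\<open>norm_le_net\<close>).\<close>

lemma opb_net:
  assumes T: "finite T"
    and b: "\<And>y y'. y \<in> net (1/2) (T \<times> {0}) \<Longrightarrow> y' \<in> net (1/2) (T \<times> {0}) \<Longrightarrow> \<bar>inner y (E * y')\<bar> \<le> b"
  shows "opb (4 * b) (idm T * E * idm T)"
proof -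
  let ?P = "T \<times> {0::nat}"
  have P: "finite ?P" using T by simp
  have proj: "idm T * y = y" if "suppd ?P y" for y
    using that T by (intro fmat_eqI) (auto simp: ent_idm_times suppd_def)
  have sEy: "suppd ?P (idm T * E * y)" if "suppd ?P y" for y
    unfolding suppd_def
  proof (intro allI impI)
    fix i j assume ij: "(i, j) \<notin> ?P"
    obtain N where N: "dimb N E" by (rule dimb_obtain1)
    have "j \<noteq> 0 \<Longrightarrow> ent y l j = 0" for l using that by (simp add: suppd_def)
    then show "ent (idm T * E * y) i j = 0"
      using ij T by (auto simp: mult.assoc ent_idm_times ent_times[OF N])
  qed
  have "suppd ?P (0 :: fmat)" by (simp add: suppd_def)
  then obtain y0 where "y0 \<in> net (1/2) ?P" using net(5)[OF P, of "1/2" 0] by auto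
  then have b0: "0 \<le> b" using b[of y0 y0] abs_ge_zero order_trans by blast
  have n1: "norm (idm T * tp E * y) \<le> 2 * b" if y: "y \<in> net (1/2) ?P" for y
  proof (rule norm_le_net[OF P])
    have sy: "suppd ?P y" using net(3)[OF P, of "1/2"] y by simp
    obtain N where N: "dimb N E" by (rule dimb_obtain1)
    show "suppd ?P (idm T * tp E * y)"
      unfolding suppd_def
    proof (intro allI impI)
      fix i j assume ij: "(i, j) \<notin> ?P"
      have "j \<noteq> 0 \<Longrightarrow> ent y l j = 0" for l using sy by (simp add: suppd_def)
      then show "ent (idm T * tp E * y) i j = 0"
        using ij T by (auto simp: mult.assoc ent_idm_times ent_times[OF dimb_tp[OF N]])
    qed
    fix y' assume y': "y' \<in> net (1/2) ?P"
    have "inner (idm T * tp E * y) y' = inner y (E * (idm T * y'))"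
      by (simp add: inner_mult_left tp_simps mult.assoc)
    also have "idm T * y' = y'" by (rule proj) (use net(3)[OF P, of "1/2"] y' in simp)
    finally show "\<bar>inner (idm T * tp E * y) y'\<bar> \<le> b" using b[OF y y'] by simp
  qed
  have n2: "norm (idm T * E * v) \<le> 4 * b * norm v" if v: "suppd ?P v" for v
  proof -
    have "norm (idm T * E * v) \<le> 2 * (2 * b * norm v)"
    proof (rule norm_le_net[OF P sEy[OF v]])
      fix y assume y: "y \<in> net (1/2) ?P"
      have sy: "idm T * y = y" by (rule proj) (use net(3)[OF P, of "1/2"] y in simp)
      have "inner (idm T * E * v) y = inner (idm T * v) (tp E * (idm T * y))"
        using proj[OF v] by (simp add: inner_mult_left tp_simps mult.assoc)
      also have "\<dots> = inner v (idm T * tp E * y)" by (simp add: inner_mult_left sy mult.assoc)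
      finally have "\<bar>inner (idm T * E * v) y\<bar> \<le> norm v * norm (idm T * tp E * y)" by (simp add: Cauchy_Schwarz_ineq2)
      also have "\<dots> \<le> norm v * (2 * b)" by (intro mult_left_mono n1 y) auto
      finally show "\<bar>inner (idm T * E * v) y\<bar> \<le> 2 * b * norm v" by (simp add: mult_ac)
    qed
    then show ?thesis by simp
  qed
  show ?thesis
  proof (rule opb_columns)
    show "0 \<le> 4 * b" using b0 by simp
    fix d z
    have "norm (idm T * E * (idm T * cv d z)) \<le> 4 * b * norm (idm T * cv d z)"
      by (rule n2[OF suppd_idm_cv[OF T]])
    also have "\<dots> \<le> 4 * b * (1 * norm (cv d z))"
      by (intro mult_left_mono opbD opb_idm T) (use b0 in auto)
    finally show "norm (idm T * E * idm T * cv d z) \<le> 4 * b * norm (cv d z)" by (simp add: mult.assoc)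
  qed
qed

section \<open>Counting supports and net points\<close>

lemma sum_Pow_power_card: "finite A \<Longrightarrow> (\<Sum>T\<in>Pow A. x ^ card T) = (1 + x :: real) ^ card A"
proof (induction A rule: finite_induct)
  case (insert a A)
  have inj: "inj_on (insert a) (Pow A)" using insert by (auto simp: inj_on_def)
  have disj: "Pow A \<inter> insert a ` Pow A = {}" using insert by auto
  have c: "card (insert a T) = Suc (card T)" if "T \<in> Pow A" for T
    using that insert finite_subset by (subst card_insert_disjoint) auto
  have "(\<Sum>T\<in>Pow (insert a A). x ^ card T) = (\<Sum>T\<in>Pow A. x ^ card T) + (\<Sum>T\<in>insert a ` Pow A. x ^ card T)"
    unfolding Pow_insert using insert disj by (intro sum.union_disjoint) auto
  also have "(\<Sum>T\<in>insert a ` Pow A. x ^ card T) = (\<Sum>T\<in>Pow A. x ^ Suc (card T))"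
    using inj c by (subst sum.reindex) (auto intro!: sum.cong)
  finally show ?case using insert by (simp add: sum_distrib_left[symmetric] algebra_simps)
qed simp

text \<open>Every admissible T has weight \<open>x ^ card T\<close> at least
  \<open>x ^ (2 * k)\<close>, and the weights of all subsets sum to a power of 1 + x. The choice x =
  k / |A| makes that power at most exp k.\<close>

lemma count_supports:
  assumes A: "finite A" and k: "0 < k" "k \<le> card A"
  shows "real (card {T. T \<subseteq> A \<and> card T \<le> 2 * k}) \<le> exp (2 * real k * ln (exp 1 * real (card A) / real k))"
proof -
  define x where "x = real k / real (card A)"
  have p: "0 < card A" using k by simp
  have x: "0 < x" "x \<le> 1" using k p by (auto simp: x_def)
  let ?F = "{T. T \<subseteq> A \<and> card T \<le> 2 * k}"
  have "real (card ?F) * x ^ (2 * k) = (\<Sum>T\<in>?F. x ^ (2 * k))" by simp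
  also have "\<dots> \<le> (\<Sum>T\<in>?F. x ^ card T)" using x by (intro sum_mono power_decreasing) auto
  also have "\<dots> \<le> (\<Sum>T\<in>Pow A. x ^ card T)" using A x by (intro sum_mono2) auto
  also have "\<dots> = (1 + x) ^ card A" by (rule sum_Pow_power_card[OF A])
  also have "\<dots> \<le> exp x ^ card A" using x by (intro power_mono exp_ge_add_one_self) auto
  also have "\<dots> = exp (real k)" using p by (simp add: exp_of_nat_mult[symmetric] x_def)
  finally have "real (card ?F) \<le> exp (real k) / x ^ (2 * k)" using x by (simp add: field_simps)
  also have "x ^ (2 * k) = exp (2 * real k * ln x)"
    using x exp_of_nat_mult[of "2 * k" "ln x"] by simp
  also have "exp (real k) / exp (2 * real k * ln x) = exp (real k - 2 * real k * ln x)" by (simp add: exp_diff)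
  also have "\<dots> \<le> exp (2 * real k * ln (exp 1 * real (card A) / real k))"
  proof -
    have "ln (exp 1 * real (card A) / real k) = 1 - ln x"
      using k p by (simp add: x_def ln_div ln_mult)
    then show ?thesis using k by (simp add: right_diff_distrib)
  qed
  finally show ?thesis .
qed

lemma card_net_half:
  assumes "finite P" "card P \<le> k" shows "real (card (net (1/2) P)) \<le> exp (3 * real k)"
proof -
  \<comment> \<open>The base in the cardinality bound is e (1 + 2 / (1/2)) = 5 e, which is at most
    the cube of e.\<close>
  have "5 \<le> exp (2::real)" using exp_lower_Taylor_quadratic[of 2] by simp
  then have "exp 1 * 5 \<le> exp 1 * exp (2::real)" by simp
  then have e: "exp 1 * 5 \<le> exp (3::real)" by (simp add: exp_add[symmetric])
  have "real (card (net (1/2) P)) \<le> (exp 1 * 5) ^ card P" using net(2)[OF assms(1), of "1/2"] by simp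
  also have "\<dots> \<le> exp 3 ^ card P" using e by (intro power_mono) auto
  also have "\<dots> \<le> exp 3 ^ k" using assms(2) by (intro power_increasing) auto
  also have "\<dots> = exp (3 * real k)" by (simp add: exp_of_nat_mult[symmetric] mult.commute)
  finally show ?thesis .
qed

lemma suppd_row: "suppd (T \<times> U) y \<Longrightarrow> T \<subseteq> {..<d} \<Longrightarrow> d \<le> a \<Longrightarrow> ent y a j = 0"
proof -
  assume y: "suppd (T \<times> U) y" and T: "T \<subseteq> {..<d}" and a: "d \<le> a"
  have "a \<notin> T" using T a by (meson lessThan_iff not_le subsetD)
  then show "ent y a j = 0" using y by (simp add: suppd_def)
qed

lemma ent_zero_row: "(\<And>j. ent A i j = 0) \<Longrightarrow> ent (A * B) i k = 0"
  by (simp add: times_fmat.rep_eq)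

lemma ent_zero_col: "(\<And>j. ent B j k = 0) \<Longrightarrow> ent (A * B) i k = 0"
  by (simp add: times_fmat.rep_eq)

lemma suppd_cv: "suppd (T \<times> {0}) y \<Longrightarrow> T \<subseteq> {..<d} \<Longrightarrow> cv d (\<lambda>i. ent y i 0) = y"
proof (rule cv_ent)
  fix i j :: nat assume "suppd (T \<times> {0}) y" "T \<subseteq> {..<d}" "d \<le> i \<or> 1 \<le> j"
  then show "ent y i j = 0" unfolding suppd_def by (metis lessThan_iff mem_Sigma_iff not_le not_one_le_zero singletonD subsetD)
qed

section \<open>Bounds for the sample covariance uniform over families of supports\<close>

context gauss
begin

lemma union_tail:
  assumes I: "finite I" and dB: "\<And>i. i \<in> I \<Longrightarrow> dimb d (B i)" and nB: "\<And>i. i \<in> I \<Longrightarrow> norm (B i) \<le> 1"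
    and up: "\<And>K. inner K (Sf * K) \<le> M * (norm K)\<^sup>2" and M1: "1 \<le> M" and eta: "0 < eta" and n: "0 < n"
  obtains Bad where "Bad \<in> sets (GS n)"
    "measure (GS n) Bad \<le> real (card I) * (2 * exp (- (real n * min eta (eta\<^sup>2) / (32 * M\<^sup>2))))"
    "\<And>z i. z \<in> space (GS n) - Bad \<Longrightarrow> i \<in> I \<Longrightarrow> \<bar>inner (B i) (cov n d z - Sf)\<bar> \<le> eta"
proof -
  interpret P: prob_space "GS n" by (rule prob_GS)
  define E where "E = (\<lambda>i. {z \<in> space (GS n). eta \<le> \<bar>inner (B i) (cov n d z - Sf)\<bar>})"
  have E: "E i \<in> sets (GS n)" if "i \<in> I" for i
    using cov_measurable[OF dB[OF that], of n] unfolding E_def inner_diff_right by measurable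
  show thesis
  proof (rule that[of "\<Union>i\<in>I. E i"])
    show "(\<Union>i\<in>I. E i) \<in> sets (GS n)" using I E by blast
    have "measure (GS n) (\<Union>i\<in>I. E i) \<le> (\<Sum>i\<in>I. measure (GS n) (E i))"
      using I E by (intro P.finite_measure_subadditive_finite) auto
    also have "\<dots> \<le> (\<Sum>i\<in>I. 2 * exp (- (real n * min eta (eta\<^sup>2) / (32 * M\<^sup>2))))"
      unfolding E_def by (intro sum_mono tail[OF dB nB up M1 eta n])
    finally show "measure (GS n) (\<Union>i\<in>I. E i) \<le> real (card I) * (2 * exp (- (real n * min eta (eta\<^sup>2) / (32 * M\<^sup>2))))"
      by simp
    show "\<bar>inner (B i) (cov n d z - Sf)\<bar> \<le> eta" if "z \<in> space (GS n) - (\<Union>i\<in>I. E i)" "i \<in> I" for z i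
      using that unfolding E_def by (metis (mono_tags, lifting) DiffD1 DiffD2 UN_I mem_Collect_eq linorder_le_cases)
  qed
qed

text \<open>The test matrices are products of two net vectors on at most k coordinates, which
  accounts for twice the exponent 3 k of \<open>card_net_half\<close>.\<close>

lemma event_op:
  assumes F: "finite F" "\<And>T. T \<in> F \<Longrightarrow> T \<subseteq> {..<d} \<and> card T \<le> k"
    and up: "\<And>K. inner K (Sf * K) \<le> M * (norm K)\<^sup>2" and M1: "1 \<le> M" and eta: "0 < eta" and n: "0 < n"
  obtains Bad where "Bad \<in> sets (GS n)"
    "measure (GS n) Bad \<le> real (card F) * exp (6 * real k) * (2 * exp (- (real n * min eta (eta\<^sup>2) / (32 * M\<^sup>2))))"
    "\<And>z T. z \<in> space (GS n) - Bad \<Longrightarrow> T \<in> F \<Longrightarrow> opb (4 * eta) (idm T * (cov n d z - Sf) * idm T)"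
proof -
  define N where "N = (\<lambda>T. net (1/2) (T \<times> {0::nat}))"
  define I where "I = (SIGMA T:F. N T \<times> N T)"
  have fT: "finite T" if "T \<in> F" for T using F(2)[OF that] finite_subset by blast
  have fN: "finite (N T)" if "T \<in> F" for T unfolding N_def by (rule net(1)) (use fT[OF that] in auto)
  have cN: "real (card (N T)) \<le> exp (3 * real k)" if "T \<in> F" for T
    unfolding N_def by (rule card_net_half) (use fT[OF that] F(2)[OF that] in auto)
  have fI: "finite I" unfolding I_def using F fN by auto
  have "real (card I) = (\<Sum>T\<in>F. real (card (N T)) * real (card (N T)))"
    unfolding I_def using F fN by (subst card_SigmaI) (auto simp: card_cartesian_product)
  also have "\<dots> \<le> (\<Sum>T\<in>F. exp (3 * real k) * exp (3 * real k))"
    by (intro sum_mono mult_mono cN) auto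
  also have "\<dots> = real (card F) * exp (6 * real k)" by (simp add: exp_add[symmetric])
  finally have cI: "real (card I) \<le> real (card F) * exp (6 * real k)" .
  define B where "B = (\<lambda>(T :: nat set, y, y'). y * tp y' :: fmat)"
  have d0: "0 < d" if "T \<in> F" "T \<noteq> {}" for T using F(2)[OF that(1)] that(2) by auto
  have sN: "suppd (T \<times> {0}) y" "norm y \<le> 1" if "T \<in> F" "y \<in> N T" for T y
    using net(3)[of "T \<times> {0}" "1/2" y] net(4)[of "T \<times> {0}" "1/2" y] that fT[OF that(1)] by (auto simp: N_def)
  have dB: "dimb d (B i)" if iI: "i \<in> I" for i
  proof -
    obtain T y y' where i: "i = (T, y, y')" "T \<in> F" "y \<in> N T" "y' \<in> N T" using iI by (auto simp: I_def)
    have T: "T \<subseteq> {..<d}" using F(2)[OF i(2)] by simp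
    show ?thesis
      unfolding dimb_def i(1) B_def prod.case
    proof (intro allI impI)
      fix a b assume ab: "d \<le> a \<or> d \<le> b"
      have "ent y a j = 0" if "d \<le> a" for j by (rule suppd_row[OF sN(1)[OF i(2,3)] T that])
      moreover have "ent (tp y') j b = 0" if "d \<le> b" for j
        using suppd_row[OF sN(1)[OF i(2,4)] T that, of j] by simp
      ultimately show "ent (y * tp y') a b = 0" using ab ent_zero_row ent_zero_col by metis
    qed
  qed
  have nB: "norm (B i) \<le> 1" if iI: "i \<in> I" for i
  proof -
    obtain T y y' where i: "i = (T, y, y')" "T \<in> F" "y \<in> N T" "y' \<in> N T" using iI by (auto simp: I_def)
    have "norm (y * tp y') \<le> 1 * 1" using sN(2) i by (intro norm_mult_le) auto
    then show ?thesis by (simp add: i(1) B_def)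
  qed
  obtain Bad where Bad: "Bad \<in> sets (GS n)"
    "measure (GS n) Bad \<le> real (card I) * (2 * exp (- (real n * min eta (eta\<^sup>2) / (32 * M\<^sup>2))))"
    "\<And>z i. z \<in> space (GS n) - Bad \<Longrightarrow> i \<in> I \<Longrightarrow> \<bar>inner (B i) (cov n d z - Sf)\<bar> \<le> eta"
    by (rule union_tail[where B = B, OF fI dB nB up M1 eta n], assumption, assumption, rule that)
  show thesis
  proof (rule that[OF Bad(1)])
    show "measure (GS n) Bad \<le> real (card F) * exp (6 * real k) * (2 * exp (- (real n * min eta (eta\<^sup>2) / (32 * M\<^sup>2))))"
      by (rule order_trans[OF Bad(2)]) (intro mult_right_mono cI, simp)
    fix z T assume z: "z \<in> space (GS n) - Bad" and T: "T \<in> F"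
    show "opb (4 * eta) (idm T * (cov n d z - Sf) * idm T)"
    proof (rule opb_net[OF fT[OF T]])
      fix y y' assume y: "y \<in> net (1/2) (T \<times> {0})" "y' \<in> net (1/2) (T \<times> {0})"
      then have "(T, y, y') \<in> I" using T by (simp add: I_def N_def)
      from Bad(3)[OF z this] show "\<bar>inner y ((cov n d z - Sf) * y')\<bar> \<le> eta"
        by (simp add: B_def inner_mult_right)
    qed
  qed
qed

text \<open>As W is fixed, the Frobenius norm is a supremum over matrices with k r free entries.
  This entropy is the origin of the term r (ku + kv) in the rate. Division by w keeps the test
  matrices in the unit ball.\<close>

lemma event_lin:
  assumes F: "finite F" "\<And>T. T \<in> F \<Longrightarrow> T \<subseteq> {..<d} \<and> card T \<le> k"
    and W: "suppd ({..<d} \<times> {..<r}) W" "opb w W" and w: "0 < w"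
    and up: "\<And>K. inner K (Sf * K) \<le> M * (norm K)\<^sup>2" and M1: "1 \<le> M" and eta: "0 < eta" and n: "0 < n"
  obtains Bad where "Bad \<in> sets (GS n)"
    "measure (GS n) Bad \<le> real (card F) * exp (3 * real (k * r)) * (2 * exp (- (real n * min eta (eta\<^sup>2) / (32 * M\<^sup>2))))"
    "\<And>z T. z \<in> space (GS n) - Bad \<Longrightarrow> T \<in> F \<Longrightarrow> norm (idm T * (cov n d z - Sf) * W) \<le> 2 * (w * eta)"
proof -
  define P where "P = (\<lambda>T :: nat set. T \<times> {..<r})"
  define N where "N = (\<lambda>T. net (1/2) (P T))"
  define I where "I = (SIGMA T:F. N T)"
  have fT: "finite T" if "T \<in> F" for T using F(2)[OF that] finite_subset by blast
  have fP: "finite (P T)" if "T \<in> F" for T using fT[OF that] by (simp add: P_def)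
  have fN: "finite (N T)" if "T \<in> F" for T unfolding N_def by (rule net(1)) (use fP[OF that] in auto)
  have cN: "real (card (N T)) \<le> exp (3 * real (k * r))" if "T \<in> F" for T
    unfolding N_def by (rule card_net_half[OF fP[OF that]]) (use F(2)[OF that] in \<open>simp add: P_def card_cartesian_product\<close>)
  have fI: "finite I" unfolding I_def using F fN by auto
  have "real (card I) = (\<Sum>T\<in>F. real (card (N T)))"
    unfolding I_def using F fN by (subst card_SigmaI) auto
  also have "\<dots> \<le> (\<Sum>T\<in>F. exp (3 * real (k * r)))" by (intro sum_mono cN)
  finally have cI: "real (card I) \<le> real (card F) * exp (3 * real (k * r))" by simp
  define B where "B = (\<lambda>(T :: nat set, y). (1 / w) *\<^sub>R (y * tp W))"
  have sN: "suppd (P T) y" "norm y \<le> 1" if "T \<in> F" "y \<in> N T" for T y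
    using net(3)[of "P T" "1/2" y] net(4)[of "P T" "1/2" y] that fP[OF that(1)] by (auto simp: N_def)
  have dB: "dimb d (B i)" if iI: "i \<in> I" for i
  proof -
    obtain T y where i: "i = (T, y)" "T \<in> F" "y \<in> N T" using iI by (auto simp: I_def)
    have T: "T \<subseteq> {..<d}" using F(2)[OF i(2)] by simp
    show ?thesis
      unfolding dimb_def i(1) B_def prod.case
    proof (intro allI impI)
      fix a b assume ab: "d \<le> a \<or> d \<le> b"
      have "ent y a j = 0" if "d \<le> a" for j by (rule suppd_row[OF sN(1)[OF i(2,3), unfolded P_def] T that])
      moreover have "ent (tp W) j b = 0" if "d \<le> b" for j using W(1) that by (simp add: suppd_def)
      ultimately have "ent (y * tp W) a b = 0" using ab ent_zero_row ent_zero_col by metis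
      then show "ent ((1 / w) *\<^sub>R (y * tp W)) a b = 0" by simp
    qed
  qed
  have nB: "norm (B i) \<le> 1" if iI: "i \<in> I" for i
  proof -
    obtain T y where i: "i = (T, y)" "T \<in> F" "y \<in> N T" using iI by (auto simp: I_def)
    have "norm (y * tp W) \<le> w * 1" by (rule opbD'_le[OF opb_tp[OF W(2)]]) (use sN(2) i in auto)
    then show ?thesis using w by (simp add: i(1) B_def field_simps)
  qed
  obtain Bad where Bad: "Bad \<in> sets (GS n)"
    "measure (GS n) Bad \<le> real (card I) * (2 * exp (- (real n * min eta (eta\<^sup>2) / (32 * M\<^sup>2))))"
    "\<And>z i. z \<in> space (GS n) - Bad \<Longrightarrow> i \<in> I \<Longrightarrow> \<bar>inner (B i) (cov n d z - Sf)\<bar> \<le> eta"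
    by (rule union_tail[where B = B, OF fI dB nB up M1 eta n], assumption, assumption, rule that)
  show thesis
  proof (rule that[OF Bad(1)])
    show "measure (GS n) Bad \<le> real (card F) * exp (3 * real (k * r)) * (2 * exp (- (real n * min eta (eta\<^sup>2) / (32 * M\<^sup>2))))"
      by (rule order_trans[OF Bad(2)]) (intro mult_right_mono cI, simp)
    fix z T assume z: "z \<in> space (GS n) - Bad" and T: "T \<in> F"
    show "norm (idm T * (cov n d z - Sf) * W) \<le> 2 * (w * eta)"
    proof (rule norm_le_net[OF fP[OF T]])
      show "suppd (P T) (idm T * (cov n d z - Sf) * W)"
        unfolding suppd_def
      proof (intro allI impI)
        fix i j assume ij: "(i, j) \<notin> P T"
        have "ent W l j = 0" if "r \<le> j" for l using W(1) that by (simp add: suppd_def)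
        then show "ent (idm T * (cov n d z - Sf) * W) i j = 0"
          using ij fT[OF T] unfolding mult.assoc by (auto simp: ent_idm_times P_def not_less intro: ent_zero_col)
      qed
      fix y assume y: "y \<in> net (1/2) (P T)"
      then have "(T, y) \<in> I" using T by (simp add: I_def N_def)
      then have 1: "\<bar>inner (B (T, y)) (cov n d z - Sf)\<bar> \<le> eta" by (rule Bad(3)[OF z])
      have "suppd (P T) y" using sN(1)[OF T] y by (simp add: N_def)
      then have Ty: "idm T * y = y" using fT[OF T] by (intro fmat_eqI) (auto simp: ent_idm_times suppd_def P_def)
      have "inner (idm T * (cov n d z - Sf) * W) y = inner ((cov n d z - Sf) * W) (idm T * y)"
        by (simp add: inner_mult_left mult.assoc del: Ty)
      also have "\<dots> = w * inner (B (T, y)) (cov n d z - Sf)"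
        using w by (simp add: Ty B_def inner_mult_right[of y] inner_commute)
      finally have "\<bar>inner (idm T * (cov n d z - Sf) * W) y\<bar> = w * \<bar>inner (B (T, y)) (cov n d z - Sf)\<bar>"
        using w by (simp add: abs_mult)
      also have "\<dots> \<le> w * eta" using w 1 by (intro mult_left_mono) auto
      finally show "\<bar>inner (idm T * (cov n d z - Sf) * W) y\<bar> \<le> w * eta" .
    qed
  qed
qed

text \<open>Only net points of norm at least 1/2 are tested, since \<open>lower_net\<close>
  approximates unit vectors. The population form is at least g / 4 there, whence the 4 in the
  logarithm.\<close>

lemma event_small:
  assumes F: "finite F" "\<And>T. T \<in> F \<Longrightarrow> T \<subseteq> {..<d} \<and> card T \<le> k"
    and low: "\<And>T v. T \<in> F \<Longrightarrow> suppd (T \<times> {0}) v \<Longrightarrow> g * (norm v)\<^sup>2 \<le> inner v (Sf * v)"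
    and g: "0 < g" and tau: "0 < tau" and \<delta>: "0 < \<delta>" and n: "0 < n"
  obtains Bad where "Bad \<in> sets (GS n)"
    "measure (GS n) Bad \<le> real (card F) * (exp 1 * (1 + 2 / \<delta>)) ^ k * exp (- (real n / 2) * (ln (g / (4 * tau)) - 1))"
    "\<And>z T y. z \<in> space (GS n) - Bad \<Longrightarrow> T \<in> F \<Longrightarrow> y \<in> net \<delta> (T \<times> {0}) \<Longrightarrow>
      1/2 \<le> norm y \<Longrightarrow> tau \<le> inner y (cov n d z * y)"
proof -
  interpret P: prob_space "GS n" by (rule prob_GS)
  define N where "N = (\<lambda>T. {y \<in> net \<delta> (T \<times> {0::nat}). 1/2 \<le> norm y})"
  define I where "I = (SIGMA T:F. N T)"
  define E where "E = (\<lambda>(T :: nat set, y). {z \<in> space (GS n). inner (cv d (\<lambda>i. ent y i 0)) (cov n d z * cv d (\<lambda>i. ent y i 0)) \<le> tau})"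
  have fT: "finite T" if "T \<in> F" for T using F(2)[OF that] finite_subset by blast
  have fN: "finite (N T)" if "T \<in> F" for T unfolding N_def using net(1)[of "T \<times> {0}" \<delta>] fT[OF that] \<delta> by simp
  have cN: "real (card (N T)) \<le> (exp 1 * (1 + 2 / \<delta>)) ^ k" if "T \<in> F" for T
  proof -
    have "real (card (N T)) \<le> real (card (net \<delta> (T \<times> {0::nat})))"
      using net(1)[of "T \<times> {0}" \<delta>] fT[OF that] \<delta> by (auto simp: N_def intro!: card_mono)
    also have "\<dots> \<le> (exp 1 * (1 + 2 / \<delta>)) ^ card (T \<times> {0::nat})" using fT[OF that] \<delta> by (intro net(2)) auto
    also have "\<dots> \<le> (exp 1 * (1 + 2 / \<delta>)) ^ k"
    proof (rule power_increasing)
      show "card (T \<times> {0::nat}) \<le> k" using F(2)[OF that] by (simp add: card_cartesian_product)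
      have "1 * 1 \<le> exp 1 * (1 + 2 / \<delta>)" using \<delta> by (intro mult_mono) auto
      then show "1 \<le> exp 1 * (1 + 2 / \<delta>)" by simp
    qed
    finally show ?thesis .
  qed
  have fI: "finite I" unfolding I_def using F fN by auto
  have "real (card I) = (\<Sum>T\<in>F. real (card (N T)))"
    unfolding I_def using F fN by (subst card_SigmaI) auto
  also have "\<dots> \<le> (\<Sum>T\<in>F. (exp 1 * (1 + 2 / \<delta>)) ^ k)" by (intro sum_mono cN)
  finally have cI: "real (card I) \<le> real (card F) * (exp 1 * (1 + 2 / \<delta>)) ^ k" by simp
  have E: "E i \<in> sets (GS n)" if iI: "i \<in> I" for i
  proof -
    obtain T y where i: "i = (T, y)" "T \<in> F" "y \<in> N T" using iI by (auto simp: I_def)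
    define v where "v = cv d (\<lambda>i. ent y i 0)"
    have "suppd (T \<times> {0}) y" using net(3)[of "T \<times> {0}" \<delta> y] i fT[OF i(2)] \<delta> by (auto simp: N_def)
    have "dimb d (v * tp v)"
      unfolding dimb_def
    proof (intro allI impI)
      fix a b assume ab: "d \<le> a \<or> d \<le> b"
      have "ent v a j = 0" if "d \<le> a" for j using that by (simp add: v_def cv_def)
      moreover have "ent (tp v) j b = 0" if "d \<le> b" for j using that by (simp add: v_def cv_def)
      ultimately show "ent (v * tp v) a b = 0" using ab ent_zero_row ent_zero_col by metis
    qed
    from cov_measurable[OF this, of n] show ?thesis
      unfolding i(1) E_def prod.case inner_mult_right v_def by simp
  qed
  have mE: "measure (GS n) (E i) \<le> exp (- (real n / 2) * (ln (g / (4 * tau)) - 1))" if iI: "i \<in> I" for i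
  proof -
    obtain T y where i: "i = (T, y)" "T \<in> F" "y \<in> N T" using iI by (auto simp: I_def)
    have sy: "suppd (T \<times> {0}) y" using net(3)[of "T \<times> {0}" \<delta> y] i fT[OF i(2)] \<delta> by (auto simp: N_def)
    have yv: "cv d (\<lambda>i. ent y i 0) = y" by (rule suppd_cv[OF sy]) (use F(2)[OF i(2)] in simp)
    have "(1/2)\<^sup>2 \<le> (norm y)\<^sup>2" using i(3) by (intro power_mono) (auto simp: N_def)
    then have "g * (1/4) \<le> g * (norm y)\<^sup>2" using g by (intro mult_left_mono) (auto simp: power2_eq_square)
    also have "\<dots> \<le> inner y (Sf * y)" by (rule low[OF i(2) sy])
    finally have "g / 4 \<le> inner (cv d (\<lambda>i. ent y i 0)) (Sf * cv d (\<lambda>i. ent y i 0))" by (simp add: yv)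
    from small_ball[OF this _ tau n] g show ?thesis by (simp add: i(1) E_def divide_divide_eq_left)
  qed
  show thesis
  proof (rule that[of "\<Union>i\<in>I. E i"])
    show "(\<Union>i\<in>I. E i) \<in> sets (GS n)" using fI E by blast
    have "measure (GS n) (\<Union>i\<in>I. E i) \<le> (\<Sum>i\<in>I. measure (GS n) (E i))"
      using fI E by (intro P.finite_measure_subadditive_finite) auto
    also have "\<dots> \<le> (\<Sum>i\<in>I. exp (- (real n / 2) * (ln (g / (4 * tau)) - 1)))" by (intro sum_mono mE)
    also have "\<dots> = real (card I) * exp (- (real n / 2) * (ln (g / (4 * tau)) - 1))" by simp
    also have "\<dots> \<le> real (card F) * (exp 1 * (1 + 2 / \<delta>)) ^ k * exp (- (real n / 2) * (ln (g / (4 * tau)) - 1))"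
      by (intro mult_right_mono cI) simp
    finally show "measure (GS n) (\<Union>i\<in>I. E i) \<le> real (card F) * (exp 1 * (1 + 2 / \<delta>)) ^ k * exp (- (real n / 2) * (ln (g / (4 * tau)) - 1))" .
    fix z T y assume z: "z \<in> space (GS n) - (\<Union>i\<in>I. E i)" and T: "T \<in> F" and y: "y \<in> net \<delta> (T \<times> {0})" "1/2 \<le> norm y"
    have sy: "suppd (T \<times> {0}) y" using net(3)[of "T \<times> {0}" \<delta> y] y fT[OF T] \<delta> by auto
    have yv: "cv d (\<lambda>i. ent y i 0) = y" by (rule suppd_cv[OF sy]) (use F(2)[OF T] in simp)
    have "(T, y) \<in> I" using T y by (simp add: I_def N_def)
    then have "z \<notin> E (T, y)" using z by blast
    then show "tau \<le> inner y (cov n d z * y)" using z by (simp add: E_def yv)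
  qed
qed

end

text \<open>Moving a unit vector to the net changes \<open>norm (Z * v)\<close> by at most half the
  square root of tau. As tau may be tiny compared with b, the resolution \<delta> must be adapted to
  their ratio, and a net of radius 1/2 would not do.\<close>

lemma lower_net:
  assumes T: "finite T" and up: "opb b (idm T * (tp Z * Z) * idm T)"
    and low: "\<And>y. y \<in> net \<delta> (T \<times> {0}) \<Longrightarrow>
      1/2 \<le> norm y \<Longrightarrow> tau \<le> inner y ((tp Z * Z) * y)"
    and tau: "0 < tau" and \<delta>: "0 < \<delta>" "\<delta> \<le> 1/2" "b * \<delta>\<^sup>2 \<le> tau / 4"
    and K: "idm T * K = K"
  shows "(norm K)\<^sup>2 \<le> (4 / tau) * (norm (Z * K))\<^sup>2"
proof -
  let ?P = "T \<times> {0::nat}"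
  have P: "finite ?P" using T by simp
  have zz: "inner v ((tp Z * Z) * v) = (norm (Z * v))\<^sup>2" for v
    by (simp add: power2_norm_eq_inner inner_mult_left mult.assoc)
  have vec1: "sqrt tau / 2 \<le> norm (Z * v)" if v: "suppd ?P v" "norm v = 1" for v
  proof -
    obtain y where y: "y \<in> net \<delta> ?P" "norm (v - y) \<le> \<delta>" using net(5)[OF P \<delta>(1), of v] v by auto
    have sy: "suppd ?P y" using net(3)[OF P \<delta>(1) y(1)] .
    have "1/2 \<le> norm y" using y(2) v(2) \<delta>(2) norm_triangle_ineq2[of v y] by linarith
    from low[OF y(1) this] have "sqrt tau \<le> norm (Z * y)" unfolding zz by (intro real_le_lsqrt) auto
    moreover have "norm (Z * (v - y)) \<le> sqrt tau / 2"
    proof -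
      have "suppd ?P (v - y)" using v(1) sy by (simp add: suppd_def)
      then have p: "idm T * (v - y) = v - y" using T by (intro fmat_eqI) (auto simp: ent_idm_times suppd_def)
      have "(norm (Z * (v - y)))\<^sup>2 = inner (v - y) ((idm T * (tp Z * Z) * idm T) * (v - y))"
      proof -
        have "(norm (Z * (v - y)))\<^sup>2 = inner (idm T * (v - y)) ((tp Z * Z) * (idm T * (v - y)))" by (simp add: p zz)
        then show ?thesis by (simp only: inner_mult_left tp_idm mult.assoc)
      qed
      also have "\<dots> \<le> norm (v - y) * (b * norm (v - y))"
        by (intro order_trans[OF norm_cauchy_schwarz] mult_left_mono opbD[OF up]) auto
      also have "\<dots> \<le> b * \<delta>\<^sup>2"
      proof -
        have "b * (norm (v - y) * norm (v - y)) \<le> b * (\<delta> * \<delta>)"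
          using y(2) opb_nonneg[OF up] \<delta>(1) by (intro mult_left_mono mult_mono) auto
        then show ?thesis by (simp add: power2_eq_square mult_ac)
      qed
      also have "\<dots> \<le> (sqrt tau / 2)\<^sup>2" using \<delta>(3) tau by (simp add: power_divide)
      finally show ?thesis by (rule power2_le_imp_le) (use tau in simp)
    qed
    moreover have "norm (Z * y) \<le> norm (Z * v) + norm (Z * (v - y))"
      using norm_triangle_ineq4[of "Z * v" "Z * (v - y)"] by (simp add: right_diff_distrib)
    ultimately show ?thesis by simp
  qed
  have vec: "(tau / 4) * (norm v)\<^sup>2 \<le> (norm (Z * v))\<^sup>2" if v: "suppd ?P v" for v
  proof (cases "v = 0")
    case False
    define u where "u = (1 / norm v) *\<^sub>R v"
    have "suppd ?P u" "norm u = 1" using v False by (auto simp: u_def suppd_def)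
    then have "sqrt tau / 2 \<le> norm (Z * u)" by (rule vec1)
    then have "sqrt tau / 2 * norm v \<le> norm (Z * v)" using False by (simp add: u_def field_simps)
    then have "(sqrt tau / 2 * norm v)\<^sup>2 \<le> (norm (Z * v))\<^sup>2" using tau by (intro power_mono) auto
    then show ?thesis using tau by (simp add: power_mult_distrib power_divide)
  qed simp
  obtain N where N: "dimb N Z" "dimb N K" by (rule dimb_obtain2)
  have "(tau / 4) * (norm K)\<^sup>2 = (\<Sum>j<N. (tau / 4) * (norm (cv N (\<lambda>i. ent K i j)))\<^sup>2)"
    by (simp add: norm_mult_columns(2)[OF N] sum_distrib_left)
  also have "\<dots> \<le> (\<Sum>j<N. (norm (Z * cv N (\<lambda>i. ent K i j)))\<^sup>2)"
  proof (intro sum_mono vec)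
    fix j
    have "i \<notin> T \<Longrightarrow> ent K i j = 0" for i using K T by (metis ent_idm_times)
    then show "suppd ?P (cv N (\<lambda>i. ent K i j))" by (auto simp: suppd_def cv_def)
  qed
  also have "\<dots> = (norm (Z * K))\<^sup>2" by (rule norm_mult_columns(1)[OF N, symmetric])
  finally show ?thesis using tau by (simp add: field_simps)
qed

section \<open>Effective sparsity and truncation\<close>

context
  fixes q s lam :: real and d n r :: nat
  assumes q: "0 \<le> q" "q < 2" and s: "0 < s" and lam: "0 < lam" and d: "0 < d" and n: "0 < n" and r: "0 < r"
begin

definition "effset = {x. 0 \<le> x \<and> x \<le> real d \<and>
   x \<le> s * (real n * lam\<^sup>2 / (real r + ln (exp 1 * real d / x))) powr (q / 2)}"

lemma eff_x_Sup: "eff_x q s d n r lam = Sup effset"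
  by (simp add: eff_x_def effset_def)

lemma effset_bdd: "bdd_above effset"
  by (rule bdd_aboveI[of _ "real d"]) (simp add: effset_def)

text \<open>At x = 0 the quotient inside the logarithm is 0 by convention; its value is irrelevant
  because the right-hand side is nonnegative.\<close>

lemma effset_0: "0 \<in> effset"
  using s by (simp add: effset_def)

lemma ln_ge_1: "0 < x \<Longrightarrow> x \<le> real d \<Longrightarrow> 1 \<le> ln (exp 1 * real d / x)"
proof -
  assume x: "0 < x" "x \<le> real d"
  have "exp 1 * 1 \<le> exp 1 * (real d / x)" using x by (intro mult_left_mono) (auto simp: field_simps)
  then have "ln (exp 1) \<le> ln (exp 1 * (real d / x))" by (intro ln_mono) auto
  then show ?thesis by simp
qed

text \<open>Near 0 the logarithm is dominated by a multiple of 1 / x, so the right-hand side is at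
  least a multiple of x^(q/2), which exceeds x since q / 2 < 1. This is what makes the effective
  sparsity at least 1.\<close>

lemma effset_pos: "\<exists>x>0. x \<in> effset"
proof -
  define a where "a = real n * lam\<^sup>2"
  \<comment> \<open>Chosen so that r + ln (e d / x) is at most b / x for all x in (0, d].\<close>
  define b where "b = (real r + exp 1) * real d"
  have a: "0 < a" using n lam by (simp add: a_def)
  have b: "0 < b" using d r by (simp add: b_def add_pos_pos)
  define t where "t = s * (a / b) powr (q / 2)"
  have t: "0 < t" using s a b by (simp add: t_def)
  define x where "x = min (min 1 (real d)) (t powr (1 / (1 - q / 2)))"
  have x: "0 < x" "x \<le> 1" "x \<le> real d" using t d by (auto simp: x_def)
  have "x powr (1 - q / 2) \<le> (t powr (1 / (1 - q / 2))) powr (1 - q / 2)"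
    using x q by (intro powr_mono2) (auto simp: x_def)
  also have "\<dots> = t" using t q by (simp add: powr_powr)
  finally have xt: "x powr (1 - q / 2) \<le> t" .
  have "x = x powr (1 - q / 2) * x powr (q / 2)" using x by (simp add: powr_add[symmetric])
  also have "\<dots> \<le> t * x powr (q / 2)" using xt by (intro mult_right_mono) auto
  also have "\<dots> = s * (a / b * x) powr (q / 2)" 
  proof -
    have "(a / b * x) powr (q / 2) = (a / b) powr (q / 2) * x powr (q / 2)" by (intro powr_mult)
    then show ?thesis by (simp only: t_def mult.assoc)
  qed
  also have "\<dots> \<le> s * (a / (real r + ln (exp 1 * real d / x))) powr (q / 2)"
  proof (intro mult_left_mono powr_mono2)
    have p: "0 < real r + ln (exp 1 * real d / x)" using ln_ge_1[OF x(1,3)] by simp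
    have "ln (exp 1 * real d / x) \<le> exp 1 * real d / x" using x d by (intro order.trans[OF ln_le_minus_one]) auto
    moreover have "real r \<le> real r * real d / x"
    proof -
      have "real r * x \<le> real r * real d" using x by (intro mult_left_mono) auto
      then show ?thesis using x by (simp add: field_simps)
    qed
    moreover have "b / x = real r * real d / x + exp 1 * real d / x"
      by (simp add: b_def add_divide_distrib distrib_right)
    ultimately have "real r + ln (exp 1 * real d / x) \<le> b / x" by linarith
    then have "a / (b / x) \<le> a / (real r + ln (exp 1 * real d / x))"
      using a p b x by (intro divide_left_mono mult_pos_pos divide_pos_pos) auto
    then show "a / b * x \<le> a / (real r + ln (exp 1 * real d / x))" by simp
  qed (use a b x q s in auto)
  finally show ?thesis using x by (intro exI[of _ x]) (simp add: effset_def a_def)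
qed

lemma eff_k_bounds: "1 \<le> eff_k q s d n r lam" "eff_k q s d n r lam \<le> int d"
proof -
  obtain x where x: "0 < x" "x \<in> effset" using effset_pos by blast
  have "x \<le> Sup effset" using x effset_bdd by (intro cSup_upper)
  then have "0 < Sup effset" using x by simp
  then show "1 \<le> eff_k q s d n r lam" by (simp add: eff_k_def eff_x_Sup)
  have "Sup effset \<le> real d"
  proof (rule cSup_least)
    show "effset \<noteq> {}" using effset_0 by blast
  qed (simp add: effset_def)
  then show "eff_k q s d n r lam \<le> int d" by (simp add: eff_k_def eff_x_Sup ceiling_le_iff)
qed

lemma eff_k_next:
  fixes j :: nat
  assumes j: "eff_k q s d n r lam < int j" "j \<le> d"
  shows "s * (real n * lam\<^sup>2 / (real r + ln (exp 1 * real d / real j))) powr (q / 2) < real j"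
proof -
  have "Sup effset \<le> real_of_int (eff_k q s d n r lam)" by (simp add: eff_k_def eff_x_Sup)
  also have "\<dots> < real j" using j(1) by linarith
  finally have "real j \<notin> effset" using cSup_upper[OF _ effset_bdd, of "real j"] by linarith
  then show ?thesis using j(2) by (simp add: effset_def not_le)
qed

end

text \<open>A discrete integral comparison: each new term is at most the decrement of the subtracted
  power, by Bernoulli's inequality in the form of \<open>exp_ge_add_one_self\<close>.\<close>

lemma sum_powr_tail:
  fixes \<alpha> :: real and j :: nat
  assumes \<alpha>: "1 < \<alpha>" and j: "0 < j" and N: "j \<le> N"
  shows "(\<Sum>i=j..N. (real j / real i) powr \<alpha>) \<le> 1 + real j / (\<alpha> - 1) * (1 - (real j / real N) powr (\<alpha> - 1))"
  using N
proof (induction N rule: dec_induct)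
  case base
  then show ?case using j by simp
next
  case (step N)
  define \<beta> where "\<beta> = \<alpha> - 1"
  have \<beta>: "0 < \<beta>" using \<alpha> by (simp add: \<beta>_def)
  have N0: "0 < N" using step j by simp
  define y where "y = real j / real (Suc N)"
  define z where "z = real j / real N"
  have y: "0 < y" and z: "0 < z" using j N0 by (auto simp: y_def z_def)
  have zy: "z = y * (real (Suc N) / real N)" using N0 by (simp add: y_def z_def)
  have b: "1 + \<beta> / real (Suc N) \<le> (real (Suc N) / real N) powr \<beta>"
  proof -
    have "1 / real (Suc N) \<le> - ln (real N / real (Suc N))"
    proof -
      have "ln (real N / real (Suc N)) \<le> real N / real (Suc N) - 1" using N0 by (intro ln_le_minus_one) simp
      also have "\<dots> = - (1 / real (Suc N))" by (simp add: field_simps)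
      finally show ?thesis by simp
    qed
    also have "- ln (real N / real (Suc N)) = ln (real (Suc N) / real N)" using N0 by (simp add: ln_div)
    finally have "\<beta> * (1 / real (Suc N)) \<le> \<beta> * ln (real (Suc N) / real N)" using \<beta> by (intro mult_left_mono) auto
    then have "1 + \<beta> / real (Suc N) \<le> 1 + \<beta> * ln (real (Suc N) / real N)" by simp
    also have "\<dots> \<le> exp (\<beta> * ln (real (Suc N) / real N))" by (rule exp_ge_add_one_self)
    also have "\<dots> = (real (Suc N) / real N) powr \<beta>" using N0 by (simp add: powr_def)
    finally show ?thesis .
  qed
  have "y powr \<beta> * (1 + \<beta> / real (Suc N)) \<le> y powr \<beta> * (real (Suc N) / real N) powr \<beta>"
    using b by (intro mult_left_mono) auto
  also have "\<dots> = z powr \<beta>" unfolding zy using y N0 by (simp add: powr_mult[symmetric])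
  finally have 1: "y powr \<beta> * (\<beta> / real (Suc N)) \<le> z powr \<beta> - y powr \<beta>" by (simp add: distrib_left)
  have "y powr \<alpha> = y powr \<beta> * y" using y powr_add[of y \<beta> 1] by (simp add: \<beta>_def)
  also have "\<dots> = real j / \<beta> * (y powr \<beta> * (\<beta> / real (Suc N)))" using \<beta> by (simp add: y_def)
  also have "\<dots> \<le> real j / \<beta> * (z powr \<beta> - y powr \<beta>)" using 1 \<beta> by (intro mult_left_mono) auto
  finally have 2: "y powr \<alpha> \<le> real j / \<beta> * (z powr \<beta> - y powr \<beta>)" .
  have "(\<Sum>i=j..Suc N. (real j / real i) powr \<alpha>) = (\<Sum>i=j..N. (real j / real i) powr \<alpha>) + y powr \<alpha>"
    using step by (simp add: y_def)
  also have "\<dots> \<le> 1 + real j / \<beta> * (1 - z powr \<beta>) + real j / \<beta> * (z powr \<beta> - y powr \<beta>)"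
    using step.IH 2 by (simp add: \<beta>_def[symmetric] z_def[symmetric])
  also have "\<dots> = 1 + real j / \<beta> * (1 - y powr \<beta>)" by (simp add: algebra_simps)
  finally show ?case by (simp add: \<beta>_def y_def)
qed

section \<open>Ordered rows and their truncation\<close>

definition row_norm :: "real mat \<Rightarrow> nat \<Rightarrow> real" where "row_norm A i = vnorm (row A i)"

lemma row_norm_nonneg: "0 \<le> row_norm A i"
  by (simp add: row_norm_def vnorm_def scalar_prod_def sum_nonneg)

lemma row_norm_sq: "i < dim_row A \<Longrightarrow> (row_norm A i)\<^sup>2 = (\<Sum>j<dim_col A. (A $$ (i, j))\<^sup>2)"
  by (simp add: row_norm_def vnorm_def scalar_prod_def sum_nonneg power2_eq_square lessThan_atLeast0)

text \<open>\<open>row_norms_desc\<close> lists only the values; truncation needs the indices of the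
  k largest rows, with ties resolved.\<close>

definition desc_rows :: "real mat \<Rightarrow> nat list" where
  "desc_rows A = rev (sort_key (row_norm A) [0..<dim_row A])"

lemma row_norms_desc_eq: "row_norms_desc A = map (row_norm A) (desc_rows A)"
proof -
  have "map vnorm (rows A) = map (row_norm A) [0..<dim_row A]" by (simp add: rows_def row_norm_def)
  moreover have "sort (map (row_norm A) [0..<dim_row A]) = map (row_norm A) (sort_key (row_norm A) [0..<dim_row A])"
    by (rule properties_for_sort) (auto simp: mset_map[symmetric])
  ultimately show ?thesis by (simp add: row_norms_desc_def desc_rows_def rev_map)
qed

lemma desc_rows: "set (desc_rows A) = {..<dim_row A}" "distinct (desc_rows A)" "length (desc_rows A) = dim_row A"
  by (auto simp: desc_rows_def)

lemma row_norms_desc_anti: "i \<le> j \<Longrightarrow> j < dim_row A \<Longrightarrow> row_norms_desc A ! j \<le> row_norms_desc A ! i"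
proof -
  assume "i \<le> j" "j < dim_row A"
  moreover have "length (sort (map vnorm (rows A))) = dim_row A" by simp
  ultimately show ?thesis unfolding row_norms_desc_def
    by (simp add: rev_nth sorted_nth_mono)
qed

lemma weak_normD:
  assumes "weak_norm q A \<le> s" "j < dim_row A"
  shows "real (Suc j) * (row_norms_desc A ! j) powr q \<le> s"
proof -
  have "real (Suc j) * (row_norms_desc A ! (Suc j - 1)) powr q \<le> weak_norm q A"
    unfolding weak_norm_def using assms(2) by (intro Max_ge imageI) auto
  then show ?thesis using assms(1) by simp
qed

lemma truncation_sum:
  assumes "k \<le> dim_row A"
  obtains T where "T \<subseteq> {..<dim_row A}" "card T = k"
    "(\<Sum>i\<in>{..<dim_row A} - T. (row_norm A i)\<^sup>2) = (\<Sum>j=k..<dim_row A. (row_norms_desc A ! j)\<^sup>2)"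
proof (rule that[of "set (take k (desc_rows A))"])
  let ?xs = "desc_rows A"
  show "set (take k ?xs) \<subseteq> {..<dim_row A}" using desc_rows(1) set_take_subset by fast
  show "card (set (take k ?xs)) = k"
    using desc_rows(2,3)[of A] assms by (simp add: distinct_card distinct_take)
  have "set ?xs = set (take k ?xs) \<union> set (drop k ?xs)" by (metis append_take_drop_id set_append)
  moreover have "set (take k ?xs) \<inter> set (drop k ?xs) = {}" by (rule set_take_disj_set_drop_if_distinct[OF desc_rows(2)]) simp
  ultimately have "{..<dim_row A} - set (take k ?xs) = set (drop k ?xs)" using desc_rows(1) by blast
  then have "(\<Sum>i\<in>{..<dim_row A} - set (take k ?xs). (row_norm A i)\<^sup>2) = sum_list (map (\<lambda>i. (row_norm A i)\<^sup>2) (drop k ?xs))"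
    using desc_rows(2) by (simp add: sum_list_distinct_conv_sum_set distinct_drop)
  also have "\<dots> = (\<Sum>j=0..<dim_row A - k. (row_norm A (?xs ! (k + j)))\<^sup>2)"
    using desc_rows(3)[of A] assms by (simp add: sum_list_sum_nth)
  also have "\<dots> = (\<Sum>j=k..<dim_row A. (row_norm A (?xs ! j))\<^sup>2)"
    using sum.shift_bounds_nat_ivl[of "\<lambda>j. (row_norm A (?xs ! j))\<^sup>2" 0 k "dim_row A - k"] assms by (simp add: add.commute)
  also have "\<dots> = (\<Sum>j=k..<dim_row A. (row_norms_desc A ! j)\<^sup>2)"
    by (intro sum.cong) (auto simp: row_norms_desc_eq desc_rows)
  finally show "(\<Sum>i\<in>{..<dim_row A} - set (take k ?xs). (row_norm A i)\<^sup>2) = (\<Sum>j=k..<dim_row A. (row_norms_desc A ! j)\<^sup>2)" .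
qed

text \<open>Just above k the defining inequality of the effective sparsity fails, which bounds s by
  a power of \<rho> / a. Inserted in the weak norm bound, the squared j-th row norm is at most
  \<rho> / a times (j0 / j)^(2/q), and these terms are summable since 2 / q > 1. The constant is 1 +
  2 / (2/q - 1).\<close>

lemma truncation_bias:
  fixes q s lam :: real and n r k :: nat and A :: "real mat"
  assumes q: "0 \<le> q" "q < 2" and s: "0 < s" and lam: "0 < lam" and n: "0 < n" and r: "0 < r"
    and d: "0 < dim_row A" and w: "weak_norm q A \<le> s" and k: "int k = eff_k q s (dim_row A) n r lam"
  obtains T where "T \<subseteq> {..<dim_row A}" "card T = k"
    "(\<Sum>i\<in>{..<dim_row A} - T. (row_norm A i)\<^sup>2)
      \<le> (2 + q) / (2 - q) * (real k * (real r + ln (exp 1 * real (dim_row A) / real k)) / (real n * lam\<^sup>2))"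
proof -
  let ?d = "dim_row A"
  define a where "a = real n * lam\<^sup>2"
  have a: "0 < a" using n lam by (simp add: a_def)
  have k1: "1 \<le> k" and kd: "k \<le> ?d" using eff_k_bounds[OF q s lam d n r] k by auto
  define \<rho> where "\<rho> = real r + ln (exp 1 * real ?d / real k)"
  have \<rho>: "0 < \<rho>" using ln_ge_1[OF q s lam d n r, of "real k"] k1 kd by (simp add: \<rho>_def)
  have Cq: "0 \<le> (2 + q) / (2 - q)" using q by simp
  obtain T where T: "T \<subseteq> {..<?d}" "card T = k"
    "(\<Sum>i\<in>{..<?d} - T. (row_norm A i)\<^sup>2) = (\<Sum>j=k..<?d. (row_norms_desc A ! j)\<^sup>2)"
    by (rule truncation_sum[OF kd])
  have rhs0: "0 \<le> (2 + q) / (2 - q) * (real k * \<rho> / a)"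
    using a \<rho> by (intro mult_nonneg_nonneg Cq) auto
  have "(\<Sum>j=k..<?d. (row_norms_desc A ! j)\<^sup>2) \<le> (2 + q) / (2 - q) * (real k * \<rho> / a)"
  proof (cases "k = ?d")
    case True
    then have "(\<Sum>j=k..<?d. (row_norms_desc A ! j)\<^sup>2) = 0" by simp
    then show ?thesis using rhs0 by linarith
  next
    case False
    \<comment> \<open>The first integer outside the set that defines the effective sparsity. Entry j
      of the sorted list, counted from 0, has weak norm index \<open>Suc j\<close>, so the discarded
      indices start at j0.\<close>
    define j0 where "j0 = Suc k"
    have j0: "j0 \<le> ?d" "0 < j0" using False kd by (auto simp: j0_def)
    define \<rho>0 where "\<rho>0 = real r + ln (exp 1 * real ?d / real j0)"
    have \<rho>0: "0 < \<rho>0" using ln_ge_1[OF q s lam d n r, of "real j0"] j0 by (simp add: \<rho>0_def)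
    have le: "\<rho>0 \<le> \<rho>" unfolding \<rho>0_def \<rho>_def using k1 d
      by (intro add_left_mono ln_mono divide_left_mono) (auto simp: j0_def)
    have nx: "s * (a / \<rho>0) powr (q / 2) < real j0"
      using eff_k_next[OF q s lam d n r, of j0] k j0 by (simp add: a_def \<rho>0_def j0_def)
    have nn: "0 \<le> row_norms_desc A ! j" if "j < ?d" for j
      using that by (simp add: row_norms_desc_eq desc_rows row_norm_nonneg)
    show ?thesis
    \<comment> \<open>For q = 0 the exponent 2 / q is meaningless, but then s < j0 leaves at most k
      nonzero rows and the bias vanishes.\<close>
    proof (cases "q = 0")
      case True
      have "s < real j0" using nx a \<rho>0 True by (simp add: powr_zero_eq_one)
      have "row_norms_desc A ! j = 0" if "k \<le> j" "j < ?d" for j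
      proof (rule ccontr)
        assume "row_norms_desc A ! j \<noteq> 0"
        then have "real (Suc j) \<le> s" using weak_normD[OF w that(2)] True by simp
        then show False using \<open>s < real j0\<close> that by (simp add: j0_def)
      qed
      then have "(\<Sum>j=k..<?d. (row_norms_desc A ! j)\<^sup>2) = 0" by simp
      then show ?thesis using rhs0 by linarith
    next
      case False
      then have q0: "0 < q" using q by simp
      define \<alpha> where "\<alpha> = 2 / q"
      have \<alpha>: "1 < \<alpha>" using q q0 by (simp add: \<alpha>_def)
      have base: "(s / real j0) powr \<alpha> \<le> \<rho> / a"
      proof -
        have "s / real j0 \<le> (\<rho>0 / a) powr (q / 2)"
        proof -
          have "(a / \<rho>0) powr (q / 2) * (\<rho>0 / a) powr (q / 2) = 1"
            using a \<rho>0 by (simp add: powr_mult[symmetric])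
          then have "s = s * (a / \<rho>0) powr (q / 2) * (\<rho>0 / a) powr (q / 2)" by (simp add: mult.assoc)
          also have "\<dots> \<le> real j0 * (\<rho>0 / a) powr (q / 2)" using nx by (intro mult_right_mono) auto
          finally show ?thesis using j0 by (simp add: field_simps)
        qed
        then have "(s / real j0) powr \<alpha> \<le> ((\<rho>0 / a) powr (q / 2)) powr \<alpha>"
          using s \<alpha> by (intro powr_mono2) auto
        also have "\<dots> = \<rho>0 / a" using q0 a \<rho>0 by (simp add: powr_powr \<alpha>_def)
        also have "\<dots> \<le> \<rho> / a" using le a by (intro divide_right_mono) auto
        finally show ?thesis .
      qed
      have tm: "(row_norms_desc A ! j)\<^sup>2 \<le> \<rho> / a * (real j0 / real (Suc j)) powr \<alpha>" if "k \<le> j" "j < ?d" for j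
      proof -
        define x where "x = row_norms_desc A ! j"
        have x0: "0 \<le> x" using nn that by (simp add: x_def)
        have "x powr q \<le> s / real (Suc j)" using weak_normD[OF w that(2)] by (simp add: x_def field_simps)
        then have "(x powr q) powr \<alpha> \<le> (s / real (Suc j)) powr \<alpha>" using \<alpha> by (intro powr_mono2) auto
        moreover have "(x powr q) powr \<alpha> = x\<^sup>2"
          using x0 q0 by (cases "x = 0") (auto simp: powr_powr \<alpha>_def)
        moreover have "(s / real (Suc j)) powr \<alpha> = (s / real j0) powr \<alpha> * (real j0 / real (Suc j)) powr \<alpha>"
          using s j0 by (simp add: powr_mult[symmetric])
        moreover have "(s / real j0) powr \<alpha> * (real j0 / real (Suc j)) powr \<alpha> \<le> \<rho> / a * (real j0 / real (Suc j)) powr \<alpha>"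
          by (intro mult_right_mono base) auto
        ultimately show ?thesis unfolding x_def by linarith
      qed
      have "(\<Sum>j=k..<?d. (row_norms_desc A ! j)\<^sup>2) \<le> (\<Sum>j=k..<?d. \<rho> / a * (real j0 / real (Suc j)) powr \<alpha>)"
        by (intro sum_mono tm) auto
      also have "\<dots> = \<rho> / a * (\<Sum>j=k..<?d. (real j0 / real (Suc j)) powr \<alpha>)" by (simp add: sum_distrib_left)
      also have "(\<Sum>j=k..<?d. (real j0 / real (Suc j)) powr \<alpha>) = (\<Sum>i=j0..?d. (real j0 / real i) powr \<alpha>)"
        by (rule sum.reindex_bij_witness[of _ "\<lambda>i. i - 1" Suc]) (auto simp: j0_def)
      also have "\<rho> / a * \<dots> \<le> \<rho> / a * (real k * (1 + 2 / (\<alpha> - 1)))"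
      proof (rule mult_left_mono)
        have "(\<Sum>i=j0..?d. (real j0 / real i) powr \<alpha>) \<le> 1 + real j0 / (\<alpha> - 1) * (1 - (real j0 / real ?d) powr (\<alpha> - 1))"
          by (rule sum_powr_tail[OF \<alpha> j0(2,1)])
        also have "\<dots> \<le> 1 + real j0 / (\<alpha> - 1) * 1" using \<alpha> by (intro add_left_mono mult_left_mono) auto
        \<comment> \<open>Here j0 = k + 1 is at most 2 k, because k is at least 1.\<close>
        also have "\<dots> \<le> real k + (2 * real k) / (\<alpha> - 1)" using k1 \<alpha>
          by (simp add: j0_def, intro add_mono divide_right_mono) auto
        finally show "(\<Sum>i=j0..?d. (real j0 / real i) powr \<alpha>) \<le> real k * (1 + 2 / (\<alpha> - 1))" by (simp add: algebra_simps)
      qed (use \<rho> a in auto)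
      also have "1 + 2 / (\<alpha> - 1) = (2 + q) / (2 - q)" using q0 q by (simp add: \<alpha>_def field_simps)
      finally show ?thesis by (simp add: mult_ac)
    qed
  qed
  then show thesis using T by (intro that[of T]) (auto simp: \<rho>_def a_def)
qed

lemma downward_closed_nat:
  fixes X :: "nat set"
  assumes "finite X" "\<And>i j. j \<in> X \<Longrightarrow> i \<le> j \<Longrightarrow> i \<in> X"
  shows "X = {..<card X}"
proof -
  have "X \<subseteq> {..<card X}"
  proof
    fix j assume "j \<in> X"
    then have "{..j} \<subseteq> X" using assms(2) by auto
    then have "card {..j} \<le> card X" by (rule card_mono[OF assms(1)])
    then show "j \<in> {..<card X}" by simp
  qed
  then show ?thesis by (intro card_subset_eq) auto
qed

text \<open>In descending order the nonzero norms form an initial segment. On it the term of index j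
  equals j and beyond it 0, so the maximum is the length of the segment.\<close>

lemma weak_norm_zero:
  assumes d: "0 < dim_row A"
  shows "weak_norm 0 A = real (card {i. i < dim_row A \<and> row_norm A i \<noteq> 0})"
proof -
  let ?d = "dim_row A" and ?L = "row_norms_desc A"
  define X where "X = {j. j < ?d \<and> ?L ! j \<noteq> 0}"
  define c where "c = card X"
  have nn: "0 \<le> ?L ! j" if "j < ?d" for j
    using that by (simp add: row_norms_desc_eq desc_rows row_norm_nonneg)
  have Xc: "X = {..<c}" unfolding c_def
  proof (rule downward_closed_nat)
    fix i j assume "j \<in> X" "i \<le> j"
    then show "i \<in> X" using row_norms_desc_anti[of i j A] nn[of j] nn[of i] by (force simp: X_def)
  qed (simp add: X_def)
  have "bij_betw (\<lambda>j. desc_rows A ! j) X {i. i < ?d \<and> row_norm A i \<noteq> 0}"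
  proof (rule bij_betwI')
    fix x y assume "x \<in> X" "y \<in> X"
    then show "(desc_rows A ! x = desc_rows A ! y) = (x = y)"
      using desc_rows(2,3)[of A] by (simp add: X_def nth_eq_iff_index_eq)
  next
    fix x assume "x \<in> X"
    then show "desc_rows A ! x \<in> {i. i < ?d \<and> row_norm A i \<noteq> 0}"
    proof -
      have x: "x < ?d" "row_norms_desc A ! x \<noteq> 0" using \<open>x \<in> X\<close> by (simp_all add: X_def)
      have "desc_rows A ! x \<in> set (desc_rows A)" using x(1) by (intro nth_mem) (simp add: desc_rows)
      moreover have "row_norm A (desc_rows A ! x) \<noteq> 0" using x by (simp add: row_norms_desc_eq desc_rows)
      ultimately show ?thesis by (simp add: desc_rows)
    qed
  next
    fix y assume y: "y \<in> {i. i < ?d \<and> row_norm A i \<noteq> 0}"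
    then have "y \<in> set (desc_rows A)" by (simp add: desc_rows)
    then obtain x where "x < ?d" "desc_rows A ! x = y" by (metis in_set_conv_nth desc_rows(3))
    then show "\<exists>x\<in>X. y = desc_rows A ! x" using y by (auto simp: X_def row_norms_desc_eq desc_rows)
  qed
  then have cc: "card {i. i < ?d \<and> row_norm A i \<noteq> 0} = c" unfolding c_def by (simp add: bij_betw_same_card)
  have val: "real (Suc j) * (?L ! j) powr 0 = (if j < c then real (Suc j) else 0)" if "j < ?d" for j
  proof -
    have "j \<in> X \<longleftrightarrow> j < c" unfolding Xc by simp
    moreover have "j \<in> X \<longleftrightarrow> ?L ! j \<noteq> 0" using that by (simp add: X_def)
    ultimately have "j < c \<longleftrightarrow> ?L ! j \<noteq> 0" by blast
    then show ?thesis by simp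
  qed
  have "weak_norm 0 A = Max ((\<lambda>j. if j < c then real (Suc j) else 0) ` {..<?d})"
  proof -
    have "{1..?d} = Suc ` {..<?d}" by (simp add: image_Suc_lessThan)
    then have "(\<lambda>j. real j * (?L ! (j - 1)) powr 0) ` {1..?d} = (\<lambda>j. real (Suc j) * (?L ! j) powr 0) ` {..<?d}"
      by (simp add: image_image)
    also have "\<dots> = (\<lambda>j. if j < c then real (Suc j) else 0) ` {..<?d}" by (intro image_cong refl val) simp
    finally show ?thesis by (simp add: weak_norm_def)
  qed
  also have "\<dots> = real c"
  proof (rule Max_eqI)
    have "card X \<le> card {..<?d}" by (rule card_mono) (auto simp: X_def)
    then have cd: "c \<le> ?d" by (simp add: c_def)
    show "real c \<in> (\<lambda>j. if j < c then real (Suc j) else 0) ` {..<?d}"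
    proof (cases "c = 0")
      case True then show ?thesis using d by (intro image_eqI[of _ _ 0]) auto
    next
      case False then show ?thesis using cd by (intro image_eqI[of _ _ "c - 1"]) auto
    qed
  qed auto
  finally show ?thesis using cc by simp
qed

section \<open>Blocks and operator norms\<close>

text \<open>The selector of the last m coordinates, which also moves them to the origin. The x block
  already sits there, and \<open>idm {..<p}\<close> plays the same role for it.\<close>

definition shiftm :: "nat \<Rightarrow> nat \<Rightarrow> fmat" where
  "shiftm p m = mkf m (p + m) (\<lambda>i j. if j = p + i then 1 else 0)"

lemma ent_shiftm_times: "ent (shiftm p m * A) i j = (if i < m then ent A (p + i) j else 0)"
proof -
  have "dimb (p + m) (shiftm p m)" by (auto simp: dimb_def shiftm_def)
  then have "ent (shiftm p m * A) i j = (\<Sum>k<p + m. ent (shiftm p m) i k * ent A k j)" by (rule ent_times)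
  also have "\<dots> = (\<Sum>k<p + m. if k = p + i \<and> i < m then ent A k j else 0)"
    by (intro sum.cong) (auto simp: shiftm_def)
  also have "\<dots> = (if i < m then ent A (p + i) j else 0)"
    by (cases "i < m") auto
  finally show ?thesis .
qed

lemma ent_times_shiftm: "ent (A * tp (shiftm p m)) i j = (if j < m then ent A i (p + j) else 0)"
proof -
  have "ent (A * tp (shiftm p m)) i j = ent (tp (shiftm p m * tp A)) i j" by (simp add: tp_mult)
  then show ?thesis by (simp only: ent_tp ent_shiftm_times)
qed

lemma emb_block_x: "A \<in> carrier_mat (p + m) (p + m) \<Longrightarrow> emb (block_x p A) = idm {..<p} * emb A * idm {..<p}"
  by (rule fmat_eqI) (auto simp: ent_times_idm ent_idm_times ent_emb block_x_def)

lemma emb_block_y: "A \<in> carrier_mat (p + m) (p + m) \<Longrightarrow> emb (block_y p m A) = shiftm p m * emb A * tp (shiftm p m)"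
  by (rule fmat_eqI) (auto simp: ent_times_shiftm ent_shiftm_times ent_emb block_y_def)

lemma emb_block_xy: "A \<in> carrier_mat (p + m) (p + m) \<Longrightarrow> emb (block_xy p m A) = idm {..<p} * emb A * tp (shiftm p m)"
  by (rule fmat_eqI) (auto simp: ent_times_shiftm ent_idm_times ent_emb block_xy_def)

lemma shiftm_gram: "tp (shiftm p m) * shiftm p m = idm {p..<p + m}"
proof (rule fmat_eqI)
  fix i j
  have "dimb (p + m) (tp (shiftm p m))" by (auto simp: dimb_def shiftm_def)
  then have "ent (tp (shiftm p m) * shiftm p m) i j = (\<Sum>k<p + m. ent (shiftm p m) k i * ent (shiftm p m) k j)"
    by (simp add: ent_times)
  also have "\<dots> = (\<Sum>k<p + m. if k = i - p \<and> i = j \<and> i \<in> {p..<p + m} then 1 else 0)"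
    by (intro sum.cong) (auto simp: shiftm_def)
  also have "\<dots> = ent (idm {p..<p + m}) i j"
    by (cases "i = j \<and> i \<in> {p..<p + m}") (auto simp: ent_idm intro!: sum.neutral)
  finally show "ent (tp (shiftm p m) * shiftm p m) i j = ent (idm {p..<p + m}) i j" .
qed

lemma opb_shiftm: "opb 1 (shiftm p m)"
proof -
  have "norm (shiftm p m * K) \<le> 1 * norm K" for K
  proof -
    have "(norm (shiftm p m * K))\<^sup>2 = inner K (idm {p..<p + m} * K)"
      by (simp add: power2_norm_eq_inner inner_mult_left shiftm_gram mult.assoc[symmetric])
    also have "\<dots> \<le> norm K * norm (idm {p..<p + m} * K)" by (rule norm_cauchy_schwarz)
    also have "\<dots> \<le> norm K * (1 * norm K)" by (intro mult_left_mono opbD opb_idm) auto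
    finally have "(norm (shiftm p m * K))\<^sup>2 \<le> (norm K)\<^sup>2" by (simp add: power2_eq_square)
    then show ?thesis by (simp add: power2_le_iff_abs_le)
  qed
  then show ?thesis by (simp add: opb_def)
qed

lemma idm_shiftm: "finite T \<Longrightarrow> T \<subseteq> {..<m} \<Longrightarrow> idm T * shiftm p m = shiftm p m * idm ((+) p ` T)"
  by (rule fmat_eqI) (auto simp: ent_idm_times ent_times_idm shiftm_def)

section \<open>Operator norms and inverses of dense matrices\<close>

lemma vnorm_cv: "vnorm (vec p z) = norm (cv p z)"
proof -
  have "vnorm (vec p z) = sqrt (\<Sum>i<p. (z i)\<^sup>2)"
    by (simp add: vnorm_def scalar_prod_def lessThan_atLeast0 power2_eq_square)
  then show ?thesis by (simp add: norm_cv[symmetric])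
qed

lemma mult_vec_cv:
  assumes "A \<in> carrier_mat p p"
  shows "A *\<^sub>v vec p z = vec p (\<lambda>i. ent (emb A * cv p z) i 0)"
proof (rule eq_vecI)
  fix i assume i: "i < dim_vec (vec p (\<lambda>i. ent (emb A * cv p z) i 0))"
  then show "(A *\<^sub>v vec p z) $ i = vec p (\<lambda>i. ent (emb A * cv p z) i 0) $ i"
    using assms by (auto simp: ent_times[OF dimb_emb[OF assms]] ent_emb cv_def scalar_prod_def lessThan_atLeast0)
qed (use assms in simp)

lemma op_norm_opb:
  assumes A: "A \<in> carrier_mat p p" and p: "0 < p" and le: "op_norm A \<le> M"
  shows "opb M (emb A)"
proof -
  have vn: "vnorm (A *\<^sub>v vec p z) = norm (emb A * cv p z)" for z
    by (simp add: mult_vec_cv[OF A] vnorm_cv mult_cv[OF dimb_emb[OF A]])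
  let ?V = "{v \<in> carrier_vec (dim_col A). vnorm v = 1}"
  have bdd: "bdd_above ((\<lambda>v. vnorm (A *\<^sub>v v)) ` ?V)"
  proof (rule bdd_aboveI2[of _ _ "norm (emb A)"])
    fix v assume "v \<in> ?V"
    then have v: "v = vec p (\<lambda>i. v $ i)" "vnorm v = 1" using A by auto
    have "vnorm (A *\<^sub>v v) = norm (emb A * cv p (\<lambda>i. v $ i))" using vn[of "\<lambda>i. v $ i"] v(1) by simp
    also have "\<dots> \<le> norm (emb A) * norm (cv p (\<lambda>i. v $ i))" by (rule norm_mult_fmat)
    also have "norm (cv p (\<lambda>i. v $ i)) = 1" using vnorm_cv[of p "\<lambda>i. v $ i"] v by simp
    finally show "vnorm (A *\<^sub>v v) \<le> norm (emb A)" by simp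
  qed
  have unit: "norm (emb A * cv p z) \<le> M" if "norm (cv p z) = 1" for z
  proof -
    have "vnorm (A *\<^sub>v vec p z) \<le> op_norm A"
      unfolding op_norm_def by (rule cSup_upper[OF _ bdd]) (use A that vnorm_cv[of p z] in auto)
    then show ?thesis using le vn by simp
  qed
  have all: "norm (emb A * cv p z) \<le> M * norm (cv p z)" for z
  proof (cases "norm (cv p z) = 0")
    case False
    define c where "c = 1 / norm (cv p z)"
    have e: "cv p (\<lambda>i. c * z i) = c *\<^sub>R cv p z" by (rule fmat_eqI) (simp add: cv_def)
    have "norm (cv p (\<lambda>i. c * z i)) = 1" unfolding e using False by (simp add: c_def)
    from unit[OF this] have "norm (c *\<^sub>R (emb A * cv p z)) \<le> M" unfolding e by simp
    then show ?thesis using False by (simp add: c_def field_simps)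
  qed simp
  \<comment> \<open>A unit vector exists because p is positive; without one the supremum would not
    force M to be nonnegative.\<close>
  have M0: "0 \<le> M"
  proof -
    have "(\<Sum>i<p. (if i = 0 then 1 else (0::real))\<^sup>2) = (\<Sum>i<p. if i = 0 then 1 else 0)" by (intro sum.cong) auto
    then have "(norm (cv p (\<lambda>i. if i = 0 then 1 else 0)))\<^sup>2 = 1\<^sup>2" using p by (simp add: norm_cv)
    then have "norm (cv p (\<lambda>i. if i = 0 then 1 else 0)) = 1" by (simp only: power2_eq_iff_nonneg norm_ge_zero zero_le_one)
    from unit[OF this] show ?thesis using norm_ge_zero order_trans by blast
  qed
  show ?thesis
  proof (rule opb_columns[OF M0])
    fix d z
    have e: "idm {..<p} * cv d z = cv p (\<lambda>i. if i < d then z i else 0)"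
      by (rule fmat_eqI) (auto simp: ent_idm_times cv_def)
    have "emb A * cv d z = emb A * (idm {..<p} * cv d z)"
      using dimb_idm_right[OF dimb_emb[OF A]] by (simp add: mult.assoc[symmetric])
    then have "norm (emb A * cv d z) \<le> M * norm (idm {..<p} * cv d z)" using all by (simp add: e)
    also have "\<dots> \<le> M * (1 * norm (cv d z))" by (intro mult_left_mono opbD opb_idm M0) auto
    finally show "norm (emb A * cv d z) \<le> M * norm (cv d z)" by simp
  qed
qed

lemma minv_emb:
  assumes A: "A \<in> carrier_mat p p" and inv: "invertible_mat A"
  shows "minv A \<in> carrier_mat p p" "emb A * emb (minv A) = idm {..<p}"
proof -
  obtain B where B: "inverts_mat A B" "inverts_mat B A" using inv by (auto simp: invertible_mat_def)
  have AB: "A * B = 1\<^sub>m p" using B(1) A by (simp add: inverts_mat_def)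
  have "dim_col (B * A) = p" using A by simp
  then have Bc: "B \<in> carrier_mat p p" using B(2) AB A unfolding inverts_mat_def
    by (metis carrier_matI carrier_matD index_mult_mat(2,3) index_one_mat(2,3))
  have "Determinant.det A * Determinant.det B = 1" using det_mult[OF A Bc] AB by simp
  then have "Determinant.det A \<noteq> 0" by auto
  then have "A \<in> Units (ring_mat TYPE(real) p undefined)" by (rule det_non_zero_imp_unit[OF A])
  then obtain C where "mat_inverse A = Some C" using mat_inverse(1)[OF A] by fastforce
  then have C: "A * minv A = 1\<^sub>m p" and c: "minv A \<in> carrier_mat p p"
    using mat_inverse(2)[OF A] by (auto simp: minv_def)
  show "minv A \<in> carrier_mat p p" by (rule c)
  show "emb A * emb (minv A) = idm {..<p}" using C emb_mult[OF A c] by (simp add: emb_one)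
qed

lemma inner_columns:
  assumes N: "dimb N A" "dimb N K"
  shows "inner K (A * K) = (\<Sum>j<N. inner (cv N (\<lambda>i. ent K i j)) (A * cv N (\<lambda>i. ent K i j)))"
proof -
  have "inner (cv N (\<lambda>i. ent K i j)) (A * cv N (\<lambda>i. ent K i j)) = (\<Sum>i<N. ent K i j * ent (A * K) i j)" for j
    unfolding inner_cv by (intro sum.cong refl) (simp add: ent_times[OF N(1)] cv_def)
  then show ?thesis unfolding inner_fmat_dimb[OF N(2)] by (subst sum.swap) simp
qed

lemma diag_opb:
  assumes T: "finite T" and c: "0 \<le> c" "\<And>i. i \<in> T \<Longrightarrow> \<bar>a i\<bar> \<le> c"
  shows "opb c (\<Sum>i\<in>T. a i *\<^sub>R idm {i})"
proof -
  let ?D = "\<Sum>i\<in>T. a i *\<^sub>R idm {i}"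
  have e: "ent (?D * K) i j = (if i \<in> T then a i * ent K i j else 0)" for K i j
  proof -
    have "?D * K = (\<Sum>i\<in>T. a i *\<^sub>R (idm {i} * K))" by (simp add: sum_distrib_right)
    then have "ent (?D * K) i j = (\<Sum>x\<in>T. if x = i then a i * ent K i j else 0)"
      by (simp add: ent_sum ent_idm_times if_distrib cong: if_cong) (auto intro!: sum.cong)
    then show ?thesis using T by simp
  qed
  have "norm (?D * K) \<le> c * norm K" for K
  proof -
    obtain N where N: "dimb N K" by (rule dimb_obtain1)
    have dD: "dimb N (?D * K)" using N by (auto simp: dimb_def e)
    have "(norm (?D * K))\<^sup>2 = (\<Sum>i<N. \<Sum>j<N. (ent (?D * K) i j)\<^sup>2)"
      unfolding power2_norm_eq_inner inner_fmat_dimb[OF dD] by (simp add: power2_eq_square)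
    also have "\<dots> \<le> (\<Sum>i<N. \<Sum>j<N. c\<^sup>2 * (ent K i j)\<^sup>2)"
    proof (intro sum_mono)
      fix i j
      have "(a i)\<^sup>2 \<le> c\<^sup>2" if "i \<in> T" using c(2)[OF that] c(1) by (simp add: abs_le_square_iff[symmetric])
      then show "(ent (?D * K) i j)\<^sup>2 \<le> c\<^sup>2 * (ent K i j)\<^sup>2"
        by (auto simp: e power_mult_distrib intro!: mult_right_mono)
    qed
    also have "\<dots> = (c * norm K)\<^sup>2"
      unfolding power_mult_distrib power2_norm_eq_inner inner_fmat_dimb[OF N]
      by (simp add: sum_distrib_left power2_eq_square)
    finally show ?thesis by (rule power2_le_imp_le) (use c in simp)
  qed
  then show ?thesis by (simp add: opb_def)
qed

lemma emb_mat_diag: "emb (mat_diag n f) = (\<Sum>i<n. f i *\<^sub>R idm {i})"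
proof (rule fmat_eqI)
  fix i j
  have "ent (\<Sum>i<n. f i *\<^sub>R idm {i}) i j = (\<Sum>x<n. if x = i \<and> i = j then f i else 0)"
    by (simp add: ent_sum) (auto intro!: sum.cong simp: ent_idm)
  also have "\<dots> = (if i < n \<and> i = j then f i else 0)" by (cases "i = j") auto
  finally show "ent (emb (mat_diag n f)) i j = ent (\<Sum>i<n. f i *\<^sub>R idm {i}) i j"
    by (auto simp: ent_emb mat_diag_def)
qed

section \<open>The parameter space\<close>

locale fq =
  fixes q su sv lam kap M :: real and p m r :: nat and S U V :: "real mat" and l :: "nat \<Rightarrow> real"
  assumes pm: "0 < p" "0 < m" and r: "0 < r" "r \<le> min p m" and M1: "1 < M" and kap1: "1 < kap"
    and covS: "covariance_mat (p + m) S"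
    and dec: "Fq_decomp q su sv p m r lam kap M S U V l"
begin

definition "rb = min p m"
definition "Sf = emb S"
definition "Sx = emb (block_x p S)"
definition "Sy = emb (block_y p m S)"
definition "Sxy = emb (block_xy p m S)"
definition "Uf = emb U"
definition "Vf = emb V"
definition "u = emb (first_cols r U)"
definition "v = emb (first_cols r V)"
definition "u2 = Uf * idm {r..<rb}"
definition "v2 = Vf * idm {r..<rb}"
definition "L = (\<Sum>i<r. l (Suc i) *\<^sub>R idm {i})"
definition "L2 = (\<Sum>i\<in>{r..<rb}. l (Suc i) *\<^sub>R idm {i})"

lemma Sc: "S \<in> carrier_mat (p + m) (p + m)" and Ssym: "S\<^sup>T = S"
  using covS by (auto simp: covariance_mat_def)

lemma U: "U \<in> carrier_mat p rb" and V: "V \<in> carrier_mat m rb"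
  using dec by (auto simp: Fq_decomp_def Let_def rb_def)

lemma r_rb: "r \<le> rb" using r by (simp add: rb_def)

lemma tS: "tp Sf = Sf" unfolding Sf_def by (metis Ssym emb_transpose)

lemma dS: "dimb (p + m) Sf" unfolding Sf_def by (rule dimb_emb[OF Sc])

lemma Sx_eq: "Sx = idm {..<p} * Sf * idm {..<p}"
  unfolding Sx_def Sf_def by (rule emb_block_x[OF Sc])
lemma Sy_eq: "Sy = shiftm p m * Sf * tp (shiftm p m)"
  unfolding Sy_def Sf_def by (rule emb_block_y[OF Sc])
lemma Sxy_eq: "Sxy = idm {..<p} * Sf * tp (shiftm p m)"
  unfolding Sxy_def Sf_def by (rule emb_block_xy[OF Sc])

lemma tSx: "tp Sx = Sx" and tSy: "tp Sy = Sy"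
  by (simp_all add: Sx_eq Sy_eq tp_simps tS mult.assoc)

lemma psd: "0 \<le> inner K (Sf * K)"
proof -
  have vec: "0 \<le> inner (cv (p + m) z) (Sf * cv (p + m) z)" for z
  proof -
    have "0 \<le> vec (p + m) z \<bullet> (S *\<^sub>v vec (p + m) z)" using covS by (simp add: covariance_mat_def)
    also have "\<dots> = qf (p + m) (ent Sf) z"
      using Sc by (auto simp: qf_def Sf_def ent_emb scalar_prod_def lessThan_atLeast0 sum_distrib_left mult_ac intro!: sum.cong)
    finally show ?thesis by (simp add: qf_inner[OF dS])
  qed
  obtain N where N: "dimb N Sf" "dimb N K" by (rule dimb_obtain2)
  show ?thesis unfolding inner_columns[OF N]
  proof (rule sum_nonneg)
    fix j
    let ?c = "cv N (\<lambda>i. ent K i j)"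
    have e: "idm {..<p + m} * ?c = cv (p + m) (\<lambda>i. if i < N then ent K i j else 0)"
      by (rule fmat_eqI) (auto simp: ent_idm_times cv_def)
    have "inner ?c (Sf * ?c) = inner (idm {..<p + m} * ?c) (Sf * (idm {..<p + m} * ?c))"
      using dimb_idm_left[OF dS] dimb_idm_right[OF dS]
      by (simp add: inner_mult_left mult.assoc[symmetric])
    also have "\<dots> \<ge> 0" unfolding e by (rule vec)
    finally show "0 \<le> inner ?c (Sf * ?c)" .
  qed
qed

lemma psd_x: "0 \<le> inner K (Sx * K)"
  using psd[of "idm {..<p} * K"] by (simp add: Sx_eq inner_mult_left mult.assoc)
lemma psd_y: "0 \<le> inner K (Sy * K)"
  using psd[of "tp (shiftm p m) * K"] by (simp add: Sy_eq inner_mult_left mult.assoc)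

lemma oSx: "opb M Sx" and oSy: "opb M Sy"
  using dec pm unfolding Sx_def Sy_def
  by (auto intro!: op_norm_opb simp: Fq_decomp_def Let_def block_x_def block_y_def)

text \<open>The form is nonnegative at M K minus the inverse of A applied to K. Expanding, and
  bounding the term with the inverse by its operator norm, gives the claim without square roots of
  matrices.\<close>

lemma lower_general:
  assumes A: "A \<in> carrier_mat k k" and k: "0 < k" and inv: "invertible_mat A" and le: "op_norm (minv A) \<le> M"
    and tA: "tp (emb A) = emb A" and ps: "\<And>K. 0 \<le> inner K (emb A * K)" and K: "idm {..<k} * K = K"
  shows "(norm K)\<^sup>2 \<le> M * inner K (emb A * K)"
proof -
  note mi = minv_emb[OF A inv]
  define B where "B = emb (minv A)"
  have oB: "opb M B" unfolding B_def by (rule op_norm_opb[OF mi(1) k le])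
  have AB: "emb A * (B * K) = K" using mi(2) K by (simp add: B_def mult.assoc[symmetric])
  have "0 \<le> inner (M *\<^sub>R K - B * K) (emb A * (M *\<^sub>R K - B * K))" by (rule ps)
  also have "\<dots> = M\<^sup>2 * inner K (emb A * K) - 2 * M * (norm K)\<^sup>2 + inner (B * K) K"
  proof -
    have "inner (B * K) (emb A * K) = inner (emb A * (B * K)) K" by (simp add: inner_mult_left tA)
    also have "\<dots> = (norm K)\<^sup>2" by (simp add: AB power2_norm_eq_inner)
    finally show ?thesis
      by (simp add: right_diff_distrib AB inner_diff_left inner_diff_right power2_norm_eq_inner)
        (simp add: power2_eq_square algebra_simps)
  qed
  also have "inner (B * K) K \<le> M * (norm K)\<^sup>2"
  proof -
    have "inner (B * K) K \<le> norm (B * K) * norm K" by (rule norm_cauchy_schwarz)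
    also have "\<dots> \<le> M * norm K * norm K" by (intro mult_right_mono opbD[OF oB]) auto
    finally show ?thesis by (simp add: power2_eq_square)
  qed
  finally have "M * (norm K)\<^sup>2 \<le> M * (M * inner K (emb A * K))" by (simp add: power2_eq_square algebra_simps)
  then show ?thesis using M1 by simp
qed

lemma lower_x: "idm {..<p} * K = K \<Longrightarrow> (norm K)\<^sup>2 \<le> M * inner K (Sx * K)"
  using dec pm tSx psd_x unfolding Sx_def
  by (intro lower_general) (auto simp: Fq_decomp_def Let_def block_x_def)
lemma lower_y: "idm {..<m} * K = K \<Longrightarrow> (norm K)\<^sup>2 \<le> M * inner K (Sy * K)"
  using dec pm tSy psd_y unfolding Sy_def
  by (intro lower_general) (auto simp: Fq_decomp_def Let_def block_y_def)

text \<open>Nonnegativity at the difference of the x part and the y part bounds the cross terms by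
  the diagonal ones. Hence the joint form is at most twice the sum of the two block forms, each at
  most M.\<close>

lemma upper: "inner K (Sf * K) \<le> 4 * M * (norm K)\<^sup>2"
proof -
  define a where "a = idm {..<p} * K"
  define b where "b = shiftm p m * K"
  define b' where "b' = tp (shiftm p m) * b"
  have ab: "a + b' = idm {..<p + m} * K"
  proof -
    have "a + b' = (idm {..<p} + idm {p..<p + m}) * K"
      by (simp add: a_def b'_def b_def mult.assoc[symmetric] shiftm_gram distrib_right)
    also have "idm {..<p} + idm {p..<p + m} = idm {..<p + m}" by (rule fmat_eqI) (auto simp: ent_idm)
    finally show ?thesis .
  qed
  have "inner K (Sf * K) = inner (a + b') (Sf * (a + b'))"
    unfolding ab using dimb_idm_left[OF dS] dimb_idm_right[OF dS]
    by (simp add: inner_mult_left mult.assoc[symmetric])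
  also have "\<dots> \<le> 2 * inner a (Sf * a) + 2 * inner b' (Sf * b')"
    using psd[of "a - b'"] by (simp add: algebra_simps inner_diff_left inner_diff_right inner_add_left inner_add_right)
  also have "inner a (Sf * a) \<le> M * (norm K)\<^sup>2"
  proof -
    have "inner a (Sf * a) = inner K (Sx * K)" by (simp add: a_def Sx_eq inner_mult_left mult.assoc)
    also have "\<dots> \<le> norm K * (M * norm K)"
      by (intro order_trans[OF norm_cauchy_schwarz] mult_left_mono opbD[OF oSx]) auto
    finally show ?thesis by (simp add: power2_eq_square mult_ac)
  qed
  also have "inner b' (Sf * b') \<le> M * (norm K)\<^sup>2"
  proof -
    have "inner b' (Sf * b') = inner b (Sy * b)" by (simp add: b'_def Sy_eq inner_mult_left mult.assoc)
    also have "\<dots> \<le> norm b * (M * norm b)"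
      by (intro order_trans[OF norm_cauchy_schwarz] mult_left_mono opbD[OF oSy]) auto
    also have "\<dots> \<le> norm K * (M * norm K)"
      using opbD[OF opb_shiftm, of p m K] M1 by (intro mult_mono mult_left_mono) (auto simp: b_def)
    finally show ?thesis by (simp add: power2_eq_square mult_ac)
  qed
  finally show ?thesis by simp
qed

lemma USU: "tp Uf * Sx * Uf = idm {..<rb}" and VSV: "tp Vf * Sy * Vf = idm {..<rb}"
proof -
  have c: "block_x p S \<in> carrier_mat p p" "block_y p m S \<in> carrier_mat m m" by (auto simp: block_x_def block_y_def)
  have "U\<^sup>T * block_x p S * U = 1\<^sub>m rb" "V\<^sup>T * block_y p m S * V = 1\<^sub>m rb"
    using dec by (auto simp: Fq_decomp_def Let_def rb_def)
  moreover have "emb (U\<^sup>T * block_x p S * U) = tp Uf * Sx * Uf"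
    using emb_mult[of "U\<^sup>T * block_x p S" rb p U rb] emb_mult[of "U\<^sup>T" rb p "block_x p S" p] U c
    by (simp add: Uf_def Sx_def emb_transpose)
  moreover have "emb (V\<^sup>T * block_y p m S * V) = tp Vf * Sy * Vf"
    using emb_mult[of "V\<^sup>T * block_y p m S" rb m V rb] emb_mult[of "V\<^sup>T" rb m "block_y p m S" m] V c
    by (simp add: Vf_def Sy_def emb_transpose)
  ultimately show "tp Uf * Sx * Uf = idm {..<rb}" "tp Vf * Sy * Vf = idm {..<rb}" by (metis emb_one)+
qed

lemma UI: "Uf * idm {..<rb} = Uf" and VI: "Vf * idm {..<rb} = Vf"
  using U V by (auto intro!: fmat_eqI simp: Uf_def Vf_def ent_times_idm ent_emb)
lemma IU: "idm {..<p} * Uf = Uf" and IV: "idm {..<m} * Vf = Vf"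
  using U V by (auto intro!: fmat_eqI simp: Uf_def Vf_def ent_idm_times ent_emb)

lemma u_eq: "u = Uf * idm {..<r}" and v_eq: "v = Vf * idm {..<r}"
  using U V r_rb by (auto intro!: fmat_eqI simp: u_def v_def Uf_def Vf_def ent_times_idm ent_emb first_cols_def)

lemma uI: "u * idm {..<r} = u" and vI: "v * idm {..<r} = v"
  by (simp_all add: u_eq v_eq mult.assoc)

lemma idm_sandwich: "finite A \<Longrightarrow> finite B \<Longrightarrow> finite C \<Longrightarrow> idm A * idm B * idm C = idm (A \<inter> B \<inter> C)"
  by (simp add: idm_idm)

lemma uSu: "tp u * Sx * u = idm {..<r}" and vSv: "tp v * Sy * v = idm {..<r}"
proof -
  have i: "{..<r} \<inter> {..<rb} \<inter> {..<r} = {..<r}" using r_rb by auto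
  have "tp u * Sx * u = idm {..<r} * (tp Uf * Sx * Uf) * idm {..<r}" by (simp add: u_eq tp_mult mult.assoc)
  then show "tp u * Sx * u = idm {..<r}" unfolding USU by (simp only: idm_sandwich finite_lessThan i)
  have "tp v * Sy * v = idm {..<r} * (tp Vf * Sy * Vf) * idm {..<r}" by (simp add: v_eq tp_mult mult.assoc)
  then show "tp v * Sy * v = idm {..<r}" unfolding VSV by (simp only: idm_sandwich finite_lessThan i)
qed

lemma idm_empty: "idm {} = 0" by (rule fmat_eqI) (simp add: ent_idm)

lemma u2Su: "tp u2 * Sx * u = 0" and v2Sv: "tp v2 * Sy * v = 0"
proof -
  have i: "{r..<rb} \<inter> {..<rb} \<inter> {..<r} = {}" by auto
  have "tp u2 * Sx * u = idm {r..<rb} * (tp Uf * Sx * Uf) * idm {..<r}" by (simp add: u_eq u2_def tp_mult mult.assoc)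
  then show "tp u2 * Sx * u = 0" unfolding USU by (simp only: idm_sandwich finite_lessThan finite_atLeastLessThan i idm_empty)
  have "tp v2 * Sy * v = idm {r..<rb} * (tp Vf * Sy * Vf) * idm {..<r}" by (simp add: v_eq v2_def tp_mult mult.assoc)
  then show "tp v2 * Sy * v = 0" unfolding VSV by (simp only: idm_sandwich finite_lessThan finite_atLeastLessThan i idm_empty)
qed

lemma oU: "opb M Uf" and oV: "opb M Vf"
proof -
  have g: "opb M A" if low: "\<And>K. (norm (A * K))\<^sup>2 \<le> M * inner (A * K) (B * (A * K))"
      and ABA: "tp A * B * A = idm {..<rb}" for A B
    unfolding opb_def
  proof
    fix K
    have "inner (A * K) (B * (A * K)) = inner K ((tp A * B * A) * K)" by (simp add: inner_mult_left mult.assoc)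
    also have "\<dots> \<le> norm K * norm (idm {..<rb} * K)" unfolding ABA by (rule norm_cauchy_schwarz)
    also have "\<dots> \<le> norm K * (1 * norm K)" by (intro mult_left_mono opbD opb_idm) auto
    finally have "M * inner (A * K) (B * (A * K)) \<le> M * (norm K * norm K)" using M1 by simp
    then have "(norm (A * K))\<^sup>2 \<le> M * (norm K)\<^sup>2" using low[of K] by (simp add: power2_eq_square)
    also have "\<dots> \<le> M\<^sup>2 * (norm K)\<^sup>2" using M1 by (intro mult_right_mono) (auto simp: power2_eq_square)
    finally show "norm (A * K) \<le> M * norm K"
      using M1 by (simp add: power_mult_distrib[symmetric] power2_le_iff_abs_le)
  qed
  show "opb M Uf" by (rule g[OF lower_x USU]) (simp add: mult.assoc[symmetric] IU)
  show "opb M Vf" by (rule g[OF lower_y VSV]) (simp add: mult.assoc[symmetric] IV)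
qed

lemma ou: "opb M u" and ov: "opb M v" and ou2: "opb M u2" and ov2: "opb M v2"
  using opb_mult[OF oU opb_idm] opb_mult[OF oV opb_idm] by (auto simp: u_eq v_eq u2_def v2_def)

lemma l_mono: "1 \<le> i \<Longrightarrow> i \<le> j \<Longrightarrow> j \<le> rb \<Longrightarrow> l j \<le> l i"
proof -
  assume i: "1 \<le> i" and "i \<le> j" "j \<le> rb"
  from this(2,3) show "l j \<le> l i"
  proof (induction j rule: dec_induct)
    case (step j)
    have "l (Suc j) \<le> l j" using dec step i by (simp add: Fq_decomp_def Let_def rb_def)
    then show ?case using step by simp
  qed simp
qed

lemma l_nonneg: "1 \<le> i \<Longrightarrow> i \<le> rb \<Longrightarrow> 0 \<le> l i"
proof -
  assume "1 \<le> i" "i \<le> rb"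
  then have "l rb \<le> l i" by (intro l_mono) auto
  moreover have "0 \<le> l rb" using dec by (simp add: Fq_decomp_def Let_def rb_def)
  ultimately show ?thesis by simp
qed

lemma lam: "0 < lam" "kap * lam < 1" and l1: "l 1 < 1" "l 1 \<le> kap * lam" and lr: "lam \<le> l r"
  using dec by (auto simp: Fq_decomp_def Let_def)

lemma l_lower: "i < r \<Longrightarrow> lam \<le> l (Suc i)"
  using lr l_mono[of "Suc i" r] r_rb by force

lemma oL: "opb (kap * lam) L"
  unfolding L_def
proof (rule diag_opb)
  show "0 \<le> kap * lam" using kap1 lam by simp
  fix i assume "i \<in> {..<r}"
  then have "l (Suc i) \<le> l 1" "0 \<le> l (Suc i)" using r_rb by (auto intro!: l_mono l_nonneg)
  then show "\<bar>l (Suc i)\<bar> \<le> kap * lam" using l1 by simp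
qed simp

lemma oL2: assumes c: "0 \<le> c" "(if r < min p m then l (r + 1) else 0) \<le> c * lam" shows "opb (c * lam) L2"
  unfolding L2_def
proof (rule diag_opb)
  show "0 \<le> c * lam" using c lam by simp
  fix i assume i: "i \<in> {r..<rb}"
  then have "l (Suc i) \<le> l (Suc r)" "0 \<le> l (Suc i)" by (auto intro!: l_mono l_nonneg)
  then show "\<bar>l (Suc i)\<bar> \<le> c * lam" using c(2) i by (simp add: rb_def)
qed simp

definition "Lf = (\<Sum>i<rb. l (Suc i) *\<^sub>R idm {i})"

lemma Sxy_Lf: "Sxy = Sx * (Uf * Lf * tp Vf) * Sy"
proof -
  let ?D = "mat_diag rb (\<lambda>i. l (i + 1))"
  have c: "block_x p S \<in> carrier_mat p p" "block_y p m S \<in> carrier_mat m m" "?D \<in> carrier_mat rb rb"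
    by (auto simp: block_x_def block_y_def mat_diag_def)
  have "block_xy p m S = block_x p S * (U * ?D * V\<^sup>T) * block_y p m S"
    using dec by (auto simp: Fq_decomp_def Let_def rb_def)
  then have "Sxy = emb (block_x p S * (U * ?D * V\<^sup>T) * block_y p m S)" by (simp add: Sxy_def)
  also have "\<dots> = emb (block_x p S) * (emb U * emb ?D * emb (V\<^sup>T)) * emb (block_y p m S)"
  proof -
    have 1: "emb (U * ?D) = emb U * emb ?D" by (rule emb_mult[OF U c(3)])
    have UD: "U * ?D \<in> carrier_mat p rb" using U c(3) by simp
    have VT: "V\<^sup>T \<in> carrier_mat rb m" using V by simp
    have 2: "emb (U * ?D * V\<^sup>T) = emb (U * ?D) * emb (V\<^sup>T)" by (rule emb_mult[OF UD VT])
    have UDV: "U * ?D * V\<^sup>T \<in> carrier_mat p m" using UD VT by simp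
    have 3: "emb (block_x p S * (U * ?D * V\<^sup>T)) = emb (block_x p S) * emb (U * ?D * V\<^sup>T)" by (rule emb_mult[OF c(1) UDV])
    have B: "block_x p S * (U * ?D * V\<^sup>T) \<in> carrier_mat p m" using c(1) UDV by simp
    show ?thesis using emb_mult[OF B c(2)] 1 2 3 by simp
  qed
  also have "emb ?D = Lf" by (simp add: emb_mat_diag Lf_def)
  finally show ?thesis by (simp add: Sx_def Sy_def Uf_def Vf_def emb_transpose)
qed

lemma diag_idm: "finite T \<Longrightarrow> idm T * (\<Sum>i\<in>T. a i *\<^sub>R idm {i}) = (\<Sum>i\<in>T. a i *\<^sub>R idm {i})"
  "finite T \<Longrightarrow> (\<Sum>i\<in>T. a i *\<^sub>R idm {i}) * idm T = (\<Sum>i\<in>T. a i *\<^sub>R idm {i})"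
  by (auto simp: sum_distrib_left sum_distrib_right idm_idm intro!: sum.cong)

lemma Sxy_split: "Sxy = Sx * (u * L * tp v + u2 * L2 * tp v2) * Sy"
proof -
  have "Lf = L + L2"
    unfolding Lf_def L_def L2_def using r_rb
    by (subst sum.union_disjoint[symmetric]) (auto simp: ivl_disj_un intro!: sum.cong)
  moreover have "u * L * tp v = Uf * L * tp Vf"
  proof -
    have "u * L * tp v = Uf * (idm {..<r} * L * idm {..<r}) * tp Vf" by (simp add: u_eq v_eq tp_mult mult.assoc)
    also have "idm {..<r} * L * idm {..<r} = L" unfolding L_def by (simp only: diag_idm finite_lessThan)
    finally show ?thesis .
  qed
  moreover have "u2 * L2 * tp v2 = Uf * L2 * tp Vf"
  proof -
    have "u2 * L2 * tp v2 = Uf * (idm {r..<rb} * L2 * idm {r..<rb}) * tp Vf" by (simp add: u2_def v2_def tp_mult mult.assoc)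
    also have "idm {r..<rb} * L2 * idm {r..<rb} = L2" unfolding L2_def by (simp only: diag_idm finite_atLeastLessThan)
    finally show ?thesis .
  qed
  ultimately show ?thesis unfolding Sxy_Lf by (simp add: distrib_left distrib_right)
qed

text \<open>Since all canonical correlations are below 1, the joint covariance is positive definite.\<close>

lemma posdef: "pdf (p + m) (ent Sf)"
  unfolding pdf_def
proof (intro allI impI)
  fix z :: "nat \<Rightarrow> real" assume z: "\<exists>i<p + m. z i \<noteq> 0"
  define w where "w = cv (p + m) z"
  define a where "a = idm {..<p} * w"
  define b where "b = shiftm p m * w"
  have l1n: "0 \<le> l 1" using l_nonneg[of 1] pm by (simp add: rb_def)
  have ab: "a + tp (shiftm p m) * b = w"
  proof -
    have "a + tp (shiftm p m) * b = (idm {..<p} + idm {p..<p + m}) * w"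
      by (simp add: a_def b_def mult.assoc[symmetric] shiftm_gram distrib_right)
    also have "idm {..<p} + idm {p..<p + m} = idm {..<p + m}" by (rule fmat_eqI) (auto simp: ent_idm)
    also have "idm {..<p + m} * w = w" unfolding w_def by (rule fmat_eqI) (auto simp: ent_idm_times cv_def)
    finally show ?thesis .
  qed
  have Ia: "idm {..<p} * a = a" by (simp add: a_def mult.assoc[symmetric])
  have Ib: "idm {..<m} * b = b" unfolding b_def by (rule fmat_eqI) (simp add: ent_idm_times ent_shiftm_times)
  define x where "x = inner a (Sx * a)"
  define y where "y = inner b (Sy * b)"
  have x0: "0 \<le> x" "0 \<le> y" by (auto simp: x_def y_def psd_x psd_y)
  define P where "P = norm (tp Uf * Sx * a)"
  define Q where "Q = norm (tp Vf * Sy * b)"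
  have P: "P\<^sup>2 \<le> x" unfolding P_def x_def by (rule bessel_psd[OF tSx psd_x USU _ UI]) simp
  have Q: "Q\<^sup>2 \<le> y" unfolding Q_def y_def by (rule bessel_psd[OF tSy psd_y VSV _ VI]) simp
  have oLf: "opb (l 1) Lf" unfolding Lf_def
  proof (rule diag_opb)
    fix i assume "i \<in> {..<rb}"
    then have "l (Suc i) \<le> l 1" "0 \<le> l (Suc i)" by (auto intro!: l_mono l_nonneg)
    then show "\<bar>l (Suc i)\<bar> \<le> l 1" by simp
  qed (use l1n in auto)
  have cross: "\<bar>inner a (Sxy * b)\<bar> \<le> l 1 * (P * Q)"
  proof -
    have "inner a (Sxy * b) = inner (tp Uf * Sx * a) (Lf * (tp Vf * Sy * b))"
      unfolding Sxy_Lf by (simp add: inner_mult_left' tSx mult.assoc tp_simps)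
    then have "\<bar>inner a (Sxy * b)\<bar> \<le> P * norm (Lf * (tp Vf * Sy * b))" by (simp add: P_def Cauchy_Schwarz_ineq2)
    also have "\<dots> \<le> P * (l 1 * Q)" unfolding Q_def by (intro mult_left_mono opbD[OF oLf]) (simp add: P_def)
    finally show ?thesis by (simp add: mult_ac)
  qed
  \<comment> \<open>Together with Bessel's inequality for P and Q, the cross terms take away at most
    the fraction \<open>l 1\<close> of x + y.\<close>
  have "2 * (P * Q) \<le> P\<^sup>2 + Q\<^sup>2" using sum_squares_bound[of P Q] by simp
  then have "2 * (P * Q) \<le> x + y" using P Q by simp
  then have "l 1 * (2 * (P * Q)) \<le> l 1 * (x + y)" using l1n by (rule mult_left_mono)
  then have "2 * \<bar>inner a (Sxy * b)\<bar> \<le> l 1 * (x + y)" using cross by simp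
  moreover have "qf (p + m) (ent Sf) z = x + 2 * inner a (Sxy * b) + y"
  proof -
    have "qf (p + m) (ent Sf) z = inner (a + tp (shiftm p m) * b) (Sf * (a + tp (shiftm p m) * b))"
      by (simp add: qf_inner[OF dS] ab w_def)
    also have "\<dots> = inner a (Sf * a) + inner a (Sf * (tp (shiftm p m) * b)) + inner (tp (shiftm p m) * b) (Sf * a)
        + inner (tp (shiftm p m) * b) (Sf * (tp (shiftm p m) * b))"
      by (simp add: distrib_left inner_add_left inner_add_right)
    also have "inner a (Sf * a) = x"
      using Ia by (simp add: x_def Sx_eq mult.assoc) (metis inner_mult_left tp_idm)
    also have "inner a (Sf * (tp (shiftm p m) * b)) = inner a (Sxy * b)"
      using Ia by (simp add: Sxy_eq mult.assoc) (metis inner_mult_left tp_idm)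
    also have "inner (tp (shiftm p m) * b) (Sf * a) = inner a (Sf * (tp (shiftm p m) * b))"
      by (metis inner_commute inner_mult_left tS)
    also have "inner a (Sf * (tp (shiftm p m) * b)) = inner a (Sxy * b)"
      using Ia by (simp add: Sxy_eq mult.assoc) (metis inner_mult_left tp_idm)
    also have "inner (tp (shiftm p m) * b) (Sf * (tp (shiftm p m) * b)) = y"
      by (simp add: y_def Sy_eq inner_mult_left mult.assoc)
    finally show ?thesis by simp
  qed
  ultimately have "(1 - l 1) * (x + y) \<le> qf (p + m) (ent Sf) z" by (simp add: algebra_simps)
  moreover have "0 < x + y"
  proof (rule ccontr)
    assume "\<not> 0 < x + y"
    then have "x = 0" "y = 0" using x0 by auto
    then have "(norm a)\<^sup>2 \<le> 0" "(norm b)\<^sup>2 \<le> 0" using lower_x[OF Ia] lower_y[OF Ib] by (auto simp: x_def y_def)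
    then have "a = 0" "b = 0" by auto
    then have "w = 0" using ab by simp
    then have "ent w i 0 = 0" for i by simp
    moreover have "ent w i 0 = z i" if "i < p + m" for i using that by (simp add: w_def cv_def)
    ultimately show False using z by metis
  qed
  then have "0 < (1 - l 1) * (x + y)" using l1(1) by simp
  ultimately show "0 < qf (p + m) (ent Sf) z" by linarith
qed

end

section \<open>Supports, truncations and comparators\<close>

text \<open>Otherwise the r by r identity would factor as P Q through fewer than r coordinates, E
  being the compression of T to an initial segment. For square matrices Q P is then the identity as
  well, although Q has a zero row.\<close>

lemma rank_support:
  assumes T: "finite T" and A: "idm T * A = A" "A * idm {..<r} = A" and AHA: "tp A * H * A = idm {..<r}"
  shows "r \<le> card T"
proof (rule ccontr)
  assume "\<not> r \<le> card T"
  then have k: "card T < r" by simp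
  obtain f where f: "bij_betw f {0..<card T} T" using ex_bij_betw_nat_finite[OF T] by blast
  obtain N where N: "\<forall>x\<in>T. x < N" using T finite_nat_set_iff_bounded by blast
  define E where "E = mkf (card T) N (\<lambda>i j. if j = f i then 1 else 0)"
  have fT: "f i \<in> T" if "i < card T" for i using f that bij_betwE by force
  have EE: "tp E * E = idm T"
  proof (rule fmat_eqI)
    fix i j
    have "dimb (max (card T) N) (tp E)" by (auto simp: dimb_def E_def)
    then have "ent (tp E * E) i j = (\<Sum>k<max (card T) N. ent E k i * ent E k j)" by (simp add: ent_times)
    also have "\<dots> = (\<Sum>k<card T. ent E k i * ent E k j)"
      by (rule sum.mono_neutral_right) (auto simp: E_def)
    also have "\<dots> = (\<Sum>k\<in>{0..<card T}. if f k = i then (if i = j then 1 else 0) else 0)"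
      using N fT by (intro sum.cong) (auto simp: E_def)
    also have "\<dots> = (\<Sum>x\<in>T. if x = i then (if i = j then 1 else 0) else 0)"
      by (rule sum.reindex_bij_betw[OF f])
    also have "\<dots> = ent (idm T) i j" using T by (simp add: ent_idm)
    finally show "ent (tp E * E) i j = ent (idm T) i j" .
  qed
  define P where "P = tp A * H * tp E"
  define Q where "Q = E * A"
  have IA: "idm {..<r} * tp A = tp A" using A(2) by (metis tp_idm tp_mult)
  have "P * Q = tp A * H * ((tp E * E) * A)" by (simp add: P_def Q_def mult.assoc)
  then have PQ: "P * Q = idm {..<r}" by (simp add: EE A AHA[symmetric] mult.assoc)
  have Ek: "ent E i j = 0" if "card T \<le> i" for i j using that by (simp add: E_def)
  have dP: "dimb r P"
    unfolding dimb_def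
  proof (intro allI impI)
    fix i j assume ij: "r \<le> i \<or> r \<le> j"
    have "ent (idm {..<r} * P) i j = ent P i j" using IA by (simp add: P_def mult.assoc[symmetric])
    then have "r \<le> i \<Longrightarrow> ent P i j = 0" by (simp add: ent_idm_times split: if_splits)
    moreover have "r \<le> j \<Longrightarrow> ent P i j = 0" unfolding P_def using Ek k by (intro ent_zero_col) simp
    ultimately show "ent P i j = 0" using ij by blast
  qed
  have dQ: "dimb r Q"
    unfolding dimb_def
  proof (intro allI impI)
    fix i j assume ij: "r \<le> i \<or> r \<le> j"
    have "ent (Q * idm {..<r}) i j = ent Q i j" using A(2) by (simp add: Q_def mult.assoc)
    then have "r \<le> j \<Longrightarrow> ent Q i j = 0" by (simp add: ent_times_idm split: if_splits)
    moreover have "r \<le> i \<Longrightarrow> ent Q i j = 0" unfolding Q_def using Ek k by (intro ent_zero_row) simp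
    ultimately show "ent Q i j = 0" using ij by blast
  qed
  have "Q * P = idm {..<r}" by (rule one_sided_inverse[OF dP dQ PQ])
  moreover have "ent (Q * P) (card T) (card T) = 0"
    unfolding Q_def mult.assoc by (rule ent_zero_row) (simp add: Ek)
  ultimately show False using k by (simp add: ent_idm)
qed

lemma row_norm_zero_iff:
  assumes "A \<in> carrier_mat p r" "i < p"
  shows "row_norm A i = 0 \<longleftrightarrow> (\<forall>j. ent (emb A) i j = 0)"
proof -
  have "row_norm A i = 0 \<longleftrightarrow> (row_norm A i)\<^sup>2 = 0" by simp
  also have "\<dots> \<longleftrightarrow> (\<forall>j<r. A $$ (i, j) = 0)"
    using assms by (auto simp: row_norm_sq sum_nonneg_eq_0_iff)
  finally show ?thesis using assms by (auto simp: ent_emb)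
qed

lemma support_rows:
  assumes A: "A \<in> carrier_mat p r" and p: "0 < p" and w: "weak_norm 0 A = real k"
  obtains T where "T \<subseteq> {..<p}" "card T = k" "idm T * emb A = emb A"
proof (rule that[of "{i. i < p \<and> row_norm A i \<noteq> 0}"])
  let ?T = "{i. i < p \<and> row_norm A i \<noteq> 0}"
  show "?T \<subseteq> {..<p}" by auto
  show "card ?T = k" using weak_norm_zero[of A] A p w by simp
  show "idm ?T * emb A = emb A"
  proof (rule fmat_eqI)
    fix i j
    have "i \<notin> ?T \<Longrightarrow> ent (emb A) i j = 0"
      using row_norm_zero_iff[OF A, of i] A by (cases "i < p") (auto simp: ent_emb)
    then show "ent (idm ?T * emb A) i j = ent (emb A) i j" by (simp add: ent_idm_times)
  qed
qed

text \<open>The estimation problem prescribes exactly k nonzero rows. Rows of A that vanish on T are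
  therefore replaced by tiny nonzero ones, at the cost e in squared norm.\<close>

lemma truncate:
  fixes q s lam e :: real and n r k p :: nat and A :: "real mat"
  assumes q: "0 \<le> q" "q < 2" and s: "0 < s" and lam: "0 < lam" and n: "0 < n" and r: "0 < r"
    and A: "A \<in> carrier_mat p r" and p: "0 < p" and w: "weak_norm q A \<le> s" and k: "int k = eff_k q s p n r lam"
    and e: "0 < e"
  obtains T w where "T \<subseteq> {..<p}" "card T = k" "suppd ({..<p} \<times> {..<r}) w" "idm T * w = w"
    "\<And>i. i \<in> T \<Longrightarrow> \<exists>j. ent w i j \<noteq> 0"
    "(norm (w - emb A))\<^sup>2 \<le> (2 + q) / (2 - q) * (real k * (real r + ln (exp 1 * real p / real k)) / (real n * lam\<^sup>2)) + e"
proof -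
  have dr: "dim_row A = p" "dim_col A = r" using A by auto
  obtain T where T: "T \<subseteq> {..<p}" "card T = k"
    "(\<Sum>i\<in>{..<p} - T. (row_norm A i)\<^sup>2)
      \<le> (2 + q) / (2 - q) * (real k * (real r + ln (exp 1 * real p / real k)) / (real n * lam\<^sup>2))"
    by (rule truncation_bias[OF q s lam n r, of A k]) (use dr p w k in auto)
  \<comment> \<open>At most p rows are filled, each with one entry t in column 0, so the total cost
    is at most p times the square of t, which is e.\<close>
  define t where "t = sqrt (e / real p)"
  have t: "0 < t" "real p * t\<^sup>2 = e" using e p by (auto simp: t_def)
  define w where "w = mkf p r (\<lambda>i j. if i \<in> T then (if row_norm A i = 0 then (if j = 0 then t else 0) else A $$ (i, j)) else 0)"
  define D where "D = w - emb A"
  have row: "(\<Sum>j<r. (ent D i j)\<^sup>2) \<le> (if i \<in> T then 0 else (row_norm A i)\<^sup>2) + t\<^sup>2" if i: "i < p" for i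
  proof (cases "i \<in> T")
    case True
    show ?thesis
    proof (cases "row_norm A i = 0")
      case z: True
      then have "\<forall>j. ent (emb A) i j = 0" using row_norm_zero_iff[OF A i] by simp
      then have "(\<Sum>j<r. (ent D i j)\<^sup>2) = (\<Sum>j<r. if j = 0 then t\<^sup>2 else 0)"
        using True i z by (intro sum.cong) (auto simp: D_def w_def)
      then show ?thesis using True r by simp
    next
      case False
      then have "(\<Sum>j<r. (ent D i j)\<^sup>2) = 0"
        using True i dr by (intro sum.neutral) (auto simp: D_def w_def ent_emb)
      then show ?thesis by simp
    qed
  next
    case False
    have "(\<Sum>j<r. (ent D i j)\<^sup>2) = (row_norm A i)\<^sup>2"
      using False i dr by (subst row_norm_sq) (auto simp: D_def w_def ent_emb intro!: sum.cong)
    then show ?thesis using False by simp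
  qed
  have "(norm D)\<^sup>2 = (\<Sum>x\<in>{..<p} \<times> {..<r}. (ent D (fst x) (snd x))\<^sup>2)"
    by (rule norm_suppd) (use dr in \<open>auto simp: suppd_def D_def w_def ent_emb\<close>)
  also have "\<dots> = (\<Sum>i<p. \<Sum>j<r. (ent D i j)\<^sup>2)" by (simp add: sum.cartesian_product case_prod_beta)
  also have "\<dots> \<le> (\<Sum>i<p. (if i \<in> T then 0 else (row_norm A i)\<^sup>2) + t\<^sup>2)" by (intro sum_mono row) auto
  also have "\<dots> = (\<Sum>i\<in>{..<p} - T. (row_norm A i)\<^sup>2) + e"
  proof -
    have "(\<Sum>i<p. if i \<in> T then 0 else (row_norm A i)\<^sup>2) = (\<Sum>i\<in>{..<p} - T. (row_norm A i)\<^sup>2)"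
      by (rule sum.mono_neutral_cong_right) auto
    then show ?thesis using t by (simp add: sum.distrib)
  qed
  finally have n2: "(norm D)\<^sup>2 \<le> (\<Sum>i\<in>{..<p} - T. (row_norm A i)\<^sup>2) + e" .
  show thesis
  proof (rule that[OF T(1,2)])
    show "suppd ({..<p} \<times> {..<r}) w" by (auto simp: suppd_def w_def)
    have fT: "finite T" using T(1) finite_subset by blast
    show "idm T * w = w" by (rule fmat_eqI) (simp add: ent_idm_times[OF fT] w_def)
    show "\<exists>j. ent w i j \<noteq> 0" if i: "i \<in> T" for i
    proof (cases "row_norm A i = 0")
      case True
      then show ?thesis using i T(1) t r by (intro exI[of _ 0]) (auto simp: w_def)
    next
      case False
      have ip: "i < p" using i T(1) by auto
      then obtain j where "ent (emb A) i j \<noteq> 0" using row_norm_zero_iff[OF A ip] False by blast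
      then show ?thesis using False i ip dr by (intro exI[of _ j]) (auto simp: w_def ent_emb split: if_splits)
    qed
    show "(norm (w - emb A))\<^sup>2 \<le> (2 + q) / (2 - q) * (real k * (real r + ln (exp 1 * real p / real k)) / (real n * lam\<^sup>2)) + e"
      using n2 T(3) by (simp add: D_def)
  qed
qed

lemma emb_inj: "A \<in> carrier_mat a b \<Longrightarrow> B \<in> carrier_mat a b \<Longrightarrow> emb A = emb B \<Longrightarrow> A = B"
proof (rule eq_matI)
  fix i j assume c: "A \<in> carrier_mat a b" "B \<in> carrier_mat a b" "emb A = emb B" and ij: "i < dim_row B" "j < dim_col B"
  have "ent (emb A) i j = A $$ (i, j)" "ent (emb B) i j = B $$ (i, j)" using c(1,2) ij by (simp_all add: ent_emb)
  then show "A $$ (i, j) = B $$ (i, j)" using c(3) by simp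
qed auto

lemma emb_gram:
  assumes A: "A \<in> carrier_mat p r" and G: "G \<in> carrier_mat p p"
  shows "emb (A\<^sup>T * G * A) = tp (emb A) * emb G * emb A"
proof -
  have At: "A\<^sup>T \<in> carrier_mat r p" using A by simp
  have "A\<^sup>T * G \<in> carrier_mat r p" using At G by simp
  then show ?thesis using emb_mult[OF _ A] emb_mult[OF At G] by (simp add: emb_transpose)
qed

lemma gram_one_iff:
  assumes A: "A \<in> carrier_mat p r" and G: "G \<in> carrier_mat p p"
  shows "A\<^sup>T * G * A = 1\<^sub>m r \<longleftrightarrow> tp (emb A) * emb G * emb A = idm {..<r}"
proof -
  have c: "A\<^sup>T * G * A \<in> carrier_mat r r" using A G by simp
  show ?thesis using emb_inj[OF c one_carrier_mat] emb_gram[OF A G] by (metis emb_one)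
qed

lemma mtrace_inner:
  assumes A: "A \<in> carrier_mat p r" and C: "C \<in> carrier_mat p m" and B: "B \<in> carrier_mat m r"
  shows "mtrace (A\<^sup>T * C * B) = inner (emb C) (emb A * tp (emb B))"
proof -
  have At: "A\<^sup>T \<in> carrier_mat r p" using A by simp
  have AC: "A\<^sup>T * C \<in> carrier_mat r m" using At C by simp
  have c: "A\<^sup>T * C * B \<in> carrier_mat r r" using AC B by simp
  have "mtrace (A\<^sup>T * C * B) = (\<Sum>i<r. ent (emb (A\<^sup>T * C * B)) i i)" using A B by (auto simp: mtrace_def ent_emb)
  also have "\<dots> = inner (idm {..<r}) (emb (A\<^sup>T * C * B))"
  proof -
    have "inner (idm {..<r}) X = (\<Sum>i<r. \<Sum>j<r. if i = j then ent X i j else 0)" for X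
      unfolding inner_fmat_dimb[OF dimb_idm] by (intro sum.cong) (auto simp: ent_idm)
    then show ?thesis by simp
  qed
  also have "emb (A\<^sup>T * C * B) = tp (emb A) * emb C * emb B"
    using emb_mult[OF AC B] emb_mult[OF At C] by (simp add: emb_transpose)
  also have "inner (idm {..<r}) (tp (emb A) * emb C * emb B) = inner (emb A * idm {..<r} * tp (emb B)) (emb C)"
    using inner_sandwich[of "emb A" "idm {..<r}" "tp (emb B)" "emb C"] by simp
  also have "emb A * idm {..<r} = emb A"
    using A by (auto intro!: fmat_eqI simp: ent_times_idm ent_emb)
  finally show ?thesis by (simp add: inner_commute)
qed

text \<open>N has the right inverse \<open>G * N\<close>, so \<open>w * N\<close> has the same
  nonzero rows as w and satisfies the cardinality constraint with equality.\<close>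

lemma comparator:
  assumes T: "T \<subseteq> {..<p}" and p: "0 < p" and w: "suppd ({..<p} \<times> {..<r}) w" "idm T * w = w"
    and nz: "\<And>i. i \<in> T \<Longrightarrow> \<exists>j. ent w i j \<noteq> 0"
    and N: "dimb r N" "N * G * N = idm {..<r}"
  obtains A where "A \<in> carrier_mat p r" "emb A = w * N" "weak_norm 0 A = real (card T)"
proof (rule that[of "mat p r (\<lambda>(i, j). ent (w * N) i j)"])
  let ?A = "mat p r (\<lambda>(i, j). ent (w * N) i j)"
  show c: "?A \<in> carrier_mat p r" by simp
  have fT: "finite T" using T finite_subset by blast
  show e: "emb ?A = w * N"
  proof (rule fmat_eqI)
    fix i j
    have "p \<le> i \<Longrightarrow> ent (w * N) i j = 0" using w(1) by (intro ent_zero_row) (simp add: suppd_def)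
    moreover have "r \<le> j \<Longrightarrow> ent (w * N) i j = 0" using N(1) by (intro ent_zero_col) (simp add: dimb_def)
    ultimately show "ent (emb ?A) i j = ent (w * N) i j" by (auto simp: ent_emb not_less)
  qed
  have wI: "w * idm {..<r} = w" using w(1) by (intro fmat_eqI) (auto simp: ent_times_idm suppd_def)
  have "{i. i < p \<and> row_norm ?A i \<noteq> 0} = T"
  proof (intro equalityI subsetI)
    fix i assume i: "i \<in> {i. i < p \<and> row_norm ?A i \<noteq> 0}"
    show "i \<in> T"
    proof (rule ccontr)
      assume nT: "i \<notin> T"
      have "ent (w * N) i j = ent (idm T * (w * N)) i j" for j using w(2) by (simp add: mult.assoc[symmetric])
      then have "ent (w * N) i j = 0" for j using nT fT by (simp add: ent_idm_times)
      moreover have ip: "i < p" using i by simp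
      ultimately have "row_norm ?A i = 0" using row_norm_zero_iff[OF c ip] e by simp
      then show False using i by simp
    qed
  next
    fix i assume i: "i \<in> T"
    have ip: "i < p" using i T by auto
    have "row_norm ?A i \<noteq> 0"
    proof
      assume "row_norm ?A i = 0"
      then have z: "ent (w * N) i j = 0" for j using row_norm_zero_iff[OF c ip] e by simp
      have "ent w i j = ent (w * (N * G * N)) i j" for j by (simp add: N(2) wI)
      then have "ent w i j = ent ((w * N) * (G * N)) i j" for j by (simp add: mult.assoc)
      then have "ent w i j = 0" for j using ent_zero_row[OF z] by simp
      then show False using nz[OF i] by simp
    qed
    then show "i \<in> {i. i < p \<and> row_norm ?A i \<noteq> 0}" using ip by simp
  qed
  then show "weak_norm 0 ?A = real (card T)" using weak_norm_zero[of ?A] p by simp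
qed

lemma frob_norm_emb: "frob_norm A = norm (emb A)"
proof -
  define N where "N = max (dim_row A) (dim_col A)"
  have d: "dimb N (emb A)" by (auto simp: dimb_def ent_emb N_def)
  have "(norm (emb A))\<^sup>2 = (\<Sum>x\<in>{..<dim_row A} \<times> {..<dim_col A}. (ent (emb A) (fst x) (snd x))\<^sup>2)"
    by (rule norm_suppd) (auto simp: suppd_def ent_emb)
  also have "\<dots> = (\<Sum>i<dim_row A. \<Sum>j<dim_col A. (A $$ (i, j))\<^sup>2)"
    by (simp add: sum.cartesian_product case_prod_beta) (auto simp: ent_emb intro!: sum.cong)
  finally show ?thesis unfolding frob_norm_def by (metis norm_ge_zero real_sqrt_unique)
qed

lemma cov_factor:
  assumes "0 < n" obtains Z where "cov n d z = tp Z * Z"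
proof (rule that[of "(1 / sqrt (real n)) *\<^sub>R mkf n d z"])
  let ?Z = "mkf n d z"
  have "cov n d z = (1 / real n) *\<^sub>R (tp ?Z * ?Z)"
  proof (rule fmat_eqI)
    fix j k
    have "dimb (max n d) (tp ?Z)" by (auto simp: dimb_def)
    then have "ent (tp ?Z * ?Z) j k = (\<Sum>i<max n d. ent ?Z i j * ent ?Z i k)" by (simp add: ent_times)
    also have "\<dots> = (\<Sum>i<n. ent ?Z i j * ent ?Z i k)" by (rule sum.mono_neutral_right) auto
    finally show "ent (cov n d z) j k = ent ((1 / real n) *\<^sub>R (tp ?Z * ?Z)) j k"
      by (auto simp: cov_def sample_cov_def ent_emb)
  qed
  then show "cov n d z = tp ((1 / sqrt (real n)) *\<^sub>R ?Z) * ((1 / sqrt (real n)) *\<^sub>R ?Z)"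
    using assms by (simp add: tp_scaleR)
qed

lemma norm_idm_sq: "(norm (idm {..<r}))\<^sup>2 = real r"
proof -
  have "(norm (idm {..<r}))\<^sup>2 = (\<Sum>i<r. \<Sum>j<r. if i = j then 1 else 0)"
    unfolding power2_norm_eq_inner inner_fmat_dimb[OF dimb_idm] by (intro sum.cong) (auto simp: ent_idm)
  then show ?thesis by simp
qed

section \<open>The deterministic bounds for the estimator\<close>

text \<open>One bound for the joint noise on a joint support serves the blocks of x, of y and the
  cross block: R1 and R2 select the coordinates of a block and carry T1' and T2' to T1 and
  T2.\<close>

lemma block_op:
  assumes R: "idm T1 * R1 = R1 * idm T1'" "idm T2 * R2 = R2 * idm T2'" "opb 1 R1" "opb 1 R2"
    and T: "finite T" "T1' \<subseteq> T" "T2' \<subseteq> T" and E: "opb e (idm T * E * idm T)"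
  shows "opb e (idm T1 * (R1 * E * tp R2) * idm T2)"
proof -
  have f: "finite T1'" "finite T2'" using T finite_subset by blast+
  have R2: "tp R2 * idm T2 = idm T2' * tp R2" using R(2) by (metis tp_idm tp_mult)
  have i: "idm T1' = idm T1' * idm T" "idm T2' = idm T * idm T2'"
    using f T by (simp_all add: idm_idm Int_absorb1 Int_absorb2)
  have "idm T1 * (R1 * E * tp R2) * idm T2 = (R1 * idm T1') * E * (idm T2' * tp R2)"
    by (simp add: R(1)[symmetric] R2[symmetric] mult.assoc)
  also have "\<dots> = (R1 * idm T1') * (idm T * E * idm T) * (idm T2' * tp R2)"
    by (subst (1) i(1), subst (1) i(2)) (simp add: mult.assoc)
  finally have eq: "idm T1 * (R1 * E * tp R2) * idm T2 = (R1 * idm T1') * (idm T * E * idm T) * (idm T2' * tp R2)" .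
  have "opb ((1 * 1) * e * (1 * 1)) ((R1 * idm T1') * (idm T * E * idm T) * (idm T2' * tp R2))"
    by (intro opb_mult R opb_tp opb_idm f E)
  then show ?thesis unfolding eq by simp
qed

lemma block_lin:
  assumes R: "idm T1 * R = R * idm T1'" "opb 1 R" and T: "finite T" "T1' \<subseteq> T"
    and E: "norm (idm T * E * W) \<le> b"
  shows "norm (idm T1 * (R * E) * W) \<le> b"
proof -
  have f: "finite T1'" using T finite_subset by blast
  have i: "idm T1' = idm T1' * idm T" using f T by (simp add: idm_idm Int_absorb2)
  have "idm T1 * R = R * idm T1' * idm T" by (metis R(1) i mult.assoc)
  then have "idm T1 * (R * E) * W = R * idm T1' * idm T * E * W" by (simp add: mult.assoc[symmetric])
  then have "idm T1 * (R * E) * W = (R * idm T1') * (idm T * E * W)" by (simp add: mult.assoc)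
  then show ?thesis using opbD_le[OF opb_mult[OF R(2) opb_idm[OF f]] E] by simp
qed

text \<open>The population constants are M. A deviation e with 2 M e \<le> 1 on the support takes
  away at most half of the lower eigenvalue, and a bias be \<le> 1 adds at most M to the norm of w;
  so 2 M serves as common constant.\<close>

lemma sideI:
  assumes M: "1 < M" and sS: "tp S = S" and oS: "opb M S"
    and low: "\<And>K. idm D * K = K \<Longrightarrow> (norm K)\<^sup>2 \<le> M * inner K (S * K)"
    and o: "opb M u" "opb M u2" and uI: "u * idm {..<r} = u" and wr: "w * idm {..<r} = w"
    and uSu: "tp u * S * u = idm {..<r}" and u2Su: "tp u2 * S * u = 0"
    and be: "norm (w - u) \<le> be" "0 \<le> be" "be \<le> 1" and om: "0 \<le> om" and H: "H = tp Z * Z"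
    and A: "tp A * H * A = idm {..<r}" "A * idm {..<r} = A"
    and T: "finite D" "T \<subseteq> D" "idm T * w = w" "idm T * A = A"
    and dev: "opb e (idm T * (H - S) * idm T)" "2 * M * e \<le> 1"
    and lin: "norm (idm T * (H - S) * w) \<le> om"
  shows "side r S H Z u u2 w A (idm T) (2 * M) be om"
proof
  have fT: "finite T" using T finite_subset by blast
  have M2: "M \<le> 2 * M" using M by simp
  have e0: "0 \<le> e" by (rule opb_nonneg[OF dev(1)])
  show "1 \<le> 2 * M" using M by simp
  show "opb (2 * M) S" "opb (2 * M) u" "opb (2 * M) u2" using oS o opb_mono M2 by blast+
  show "opb (2 * M) w"
  proof -
    have "opb (M + norm (w - u)) (u + (w - u))" by (intro opb_add o opb_norm)
    then show ?thesis using opb_mono[of "M + norm (w - u)" w "2 * M"] be M by simp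
  qed
  show "opb (2 * M) (idm T * H * idm T)"
  proof -
    have "opb (1 * M * 1 + e) (idm T * S * idm T + idm T * (H - S) * idm T)"
      by (intro opb_add opb_mult opb_idm fT oS dev)
    moreover have "idm T * S * idm T + idm T * (H - S) * idm T = idm T * H * idm T" by (simp add: algebra_simps)
    moreover have "e \<le> M"
    proof -
      have "e * 1 \<le> e * (2 * M)" using M e0 by (intro mult_left_mono) auto
      then show ?thesis using dev(2) M by (simp add: mult_ac)
    qed
    ultimately show ?thesis using opb_mono[of "1 * M * 1 + e" "idm T * H * idm T" "2 * M"] by simp
  qed
  show "(norm K)\<^sup>2 \<le> 2 * M * (norm (Z * K))\<^sup>2" if K: "idm T * K = K" for K
  proof -
    have "idm D * K = idm D * idm T * K" using K by (simp add: mult.assoc)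
    then have "idm D * K = K" using T fT K by (simp add: idm_idm Int_absorb1)
    then have "(norm K)\<^sup>2 \<le> M * inner K (S * K)" by (rule low)
    also have "inner K (S * K) = (norm (Z * K))\<^sup>2 - inner K ((idm T * (H - S) * idm T) * K)"
    proof -
      have "inner K ((idm T * (H - S) * idm T) * K) = inner (idm T * K) ((H - S) * (idm T * K))"
        by (simp only: inner_mult_left tp_idm mult.assoc)
      then show ?thesis
        by (simp add: K H left_diff_distrib inner_diff_right power2_norm_eq_inner inner_mult_left mult.assoc)
    qed
    also have "M * ((norm (Z * K))\<^sup>2 - inner K ((idm T * (H - S) * idm T) * K)) \<le> M * ((norm (Z * K))\<^sup>2 + e * (norm K)\<^sup>2)"
    proof -
      have "- inner K ((idm T * (H - S) * idm T) * K) \<le> norm K * norm ((idm T * (H - S) * idm T) * K)"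
        using Cauchy_Schwarz_ineq2[of K "(idm T * (H - S) * idm T) * K"] by linarith
      also have "\<dots> \<le> norm K * (e * norm K)" by (intro mult_left_mono opbD[OF dev(1)]) auto
      also have "\<dots> = e * (norm K)\<^sup>2" by (simp add: power2_eq_square mult_ac)
      finally have "(norm (Z * K))\<^sup>2 - inner K ((idm T * (H - S) * idm T) * K) \<le> (norm (Z * K))\<^sup>2 + e * (norm K)\<^sup>2" by linarith
      then show ?thesis using M by (intro mult_left_mono) auto
    qed
    finally have "(norm K)\<^sup>2 \<le> M * (norm (Z * K))\<^sup>2 + (M * e) * (norm K)\<^sup>2" by (simp add: distrib_left)
    also have "(M * e) * (norm K)\<^sup>2 \<le> (1/2) * (norm K)\<^sup>2" using dev(2) by (intro mult_right_mono) auto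
    finally show ?thesis by simp
  qed
qed (use assms finite_subset[OF T(2,1)] in \<open>auto intro: opb_idm\<close>)

text \<open>The assumption on \<rho> brings the Gram matrix within 1/16 of the identity, as
  \<open>inverse_sqrt_near_one\<close> requires; twice its distance is the bound for N in the
  locale.\<close>

lemma side_normalisedI:
  assumes X: "side r S H Z u u2 w A j m be om" and b: "be + om \<le> \<rho>" "32 * m\<^sup>2 * \<rho> \<le> 1"
  obtains N where "side_normalised r S H Z u u2 w A j m be om N \<rho>" "dimb r N" "N * (tp w * H * w) * N = idm {..<r}"
proof -
  interpret X: side r S H Z u u2 w A j m be om by (rule X)
  let ?G = "tp w * H * w"
  have r0: "0 \<le> \<rho>" using b X.be0 X.om0 by simp
  have G: "?G = idm {..<r} * ?G * idm {..<r}"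
  proof -
    have "tp (w * idm {..<r}) * H * (w * idm {..<r}) = idm {..<r} * ?G * idm {..<r}"
      by (simp add: tp_mult mult.assoc)
    then show ?thesis by (simp add: X.wr)
  qed
  have dG: "dimb r ?G" unfolding dimb_def
    by (subst G) (auto simp: ent_times_idm ent_idm_times)
  have sG: "tp ?G = ?G" by (simp add: tp_simps X.sH mult.assoc)
  have "m * om \<le> m\<^sup>2 * om" using X.m1 X.om0 by (intro mult_right_mono) (auto simp: power2_eq_square)
  then have "m * om + 2 * m\<^sup>2 * be \<le> 2 * m\<^sup>2 * om + 2 * m\<^sup>2 * be"
    using mult_nonneg_nonneg[OF zero_le_power2[of m] X.om0] by linarith
  also have "\<dots> = 2 * m\<^sup>2 * (be + om)" by (simp add: distrib_left)
  also have "\<dots> \<le> 2 * m\<^sup>2 * \<rho>" using b(1) by (intro mult_left_mono) auto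
  finally have h: "norm (?G - idm {..<r}) \<le> 2 * m\<^sup>2 * \<rho>" using X.gram_near_one by linarith
  obtain N where N: "dimb r N" "tp N = N" "N * ?G * N = idm {..<r}" "norm (N - idm {..<r}) \<le> 2 * (2 * m\<^sup>2 * \<rho>)"
    by (rule inverse_sqrt_near_one[OF dG sG h]) (use b(2) in auto)
  have "4 * m\<^sup>2 * \<rho> \<le> 32 * m\<^sup>2 * \<rho>" using r0 by (intro mult_right_mono) auto
  then have "side_normalised r S H Z u u2 w A j m be om N \<rho>"
    using N b by unfold_locales auto
  then show thesis using N by (intro that)
qed

locale cca = fq +
  fixes n ku kv :: nat
  assumes n: "0 < n" and s: "0 < su" "0 < sv" and q: "0 \<le> q" "q < 2"
    and ku: "int ku = eff_k q su p n r lam" and kv: "int kv = eff_k q sv m n r lam"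
begin

definition "lu = ln (exp 1 * real p / real ku)"
definition "lv = ln (exp 1 * real m / real kv)"
definition "ell = real ku * lu + real kv * lv"
definition "LL = real r * real (ku + kv) + ell"
text \<open>The confidence parameter: exp (- C aa) is the product of the two failure probabilities
  allowed, so a single event of that failure probability suffices.\<close>

definition "aa = (real ku + lu) + (real kv + lv)"
definition "eps2 = eps_sq q su sv n p m r lam"
text \<open>The supports in joint coordinates. The factors 2 leave room for the rows of the
  estimator together with those of the truncation.\<close>

definition "F = {T. T \<subseteq> {..<p + m} \<and> card (T \<inter> {..<p}) \<le> 2 * ku \<and> card (T \<inter> {p..<p + m}) \<le> 2 * kv}"

lemma k_bounds: "1 \<le> ku" "ku \<le> p" "1 \<le> kv" "kv \<le> m"
  using eff_k_bounds[OF q s(1) lam(1) pm(1) n r(1)] eff_k_bounds[OF q s(2) lam(1) pm(2) n r(1)] ku kv by auto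

lemma l_ge1: "1 \<le> lu" "1 \<le> lv"
  using ln_ge_1[OF q s(1) lam(1) pm(1) n r(1), of "real ku"] ln_ge_1[OF q s(2) lam(1) pm(2) n r(1), of "real kv"] k_bounds
  by (auto simp: lu_def lv_def)

lemma eps2: "eps2 = LL / (real n * lam\<^sup>2)" and LL_eq: "LL = real n * lam\<^sup>2 * eps2"
proof -
  have k: "real_of_int (eff_k q su p n r lam) = real ku" "real_of_int (eff_k q sv m n r lam) = real kv"
    using ku kv by (metis of_int_of_nat_eq)+
  show 1: "eps2 = LL / (real n * lam\<^sup>2)"
    by (simp add: eps2_def eps_sq_def Let_def k LL_def ell_def lu_def lv_def)
  show "LL = real n * lam\<^sup>2 * eps2" using n lam by (simp add: 1)
qed

lemma ell_ge: "real (ku + kv) \<le> ell" "2 \<le> ell" "ell \<le> LL"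
proof -
  have "real ku * 1 \<le> real ku * lu" using l_ge1 by (intro mult_left_mono) auto
  moreover have "real kv * 1 \<le> real kv * lv" using l_ge1 by (intro mult_left_mono) auto
  ultimately show "real (ku + kv) \<le> ell" by (simp add: ell_def)
  then show "2 \<le> ell" using k_bounds by simp
  show "ell \<le> LL" by (simp add: LL_def)
qed

lemma aa_le: "aa \<le> 2 * ell"
proof -
  have g: "k + x \<le> 2 * (k * x)" if "1 \<le> k" "1 \<le> x" for k x :: real
  proof -
    have "0 \<le> (k - 1) * (x - 1)" using that by simp
    moreover have "k * 1 \<le> k * x" "1 * x \<le> k * x" using that by (intro mult_left_mono mult_right_mono; simp)+
    ultimately show ?thesis by simp
  qed
  show ?thesis using g[of "real ku" lu] g[of "real kv" lv] k_bounds l_ge1 by (simp add: aa_def ell_def)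
qed

lemma lam1: "lam < 1"
proof -
  have "1 * lam \<le> kap * lam" using kap1 lam by (intro mult_right_mono) auto
  then show ?thesis using lam(2) by linarith
qed

lemma finF: "finite F"
  by (rule finite_subset[of _ "Pow {..<p + m}"]) (auto simp: F_def)

lemma F_props: "T \<in> F \<Longrightarrow> T \<subseteq> {..<p + m} \<and> card T \<le> 2 * (ku + kv)"
proof -
  assume T: "T \<in> F"
  then have "T = (T \<inter> {..<p}) \<union> (T \<inter> {p..<p + m})" by (auto simp: F_def)
  then have "card T \<le> card (T \<inter> {..<p}) + card (T \<inter> {p..<p + m})" by (metis card_Un_le)
  then show ?thesis using T by (auto simp: F_def)
qed

lemma cardF: "real (card F) \<le> exp (2 * ell)"
proof -
  let ?F1 = "{T. T \<subseteq> {..<p} \<and> card T \<le> 2 * ku}" and ?F2 = "{T. T \<subseteq> {p..<p + m} \<and> card T \<le> 2 * kv}"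
  have f1: "finite ?F1" by (rule finite_subset[of _ "Pow {..<p}"]) auto
  have f2: "finite ?F2" by (rule finite_subset[of _ "Pow {p..<p + m}"]) auto
  have inj: "inj_on (\<lambda>T. (T \<inter> {..<p}, T \<inter> {p..<p + m})) F"
  proof (rule inj_onI)
    fix T T' assume T: "T \<in> F" "T' \<in> F" "(T \<inter> {..<p}, T \<inter> {p..<p + m}) = (T' \<inter> {..<p}, T' \<inter> {p..<p + m})"
    have "T = (T \<inter> {..<p}) \<union> (T \<inter> {p..<p + m})" "T' = (T' \<inter> {..<p}) \<union> (T' \<inter> {p..<p + m})"
      using T(1,2) by (auto simp: F_def)
    then show "T = T'" using T(3) by simp
  qed
  have "card F \<le> card (?F1 \<times> ?F2)"
    by (rule card_inj_on_le[OF inj]) (use f1 f2 in \<open>auto simp: F_def\<close>)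
  then have "real (card F) \<le> real (card ?F1) * real (card ?F2)" by (simp add: card_cartesian_product flip: of_nat_mult)
  also have "\<dots> \<le> exp (2 * real ku * lu) * exp (2 * real kv * lv)"
    using count_supports[of "{..<p}" ku] count_supports[of "{p..<p + m}" kv] k_bounds
    by (intro mult_mono) (auto simp: lu_def lv_def)
  also have "\<dots> = exp (2 * ell)" by (simp add: exp_add[symmetric] ell_def algebra_simps)
  finally show ?thesis .
qed

lemma F_join:
  assumes "Tx \<subseteq> {..<p}" "card Tx \<le> 2 * ku" "Ty \<subseteq> {..<m}" "card Ty \<le> 2 * kv"
  shows "Tx \<union> (+) p ` Ty \<in> F"
proof -
  have 1: "(Tx \<union> (+) p ` Ty) \<inter> {..<p} = Tx" using assms by auto
  have 2: "(Tx \<union> (+) p ` Ty) \<inter> {p..<p + m} = (+) p ` Ty" using assms by auto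
  have "card ((+) p ` Ty) = card Ty" by (rule card_image) auto
  then show ?thesis using assms by (auto simp: F_def 1 2)
qed

lemma feasible:
  assumes feas: "cca_feasible p m r (int ku) (int kv) Sh A B" and Sh: "Sh \<in> carrier_mat (p + m) (p + m)"
  defines "H \<equiv> emb Sh"
  shows "A \<in> carrier_mat p r" "B \<in> carrier_mat m r"
    "tp (emb A) * (idm {..<p} * H * tp (idm {..<p})) * emb A = idm {..<r}"
    "tp (emb B) * (shiftm p m * H * tp (shiftm p m)) * emb B = idm {..<r}"
    "emb A * idm {..<r} = emb A" "emb B * idm {..<r} = emb B"
    "\<exists>T. T \<subseteq> {..<p} \<and> card T = ku \<and> idm T * emb A = emb A"
    "\<exists>T. T \<subseteq> {..<m} \<and> card T = kv \<and> idm T * emb B = emb B"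
proof -
  show A: "A \<in> carrier_mat p r" and B: "B \<in> carrier_mat m r" using feas by (auto simp: cca_feasible_def)
  have bx: "block_x p Sh \<in> carrier_mat p p" and bY: "block_y p m Sh \<in> carrier_mat m m" by (auto simp: block_x_def block_y_def)
  show "tp (emb A) * (idm {..<p} * H * tp (idm {..<p})) * emb A = idm {..<r}"
    using feas gram_one_iff[OF A bx] emb_block_x[OF Sh] by (simp add: cca_feasible_def H_def)
  show "tp (emb B) * (shiftm p m * H * tp (shiftm p m)) * emb B = idm {..<r}"
    using feas gram_one_iff[OF B bY] emb_block_y[OF Sh] by (simp add: cca_feasible_def H_def)
  show "emb A * idm {..<r} = emb A" "emb B * idm {..<r} = emb B"
    using A B by (auto intro!: fmat_eqI simp: ent_times_idm ent_emb)
  show "\<exists>T. T \<subseteq> {..<p} \<and> card T = ku \<and> idm T * emb A = emb A"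
    by (rule support_rows[OF A pm(1), of ku]) (use feas in \<open>auto simp: cca_feasible_def\<close>)
  show "\<exists>T. T \<subseteq> {..<m} \<and> card T = kv \<and> idm T * emb B = emb B"
    by (rule support_rows[OF B pm(2), of kv]) (use feas in \<open>auto simp: cca_feasible_def\<close>)
qed

lemma idm_idm_self: "finite T \<Longrightarrow> T \<subseteq> {..<p} \<Longrightarrow> idm T * idm {..<p} = idm {..<p} * idm T"
  by (simp add: idm_idm Int_commute)

lemma union_support:
  assumes "finite T1" "finite T2" "idm T1 * X = X" shows "idm (T1 \<union> T2) * X = X" "idm (T2 \<union> T1) * X = X"
proof -
  have "idm (T1 \<union> T2) * X = idm (T1 \<union> T2) * idm T1 * X" using assms by (simp add: mult.assoc)
  also have "idm (T1 \<union> T2) * idm T1 = idm T1" using assms by (simp add: idm_idm Int_absorb1)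
  finally show "idm (T1 \<union> T2) * X = X" using assms by simp
  then show "idm (T2 \<union> T1) * X = X" by (simp add: Un_commute)
qed

text \<open>The deterministic conclusion on the favourable event. All that is used of the sample is
  the noise on the supports of F, in operator norm and against the two fixed truncations.\<close>

lemma good_bound:
  assumes sol: "cca_solution p m r (int ku) (int kv) Sh A B" and Sh: "Sh \<in> carrier_mat (p + m) (p + m)"
    and H: "emb Sh = tp Z * Z"
    and op: "\<And>T. T \<in> F \<Longrightarrow> opb (4 * eta) (idm T * (emb Sh - Sf) * idm T)"
    and lu: "\<And>T. T \<in> F \<Longrightarrow> norm (idm T * (emb Sh - Sf) * wu) \<le> om"
    and lv: "\<And>T. T \<in> F \<Longrightarrow> norm (idm T * (emb Sh - Sf) * (tp (shiftm p m) * wv)) \<le> om"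
    and wu: "Tu \<subseteq> {..<p}" "card Tu = ku" "suppd ({..<p} \<times> {..<r}) wu" "idm Tu * wu = wu" "\<And>i. i \<in> Tu \<Longrightarrow> \<exists>j. ent wu i j \<noteq> 0"
    and wv: "Tv \<subseteq> {..<m}" "card Tv = kv" "suppd ({..<m} \<times> {..<r}) wv" "idm Tv * wv = wv" "\<And>i. i \<in> Tv \<Longrightarrow> \<exists>j. ent wv i j \<noteq> 0"
    and be: "norm (wu - u) \<le> be" "norm (wv - v) \<le> be" "0 \<le> be" "be \<le> 1" and om: "0 \<le> om"
    and \<rho>: "\<rho> = be + om / lam" "32 * (2 * M)\<^sup>2 * \<rho> \<le> 1"
    and eta: "0 < eta" "256 * (2 * M) ^ 12 * eta \<le> lam"
    and c: "0 \<le> c" "256 * (2 * M) ^ 12 * c \<le> 1" "(if r < min p m then l (r + 1) else 0) \<le> c * lam"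
  shows "norm (emb A * tp (emb B) - u * tp v) \<le> 74 * (2 * M) ^ 8 * kap * \<rho>"
proof -
  let ?Rx = "idm {..<p}" and ?Ry = "shiftm p m"
  define Hf where "Hf = emb Sh"
  define Hx where "Hx = ?Rx * Hf * tp ?Rx"
  define Hy where "Hy = ?Ry * Hf * tp ?Ry"
  define Hxy where "Hxy = ?Rx * Hf * tp ?Ry"
  define Ef where "Ef = Hf - Sf"
  have feas: "cca_feasible p m r (int ku) (int kv) Sh A B" using sol by (simp add: cca_solution_def)
  note fe = feasible[OF feas Sh, folded Hf_def, folded Hx_def Hy_def]
  obtain Ta where Ta: "Ta \<subseteq> {..<p}" "card Ta = ku" "idm Ta * emb A = emb A" using fe(7) by blast
  obtain Tb where Tb: "Tb \<subseteq> {..<m}" "card Tb = kv" "idm Tb * emb B = emb B" using fe(8) by blast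
  define Tx where "Tx = Ta \<union> Tu"
  define Ty where "Ty = Tb \<union> Tv"
  have fin: "finite Ta" "finite Tu" "finite Tb" "finite Tv"
    using Ta(1) wu(1) Tb(1) wv(1) finite_subset by blast+
  have Tx: "Tx \<subseteq> {..<p}" "finite Tx" "card Tx \<le> 2 * ku"
    using Ta wu(1,2) fin card_Un_le[of Ta Tu] by (auto simp: Tx_def)
  have Ty: "Ty \<subseteq> {..<m}" "finite Ty" "card Ty \<le> 2 * kv"
    using Tb wv(1,2) fin card_Un_le[of Tb Tv] by (auto simp: Ty_def)
  \<comment> \<open>A single joint support carries the estimator and the truncations of both sides;
    the random choice of it is covered by uniformity over F.\<close>
  define T where "T = Tx \<union> (+) p ` Ty"
  have TF: "T \<in> F" unfolding T_def by (rule F_join[OF Tx(1,3) Ty(1,3)])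
  have fT: "finite T" "Tx \<subseteq> T" "(+) p ` Ty \<subseteq> T" using Tx Ty by (auto simp: T_def)
  have Rx: "idm Tx * ?Rx = ?Rx * idm Tx" by (rule idm_idm_self[OF Tx(2,1)])
  have Ry: "idm Ty * ?Ry = ?Ry * idm ((+) p ` Ty)" by (rule idm_shiftm[OF Ty(2,1)])
  have oRx: "opb 1 ?Rx" by (rule opb_idm) simp
  have oRy: "opb 1 ?Ry" by (rule opb_shiftm)
  have Ex: "Hx - Sx = ?Rx * Ef * tp ?Rx" by (simp add: Hx_def Sx_eq Ef_def algebra_simps)
  have Ey: "Hy - Sy = ?Ry * Ef * tp ?Ry" by (simp add: Hy_def Sy_eq Ef_def algebra_simps)
  have Exy: "Hxy - Sxy = ?Rx * Ef * tp ?Ry" by (simp add: Hxy_def Sxy_eq Ef_def algebra_simps)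
  have opT: "opb (4 * eta) (idm T * Ef * idm T)" using op[OF TF] by (simp add: Ef_def Hf_def)
  have dx: "opb (4 * eta) (idm Tx * (Hx - Sx) * idm Tx)" unfolding Ex
    by (rule block_op[OF Rx Rx oRx oRx fT(1,2,2) opT])
  have dy: "opb (4 * eta) (idm Ty * (Hy - Sy) * idm Ty)" unfolding Ey
    by (rule block_op[OF Ry Ry oRy oRy fT(1,3,3) opT])
  have dxy: "opb (4 * eta) (idm Tx * (Hxy - Sxy) * idm Ty)" unfolding Exy
    by (rule block_op[OF Rx Ry oRx oRy fT(1,2,3) opT])
  have Iwu: "?Rx * wu = wu" using wu(3) by (intro fmat_eqI) (auto simp: ent_idm_times suppd_def)
  have luT: "norm (idm T * Ef * wu) \<le> om" using lu[OF TF] by (simp add: Ef_def Hf_def)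
  have lvT: "norm (idm T * Ef * (tp ?Ry * wv)) \<le> om" using lv[OF TF] by (simp add: Ef_def Hf_def)
  have tE: "tp Ef = Ef"
    using H tS by (simp add: Ef_def Hf_def tp_simps)
  have lx: "norm (idm Tx * (Hx - Sx) * wu) \<le> om"
    using block_lin[OF Rx oRx fT(1,2) luT] Iwu by (simp add: Ex mult.assoc)
  have ly: "norm (idm Ty * (Hy - Sy) * wv) \<le> om"
    using block_lin[OF Ry oRy fT(1,3) lvT] by (simp add: Ey mult.assoc)
  have lxy: "norm (idm Tx * (Hxy - Sxy) * wv) \<le> om"
    using block_lin[OF Rx oRx fT(1,2) lvT] by (simp add: Exy mult.assoc)
  have lyx: "norm (idm Ty * tp (Hxy - Sxy) * wu) \<le> om"
    using block_lin[OF Ry oRy fT(1,3) luT] Iwu by (simp add: Exy tp_simps tE mult.assoc)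
  have Hx': "Hx = tp (Z * tp ?Rx) * (Z * tp ?Rx)" by (simp add: Hx_def Hf_def H tp_simps mult.assoc)
  have Hy': "Hy = tp (Z * tp ?Ry) * (Z * tp ?Ry)" by (simp add: Hy_def Hf_def H tp_simps mult.assoc)
  have M12: "2 * M \<le> (2 * M) ^ 12" using power_increasing[of 1 12 "2 * M"] M1 by simp
  have e1: "2 * M * (4 * eta) \<le> 1"
  proof -
    have "2 * M * eta \<le> (2 * M) ^ 12 * eta" using M12 eta(1) by (intro mult_right_mono) auto
    moreover define X where "X = (2 * M) ^ 12 * eta"
    moreover have "256 * X \<le> lam" using eta(2) by (simp add: X_def mult.assoc)
    moreover have "0 \<le> X" using eta(1) M1 by (simp add: X_def)
    moreover have "2 * M * (4 * eta) = 4 * (2 * M * eta)" by simp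
    ultimately show ?thesis using lam1 by linarith
  qed
  have wr: "wu * idm {..<r} = wu" "wv * idm {..<r} = wv"
    using wu(3) wv(3) by (auto intro!: fmat_eqI simp: ent_times_idm suppd_def)
  have sX: "side r Sx Hx (Z * tp ?Rx) u u2 wu (emb A) (idm Tx) (2 * M) be om"
    by (rule sideI[OF M1 tSx oSx lower_x ou ou2 uI wr(1) uSu u2Su be(1,3,4) om Hx' fe(3,5) _ Tx(1) _ _ dx e1 lx])
       (use union_support[OF fin(2,1) wu(4)] union_support[OF fin(1,2) Ta(3)] in \<open>auto simp: Tx_def\<close>)
  have sY: "side r Sy Hy (Z * tp ?Ry) v v2 wv (emb B) (idm Ty) (2 * M) be om"
    by (rule sideI[OF M1 tSy oSy lower_y ov ov2 vI wr(2) vSv v2Sv be(2,3,4) om Hy' fe(4,6) _ Ty(1) _ _ dy e1 ly])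
       (use union_support[OF fin(4,3) wv(4)] union_support[OF fin(3,4) Tb(3)] in \<open>auto simp: Ty_def\<close>)
  \<comment> \<open>The cross noise counts relative to the signal strength \<lambda>, hence om / lam
    in \<rho>. As lam < 1, this also covers the noise in Hx and Hy.\<close>
  have om_lam: "om \<le> om / lam"
    using om lam(1) lam1 by (simp add: pos_le_divide_eq mult_left_le)
  have b: "be + om \<le> \<rho>" using om_lam by (simp add: \<rho>(1))
  have omr: "om \<le> lam * \<rho>" using lam(1) be(3) by (simp add: \<rho>(1) distrib_left)
  obtain Nu where Nu: "side_normalised r Sx Hx (Z * tp ?Rx) u u2 wu (emb A) (idm Tx) (2 * M) be om Nu \<rho>"
    "dimb r Nu" "Nu * (tp wu * Hx * wu) * Nu = idm {..<r}"
    by (rule side_normalisedI[OF sX b \<rho>(2)])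
  obtain Nv where Nv: "side_normalised r Sy Hy (Z * tp ?Ry) v v2 wv (emb B) (idm Ty) (2 * M) be om Nv \<rho>"
    "dimb r Nv" "Nv * (tp wv * Hy * wv) * Nv = idm {..<r}"
    by (rule side_normalisedI[OF sY b \<rho>(2)])
  interpret X: side_normalised r Sx Hx "Z * tp ?Rx" u u2 wu "emb A" "idm Tx" "2 * M" be om Nu \<rho> by (rule Nu(1))
  interpret Y: side_normalised r Sy Hy "Z * tp ?Ry" v v2 wv "emb B" "idm Ty" "2 * M" be om Nv \<rho> by (rule Nv(1))
  obtain A' where A': "A' \<in> carrier_mat p r" "emb A' = wu * Nu" "weak_norm 0 A' = real (card Tu)"
    by (rule comparator[OF wu(1) pm(1) wu(3,4,5) Nu(2,3)])
  obtain B' where B': "B' \<in> carrier_mat m r" "emb B' = wv * Nv" "weak_norm 0 B' = real (card Tv)"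
    by (rule comparator[OF wv(1) pm(2) wv(3,4,5) Nv(2,3)])
  have bx: "block_x p Sh \<in> carrier_mat p p" and bY: "block_y p m Sh \<in> carrier_mat m m"
    and bxy: "block_xy p m Sh \<in> carrier_mat p m" by (auto simp: block_x_def block_y_def block_xy_def)
  have exy: "emb (block_xy p m Sh) = Hxy" by (simp add: Hxy_def Hf_def emb_block_xy[OF Sh])
  have "cca_feasible p m r (int ku) (int kv) Sh A' B'"
    unfolding cca_feasible_def
  proof (intro conjI)
    show "A'\<^sup>T * block_x p Sh * A' = 1\<^sub>m r" unfolding gram_one_iff[OF A'(1) bx]
      using X.A0HA0 by (simp add: emb_block_x[OF Sh] A'(2) X.A0_def Hx_def Hf_def)
    show "B'\<^sup>T * block_y p m Sh * B' = 1\<^sub>m r" unfolding gram_one_iff[OF B'(1) bY]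
      using Y.A0HA0 by (simp add: emb_block_y[OF Sh] B'(2) Y.A0_def Hy_def Hf_def)
  qed (use A' B' wu(2) wv(2) in auto)
  then have "mtrace (A'\<^sup>T * block_xy p m Sh * B') \<le> mtrace (A\<^sup>T * block_xy p m Sh * B)"
    using sol by (simp add: cca_solution_def)
  then have opt: "inner Hxy (X.A0 * tp Y.A0) \<le> inner Hxy (emb A * tp (emb B))"
    unfolding mtrace_inner[OF A'(1) bxy B'(1)] mtrace_inner[OF fe(1) bxy fe(2)] exy A'(2) B'(2) X.A0_def Y.A0_def .
  interpret W: two_sided r Sx Hx "Z * tp ?Rx" u u2 wu "emb A" "idm Tx" Sy Hy "Z * tp ?Ry" v v2 wv "emb B" "idm Ty"
    "2 * M" be be om Nu Nv \<rho> Sxy Hxy L L2 "\<lambda>i. l (Suc i)" lam kap "4 * eta" c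
  proof unfold_locales
    show "Sxy = Sx * (u * L * tp v + u2 * L2 * tp v2) * Sy" by (rule Sxy_split)
    show "L = (\<Sum>i<r. l (Suc i) *\<^sub>R idm {i})" by (rule L_def)
    show "lam \<le> l (Suc i)" if "i < r" for i by (rule l_lower[OF that])
    show "opb (kap * lam) L" by (rule oL)
    show "opb (c * lam) L2" by (rule oL2[OF c(1,3)])
    show "0 \<le> c" by (rule c(1))
    show "0 < lam" by (rule lam(1))
    show "1 \<le> kap" using kap1 by simp
    show "opb (4 * eta) (idm Tx * (Hxy - Sxy) * idm Ty)" by (rule dxy)
    show "0 \<le> 4 * eta" using eta by simp
    show "norm (idm Tx * (Hxy - Sxy) * wv) \<le> lam * \<rho>" using lxy omr by linarith
    show "norm (idm Ty * tp (Hxy - Sxy) * wu) \<le> lam * \<rho>" using lyx omr by linarith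
    show "inner Hxy (X.A0 * tp Y.A0) \<le> inner Hxy (emb A * tp (emb B))" by (rule opt)
    show "256 * (2 * M) ^ 12 * c \<le> 1" by (rule c(2))
    show "64 * (2 * M) ^ 12 * (4 * eta) \<le> lam" using eta(2) by simp
  qed
  show ?thesis by (rule W.estimation_error)
qed

text \<open>Orthonormality in the sample metric and its lower bound tau / 4 bound the operator norms
  of A and B by 4 / tau, and a product with r columns then has squared Frobenius norm of order r.
  Supports inside one block suffice, as A and B are treated separately.\<close>

lemma bad_bound:
  assumes sol: "cca_solution p m r (int ku) (int kv) Sh A B" and Sh: "Sh \<in> carrier_mat (p + m) (p + m)"
    and H: "emb Sh = tp Z * Z"
    and op: "\<And>T. T \<in> F \<Longrightarrow> opb b (idm T * (emb Sh) * idm T)"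
    and sm: "\<And>T y. T \<in> F \<Longrightarrow> T \<subseteq> {..<p} \<or> T \<subseteq> {p..<p + m} \<Longrightarrow> y \<in> net \<delta> (T \<times> {0}) \<Longrightarrow>
      1/2 \<le> norm y \<Longrightarrow> tau \<le> inner y (emb Sh * y)"
    and tau: "0 < tau" "tau \<le> 1" and \<delta>: "0 < \<delta>" "\<delta> \<le> 1/2" "b * \<delta>\<^sup>2 \<le> tau / 4"
  shows "(norm (emb A * tp (emb B) - u * tp v))\<^sup>2 \<le> 2 * ((4 / tau) ^ 4 + M ^ 4) * real r" "r \<le> ku" "r \<le> kv"
proof -
  let ?Rx = "idm {..<p}" and ?Ry = "shiftm p m"
  define Hf where "Hf = emb Sh"
  have feas: "cca_feasible p m r (int ku) (int kv) Sh A B" using sol by (simp add: cca_solution_def)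
  note fe = feasible[OF feas Sh, folded Hf_def]
  obtain Ta where Ta: "Ta \<subseteq> {..<p}" "card Ta = ku" "idm Ta * emb A = emb A" using fe(7) by blast
  obtain Tb where Tb: "Tb \<subseteq> {..<m}" "card Tb = kv" "idm Tb * emb B = emb B" using fe(8) by blast
  have fin: "finite Ta" "finite Tb" using Ta(1) Tb(1) finite_subset by blast+
  show "r \<le> ku" using rank_support[OF fin(1) Ta(3) fe(5,3)] Ta(2) by simp
  show "r \<le> kv" using rank_support[OF fin(2) Tb(3) fe(6,4)] Tb(2) by simp
  define t where "t = 4 / tau"
  have t1: "1 \<le> t" using tau by (simp add: t_def)
  have g: "opb t (tp R * X)" if T: "finite T" "T \<in> F" "T \<subseteq> {..<p} \<or> T \<subseteq> {p..<p + m}" and TX: "idm T * (tp R * X) = tp R * X"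
    and XX: "tp X * (R * Hf * tp R) * X = idm {..<r}" for T R X
    unfolding opb_def
  proof
    fix K
    have "(norm (tp R * X * K))\<^sup>2 \<le> t * (norm (Z * (tp R * X * K)))\<^sup>2" unfolding t_def
    proof (rule lower_net[OF T(1) _ _ tau(1) \<delta>])
      show "opb b (idm T * (tp Z * Z) * idm T)" using op[OF T(2)] by (simp add: H)
      show "tau \<le> inner y (tp Z * Z * y)" if "y \<in> net \<delta> (T \<times> {0})" "1 / 2 \<le> norm y" for y
        using sm[OF T(2,3) that] by (simp add: H)
      show "idm T * (tp R * X * K) = tp R * X * K" using TX by (simp add: mult.assoc[symmetric])
    qed
    also have "(norm (Z * (tp R * X * K)))\<^sup>2 = inner K ((tp X * (R * Hf * tp R) * X) * K)"
      by (simp add: power2_norm_eq_inner inner_mult_left tp_simps Hf_def H mult.assoc)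
    also have "\<dots> \<le> norm K * (1 * norm K)" unfolding XX
      by (intro order_trans[OF norm_cauchy_schwarz] mult_left_mono opbD opb_idm) auto
    finally have "(norm (tp R * X * K))\<^sup>2 \<le> t * (norm K)\<^sup>2" using t1 by (simp add: power2_eq_square)
    also have "\<dots> \<le> t\<^sup>2 * (norm K)\<^sup>2" using t1 by (intro mult_right_mono) (auto simp: power2_eq_square)
    finally show "norm (tp R * X * K) \<le> t * norm K"
      using t1 by (simp add: power_mult_distrib[symmetric] power2_le_iff_abs_le)
  qed
  have TaF: "Ta \<in> F" using F_join[OF Ta(1), of "{}"] Ta(2) by simp
  have oA: "opb t (emb A)"
  proof -
    have "?Rx * emb A = ?Rx * idm Ta * emb A" using Ta(3) by (simp add: mult.assoc)
    also have "\<dots> = emb A" using Ta fin by (simp add: idm_idm Int_absorb1)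
    finally have RA: "?Rx * emb A = emb A" .
    have "opb t (tp ?Rx * emb A)"
      by (rule g[OF fin(1) TaF _ _ fe(3)]) (use RA Ta in auto)
    then show ?thesis by (simp add: RA)
  qed
  have oB: "opb t (emb B)"
  proof -
    let ?T = "(+) p ` Tb"
    have TF: "?T \<in> F" using F_join[of "{}" Tb] Tb by simp
    have "idm ?T * tp ?Ry = tp ?Ry * idm Tb" using idm_shiftm[OF fin(2) Tb(1), of p] by (metis tp_idm tp_mult)
    then have "idm ?T * (tp ?Ry * emb B) = tp ?Ry * emb B" using Tb(3) by (metis mult.assoc)
    then have oRB: "opb t (tp ?Ry * emb B)"
      by (intro g[OF _ TF _ _ fe(4)]) (use Tb fin in auto)
    have RR: "?Ry * (tp ?Ry * emb B) = emb B"
    proof (rule fmat_eqI)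
      fix i j
      have d: "dimb (p + m) (tp ?Ry)" by (auto simp: dimb_def shiftm_def)
      have "ent (?Ry * (tp ?Ry * emb B)) i j = (if i < m then ent (tp ?Ry * emb B) (p + i) j else 0)"
        by (simp add: ent_shiftm_times)
      also have "\<dots> = ent (emb B) i j"
      proof (cases "i < m")
        case True
        have "ent (tp ?Ry * emb B) (p + i) j = (\<Sum>k<p + m. if k = i then ent (emb B) i j else 0)"
          unfolding ent_times[OF d] using True by (intro sum.cong) (auto simp: shiftm_def)
        then show ?thesis using True by simp
      next
        case False
        then show ?thesis using fe(2) by (simp add: ent_emb)
      qed
      finally show "ent (?Ry * (tp ?Ry * emb B)) i j = ent (emb B) i j" .
    qed
    have "opb (1 * t) (?Ry * (tp ?Ry * emb B))" by (intro opb_mult opb_shiftm oRB)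
    then show ?thesis by (simp add: RR)
  qed
  have prod: "(norm (X * tp Y))\<^sup>2 \<le> c ^ 4 * real r" if X: "opb c X" and Y: "opb c Y" "Y * idm {..<r} = Y" for c X Y
  proof -
    have c0: "0 \<le> c" by (rule opb_nonneg[OF X])
    have "norm (X * tp Y) \<le> c * norm (tp Y)" by (rule opbD[OF X])
    also have "norm (tp Y) = norm (Y * idm {..<r})" by (simp add: Y)
    also have "c * norm (Y * idm {..<r}) \<le> c * (c * norm (idm {..<r}))" by (intro mult_left_mono opbD Y c0)
    finally have "(norm (X * tp Y))\<^sup>2 \<le> (c * (c * norm (idm {..<r})))\<^sup>2" by (intro power_mono) auto
    also have "\<dots> = c ^ 4 * real r"
      unfolding norm_idm_sq[symmetric] by (simp add: power_mult_distrib power2_eq_square power4_eq_xxxx mult_ac)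
    finally show ?thesis .
  qed
  have 1: "(norm (emb A * tp (emb B)))\<^sup>2 \<le> t ^ 4 * real r" by (rule prod[OF oA oB fe(6)])
  have 2: "(norm (u * tp v))\<^sup>2 \<le> M ^ 4 * real r" by (rule prod[OF ou ov vI])
  have "(norm (emb A * tp (emb B) - u * tp v))\<^sup>2 \<le> (norm (emb A * tp (emb B)) + norm (u * tp v))\<^sup>2"
    by (intro power_mono norm_triangle_ineq4) auto
  also have "\<dots> \<le> 2 * ((norm (emb A * tp (emb B)))\<^sup>2 + (norm (u * tp v))\<^sup>2)"
    using sum_squares_bound[of "norm (emb A * tp (emb B))" "norm (u * tp v)"] by (simp add: power2_sum)
  also have "\<dots> \<le> 2 * (t ^ 4 * real r + M ^ 4 * real r)" using 1 2 by simp
  finally show "(norm (emb A * tp (emb B) - u * tp v))\<^sup>2 \<le> 2 * ((4 / tau) ^ 4 + M ^ 4) * real r"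
    by (simp add: t_def algebra_simps)
qed

end

section \<open>Probability of the favourable events\<close>

text \<open>Nonnegativity of the form at c K - S K gives that the squared norm of S K is at most c
  times \<open>inner K (S * K)\<close>.\<close>

lemma opb_psd:
  assumes psd: "\<And>K. 0 \<le> inner K (S * K)" and up: "\<And>K. inner K (S * K) \<le> c * (norm K)\<^sup>2" and c: "0 < c" and tS: "tp S = S"
  shows "opb c S"
  unfolding opb_def
proof
  fix K
  define X where "X = S * K"
  have KX: "inner K (S * X) = (norm X)\<^sup>2" using inner_mult_left[of S K X] by (simp add: X_def tS power2_norm_eq_inner)
  have "0 \<le> inner (c *\<^sub>R K - X) (S * (c *\<^sub>R K - X))" by (rule psd)
  also have "\<dots> = c\<^sup>2 * inner K X - 2 * c * (norm X)\<^sup>2 + inner X (S * X)"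
    using KX by (simp add: right_diff_distrib inner_diff_left inner_diff_right X_def[symmetric] power2_eq_square)
      (simp add: inner_commute power2_norm_eq_inner[unfolded power2_eq_square] algebra_simps)
  also have "inner X (S * X) \<le> c * (norm X)\<^sup>2" by (rule up)
  finally have "c * (norm X)\<^sup>2 \<le> c * (c * inner K X)" by (simp add: power2_eq_square algebra_simps)
  then have "(norm X)\<^sup>2 \<le> c * inner K X" using c by simp
  also have "\<dots> \<le> c * (norm K * norm X)" using c by (intro mult_left_mono norm_cauchy_schwarz) auto
  finally have "norm X * norm X \<le> (c * norm K) * norm X" by (simp add: power2_eq_square mult_ac)
  then show "norm (S * K) \<le> c * norm K"
    using c by (cases "norm X = 0") (auto simp: X_def dest: mult_right_le_imp_le)
qed

text \<open>Denominator of the tail exponent: 32 times the square of 4 M, where 4 M bounds the joint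
  covariance (\<open>upper\<close>).\<close>

definition ct :: "real \<Rightarrow> real" where "ct M = 512 * M\<^sup>2"
definition Cq :: "real \<Rightarrow> real" where "Cq q = (2 + q) / (2 - q)"
text \<open>The sum of all demands on the small constant, so that its reciprocal meets each of them.
  In order: eta small relative to \<lambda>, \<rho> small, the remaining correlations small, and a
  sample size of at least 8 ell.\<close>

definition small_inv :: "real \<Rightarrow> real \<Rightarrow> real" where
  "small_inv q M = 2 ^ 16 * 17 * ct M * (2 * M) ^ 24 + 1024 * (2 * M) ^ 4 * (4 * Cq q + 288 * M\<^sup>2 * ct M)
     + 256 * (2 * M) ^ 12 + 8"
definition csmall :: "real \<Rightarrow> real \<Rightarrow> real" where "csmall q M = 1 / small_inv q M"
text \<open>Crude upper bound for sparse operator norms of the sample covariance in the high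
  confidence case: noise plus population.\<close>

definition bbound :: "real \<Rightarrow> real \<Rightarrow> real" where "bbound M C = 4 * (ct M * (16 + 2 * C)) + 4 * M"
text \<open>Minus the logarithm of the sparse eigenvalue bound tau in the high confidence case,
  chosen to outweigh net entropy and confidence.\<close>

definition ybound :: "real \<Rightarrow> real \<Rightarrow> real" where
  "ybound M C = 14 + ln (4 * bbound M C) + 4 * ln (4 * M) + 2 * C"
text \<open>The square of the constant of \<open>estimation_error\<close>, times the constant that
  bounds the square of \<rho> by the rate.\<close>

definition Cgood :: "real \<Rightarrow> real \<Rightarrow> real \<Rightarrow> real \<Rightarrow> real" where
  "Cgood q kap M C = (74 * (2 * M) ^ 8 * kap)\<^sup>2 * (4 * Cq q + 32 * M\<^sup>2 * ct M * (8 + 2 * C))"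
text \<open>The constant of \<open>bad_bound\<close> times C / c, which bounds the ratio of r to the
  squared rate in that case.\<close>

definition Cbad :: "real \<Rightarrow> real \<Rightarrow> real \<Rightarrow> real" where
  "Cbad q M C = 2 * ((4 / exp (- ybound M C)) ^ 4 + M ^ 4) * (C / csmall q M)"

lemma csmall_facts:
  assumes q: "0 \<le> q" "q < 2" and M: "1 < M"
  shows "1 \<le> Cq q" "1 \<le> ct M" "0 < csmall q M" "csmall q M \<le> 1/8"
    "2 ^ 16 * 17 * ct M * (2 * M) ^ 24 * csmall q M \<le> 1"
    "1024 * (2 * M) ^ 4 * (4 * Cq q + 288 * M\<^sup>2 * ct M) * csmall q M \<le> 1"
    "256 * (2 * M) ^ 12 * csmall q M \<le> 1"
proof -
  show Cq: "1 \<le> Cq q" using q by (simp add: Cq_def field_simps)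
  have "1\<^sup>2 \<le> M\<^sup>2" using M by (intro power_mono) auto
  then show ct: "1 \<le> ct M" by (simp add: ct_def)
  define a where "a = 2 ^ 16 * 17 * ct M * (2 * M) ^ 24"
  define b where "b = 1024 * (2 * M) ^ 4 * (4 * Cq q + 288 * M\<^sup>2 * ct M)"
  define d where "d = 256 * (2 * M) ^ 12"
  have p: "0 \<le> a" "0 \<le> b" "0 \<le> d" using ct Cq M by (auto simp: a_def b_def d_def)
  have s: "small_inv q M = a + b + d + 8" by (simp add: small_inv_def a_def b_def d_def)
  have c: "csmall q M = 1 / (a + b + d + 8)" by (simp add: csmall_def s)
  show "0 < csmall q M" "csmall q M \<le> 1/8" using p by (auto simp: c field_simps)
  show "2 ^ 16 * 17 * ct M * (2 * M) ^ 24 * csmall q M \<le> 1" unfolding a_def[symmetric] c using p by (simp add: field_simps)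
  show "1024 * (2 * M) ^ 4 * (4 * Cq q + 288 * M\<^sup>2 * ct M) * csmall q M \<le> 1" unfolding b_def[symmetric] c using p by (simp add: field_simps)
  show "256 * (2 * M) ^ 12 * csmall q M \<le> 1" unfolding d_def[symmetric] c using p by (simp add: field_simps)
qed

lemma exp_3: "6 * exp (-3) \<le> (1::real)"
proof -
  have "6 \<le> exp (3::real)" using exp_lower_Taylor_quadratic[of 3] by (simp add: power2_eq_square)
  then show ?thesis by (simp add: exp_minus field_simps)
qed

section \<open>The two cases for the confidence level\<close>

context cca
begin

sublocale G: gauss "p + m" S
  using Sc Ssym posdef by unfold_locales (simp_all add: Sf_def)

lemma GSf: "G.Sf = Sf" by (simp add: G.Sf_def Sf_def)

lemma upG: "inner K (G.Sf * K) \<le> (4 * M) * (norm K)\<^sup>2"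
  using upper[of K] by (simp add: GSf)

abbreviation "c0 \<equiv> csmall q M"
abbreviation "P \<equiv> gauss_sample n (p + m) S"

lemma rate: "real n * x / (32 * (4 * M)\<^sup>2) = real n * x / ct M"
  by (simp add: ct_def power_mult_distrib)

lemmas cf = csmall_facts[OF q M1]

lemma aa_nonneg: "0 \<le> aa" using l_ge1 by (simp add: aa_def)

text \<open>This converts the failure of the confidence condition into a bound on r: aa is then at
  least a multiple of n lam^2, and r times aa is at most LL, which is n lam^2 times the squared
  rate.\<close>

lemma r_aa: "r \<le> ku \<Longrightarrow> r \<le> kv \<Longrightarrow> real r * aa \<le> LL"
proof -
  assume k: "r \<le> ku" "r \<le> kv"
  have "real r * lu \<le> real ku * lu" "real r * lv \<le> real kv * lv" using k l_ge1 by (auto intro!: mult_right_mono)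
  then show ?thesis by (simp add: aa_def LL_def ell_def algebra_simps)
qed

text \<open>The summand 3 in each exponent absorbs the factor 6 of three two-sided tails.\<close>

lemma event_complement:
  assumes B: "B1 \<in> sets P" "B2 \<in> sets P" "B3 \<in> sets P"
    and m: "measure P B1 \<le> 2 * exp (- 3 - x)" "measure P B2 \<le> 2 * exp (- 3 - x)" "measure P B3 \<le> 2 * exp (- 3 - x)"
  shows "1 - exp (- x) \<le> measure P (space P - (B1 \<union> B2 \<union> B3))"
proof -
  interpret Pr: prob_space P by (rule G.prob_GS)
  have "measure P (B1 \<union> B2 \<union> B3) \<le> measure P (B1 \<union> B2) + measure P B3" using B by (intro measure_Un_le) auto
  also have "measure P (B1 \<union> B2) \<le> measure P B1 + measure P B2" using B by (intro measure_Un_le) auto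
  finally have "measure P (B1 \<union> B2 \<union> B3) \<le> 6 * exp (- 3 - x)" using m by linarith
  also have "6 * exp (- 3 - x) = (6 * exp (- 3)) * exp (- x)" by (simp add: exp_add[symmetric] mult.assoc)
  also have "\<dots> \<le> 1 * exp (- x)" by (intro mult_right_mono exp_3) auto
  finally show ?thesis using B by (subst Pr.prob_compl) auto
qed

lemma good_event:
  assumes C: "0 < C" and good: "C * aa \<le> c0 * (real n * lam\<^sup>2)" and e: "eps2 \<le> c0"
    and lr: "(if r < min p m then l (r + 1) else 0) \<le> c0 * lam"
  shows "\<exists>E\<in>sets P. 1 - exp (- (C * aa)) \<le> measure P E \<and>
    (\<forall>z\<in>E. \<forall>A B. cca_solution p m r (int ku) (int kv) (sample_cov n (p + m) z) A B \<longrightarrow>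
      (norm (emb A * tp (emb B) - u * tp v))\<^sup>2 \<le> Cgood q kap M C * eps2)"
proof -
  define N where "N = real n * lam\<^sup>2"
  have N: "0 < N" using n lam by (simp add: N_def)
  have nr: "0 < real n" using n by simp
  have LLN: "LL = N * eps2" using LL_eq by (simp add: N_def)
  have LLc: "LL \<le> c0 * N" using mult_left_mono[OF e, of N] N by (simp add: LLN mult.commute)
  have ct1: "1 \<le> ct M" by (rule cf(2))
  have e0: "0 < eps2" using ell_ge N LLN by (smt (verit) zero_less_mult_pos)
  have Caa: "C * aa \<le> 2 * C * LL"
  proof -
    have "C * aa \<le> C * (2 * LL)" using aa_le ell_ge(3) C by (intro mult_left_mono) auto
    then show ?thesis by simp
  qed
  have Caa0: "0 \<le> C * aa" using C aa_nonneg by simp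
  \<comment> \<open>Chosen to make the tail exponent equal to the quantity in brackets. In it, 14
    ell is 2 ell for the choice of the support and at most 12 ell for the two nets, C aa is the
    confidence, and 3 pays for adding events. For eta2, 6 LL covers supports and one net of matrices
    with r columns.\<close>
  define eta where "eta = sqrt (ct M * (14 * ell + C * aa + 3) / real n)"
  define eta2 where "eta2 = sqrt (ct M * (6 * LL + C * aa + 3) / real n)"
  have pos1: "0 < 14 * ell + C * aa + 3" and pos2: "0 < 6 * LL + C * aa + 3" using ell_ge Caa0 by auto
  have eta0: "0 < eta" "0 < eta2" using pos1 pos2 ct1 nr by (auto simp: eta_def eta2_def)
  have esq: "eta\<^sup>2 = ct M * (14 * ell + C * aa + 3) / real n" "eta2\<^sup>2 = ct M * (6 * LL + C * aa + 3) / real n"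
    using pos1 pos2 ct1 nr by (auto simp: eta_def eta2_def)
  have conv: "ct M * x / real n \<le> ct M * y * lam\<^sup>2" if "x \<le> y * N" for x y
  proof -
    have "ct M * x \<le> ct M * (y * N)" using that ct1 by (intro mult_left_mono) auto
    then show ?thesis using nr by (simp add: N_def field_simps)
  qed
  have eta_le: "eta\<^sup>2 \<le> ct M * (17 * c0) * lam\<^sup>2" unfolding esq
    by (rule conv) (use ell_ge LLc good in \<open>simp add: N_def[symmetric]\<close>)
  have eta2_le: "eta2\<^sup>2 \<le> ct M * (9 * c0) * lam\<^sup>2" unfolding esq
    by (rule conv) (use ell_ge LLc good in \<open>simp add: N_def[symmetric]\<close>)
  have eta2_eps: "eta2\<^sup>2 \<le> ct M * ((8 + 2 * C) * eps2) * lam\<^sup>2" unfolding esq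
    by (rule conv) (use ell_ge Caa in \<open>simp add: LLN algebra_simps\<close>)
  have "1 \<le> 2 * M" using M1 by simp
  then have M24: "1 \<le> (2 * M) ^ 24" "1 \<le> (2 * M) ^ 12" by (rule one_le_power)+
  have small: "256 * (2 * M) ^ 12 * y \<le> lam" if y: "0 < y" "y\<^sup>2 \<le> ct M * (17 * c0) * lam\<^sup>2" for y
  proof -
    have "(256 * (2 * M) ^ 12 * y)\<^sup>2 = 2 ^ 16 * (2 * M) ^ 24 * y\<^sup>2"
      by (simp add: power_mult_distrib power_mult[symmetric])
    also have "\<dots> \<le> 2 ^ 16 * (2 * M) ^ 24 * (ct M * (17 * c0) * lam\<^sup>2)" using M24 by (intro mult_left_mono y) auto
    also have "\<dots> = (2 ^ 16 * 17 * ct M * (2 * M) ^ 24 * c0) * lam\<^sup>2" by (simp only: mult_ac)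
    also have "\<dots> \<le> 1 * lam\<^sup>2" by (intro mult_right_mono cf(5)) auto
    finally have "(256 * (2 * M) ^ 12 * y)\<^sup>2 \<le> lam\<^sup>2" by simp
    then show ?thesis by (rule power2_le_imp_le) (use lam in simp)
  qed
  have le1: "y \<le> 1" if y: "0 < y" "y\<^sup>2 \<le> ct M * (17 * c0) * lam\<^sup>2" for y
  proof -
    have "1 * y \<le> (256 * (2 * M) ^ 12) * y" using y M24(2) by (intro mult_right_mono) auto
    then show ?thesis using small[OF y] lam1 by simp
  qed
  have "ct M * (9 * c0) * lam\<^sup>2 \<le> ct M * (17 * c0) * lam\<^sup>2"
    using ct1 cf(3) by (intro mult_right_mono mult_left_mono) auto
  then have eta2_17: "eta2\<^sup>2 \<le> ct M * (17 * c0) * lam\<^sup>2" using eta2_le by linarith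
  have et1: "eta \<le> 1" "eta2 \<le> 1" using le1[OF eta0(1) eta_le] le1[OF eta0(2) eta2_17] by auto
  \<comment> \<open>Both deviations are at most 1, so the quadratic regime of the tail bound
    applies.\<close>
  have mn: "min eta (eta\<^sup>2) = eta\<^sup>2" "min eta2 (eta2\<^sup>2) = eta2\<^sup>2"
    using et1 eta0 by (auto simp: min_def power2_eq_square mult_le_cancel_left1)
  have ex1: "real n * min eta (eta\<^sup>2) / (32 * (4 * M)\<^sup>2) = 14 * ell + C * aa + 3"
    unfolding rate mn unfolding esq using nr ct1 by simp
  have ex2: "real n * min eta2 (eta2\<^sup>2) / (32 * (4 * M)\<^sup>2) = 6 * LL + C * aa + 3"
    unfolding rate mn unfolding esq using nr ct1 by simp
  \<comment> \<open>Half of the square is the truncation bias; the other half covers the filling of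
    zero rows, done with e = eps2.\<close>
  define be where "be = sqrt (2 * Cq q * eps2)"
  have be2: "be\<^sup>2 = 2 * Cq q * eps2" and be0: "0 \<le> be" using cf(1) e0 by (auto simp: be_def)
  define om where "om = 4 * M * eta2"
  have om0: "0 \<le> om" using eta0 M1 by (simp add: om_def)
  define \<rho> where "\<rho> = be + om / lam"
  have rho0: "0 \<le> \<rho>" using be0 om0 lam by (simp add: \<rho>_def)
  have rho2: "\<rho>\<^sup>2 \<le> 4 * Cq q * eps2 + 32 * M\<^sup>2 * y" if "eta2\<^sup>2 \<le> y * lam\<^sup>2" for y
  proof -
    have "\<rho>\<^sup>2 \<le> 2 * be\<^sup>2 + 2 * (om / lam)\<^sup>2"
      using sum_squares_bound[of be "om / lam"] by (simp add: \<rho>_def power2_sum)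
    also have "(om / lam)\<^sup>2 = 16 * M\<^sup>2 * (eta2\<^sup>2 / lam\<^sup>2)" by (simp add: om_def power_mult_distrib power_divide)
    also have "\<dots> \<le> 16 * M\<^sup>2 * y" using that lam by (intro mult_left_mono) (auto simp: pos_divide_le_eq)
    finally show ?thesis by (simp add: be2)
  qed
  have rho_c: "\<rho>\<^sup>2 \<le> (4 * Cq q + 288 * M\<^sup>2 * ct M) * c0"
  proof -
    have "4 * Cq q * eps2 \<le> 4 * Cq q * c0" using e cf(1) by (intro mult_left_mono) auto
    then show ?thesis using rho2[OF eta2_le] by (simp add: algebra_simps)
  qed
  have rho_eps: "\<rho>\<^sup>2 \<le> (4 * Cq q + 32 * M\<^sup>2 * ct M * (8 + 2 * C)) * eps2"
    using rho2[OF eta2_eps] by (simp add: algebra_simps)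
  have rho_small: "32 * (2 * M)\<^sup>2 * \<rho> \<le> 1"
  proof -
    have "(32 * (2 * M)\<^sup>2 * \<rho>)\<^sup>2 = 1024 * (2 * M) ^ 4 * \<rho>\<^sup>2"
      by (simp add: power_mult_distrib power_mult[symmetric])
    also have "\<dots> \<le> 1024 * (2 * M) ^ 4 * ((4 * Cq q + 288 * M\<^sup>2 * ct M) * c0)" by (intro mult_left_mono rho_c) auto
    also have "\<dots> \<le> 1\<^sup>2" using cf(6) by (simp add: mult.assoc)
    finally show ?thesis by (rule power2_le_imp_le) simp
  qed
  have be1: "be \<le> 1"
  proof -
    have "1 * \<rho> \<le> (32 * (2 * M)\<^sup>2) * \<rho>"
    proof (rule mult_right_mono[OF _ rho0])
      have "1\<^sup>2 \<le> (2 * M)\<^sup>2" using M1 by (intro power_mono) auto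
      then show "1 \<le> 32 * (2 * M)\<^sup>2" by simp
    qed
    moreover have "be \<le> \<rho>" using om0 lam by (simp add: \<rho>_def)
    ultimately show ?thesis using rho_small by simp
  qed
  have Ul: "first_cols r U \<in> carrier_mat p r" and Vl: "first_cols r V \<in> carrier_mat m r"
    using U V by (auto simp: first_cols_def)
  have wU: "weak_norm q (first_cols r U) \<le> su" and wV: "weak_norm q (first_cols r V) \<le> sv"
    using dec by (auto simp: Fq_decomp_def Let_def)
  obtain Tu wu where wu: "Tu \<subseteq> {..<p}" "card Tu = ku" "suppd ({..<p} \<times> {..<r}) wu" "idm Tu * wu = wu"
    "\<And>i. i \<in> Tu \<Longrightarrow> \<exists>j. ent wu i j \<noteq> 0"
    "(norm (wu - emb (first_cols r U)))\<^sup>2 \<le> (2 + q) / (2 - q) * (real ku * (real r + ln (exp 1 * real p / real ku)) / (real n * lam\<^sup>2)) + eps2"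
    by (rule truncate[OF q s(1) lam(1) n r(1) Ul pm(1) wU ku e0]) (rule that)
  obtain Tv wv where wv: "Tv \<subseteq> {..<m}" "card Tv = kv" "suppd ({..<m} \<times> {..<r}) wv" "idm Tv * wv = wv"
    "\<And>i. i \<in> Tv \<Longrightarrow> \<exists>j. ent wv i j \<noteq> 0"
    "(norm (wv - emb (first_cols r V)))\<^sup>2 \<le> (2 + q) / (2 - q) * (real kv * (real r + ln (exp 1 * real m / real kv)) / (real n * lam\<^sup>2)) + eps2"
    by (rule truncate[OF q s(2) lam(1) n r(1) Vl pm(2) wV kv e0]) (rule that)
  have bias: "norm D \<le> be" if D: "(norm D)\<^sup>2 \<le> Cq q * (x / (real n * lam\<^sup>2)) + eps2" and x: "x \<le> LL" for D :: fmat and x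
  proof -
    have "x / (real n * lam\<^sup>2) \<le> eps2" unfolding eps2 using x n by (intro divide_right_mono) auto
    then have "Cq q * (x / (real n * lam\<^sup>2)) \<le> Cq q * eps2" using cf(1) by (intro mult_left_mono) auto
    moreover have "1 * eps2 \<le> Cq q * eps2" using cf(1) e0 by (intro mult_right_mono) auto
    ultimately have "(norm D)\<^sup>2 \<le> be\<^sup>2" using D unfolding be2 by linarith
    then show ?thesis by (rule power2_le_imp_le) (rule be0)
  qed
  have kul: "0 \<le> real kv * lv" "0 \<le> real ku * lu" using l_ge1 by auto
  have bu: "norm (wu - u) \<le> be" unfolding u_def
    by (rule bias[OF wu(6)[folded Cq_def lu_def]]) (use kul in \<open>simp add: LL_def ell_def algebra_simps\<close>)
  have bv: "norm (wv - v) \<le> be" unfolding v_def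
    by (rule bias[OF wv(6)[folded Cq_def lv_def]]) (use kul in \<open>simp add: LL_def ell_def algebra_simps\<close>)
  have ow: "opb (2 * M) w" if "opb M x" "norm (w - x) \<le> be" for w x
  proof -
    have "opb (M + norm (w - x)) (x + (w - x))" by (intro opb_add that opb_norm)
    then show ?thesis using opb_mono[of "M + norm (w - x)" w "2 * M"] that(2) be1 M1 by simp
  qed
  \<comment> \<open>The truncation for y placed in joint coordinates, so that its noise in both Hy
    and Hxy comes from a single event.\<close>
  define W where "W = tp (shiftm p m) * wv"
  have sWu: "suppd ({..<p + m} \<times> {..<r}) wu" using wu(3) by (auto simp: suppd_def)
  have sW: "suppd ({..<p + m} \<times> {..<r}) W"
    unfolding suppd_def
  proof (intro allI impI)
    fix i j assume ij: "(i, j) \<notin> {..<p + m} \<times> {..<r}"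
    have "p + m \<le> i \<Longrightarrow> ent W i j = 0" unfolding W_def by (rule ent_zero_row) (simp add: shiftm_def)
    moreover have "r \<le> j \<Longrightarrow> ent W i j = 0" unfolding W_def using wv(3) by (intro ent_zero_col) (simp add: suppd_def)
    ultimately show "ent W i j = 0" using ij by auto
  qed
  have oWu: "opb (2 * M) wu" by (rule ow[OF ou bu])
  have oW: "opb (2 * M) W" unfolding W_def
    using opb_mult[OF opb_tp[OF opb_shiftm] ow[OF ov bv]] by simp
  have M41: "1 \<le> 4 * M" and M20: "0 < 2 * M" using M1 by auto
  obtain B1 where B1: "B1 \<in> sets P"
    "measure P B1 \<le> real (card F) * exp (6 * real (2 * (ku + kv))) * (2 * exp (- (real n * min eta (eta\<^sup>2) / (32 * (4 * M)\<^sup>2))))"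
    "\<And>z T. z \<in> space P - B1 \<Longrightarrow> T \<in> F \<Longrightarrow> opb (4 * eta) (idm T * (cov n (p + m) z - G.Sf) * idm T)"
    by (rule G.event_op[OF finF F_props upG M41 eta0(1) n]) (assumption, rule that)
  obtain B2 where B2: "B2 \<in> sets P"
    "measure P B2 \<le> real (card F) * exp (3 * real (2 * (ku + kv) * r)) * (2 * exp (- (real n * min eta2 (eta2\<^sup>2) / (32 * (4 * M)\<^sup>2))))"
    "\<And>z T. z \<in> space P - B2 \<Longrightarrow> T \<in> F \<Longrightarrow> norm (idm T * (cov n (p + m) z - G.Sf) * wu) \<le> 2 * (2 * M * eta2)"
    by (rule G.event_lin[OF finF F_props sWu oWu M20 upG M41 eta0(2) n]) (assumption, rule that)
  obtain B3 where B3: "B3 \<in> sets P"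
    "measure P B3 \<le> real (card F) * exp (3 * real (2 * (ku + kv) * r)) * (2 * exp (- (real n * min eta2 (eta2\<^sup>2) / (32 * (4 * M)\<^sup>2))))"
    "\<And>z T. z \<in> space P - B3 \<Longrightarrow> T \<in> F \<Longrightarrow> norm (idm T * (cov n (p + m) z - G.Sf) * W) \<le> 2 * (2 * M * eta2)"
    by (rule G.event_lin[OF finF F_props sW oW M20 upG M41 eta0(2) n]) (assumption, rule that)
  have fail: "real (card F) * exp x * (2 * exp (- (y + C * aa + 3))) \<le> 2 * exp (- 3 - C * aa)"
    if "2 * ell + x \<le> y" for x y
  proof -
    have "real (card F) * exp x * (2 * exp (- (y + C * aa + 3))) \<le> exp (2 * ell) * exp x * (2 * exp (- (y + C * aa + 3)))"
      by (intro mult_right_mono cardF) auto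
    also have "\<dots> = 2 * exp (2 * ell + x - y - C * aa - 3)" by (simp add: exp_add[symmetric] algebra_simps)
    also have "\<dots> \<le> 2 * exp (- 3 - C * aa)" using that by simp
    finally show ?thesis .
  qed
  have m1: "measure P B1 \<le> 2 * exp (- 3 - C * aa)"
    by (rule order_trans[OF B1(2)], unfold ex1, rule fail) (use ell_ge in simp)
  have LLx: "2 * ell + 3 * real (2 * (ku + kv) * r) \<le> 6 * LL"
    using ell_ge(2) by (simp add: LL_def algebra_simps)
  have m2: "measure P B2 \<le> 2 * exp (- 3 - C * aa)"
    by (rule order_trans[OF B2(2)], unfold ex2, rule fail[OF LLx])
  have m3: "measure P B3 \<le> 2 * exp (- 3 - C * aa)"
    by (rule order_trans[OF B3(2)], unfold ex2, rule fail[OF LLx])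
  show ?thesis
  proof (rule bexI[of _ "space P - (B1 \<union> B2 \<union> B3)"], intro conjI ballI allI impI)
    show "1 - exp (- (C * aa)) \<le> measure P (space P - (B1 \<union> B2 \<union> B3))"
      by (rule event_complement[OF B1(1) B2(1) B3(1) m1 m2 m3])
    show "space P - (B1 \<union> B2 \<union> B3) \<in> sets P" using B1(1) B2(1) B3(1) by auto
    fix z A B
    assume z: "z \<in> space P - (B1 \<union> B2 \<union> B3)"
      and sol: "cca_solution p m r (int ku) (int kv) (sample_cov n (p + m) z) A B"
    have z1: "z \<in> space P - B1" "z \<in> space P - B2" "z \<in> space P - B3" using z by auto
    obtain Z where Z: "cov n (p + m) z = tp Z * Z" by (rule cov_factor[OF n])
    have Sh: "sample_cov n (p + m) z \<in> carrier_mat (p + m) (p + m)" by (simp add: sample_cov_def)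
    have "norm (emb A * tp (emb B) - u * tp v) \<le> 74 * (2 * M) ^ 8 * kap * \<rho>"
    proof (rule good_bound[OF sol Sh Z[unfolded cov_def] _ _ _ wu(1-5) wv(1-5) bu bv be0 be1 om0 \<rho>_def rho_small eta0(1) small[OF eta0(1) eta_le] _ cf(7) lr])
      show "opb (4 * eta) (idm T * (emb (sample_cov n (p + m) z) - Sf) * idm T)" if "T \<in> F" for T
        using B1(3)[OF z1(1) that] by (simp add: GSf cov_def)
      show "norm (idm T * (emb (sample_cov n (p + m) z) - Sf) * wu) \<le> om" if "T \<in> F" for T
        using B2(3)[OF z1(2) that] by (simp add: GSf cov_def om_def)
      show "norm (idm T * (emb (sample_cov n (p + m) z) - Sf) * (tp (shiftm p m) * wv)) \<le> om" if "T \<in> F" for T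
        using B3(3)[OF z1(3) that] by (simp add: GSf cov_def om_def W_def)
      show "0 \<le> c0" using cf(3) by simp
    qed
    then have "(norm (emb A * tp (emb B) - u * tp v))\<^sup>2 \<le> (74 * (2 * M) ^ 8 * kap * \<rho>)\<^sup>2" by (intro power_mono) auto
    also have "\<dots> = (74 * (2 * M) ^ 8 * kap)\<^sup>2 * \<rho>\<^sup>2" by (rule power_mult_distrib)
    also have "\<dots> \<le> (74 * (2 * M) ^ 8 * kap)\<^sup>2 * ((4 * Cq q + 32 * M\<^sup>2 * ct M * (8 + 2 * C)) * eps2)"
      by (intro mult_left_mono rho_eps) auto
    finally show "(norm (emb A * tp (emb B) - u * tp v))\<^sup>2 \<le> Cgood q kap M C * eps2"
      by (simp add: Cgood_def mult.assoc)
  qed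
qed

lemma ln_3_le_2: "ln (3::real) \<le> 2"
  using ln_le_minus_one[of "3::real"] by simp

lemma bad_event:
  assumes C: "0 < C" and bad: "c0 * (real n * lam\<^sup>2) < C * aa" and e: "eps2 \<le> c0"
  shows "\<exists>E\<in>sets P. 1 - exp (- (C * aa)) \<le> measure P E \<and>
    (\<forall>z\<in>E. \<forall>A B. cca_solution p m r (int ku) (int kv) (sample_cov n (p + m) z) A B \<longrightarrow>
      (norm (emb A * tp (emb B) - u * tp v))\<^sup>2 \<le> Cbad q M C * eps2)"
proof -
  have nr: "0 < real n" using n by simp
  define N where "N = real n * lam\<^sup>2"
  have N: "0 < N" using n lam by (simp add: N_def)
  have LLN: "LL = N * eps2" using LL_eq by (simp add: N_def)
  have ct1: "1 \<le> ct M" by (rule cf(2))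
  have Nn: "N \<le> real n" using lam lam1 nr by (simp add: N_def power_le_one mult_left_le)
  \<comment> \<open>The small constant is at most 1/8 and lam < 1. The small ball exponent n / 2 is
    therefore at least 4 ell.\<close>
  have LLn: "8 * ell \<le> real n"
  proof -
    have "LL \<le> N * (1/8)" unfolding LLN using e cf(4) N by (intro mult_left_mono) auto
    then show ?thesis using Nn ell_ge(3) by simp
  qed
  have Caa: "C * aa \<le> 2 * C * ell"
  proof -
    have "C * aa \<le> C * (2 * ell)" using aa_le C by (intro mult_left_mono) auto
    then show ?thesis by simp
  qed
  \<comment> \<open>A constant deviation of at least 1, in the linear regime of the tail. The 16
    consists of 14 for entropy and 2 for the summand 3, as ell is at least 2; 2 C covers the
    confidence.\<close>
  define K1 where "K1 = ct M * (16 + 2 * C)"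
  have K1: "1 \<le> K1"
  proof -
    have "1 * 1 \<le> ct M * (16 + 2 * C)" using ct1 C by (intro mult_mono) auto
    then show ?thesis by (simp add: K1_def)
  qed
  have mn: "min K1 (K1\<^sup>2) = K1" using K1 by (simp add: min_def power2_eq_square)
  have ex1: "14 * ell + C * aa + 3 \<le> real n * min K1 (K1\<^sup>2) / (32 * (4 * M)\<^sup>2)"
  proof -
    have "14 * ell + C * aa + 3 \<le> ell * (16 + 2 * C)" using Caa ell_ge(2) by (simp add: algebra_simps)
    also have "\<dots> \<le> real n * (16 + 2 * C)" using LLn ell_ge(2) C by (intro mult_right_mono) auto
    also have "\<dots> = real n * min K1 (K1\<^sup>2) / (32 * (4 * M)\<^sup>2)" unfolding rate mn using ct1 by (simp add: K1_def)
    finally show ?thesis .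
  qed
  define b where "b = bbound M C"
  have b: "b = 4 * K1 + 4 * M" by (simp add: b_def bbound_def K1_def)
  have b1: "1 \<le> b" using K1 M1 by (simp add: b)
  \<comment> \<open>A net of resolution proportional to the square root of tau = exp (- y) costs exp
    (ell y) up to factors without y, whereas the small ball estimate gains exp (- 4 ell y). The
    surplus of 3 ell y pays for everything else.\<close>
  define y where "y = ybound M C"
  have y: "y = 14 + ln (4 * b) + 4 * ln (4 * M) + 2 * C" by (simp add: y_def ybound_def b_def)
  have ln0: "0 \<le> ln (4 * b)" "0 \<le> ln (4 * M)" using b1 M1 by (auto intro!: ln_ge_zero)
  have y0: "0 \<le> y" "ln (4 * M) + 1 \<le> y" using ln0 C by (auto simp: y)
  define tau where "tau = exp (- y)"
  have tau: "0 < tau" "tau \<le> 1" using y0 by (auto simp: tau_def)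
  \<comment> \<open>The coarsest resolution that \<open>lower_net\<close> admits for the upper bound
    b.\<close>
  define \<delta> where "\<delta> = sqrt (tau / (4 * b))"
  have d2: "\<delta>\<^sup>2 = tau / (4 * b)" using tau b1 by (simp add: \<delta>_def)
  have d0: "0 < \<delta>" using tau b1 by (simp add: \<delta>_def)
  have dh: "\<delta> \<le> 1/2"
  proof -
    have "\<delta>\<^sup>2 \<le> (1/2)\<^sup>2" unfolding d2 using tau b1 by (simp add: power2_eq_square pos_divide_le_eq)
    then show ?thesis by (rule power2_le_imp_le) simp
  qed
  have bd: "b * \<delta>\<^sup>2 \<le> tau / 4" unfolding d2 using b1 by simp
  have M41: "1 \<le> 4 * M" and K10: "0 < K1" using M1 K1 by auto
  obtain B1 where B1: "B1 \<in> sets P"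
    "measure P B1 \<le> real (card F) * exp (6 * real (2 * (ku + kv))) * (2 * exp (- (real n * min K1 (K1\<^sup>2) / (32 * (4 * M)\<^sup>2))))"
    "\<And>z T. z \<in> space P - B1 \<Longrightarrow> T \<in> F \<Longrightarrow> opb (4 * K1) (idm T * (cov n (p + m) z - G.Sf) * idm T)"
    by (rule G.event_op[OF finF F_props upG M41 K10 n]) (assumption, rule that)
  have m1: "measure P B1 \<le> 2 * exp (- 3 - C * aa)"
  proof -
    have "measure P B1 \<le> exp (2 * ell) * exp (12 * ell) * (2 * exp (- (14 * ell + C * aa + 3)))"
      by (rule order_trans[OF B1(2)], intro mult_mono cardF) (use ex1 ell_ge in auto)
    also have "\<dots> = 2 * exp (- 3 - C * aa)" by (simp add: exp_add[symmetric])
    finally show ?thesis .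
  qed
  \<comment> \<open>Within one block the population form is at least 1 / M, by
    \<open>lower_x\<close> and \<open>lower_y\<close>.\<close>
  define F' where "F' = {T \<in> F. T \<subseteq> {..<p} \<or> T \<subseteq> {p..<p + m}}"
  have F': "finite F'" "\<And>T. T \<in> F' \<Longrightarrow> T \<subseteq> {..<p + m} \<and> card T \<le> 2 * (ku + kv)"
    using finF F_props by (auto simp: F'_def)
  have cF': "real (card F') \<le> exp (2 * ell)"
    using cardF card_mono[OF finF, of F'] by (simp add: F'_def)
  have low: "1 / M * (norm w)\<^sup>2 \<le> inner w (G.Sf * w)" if T: "T \<in> F'" and w: "suppd (T \<times> {0}) w" for T w
  proof -
    have "(norm w)\<^sup>2 \<le> M * inner w (Sf * w)"
    proof (cases "T \<subseteq> {..<p}")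
      case True
      have Iw: "idm {..<p} * w = w"
        using w True by (intro fmat_eqI) (auto simp: ent_idm_times suppd_def)
      have "(norm w)\<^sup>2 \<le> M * inner w (Sx * w)" by (rule lower_x[OF Iw])
      also have "inner w (Sx * w) = inner (idm {..<p} * w) (Sf * (idm {..<p} * w))"
        by (simp add: Sx_eq inner_mult_left mult.assoc)
      finally show ?thesis by (simp add: Iw)
    next
      case False
      then have Tp: "T \<subseteq> {p..<p + m}" using T by (simp add: F'_def)
      have Iw: "tp (shiftm p m) * (shiftm p m * w) = w"
      proof -
        have "idm {p..<p + m} * w = w"
          using w Tp by (intro fmat_eqI) (use subsetD[OF Tp] in \<open>simp add: ent_idm_times suppd_def; blast\<close>)
        then show ?thesis by (simp add: mult.assoc[symmetric] shiftm_gram)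
      qed
      define x where "x = shiftm p m * w"
      have Ix: "idm {..<m} * x = x" unfolding x_def by (rule fmat_eqI) (simp add: ent_idm_times ent_shiftm_times)
      have "norm w \<le> 1 * norm x"
        using opbD[OF opb_tp[OF opb_shiftm], of p m x] Iw by (simp add: x_def)
      then have "(norm w)\<^sup>2 \<le> (norm x)\<^sup>2" by (intro power_mono) auto
      also have "\<dots> \<le> M * inner x (Sy * x)" by (rule lower_y[OF Ix])
      also have "inner x (Sy * x) = inner (tp (shiftm p m) * x) (Sf * (tp (shiftm p m) * x))"
        by (simp add: Sy_eq inner_mult_left mult.assoc)
      finally show ?thesis using Iw by (simp add: x_def)
    qed
    then show ?thesis using M1 by (simp add: GSf field_simps)
  qed
  have g: "0 < 1 / M" using M1 by simp
  obtain B2 where B2: "B2 \<in> sets P"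
    "measure P B2 \<le> real (card F') * (exp 1 * (1 + 2 / \<delta>)) ^ (2 * (ku + kv)) * exp (- (real n / 2) * (ln (1 / M / (4 * tau)) - 1))"
    "\<And>z T y. z \<in> space P - B2 \<Longrightarrow> T \<in> F' \<Longrightarrow> y \<in> net \<delta> (T \<times> {0}) \<Longrightarrow>
      1/2 \<le> norm y \<Longrightarrow> tau \<le> inner y (cov n (p + m) z * y)"
    by (rule G.event_small[OF F' low g tau(1) d0 n]) (assumption, assumption, assumption, rule that)
  have m2: "measure P B2 \<le> 2 * exp (- 3 - C * aa)"
  proof -
    have l1: "ln (1 / M / (4 * tau)) = y - ln (4 * M)"
      using M1 tau by (simp add: ln_div ln_mult tau_def)
    have ba: "exp 1 * (1 + 2 / \<delta>) \<le> exp (3 + (y + ln (4 * b)) / 2)"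
    proof -
      have "1 + 2 / \<delta> \<le> 3 / \<delta>" using d0 dh by (simp add: field_simps)
      also have "3 / \<delta> = exp (ln 3 + (y + ln (4 * b)) / 2)"
      proof -
        have "(exp (- ((y + ln (4 * b)) / 2)))\<^sup>2 = exp (- y - ln (4 * b))"
          by (simp add: power2_eq_square exp_add[symmetric] field_simps)
        also have "\<dots> = tau / (4 * b)" using b1 by (simp add: exp_diff tau_def)
        finally have "\<delta> = exp (- ((y + ln (4 * b)) / 2))" unfolding \<delta>_def by (intro real_sqrt_unique) auto
        then show ?thesis by (simp only: exp_add exp_minus divide_inverse inverse_inverse_eq) simp
      qed
      also have "\<dots> \<le> exp (2 + (y + ln (4 * b)) / 2)" using ln_3_le_2 by simp
      finally have "exp 1 * (1 + 2 / \<delta>) \<le> exp 1 * exp (2 + (y + ln (4 * b)) / 2)" by simp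
      also have "\<dots> = exp (3 + (y + ln (4 * b)) / 2)" by (simp add: exp_add[symmetric])
      finally show ?thesis .
    qed
    have "(exp 1 * (1 + 2 / \<delta>)) ^ (2 * (ku + kv)) \<le> exp (3 + (y + ln (4 * b)) / 2) ^ (2 * (ku + kv))"
      using ba d0 by (intro power_mono) auto
    also have "\<dots> = exp (real (2 * (ku + kv)) * (3 + (y + ln (4 * b)) / 2))" by (rule exp_of_nat_mult[symmetric])
    also have "\<dots> \<le> exp ((2 * ell) * (3 + (y + ln (4 * b)) / 2))"
      using ell_ge(1) y0 ln0 by (simp only: exp_le_cancel_iff, intro mult_right_mono) auto
    finally have p1: "(exp 1 * (1 + 2 / \<delta>)) ^ (2 * (ku + kv)) \<le> exp ((2 * ell) * (3 + (y + ln (4 * b)) / 2))" .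
    have p2: "exp (- (real n / 2) * (ln (1 / M / (4 * tau)) - 1)) \<le> exp (- (4 * ell) * (y - ln (4 * M) - 1))"
      unfolding l1 using LLn y0(2) by (simp only: exp_le_cancel_iff, intro mult_right_mono) auto
    have "measure P B2 \<le> exp (2 * ell) * exp ((2 * ell) * (3 + (y + ln (4 * b)) / 2)) * exp (- (4 * ell) * (y - ln (4 * M) - 1))"
      by (rule order_trans[OF B2(2)], intro mult_mono cF' p1 p2) (use d0 in auto)
    also have "\<dots> = exp (ell * (12 + ln (4 * b) + 4 * ln (4 * M) - 3 * y))"
      by (simp add: exp_add[symmetric] algebra_simps)
    also have "\<dots> \<le> exp (- 3 - C * aa)"
    proof -
      have "ell * (12 + ln (4 * b) + 4 * ln (4 * M) - 3 * y) \<le> ell * (- 2 - 2 * C)"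
        using ell_ge(2) y0 by (intro mult_left_mono) (auto simp: y)
      also have "\<dots> \<le> - 3 - C * aa" using Caa ell_ge(2) by (simp add: algebra_simps)
      finally show ?thesis by simp
    qed
    finally show ?thesis by (smt (verit) exp_gt_zero)
  qed
  have oSf: "opb (4 * M) Sf" by (rule opb_psd[OF psd _ _ tS]) (use upper M1 in auto)
  show ?thesis
  \<comment> \<open>The empty set stands in for the third exceptional event of
    \<open>event_complement\<close>.\<close>
  proof (rule bexI[of _ "space P - (B1 \<union> B2 \<union> {})"], intro conjI ballI allI impI)
    show "1 - exp (- (C * aa)) \<le> measure P (space P - (B1 \<union> B2 \<union> {}))"
      by (rule event_complement[OF B1(1) B2(1) _ m1 m2]) auto
    show "space P - (B1 \<union> B2 \<union> {}) \<in> sets P" using B1(1) B2(1) by auto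
    fix z A B
    assume z: "z \<in> space P - (B1 \<union> B2 \<union> {})"
      and sol: "cca_solution p m r (int ku) (int kv) (sample_cov n (p + m) z) A B"
    have z1: "z \<in> space P - B1" "z \<in> space P - B2" using z by auto
    obtain Z where Z: "cov n (p + m) z = tp Z * Z" by (rule cov_factor[OF n])
    have Sh: "sample_cov n (p + m) z \<in> carrier_mat (p + m) (p + m)" by (simp add: sample_cov_def)
    have op: "opb b (idm T * emb (sample_cov n (p + m) z) * idm T)" if T: "T \<in> F" for T
    proof -
      have fT: "finite T" using F_props[OF T] finite_subset by blast
      have "opb (4 * K1 + 1 * (4 * M) * 1) (idm T * (cov n (p + m) z - G.Sf) * idm T + idm T * Sf * idm T)"
        by (intro opb_add B1(3)[OF z1(1) T] opb_mult opb_idm fT oSf)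
      moreover have "idm T * (cov n (p + m) z - G.Sf) * idm T + idm T * Sf * idm T = idm T * cov n (p + m) z * idm T"
        by (simp add: GSf algebra_simps)
      ultimately show ?thesis by (simp add: b cov_def)
    qed
    have sm: "tau \<le> inner y (emb (sample_cov n (p + m) z) * y)"
      if "T \<in> F" "T \<subseteq> {..<p} \<or> T \<subseteq> {p..<p + m}" "y \<in> net \<delta> (T \<times> {0})" "1/2 \<le> norm y" for T y
      using B2(3)[OF z1(2) _ that(3,4)] that(1,2) by (simp add: F'_def cov_def)
    note bb = bad_bound[OF sol Sh Z[unfolded cov_def] op sm tau d0 dh bd]
    \<comment> \<open>With r at most ku and kv, the failed confidence condition bounds r by C / c
      times the squared rate.\<close>
    have "real r * (c0 * N) \<le> real r * (C * aa)" using bad by (intro mult_left_mono) (auto simp: N_def)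
    also have "\<dots> = C * (real r * aa)" by simp
    also have "\<dots> \<le> C * (N * eps2)" using r_aa[OF bb(2,3)] C by (intro mult_left_mono) (auto simp: LLN)
    finally have "N * (real r * c0) \<le> N * (C * eps2)" by (simp add: mult_ac)
    then have "real r * c0 \<le> C * eps2" using N by simp
    then have rr: "real r \<le> C / c0 * eps2" using cf(3) by (simp add: field_simps)
    have "(norm (emb A * tp (emb B) - u * tp v))\<^sup>2 \<le> 2 * ((4 / tau) ^ 4 + M ^ 4) * real r" by (rule bb(1))
    also have "\<dots> \<le> 2 * ((4 / tau) ^ 4 + M ^ 4) * (C / c0 * eps2)"
      using tau M1 by (intro mult_left_mono rr) auto
    finally show "(norm (emb A * tp (emb B) - u * tp v))\<^sup>2 \<le> Cbad q M C * eps2"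
      by (simp add: Cbad_def tau_def y_def mult.assoc)
  qed
qed

end

section \<open>Combination of the two cases\<close>

lemma Cgood_pos:
  assumes "0 \<le> q" "q < 2" "1 < kap" "1 < M" "0 < C"
  shows "0 < Cgood q kap M C"
proof -
  have "0 < ct M" "0 < Cq q" using csmall_facts[OF assms(1,2,4)] by auto
  then have "0 < 4 * Cq q + 32 * M\<^sup>2 * ct M * (8 + 2 * C)" using assms by (intro add_pos_nonneg) auto
  moreover have "0 < 74 * (2 * M) ^ 8 * kap" using assms by simp
  ultimately show ?thesis unfolding Cgood_def by (intro mult_pos_pos[OF zero_less_power])
qed

lemma Cbad_pos:
  assumes "0 \<le> q" "q < 2" "1 < M" "0 < C"
  shows "0 < Cbad q M C"
proof -
  have "0 < C / csmall q M" using csmall_facts(3)[OF assms(1-3)] assms(4) by simp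
  moreover have "0 < (4 / exp (- ybound M C)) ^ 4 + M ^ 4" using assms(3) by (intro add_pos_pos zero_less_power) auto
  ultimately show ?thesis unfolding Cbad_def by (intro mult_pos_pos) auto
qed

lemma (in cca) estimator_error:
  assumes C: "0 < C" and e: "eps2 \<le> csmall q M"
    and lr: "(if r < min p m then l (r + 1) else 0) \<le> csmall q M * lam"
  shows "\<exists>E\<in>sets (gauss_sample n (p + m) S).
    measure (gauss_sample n (p + m) S) E \<ge> 1 - exp (- C * (real ku + lu)) - exp (- C * (real kv + lv)) \<and>
    (\<forall>z\<in>E. \<forall>A B. cca_solution p m r (int ku) (int kv) (sample_cov n (p + m) z) A B \<longrightarrow>
      (frob_norm (A * B\<^sup>T - first_cols r U * (first_cols r V)\<^sup>T))\<^sup>2 \<le> (Cgood q kap M C + Cbad q M C) * eps2)"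
proof -
  have e0: "0 \<le> eps2" using ell_ge(3) LL_eq n lam ell_ge(2) by (smt (verit) zero_less_mult_pos of_nat_0_less_iff zero_less_power zero_less_mult_iff)
  have Cg: "0 < Cgood q kap M C" and Cb: "0 < Cbad q M C"
    using Cgood_pos[OF q kap1 M1 C] Cbad_pos[OF q M1 C] .
  obtain K E where K: "K \<le> Cgood q kap M C + Cbad q M C" and E: "E \<in> sets P" "1 - exp (- (C * aa)) \<le> measure P E"
    "\<And>z A B. z \<in> E \<Longrightarrow> cca_solution p m r (int ku) (int kv) (sample_cov n (p + m) z) A B \<Longrightarrow>
      (norm (emb A * tp (emb B) - u * tp v))\<^sup>2 \<le> K * eps2"
  proof (cases "C * aa \<le> csmall q M * (real n * lam\<^sup>2)")
    case True
    show ?thesis using good_event[OF C True e lr] that[of "Cgood q kap M C"] Cb by auto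
  next
    case False
    show ?thesis using bad_event[OF C _ e] False that[of "Cbad q M C"] Cg by auto
  qed
  show ?thesis
  proof (rule bexI[OF _ E(1)], intro conjI ballI allI impI)
    \<comment> \<open>The first exponential alone already dominates the failure probability exp (- C
      aa).\<close>
    have "0 \<le> C * (real kv + lv)" using C l_ge1 by simp
    then have "exp (- (C * aa)) \<le> exp (- C * (real ku + lu))" by (simp add: aa_def distrib_left)
    then show "1 - exp (- C * (real ku + lu)) - exp (- C * (real kv + lv)) \<le> measure P E"
      using E(2) exp_ge_zero[of "- C * (real kv + lv)"] by linarith
    fix z A B
    assume z: "z \<in> E" and sol: "cca_solution p m r (int ku) (int kv) (sample_cov n (p + m) z) A B"
    have A: "A \<in> carrier_mat p r" and B: "B \<in> carrier_mat m r" using sol by (auto simp: cca_solution_def cca_feasible_def)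
    have U1: "first_cols r U \<in> carrier_mat p r" and V1: "first_cols r V \<in> carrier_mat m r"
      using U V by (auto simp: first_cols_def)
    have "emb (A * B\<^sup>T) = emb A * tp (emb B)" "emb (first_cols r U * (first_cols r V)\<^sup>T) = u * tp v"
      using A B U1 V1 by (auto simp: emb_mult[of _ p r _ m] emb_transpose u_def v_def)
    then have "frob_norm (A * B\<^sup>T - first_cols r U * (first_cols r V)\<^sup>T) = norm (emb A * tp (emb B) - u * tp v)"
      using A B U1 V1 by (simp add: frob_norm_emb emb_minus[of _ p m])
    then show "(frob_norm (A * B\<^sup>T - first_cols r U * (first_cols r V)\<^sup>T))\<^sup>2 \<le> (Cgood q kap M C + Cbad q M C) * eps2"
      using order_trans[OF E(3)[OF z sol] mult_right_mono[OF K e0]] by simp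
  qed
qed

theorem theorem1:
  fixes q kap M :: real
  assumes "0 \<le> q" "q < 2" "1 < kap" "1 < M"
  shows "\<exists>C :: real \<Rightarrow> real. (\<forall>C'>0. 0 < C C') \<and>
    (\<forall>c0. 0 < c0 \<and> c0 < 1 \<longrightarrow>
      (\<exists>c. 0 < c \<and> c < 1 \<and>
        (\<forall>C'>0. \<forall>(n::nat) (p::nat) (m::nat) (r::nat) (su::real) (sv::real) (lam::real) (ku::int) (kv::int).
           0 < n \<and> 0 < p \<and> 0 < m \<and> 0 < r \<and> r \<le> min p m \<and> 0 < su \<and> 0 < sv \<and> 0 < lam \<and>
           kap * lam \<le> 1 - c0 \<and>
           ku = eff_k q su p n r lam \<and> kv = eff_k q sv m n r lam \<and>
           eps_sq q su sv n p m r lam \<le> c \<longrightarrow>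
           (\<forall>S\<in>Fq q su sv p m r lam kap M. \<forall>U V l.
              Fq_decomp q su sv p m r lam kap M S U V l \<and>
              (if r < min p m then l (r + 1) else 0) \<le> c * lam \<longrightarrow>
              (\<exists>E\<in>sets (gauss_sample n (p + m) S).
                 measure (gauss_sample n (p + m) S) E \<ge>
                   1 - exp (- C' * (real_of_int ku + ln (exp 1 * real p / real_of_int ku)))
                     - exp (- C' * (real_of_int kv + ln (exp 1 * real m / real_of_int kv))) \<and>
                 (\<forall>z\<in>E. \<forall>U1h V1h.
                    cca_solution p m r ku kv (sample_cov n (p + m) z) U1h V1h \<longrightarrow>
                    (frob_norm (U1h * V1h\<^sup>T - first_cols r U * (first_cols r V)\<^sup>T))\<^sup>2
                      \<le> C C' * eps_sq q su sv n p m r lam))))))"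
proof (intro exI[of _ "\<lambda>C'. Cgood q kap M C' + Cbad q M C'"] conjI allI impI)
  fix C' :: real assume "0 < C'"
  then show "0 < Cgood q kap M C' + Cbad q M C'" using assms by (intro add_pos_pos Cgood_pos Cbad_pos)
next
  fix c0 :: real
  note cf = csmall_facts[OF assms(1,2,4)]
  show "\<exists>c. 0 < c \<and> c < 1 \<and>
        (\<forall>C'>0. \<forall>(n::nat) (p::nat) (m::nat) (r::nat) (su::real) (sv::real) (lam::real) (ku::int) (kv::int).
           0 < n \<and> 0 < p \<and> 0 < m \<and> 0 < r \<and> r \<le> min p m \<and> 0 < su \<and> 0 < sv \<and> 0 < lam \<and>
           kap * lam \<le> 1 - c0 \<and>
           ku = eff_k q su p n r lam \<and> kv = eff_k q sv m n r lam \<and>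
           eps_sq q su sv n p m r lam \<le> c \<longrightarrow>
           (\<forall>S\<in>Fq q su sv p m r lam kap M. \<forall>U V l.
              Fq_decomp q su sv p m r lam kap M S U V l \<and>
              (if r < min p m then l (r + 1) else 0) \<le> c * lam \<longrightarrow>
              (\<exists>E\<in>sets (gauss_sample n (p + m) S).
                 measure (gauss_sample n (p + m) S) E \<ge>
                   1 - exp (- C' * (real_of_int ku + ln (exp 1 * real p / real_of_int ku)))
                     - exp (- C' * (real_of_int kv + ln (exp 1 * real m / real_of_int kv))) \<and>
                 (\<forall>z\<in>E. \<forall>U1h V1h.
                    cca_solution p m r ku kv (sample_cov n (p + m) z) U1h V1h \<longrightarrow>
                    (frob_norm (U1h * V1h\<^sup>T - first_cols r U * (first_cols r V)\<^sup>T))\<^sup>2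
                      \<le> (Cgood q kap M C' + Cbad q M C') * eps_sq q su sv n p m r lam))))"
    (is "\<exists>c. 0 < c \<and> c < 1 \<and> ?P c")
  \<comment> \<open>The witness involves only q and M; it is fixed before C' and the dimensions are
    introduced.\<close>
  proof (intro exI[of _ "csmall q M"] conjI allI impI ballI, goal_cases)
    case 1 show ?case by (rule cf(3))
  next
    case 2 show ?case using cf(4) by simp
  next
    case (3 C' n p m r su sv lam ku kv S U V l)
    then have "1 \<le> ku" "1 \<le> kv"
      using eff_k_bounds(1)[OF assms(1,2), of su lam p n r] eff_k_bounds(1)[OF assms(1,2), of sv lam m n r] by auto
    then obtain ku' kv' where k: "ku = int ku'" "kv = int kv'" by (metis nonneg_int_cases order_trans zero_le_one)
    interpret cca q su sv lam kap M p m r S U V l n ku' kv'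
      using 3 assms k by unfold_locales (auto simp: Fq_def)
    show ?case unfolding k of_int_of_nat_eq
      by (rule estimator_error[unfolded eps2_def lu_def lv_def]) (use 3 in auto)
  qed
qed

end
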